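(* Let $\underline{M}$ and $\underline{M}'$ be pure $A$-motives over a finite field $L\supseteq\mathbb{F}_q$ of the same characteristic, and let $v\subset A$ be any maximal ideal. Then the natural map $\operatorname{Hom}(\underline{M},\underline{M}')\otimes_AA_v\to\operatorname{Hom}_{A_{v,L}[\phi]}\big(\underline{M}_v(\underline{M}),\underline{M}_v(\underline{M}')\big)$, $f\otimes a\mapsto a\cdot(f\otimes\mathrm{id})$, is an isomorphism.
   Context: $\mathbb{F}_q$ finite field, $C$ smooth projective geometrically irreducible curve over $\mathbb{F}_q$, $\infty\in C(\mathbb{F}_q)$, $A=\Gamma(C\setminus\{\infty\},\mathcal{O}_C)$, $A_v$ the completion of $A$ at $v$, $C_L=C\times_{\mathbb{F}_q}L$, $A_L=A\otimes_{\mathbb{F}_q}L$, $\sigma^*(a\otimes b)=a\otimes b^q$, $\sigma^*M=M\otimes_{A_L,\sigma^*}A_L$; $A_{v,L}=A_v\otimes_{\mathbb{F}_q}L$ (the completion of $A_L$ at $v$, $L$ being finite), with $\sigma^*$ acting on the $L$-factor. $c^*:A\to L$ an $\mathbb{F}_q$-homomorphism, $J\subset A_L$ generated by $a\otimes1-1\otimes c^*(a)$. A pure $A$-motive $(M,\tau)$ of rank $r$, dimension $d$, characteristic $c^*$: $M$ locally free of rank $r$ over $A_L$, $\tau:\sigma^*M\to M$ injective $A_L$-linear, $\operatorname{coker}\tau$ of $L$-dimension $d$ annihilated by $J^d$, and $M$ extends to a locally free $\mathcal{M}$ on $C_L$ on which $\tau^l=\tau\circ\sigma^*\tau\circ\cdots\circ(\sigma^*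 )^{l-1}\tau$ induces an isomorphism $(\sigma^* )^l\mathcal{M}_\infty\to\mathcal{M}(k\cdot\infty)_\infty$ for some positive integers $k,l$. $\operatorname{Hom}$ = $A_L$-linear maps commuting with $\tau$. The local $\sigma$-shtuka of $\underline{M}$ at $v$ is $\underline{M}_v(\underline{M})=(M\otimes_{A_L}A_{v,L},\ \phi=\tau\otimes\mathrm{id})$, and $\operatorname{Hom}_{A_{v,L}[\phi]}$ denotes $A_{v,L}$-linear maps $g$ with $g\circ\phi=\phi'\circ\sigma^*g$. *)

theory Defs
  imports "HOL-Algebra.Algebra" "HOL-Analysis.Abstract_Topology"
begin

section \<open>Modules, tensor products, localization\<close>

definition module_hom ::
  "('r, 'x) ring_scheme \<Rightarrow> ('r, 'm) module \<Rightarrow> ('r, 'n) module \<Rightarrow> ('m \<Rightarrow> 'n) \<Rightarrow> bool" where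
  "module_hom R M N f \<longleftrightarrow>
     f \<in> carrier M \<rightarrow> carrier N \<and>
     (\<forall>x\<in>carrier M. \<forall>y\<in>carrier M. f (x \<oplus>\<^bsub>M\<^esub> y) = f x \<oplus>\<^bsub>N\<^esub> f y) \<and>
     (\<forall>r\<in>carrier R. \<forall>x\<in>carrier M. f (r \<odot>\<^bsub>M\<^esub> x) = r \<odot>\<^bsub>N\<^esub> f x)"

definition module_iso ::
  "('r, 'x) ring_scheme \<Rightarrow> ('r, 'm) module \<Rightarrow> ('r, 'n) module \<Rightarrow> ('m \<Rightarrow> 'n) \<Rightarrow> bool" where
  "module_iso R M N f \<longleftrightarrow> module_hom R M N f \<and> bij_betw f (carrier M) (carrier N)"

definition self_module :: "('r, 'x) ring_scheme \<Rightarrow> ('r, 'r) module" where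
  "self_module R = \<lparr>carrier = carrier R, monoid.mult = monoid.mult R, one = one R, ring.zero = ring.zero R, add = add R,
     smult = monoid.mult R\<rparr>"

text \<open>The ring \<open>S\<close> as an \<open>R\<close>-algebra through a ring homomorphism \<open>h : R \<rightarrow> S\<close>.\<close>

definition alg_via :: "('r \<Rightarrow> 's) \<Rightarrow> ('s, 'x) ring_scheme \<Rightarrow> ('r, 's) module" where
  "alg_via h S = \<lparr>carrier = carrier S, monoid.mult = monoid.mult S, one = one S, ring.zero = ring.zero S, add = add S,
     smult = (\<lambda>r s. h r \<otimes>\<^bsub>S\<^esub> s)\<rparr>"

definition restrict_scalars :: "('r \<Rightarrow> 's) \<Rightarrow> ('s, 'm) module \<Rightarrow> ('r, 'm) module" where
  "restrict_scalars h M = \<lparr>carrier = carrier M, monoid.mult = monoid.mult M, one = one M, ring.zero = ring.zero M,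
     add = add M, smult = (\<lambda>r x. h r \<odot>\<^bsub>M\<^esub> x)\<rparr>"

definition quotient_module :: "('r, 'm) module \<Rightarrow> 'm set \<Rightarrow> ('r, 'm set) module" where
  "quotient_module M N = \<lparr>carrier = a_rcosets\<^bsub>M\<^esub> N, monoid.mult = undefined, one = undefined,
     ring.zero = N, add = set_add M, smult = (\<lambda>r Z. \<Union>x\<in>Z. a_r_coset M N (r \<odot>\<^bsub>M\<^esub> x))\<rparr>"

definition is_basis ::
  "('r, 'x) ring_scheme \<Rightarrow> ('r, 'm) module \<Rightarrow> nat \<Rightarrow> (nat \<Rightarrow> 'm) \<Rightarrow> bool" where
  "is_basis R M r e \<longleftrightarrow>
     e \<in> {..<r} \<rightarrow> carrier M \<and>
     (\<forall>x\<in>carrier M. \<exists>!a. a \<in> {..<r} \<rightarrow>\<^sub>E carrier R \<and> x = (\<Oplus>\<^bsub>M\<^esub>i\<in>{..<r}. a i \<odot>\<^bsub>M\<^esub> e i))"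

definition free_of_rank :: "('r, 'x) ring_scheme \<Rightarrow> ('r, 'm) module \<Rightarrow> nat \<Rightarrow> bool" where
  "free_of_rank R M r \<longleftrightarrow> (\<exists>e. is_basis R M r e)"

text \<open>\<open>M \<otimes>\<^sub>R N\<close> is the free abelian group on \<open>M \<times> N\<close> modulo the bilinearity relations; its elements
  are cosets.\<close>

type_synonym ('m, 'n) tens = "(('m \<times> 'n) \<Rightarrow>\<^sub>0 int) set"

definition tensor_rels ::
  "('r, 'x) ring_scheme \<Rightarrow> ('r, 'm) module \<Rightarrow> ('r, 'n) module \<Rightarrow> (('m \<times> 'n) \<Rightarrow>\<^sub>0 int) set" where
  "tensor_rels R M N =
     {frag_of (x \<oplus>\<^bsub>M\<^esub> x', y) - frag_of (x, y) - frag_of (x', y) | x x' y.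
        x \<in> carrier M \<and> x' \<in> carrier M \<and> y \<in> carrier N} \<union>
     {frag_of (x, y \<oplus>\<^bsub>N\<^esub> y') - frag_of (x, y) - frag_of (x, y') | x y y'.
        x \<in> carrier M \<and> y \<in> carrier N \<and> y' \<in> carrier N} \<union>
     {frag_of (r \<odot>\<^bsub>M\<^esub> x, y) - frag_of (x, r \<odot>\<^bsub>N\<^esub> y) | r x y.
        r \<in> carrier R \<and> x \<in> carrier M \<and> y \<in> carrier N}"

definition tensor_ker ::
  "('r, 'x) ring_scheme \<Rightarrow> ('r, 'm) module \<Rightarrow> ('r, 'n) module \<Rightarrow> ('m, 'n) tens" where
  "tensor_ker R M N = generate (free_Abelian_group (carrier M \<times> carrier N)) (tensor_rels R M N)"

definition pure_tensor ::
  "('r, 'x) ring_scheme \<Rightarrow> ('r, 'm) module \<Rightarrow> ('r, 'n) module \<Rightarrow> 'm \<Rightarrow> 'n \<Rightarrow> ('m, 'n) tens" where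
  "pure_tensor R M N x y =
     tensor_ker R M N #>\<^bsub>free_Abelian_group (carrier M \<times> carrier N)\<^esub> frag_of (x, y)"

definition tensor_group ::
  "('r, 'x) ring_scheme \<Rightarrow> ('r, 'm) module \<Rightarrow> ('r, 'n) module \<Rightarrow> ('m, 'n) tens ring" where
  "tensor_group R M N =
     \<lparr>carrier = rcosets\<^bsub>free_Abelian_group (carrier M \<times> carrier N)\<^esub> (tensor_ker R M N),
      monoid.mult = undefined, one = undefined, ring.zero = tensor_ker R M N,
      add = set_mult (free_Abelian_group (carrier M \<times> carrier N))\<rparr>"

text \<open>The additive map with \<open>x \<otimes> y \<mapsto> B x y\<close>, evaluated on a representative; the choice of the
  representative does not matter as soon as \<open>B\<close> is biadditive and balanced.\<close>

definition tensor_lift ::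
  "('t, 'z) ring_scheme \<Rightarrow> ('m \<Rightarrow> 'n \<Rightarrow> 't) \<Rightarrow> ('m, 'n) tens \<Rightarrow> 't" where
  "tensor_lift T B Z = (let u = (SOME u. u \<in> Z) in
     \<Oplus>\<^bsub>T\<^esub>p\<in>Poly_Mapping.keys u. [Poly_Mapping.lookup u p] \<cdot>\<^bsub>T\<^esub> B (fst p) (snd p))"

text \<open>\<open>M \<otimes>\<^sub>R N\<close> as an \<open>R\<close>-module; \<open>mult\<close> and \<open>one\<close> are meaningful when \<open>M\<close> and \<open>N\<close> are
  \<open>R\<close>-algebras.\<close>

definition tensor ::
  "('r, 'x) ring_scheme \<Rightarrow> ('r, 'm) module \<Rightarrow> ('r, 'n) module \<Rightarrow> ('r, ('m, 'n) tens) module" where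
  "tensor R M N = (let G = tensor_group R M N; pt = pure_tensor R M N in
     \<lparr>carrier = carrier G,
      monoid.mult = (\<lambda>Z Z'. tensor_lift G (\<lambda>x y. tensor_lift G
                (\<lambda>x' y'. pt (x \<otimes>\<^bsub>M\<^esub> x') (y \<otimes>\<^bsub>N\<^esub> y')) Z') Z),
      one = pt \<one>\<^bsub>M\<^esub> \<one>\<^bsub>N\<^esub>, ring.zero = ring.zero G, add = add G,
      smult = (\<lambda>r Z. tensor_lift G (\<lambda>x y. pt (r \<odot>\<^bsub>M\<^esub> x) y) Z)\<rparr>)"

text \<open>Extension of scalars: \<open>M \<otimes>\<^sub>R N\<close> as a module over the \<open>R\<close>-algebra \<open>N\<close>.\<close>

definition extend_scalars ::
  "('r, 'x) ring_scheme \<Rightarrow> ('r, 'm) module \<Rightarrow> ('r, 'n) module \<Rightarrow> ('n, ('m, 'n) tens) module" where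
  "extend_scalars R M N = (let T = tensor R M N in
     \<lparr>carrier = carrier T, monoid.mult = monoid.mult T, one = one T, ring.zero = ring.zero T, add = add T,
      smult = (\<lambda>s Z. tensor_lift T (\<lambda>x y. pure_tensor R M N x (s \<otimes>\<^bsub>N\<^esub> y)) Z)\<rparr>)"

definition tensor_map ::
  "('r, 'x) ring_scheme \<Rightarrow> ('r, 'm) module \<Rightarrow> ('r, 'n) module \<Rightarrow> ('r, 'm1) module \<Rightarrow> ('r, 'n1) module \<Rightarrow>
   ('m \<Rightarrow> 'm1) \<Rightarrow> ('n \<Rightarrow> 'n1) \<Rightarrow> ('m, 'n) tens \<Rightarrow> ('m1, 'n1) tens" where
  "tensor_map R M N M1 N1 f g =
     tensor_lift (tensor R M1 N1) (\<lambda>x y. pure_tensor R M1 N1 (f x) (g y))"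

text \<open>\<open>fraction R S M x s\<close> is the element \<open>x/s\<close> of \<open>S\<^sup>-\<^sup>1M\<close>, as an equivalence class of pairs.\<close>

definition fraction ::
  "('r, 'x) ring_scheme \<Rightarrow> 'r set \<Rightarrow> ('r, 'm) module \<Rightarrow> 'm \<Rightarrow> 'r \<Rightarrow> ('m \<times> 'r) set" where
  "fraction R S M x s = {(y, t). y \<in> carrier M \<and> t \<in> S \<and>
     (\<exists>u\<in>S. u \<odot>\<^bsub>M\<^esub> (t \<odot>\<^bsub>M\<^esub> x) = u \<odot>\<^bsub>M\<^esub> (s \<odot>\<^bsub>M\<^esub> y))}"

definition localization ::
  "('r, 'x) ring_scheme \<Rightarrow> 'r set \<Rightarrow> ('r, 'm) module \<Rightarrow> (('r \<times> 'r) set, ('m \<times> 'r) set) module" where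
  "localization R S M =
     \<lparr>carrier = {fraction R S M x s | x s. x \<in> carrier M \<and> s \<in> S},
      monoid.mult = (\<lambda>Z Z'. \<Union>(x, s)\<in>Z. \<Union>(y, t)\<in>Z'. fraction R S M (x \<otimes>\<^bsub>M\<^esub> y) (s \<otimes>\<^bsub>R\<^esub> t)),
      one = fraction R S M \<one>\<^bsub>M\<^esub> \<one>\<^bsub>R\<^esub>,
      ring.zero = fraction R S M \<zero>\<^bsub>M\<^esub> \<one>\<^bsub>R\<^esub>,
      add = (\<lambda>Z Z'. \<Union>(x, s)\<in>Z. \<Union>(y, t)\<in>Z'.
               fraction R S M ((t \<odot>\<^bsub>M\<^esub> x) \<oplus>\<^bsub>M\<^esub> (s \<odot>\<^bsub>M\<^esub> y)) (s \<otimes>\<^bsub>R\<^esub> t)),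
      smult = (\<lambda>Z Z'. \<Union>(a, s)\<in>Z. \<Union>(y, t)\<in>Z'. fraction R S M (a \<odot>\<^bsub>M\<^esub> y) (s \<otimes>\<^bsub>R\<^esub> t))\<rparr>"

text \<open>Every point of \<open>Spec R\<close> has a neighbourhood \<open>D(f)\<close> on which the sheaf of \<open>M\<close> is free of rank
  \<open>r\<close>.\<close>

definition locally_free :: "('r, 'x) ring_scheme \<Rightarrow> ('r, 'm) module \<Rightarrow> nat \<Rightarrow> bool" where
  "locally_free R M r \<longleftrightarrow> module R M \<and>
     (\<forall>p. primeideal p R \<longrightarrow> (\<exists>f\<in>carrier R - p. let S = {f [^]\<^bsub>R\<^esub> n | n::nat. True} in
        free_of_rank (localization R S (self_module R)) (localization R S M) r))"


section \<open>Ideal powers and adic completion\<close>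

primrec ideal_power :: "('r, 'x) ring_scheme \<Rightarrow> 'r set \<Rightarrow> nat \<Rightarrow> 'r set" where
  "ideal_power R I 0 = carrier R"
| "ideal_power R I (Suc n) = ideal_prod R (ideal_power R I n) I"

definition completion_map :: "('k, 'a) module \<Rightarrow> 'a set \<Rightarrow> 'a \<Rightarrow> nat \<Rightarrow> 'a set" where
  "completion_map R I a = (\<lambda>n. a_r_coset R (ideal_power R I n) a)"

text \<open>The inverse limit of the \<open>R/I\<^sup>n\<close>: a coset of \<open>I\<^sup>n\<^sup>+\<^sup>1\<close> maps to the coset of \<open>I\<^sup>n\<close> containing it.\<close>

definition completion :: "('k, 'a) module \<Rightarrow> 'a set \<Rightarrow> ('k, nat \<Rightarrow> 'a set) module" where
  "completion R I = (let Q = (\<lambda>n. R Quot (ideal_power R I n)) in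
     \<lparr>carrier = {x. \<forall>n. x n \<in> carrier (Q n) \<and> x (Suc n) \<subseteq> x n},
      monoid.mult = (\<lambda>x y n. x n \<otimes>\<^bsub>Q n\<^esub> y n), one = (\<lambda>n. \<one>\<^bsub>Q n\<^esub>),
      ring.zero = (\<lambda>n. \<zero>\<^bsub>Q n\<^esub>), add = (\<lambda>x y n. x n \<oplus>\<^bsub>Q n\<^esub> y n),
      smult = (\<lambda>c x n. completion_map R I (c \<odot>\<^bsub>R\<^esub> \<one>\<^bsub>R\<^esub>) n \<otimes>\<^bsub>Q n\<^esub> x n)\<rparr>)"


section \<open>Projective curves\<close>

text \<open>An integral closed subscheme \<open>C\<close> of projective space over a field \<open>K\<close> is given by its function
  field \<open>E\<close> together with the homogeneous coordinates \<open>xs\<close> of its generic point; conversely every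
  such list with a nonzero entry whose ratios generate \<open>E\<close> over \<open>K\<close> defines one.  The nonempty standard
  affine charts are the spectra of the rings \<open>K[x\<^sub>j/x\<^sub>i]\<close> with \<open>x\<^sub>i \<noteq> 0\<close>.  As \<open>C\<close> is separated, a
  point is determined by its local ring inside \<open>E\<close>, and points are identified with these local rings
  (a projective model in the sense of Zariski and Samuel).  The generic point is \<open>E\<close> itself.\<close>

definition constants :: "('k, 'x) ring_scheme \<Rightarrow> ('k, 'e) module \<Rightarrow> 'e set" where
  "constants K E = {c \<odot>\<^bsub>E\<^esub> \<one>\<^bsub>E\<^esub> | c. c \<in> carrier K}"

definition coord_ratios :: "('k, 'e) module \<Rightarrow> 'e list \<Rightarrow> nat \<Rightarrow> 'e set" where
  "coord_ratios E xs i = {(xs ! j) \<otimes>\<^bsub>E\<^esub> inv\<^bsub>E\<^esub> (xs ! i) | j. j < length xs}"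

definition chart_ring :: "('k, 'x) ring_scheme \<Rightarrow> ('k, 'e) module \<Rightarrow> 'e list \<Rightarrow> nat \<Rightarrow> 'e set" where
  "chart_ring K E xs i = generate_ring E (constants K E \<union> coord_ratios E xs i)"

definition local_subring :: "('k, 'e) module \<Rightarrow> 'e set \<Rightarrow> 'e set \<Rightarrow> 'e set" where
  "local_subring E R p = {a \<otimes>\<^bsub>E\<^esub> inv\<^bsub>E\<^esub> b | a b. a \<in> R \<and> b \<in> R - p}"

definition points :: "('k, 'x) ring_scheme \<Rightarrow> ('k, 'e) module \<Rightarrow> 'e list \<Rightarrow> 'e set set" where
  "points K E xs = {local_subring E (chart_ring K E xs i) p | i p.
     i < length xs \<and> xs ! i \<noteq> \<zero>\<^bsub>E\<^esub> \<and> primeideal p (E\<lparr>carrier := chart_ring K E xs i\<rparr>)}"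

definition maximal_ideal_at :: "('k, 'e) module \<Rightarrow> 'e set \<Rightarrow> 'e set" where
  "maximal_ideal_at E P = P - Units (E\<lparr>carrier := P\<rparr>)"

text \<open>On the integral separated scheme \<open>C\<close>, domains of definition of rational functions are open and
  form a subbasis of the Zariski topology, and sections over a nonempty open \<open>U\<close> are the rational
  functions lying in all local rings of \<open>U\<close>.\<close>

definition zariski :: "('k, 'x) ring_scheme \<Rightarrow> ('k, 'e) module \<Rightarrow> 'e list \<Rightarrow> 'e set topology" where
  "zariski K E xs = topology_generated_by {{P \<in> points K E xs. y \<in> P} | y. y \<in> carrier E}"

definition regular_functions :: "('k, 'e) module \<Rightarrow> 'e set set \<Rightarrow> ('k, 'e) module" where
  "regular_functions E U = E\<lparr>carrier := {y \<in> carrier E. \<forall>P\<in>U. y \<in> P}\<rparr>"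

text \<open>The generation clause says that \<open>E\<close> is the function field of \<open>C\<close>; dimension one is transcendence
  degree one.\<close>

definition integral_projective_curve ::
  "('k, 'x) ring_scheme \<Rightarrow> ('k, 'e) module \<Rightarrow> 'e list \<Rightarrow> bool" where
  "integral_projective_curve K E xs \<longleftrightarrow>
     field K \<and> field E \<and> algebra K E \<and> set xs \<subseteq> carrier E \<and>
     (\<exists>i<length xs. xs ! i \<noteq> \<zero>\<^bsub>E\<^esub> \<and>
        generate_field E (constants K E \<union> coord_ratios E xs i) = carrier E) \<and>
     (\<exists>t\<in>carrier E. ring.transcendental E (constants K E) t \<and>
        (\<forall>y\<in>carrier E. \<not> ring.transcendental E (generate_field E (insert t (constants K E))) y))"

text \<open>Local rings on a curve have dimension at most one, so regularity means that the maximal ideal is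
  generated by one element (by \<open>0\<close> at the generic point).\<close>

definition regular_curve :: "('k, 'x) ring_scheme \<Rightarrow> ('k, 'e) module \<Rightarrow> 'e list \<Rightarrow> bool" where
  "regular_curve K E xs \<longleftrightarrow>
     (\<forall>P\<in>points K E xs. \<exists>t\<in>P. maximal_ideal_at E P = PIdl\<^bsub>E\<lparr>carrier := P\<rparr>\<^esub> t)"

text \<open>Base change \<open>C \<times>\<^sub>K L\<close>: function field \<open>E \<otimes>\<^sub>K L\<close>, as an \<open>L\<close>-algebra, and the same coordinates.\<close>

abbreviation base_field ::
  "('k, 'x) ring_scheme \<Rightarrow> ('k, 'e) module \<Rightarrow> ('k, 'l) module \<Rightarrow> ('l, ('e, 'l) tens) module" where
  "base_field K E L \<equiv> extend_scalars K E L"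

definition base_coords ::
  "('k, 'x) ring_scheme \<Rightarrow> ('k, 'e) module \<Rightarrow> ('k, 'l) module \<Rightarrow> 'e list \<Rightarrow> ('e, 'l) tens list" where
  "base_coords K E L xs = map (\<lambda>x. pure_tensor K E L x \<one>\<^bsub>L\<^esub>) xs"

text \<open>For a finite field \<open>K\<close>, all finite extensions of \<open>K\<close> have copies on the natural numbers.
  Geometric irreducibility (for the geometrically reduced \<open>C\<close>) says that every \<open>C \<times>\<^sub>K K'\<close> is integral,
  that is, that \<open>E \<otimes>\<^sub>K K'\<close> is its function field; smoothness says that every \<open>C \<times>\<^sub>K K'\<close> is regular.\<close>

definition finite_extension_nat :: "('k, 'x) ring_scheme \<Rightarrow> ('k, nat) module \<Rightarrow> bool" where
  "finite_extension_nat K K' \<longleftrightarrow> field K' \<and> algebra K K' \<and> finite (carrier K')"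

definition geometrically_irreducible :: "('k, 'x) ring_scheme \<Rightarrow> ('k, 'e) module \<Rightarrow> bool" where
  "geometrically_irreducible K E \<longleftrightarrow> (\<forall>K'. finite_extension_nat K K' \<longrightarrow> field (base_field K E K'))"

definition smooth :: "('k, 'x) ring_scheme \<Rightarrow> ('k, 'e) module \<Rightarrow> 'e list \<Rightarrow> bool" where
  "smooth K E xs \<longleftrightarrow>
     (\<forall>K'. finite_extension_nat K K' \<longrightarrow> regular_curve K' (base_field K E K') (base_coords K E K' xs))"

definition smooth_projective_curve ::
  "('k, 'x) ring_scheme \<Rightarrow> ('k, 'e) module \<Rightarrow> 'e list \<Rightarrow> bool" where
  "smooth_projective_curve K E xs \<longleftrightarrow>
     finite (carrier K) \<and> integral_projective_curve K E xs \<and>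
     geometrically_irreducible K E \<and> smooth K E xs"

definition rational_point ::
  "('k, 'x) ring_scheme \<Rightarrow> ('k, 'e) module \<Rightarrow> 'e list \<Rightarrow> 'e set \<Rightarrow> bool" where
  "rational_point K E xs P \<longleftrightarrow> P \<in> points K E xs \<and>
     (\<forall>y\<in>P. \<exists>c\<in>constants K E. y \<ominus>\<^bsub>E\<^esub> c \<in> maximal_ideal_at E P)"

text \<open>For a rational point \<open>P\<close> there is exactly one point of \<open>C \<times>\<^sub>K L\<close> above \<open>P\<close>; its local ring is
  the image of \<open>P \<otimes>\<^sub>K L\<close> in \<open>E \<otimes>\<^sub>K L\<close>.\<close>

definition base_point ::
  "('k, 'x) ring_scheme \<Rightarrow> ('k, 'e) module \<Rightarrow> ('k, 'l) module \<Rightarrow> 'e set \<Rightarrow> ('e, 'l) tens set" where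
  "base_point K E L P = tensor_map K (E\<lparr>carrier := P\<rparr>) L E L (\<lambda>x. x) (\<lambda>b. b) `
     carrier (tensor K (E\<lparr>carrier := P\<rparr>) L)"

text \<open>Locally free sheaves of rank \<open>r\<close> on the curve, realized (through their generic stalk) as
  subsheaves of the constant sheaf of an \<open>E\<close>-vector space \<open>V\<close>.  Restriction maps are inclusions, so the
  sheaf axiom reads \<open>Mc(\<Union>U\<^sub>i) = \<Inter>Mc(U\<^sub>i)\<close>; only nonempty open sets matter.\<close>

definition locally_free_sheaf ::
  "('k, 'x) ring_scheme \<Rightarrow> ('k, 'e) module \<Rightarrow> 'e list \<Rightarrow> ('e, 'v) module \<Rightarrow> nat \<Rightarrow>
   ('e set set \<Rightarrow> 'v set) \<Rightarrow> bool" where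
  "locally_free_sheaf K E xs V r Mc \<longleftrightarrow>
     (\<forall>U. openin (zariski K E xs) U \<and> U \<noteq> {} \<longrightarrow> submodule (Mc U) (regular_functions E U) V) \<and>
     (\<forall>\<U>. \<U> \<noteq> {} \<and> (\<forall>U\<in>\<U>. openin (zariski K E xs) U \<and> U \<noteq> {}) \<longrightarrow> Mc (\<Union>\<U>) = (\<Inter>U\<in>\<U>. Mc U)) \<and>
     (\<forall>P\<in>points K E xs. \<exists>U e. openin (zariski K E xs) U \<and> P \<in> U \<and>
        (\<forall>W. openin (zariski K E xs) W \<and> W \<noteq> {} \<and> W \<subseteq> U \<longrightarrow>
           is_basis (regular_functions E W) (V\<lparr>carrier := Mc W\<rparr>) r e))"

definition stalk ::
  "('k, 'x) ring_scheme \<Rightarrow> ('k, 'e) module \<Rightarrow> 'e list \<Rightarrow> ('e set set \<Rightarrow> 'v set) \<Rightarrow> 'e set \<Rightarrow> 'v set" where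
  "stalk K E xs Mc P = \<Union>{Mc U | U. openin (zariski K E xs) U \<and> P \<in> U}"

text \<open>The stalk at \<open>P\<close> of \<open>Mc(n \<cdot> P)\<close>, namely \<open>\<mm>\<^sub>P\<^sup>-\<^sup>n Mc\<^sub>P\<close>.\<close>

definition twisted_stalk ::
  "('k, 'x) ring_scheme \<Rightarrow> ('k, 'e) module \<Rightarrow> 'e list \<Rightarrow> ('e, 'v) module \<Rightarrow>
   ('e set set \<Rightarrow> 'v set) \<Rightarrow> 'e set \<Rightarrow> nat \<Rightarrow> 'v set" where
  "twisted_stalk K E xs V Mc P n = {y \<in> carrier V.
     \<forall>z\<in>ideal_power (E\<lparr>carrier := P\<rparr>) (maximal_ideal_at E P) n. z \<odot>\<^bsub>V\<^esub> y \<in> stalk K E xs Mc P}"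


section \<open>Frobenius pullback and modules with Frobenius\<close>

text \<open>\<open>\<sigma>\<^sup>* : a \<otimes> b \<mapsto> a \<otimes> b\<^sup>q\<close> on \<open>B \<otimes>\<^sub>k L\<close>, where \<open>q\<close> is the order of \<open>k\<close>.\<close>

definition frob ::
  "('k, 'x) ring_scheme \<Rightarrow> ('k, 'b) module \<Rightarrow> ('k, 'l) module \<Rightarrow> ('b, 'l) tens \<Rightarrow> ('b, 'l) tens" where
  "frob k B L = tensor_map k B L B L (\<lambda>a. a) (\<lambda>b. b [^]\<^bsub>L\<^esub> order k)"

text \<open>\<open>\<sigma>\<^sup>*M = M \<otimes>\<^sub>S\<^sub>,\<^sub>\<sigma> S\<close> for a ring endomorphism \<open>\<sigma>\<close> of \<open>S\<close>.\<close>

definition pullback ::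
  "('s, 'x) ring_scheme \<Rightarrow> ('s \<Rightarrow> 's) \<Rightarrow> ('s, 'm) module \<Rightarrow> ('s, ('m, 's) tens) module" where
  "pullback S \<sigma> M = extend_scalars S M (alg_via \<sigma> S)"

definition pullback_map ::
  "('s, 'x) ring_scheme \<Rightarrow> ('s \<Rightarrow> 's) \<Rightarrow> ('s, 'm) module \<Rightarrow> ('s, 'n) module \<Rightarrow> ('m \<Rightarrow> 'n) \<Rightarrow>
   ('m, 's) tens \<Rightarrow> ('n, 's) tens" where
  "pullback_map S \<sigma> M N f = tensor_map S M (alg_via \<sigma> S) N (alg_via \<sigma> S) f (\<lambda>s. s)"

text \<open>The \<open>S\<close>-linear maps \<open>g : M \<rightarrow> M'\<close> with \<open>g \<circ> \<phi> = \<phi>' \<circ> \<sigma>\<^sup>*g\<close>, where \<open>\<phi> : \<sigma>\<^sup>*M \<rightarrow> M\<close> and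
  \<open>\<phi>' : \<sigma>\<^sup>*M' \<rightarrow> M'\<close>, as a module over a ring acting through \<open>i\<close> into \<open>S\<close>.  Maps are extensional, so
  that equality of maps is equality on the carrier.\<close>

definition frob_hom ::
  "('b \<Rightarrow> 's) \<Rightarrow> ('s, 'x) ring_scheme \<Rightarrow> ('s \<Rightarrow> 's) \<Rightarrow>
   ('s, 'm) module \<Rightarrow> (('m, 's) tens \<Rightarrow> 'm) \<Rightarrow> ('s, 'n) module \<Rightarrow> (('n, 's) tens \<Rightarrow> 'n) \<Rightarrow>
   ('b, 'm \<Rightarrow> 'n) module" where
  "frob_hom i S \<sigma> M \<phi> M' \<phi>' =
     \<lparr>carrier = {g \<in> extensional (carrier M). module_hom S M M' g \<and>
         (\<forall>x\<in>carrier (pullback S \<sigma> M). g (\<phi> x) = \<phi>' (pullback_map S \<sigma> M M' g x))},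
      monoid.mult = undefined, one = undefined,
      ring.zero = (\<lambda>x\<in>carrier M. \<zero>\<^bsub>M'\<^esub>),
      add = (\<lambda>f g. \<lambda>x\<in>carrier M. f x \<oplus>\<^bsub>M'\<^esub> g x),
      smult = (\<lambda>b f. \<lambda>x\<in>carrier M. i b \<odot>\<^bsub>M'\<^esub> f x)\<rparr>"

text \<open>Let \<open>h : S \<rightarrow> T\<close> be a ring homomorphism compatible with endomorphisms \<open>\<sigma>\<close>, \<open>\<sigma>T\<close>.  For
  \<open>\<tau> : \<sigma>\<^sup>*M \<rightarrow> M\<close>, \<open>base_change_frob\<close> is
  \<open>\<tau> \<otimes> id : \<sigma>\<^sub>T\<^sup>*(M \<otimes>\<^sub>S T) = \<sigma>\<^sup>*M \<otimes>\<^sub>S T \<rightarrow> M \<otimes>\<^sub>S T\<close>, the identification \<open>pullback_base_change\<close> being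
  \<open>(m \<otimes> s) \<otimes> t \<mapsto> (m \<otimes> 1) \<otimes> \<sigma>\<^sub>T(s) t\<close>.\<close>

definition pullback_base_change ::
  "('s, 'x) ring_scheme \<Rightarrow> ('s \<Rightarrow> 's) \<Rightarrow> ('t, 'y) ring_scheme \<Rightarrow> ('t \<Rightarrow> 't) \<Rightarrow> ('s \<Rightarrow> 't) \<Rightarrow>
   ('s, 'm) module \<Rightarrow> (('m, 't) tens, 't) tens \<Rightarrow> (('m, 's) tens, 't) tens" where
  "pullback_base_change S \<sigma> T \<sigma>T h M =
     (let sM = pullback S \<sigma> M; N = extend_scalars S sM (alg_via h T) in
      tensor_lift N (\<lambda>y t. t \<odot>\<^bsub>N\<^esub> tensor_lift N
        (\<lambda>m s. pure_tensor S sM (alg_via h T) (pure_tensor S M (alg_via \<sigma> S) m \<one>\<^bsub>S\<^esub>) (\<sigma>T s)) y))"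

definition base_change_frob ::
  "('s, 'x) ring_scheme \<Rightarrow> ('s \<Rightarrow> 's) \<Rightarrow> ('t, 'y) ring_scheme \<Rightarrow> ('t \<Rightarrow> 't) \<Rightarrow> ('s \<Rightarrow> 't) \<Rightarrow>
   ('s, 'm) module \<Rightarrow> (('m, 's) tens \<Rightarrow> 'm) \<Rightarrow> (('m, 't) tens, 't) tens \<Rightarrow> ('m, 't) tens" where
  "base_change_frob S \<sigma> T \<sigma>T h M \<tau> Z =
     tensor_map S (pullback S \<sigma> M) (alg_via h T) M (alg_via h T) \<tau> (\<lambda>t. t)
       (pullback_base_change S \<sigma> T \<sigma>T h M Z)"

text \<open>The \<open>\<sigma>\<close>-semilinear map \<open>m \<mapsto> \<tau>(m \<otimes> 1)\<close>.  With \<open>(\<sigma>\<^sup>*)\<^sup>lM\<close> identified with \<open>(\<sigma>\<^sup>l)\<^sup>*M\<close>, the map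
  \<open>\<tau>\<^sup>l = \<tau> \<circ> \<sigma>\<^sup>*\<tau> \<circ> \<dots> \<circ> (\<sigma>\<^sup>*)\<^sup>l\<^sup>-\<^sup>1\<tau>\<close> sends \<open>m \<otimes> s\<close> to \<open>s\<close> times the \<open>l\<close>-th iterate of the semilinear map
  at \<open>m\<close>.\<close>

definition semilinear ::
  "('s, 'x) ring_scheme \<Rightarrow> ('s \<Rightarrow> 's) \<Rightarrow> ('s, 'm) module \<Rightarrow> (('m, 's) tens \<Rightarrow> 'm) \<Rightarrow> 'm \<Rightarrow> 'm" where
  "semilinear S \<sigma> M \<tau> m = \<tau> (pure_tensor S M (alg_via \<sigma> S) m \<one>\<^bsub>S\<^esub>)"

definition frob_iterate ::
  "('s, 'x) ring_scheme \<Rightarrow> ('s \<Rightarrow> 's) \<Rightarrow> ('s, 'm) module \<Rightarrow> (('m, 's) tens \<Rightarrow> 'm) \<Rightarrow> nat \<Rightarrow>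
   ('m, 's) tens \<Rightarrow> 'm" where
  "frob_iterate S \<sigma> M \<tau> l = tensor_lift M (\<lambda>m s. s \<odot>\<^bsub>M\<^esub> (semilinear S \<sigma> M \<tau> ^^ l) m)"


section \<open>Pure motives\<close>

text \<open>Throughout, \<open>k\<close> is the finite field of constants, the curve is given by its function field \<open>F\<close> and
  coordinates \<open>xs\<close>, and \<open>P\<close> is the local ring at the point at infinity.\<close>

definition coord_ring :: "('k, 'x) ring_scheme \<Rightarrow> ('k, 'f) module \<Rightarrow> 'f list \<Rightarrow> 'f set \<Rightarrow> ('k, 'f) module" where
  "coord_ring k F xs P = regular_functions F (points k F xs - {P})"

definition char_ideal ::
  "('k, 'x) ring_scheme \<Rightarrow> ('k, 'f) module \<Rightarrow> ('k, 'l) module \<Rightarrow> ('f \<Rightarrow> 'l) \<Rightarrow> ('f, 'l) tens set" where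
  "char_ideal k A L c = genideal (tensor k A L)
     {pure_tensor k A L a \<one>\<^bsub>L\<^esub> \<ominus>\<^bsub>tensor k A L\<^esub> pure_tensor k A L \<one>\<^bsub>A\<^esub> (c a) | a. a \<in> carrier A}"

text \<open>\<open>V\<close> is the generic stalk \<open>M \<otimes> (F \<otimes>\<^sub>k L)\<close>, and \<open>\<tau>\<^sup>l\<close> on stalks at infinity is the restriction of
  \<open>\<tau>\<^sup>l\<close> on \<open>V\<close>.\<close>

definition extends_purely ::
  "('k, 'x) ring_scheme \<Rightarrow> ('k, 'f) module \<Rightarrow> 'f list \<Rightarrow> 'f set \<Rightarrow> ('k, 'l) module \<Rightarrow> nat \<Rightarrow>
   (('f, 'l) tens, 'm) module \<Rightarrow> (('m, ('f, 'l) tens) tens \<Rightarrow> 'm) \<Rightarrow> bool" where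
  "extends_purely k F xs P L r M \<tau> \<longleftrightarrow>
    (let A = coord_ring k F xs P; AL = tensor k A L;
         FL = base_field k F L; xsL = base_coords k F L xs; PL = base_point k F L P;
         h = tensor_map k A L F L (\<lambda>a. a) (\<lambda>b. b);
         V = extend_scalars AL M (alg_via h FL);
         \<sigma> = frob k F L;
         \<tau>V = base_change_frob AL (frob k A L) FL \<sigma> h M \<tau>
     in \<exists>Mc n l. locally_free_sheaf L FL xsL V r Mc \<and>
          Mc (points L FL xsL - {PL}) =
            (\<lambda>m. pure_tensor AL M (alg_via h FL) m \<one>\<^bsub>FL\<^esub>) ` carrier M \<and>
          n > 0 \<and> l > 0 \<and>
          bij_betw (frob_iterate FL \<sigma> V \<tau>V l)
            (carrier (pullback (FL\<lparr>carrier := PL\<rparr>) (\<sigma> ^^ l) (V\<lparr>carrier := stalk L FL xsL Mc PL\<rparr>)))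
            (twisted_stalk L FL xsL V Mc PL n))"

definition pure_motive ::
  "('k, 'x) ring_scheme \<Rightarrow> ('k, 'f) module \<Rightarrow> 'f list \<Rightarrow> 'f set \<Rightarrow> ('k, 'l) module \<Rightarrow> ('f \<Rightarrow> 'l) \<Rightarrow>
   nat \<Rightarrow> nat \<Rightarrow> (('f, 'l) tens, 'm) module \<Rightarrow> (('m, ('f, 'l) tens) tens \<Rightarrow> 'm) \<Rightarrow> bool" where
  "pure_motive k F xs P L c r d M \<tau> \<longleftrightarrow>
    (let A = coord_ring k F xs P; AL = tensor k A L; sM = pullback AL (frob k A L) M;
         im = \<tau> ` carrier sM
     in locally_free AL M r \<and>
        module_hom AL sM M \<tau> \<and> inj_on \<tau> (carrier sM) \<and>
        free_of_rank L (restrict_scalars (pure_tensor k A L \<one>\<^bsub>A\<^esub>) (quotient_module M im)) d \<and>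
        (\<forall>j\<in>ideal_power AL (char_ideal k A L c) d. \<forall>Z\<in>carrier (quotient_module M im).
           j \<odot>\<^bsub>quotient_module M im\<^esub> Z = \<zero>\<^bsub>quotient_module M im\<^esub>) \<and>
        extends_purely k F xs P L r M \<tau>)"

text \<open>\<open>Hom(M, M')\<close>, an \<open>A\<close>-module through \<open>a \<mapsto> a \<otimes> 1\<close>.\<close>

definition motive_hom ::
  "('k, 'x) ring_scheme \<Rightarrow> ('k, 'a) module \<Rightarrow> ('k, 'l) module \<Rightarrow>
   (('a, 'l) tens, 'm) module \<Rightarrow> (('m, ('a, 'l) tens) tens \<Rightarrow> 'm) \<Rightarrow>
   (('a, 'l) tens, 'n) module \<Rightarrow> (('n, ('a, 'l) tens) tens \<Rightarrow> 'n) \<Rightarrow> ('a, 'm \<Rightarrow> 'n) module" where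
  "motive_hom k A L M \<tau> M' \<tau>' =
     frob_hom (\<lambda>a. pure_tensor k A L a \<one>\<^bsub>L\<^esub>) (tensor k A L) (frob k A L) M \<tau> M' \<tau>'"


section \<open>Local shtukas\<close>

definition local_ring_map ::
  "('k, 'x) ring_scheme \<Rightarrow> ('k, 'a) module \<Rightarrow> ('k, 'l) module \<Rightarrow> 'a set \<Rightarrow>
   ('a, 'l) tens \<Rightarrow> (nat \<Rightarrow> 'a set, 'l) tens" where
  "local_ring_map k A L v = tensor_map k A L (completion A v) L (completion_map A v) (\<lambda>b. b)"

definition local_module ::
  "('k, 'x) ring_scheme \<Rightarrow> ('k, 'a) module \<Rightarrow> ('k, 'l) module \<Rightarrow> 'a set \<Rightarrow> (('a, 'l) tens, 'm) module \<Rightarrow>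
   ((nat \<Rightarrow> 'a set, 'l) tens, ('m, (nat \<Rightarrow> 'a set, 'l) tens) tens) module" where
  "local_module k A L v M =
     extend_scalars (tensor k A L) M (alg_via (local_ring_map k A L v) (tensor k (completion A v) L))"

definition local_frob ::
  "('k, 'x) ring_scheme \<Rightarrow> ('k, 'a) module \<Rightarrow> ('k, 'l) module \<Rightarrow> 'a set \<Rightarrow>
   (('a, 'l) tens, 'm) module \<Rightarrow> (('m, ('a, 'l) tens) tens \<Rightarrow> 'm) \<Rightarrow>
   (('m, (nat \<Rightarrow> 'a set, 'l) tens) tens, (nat \<Rightarrow> 'a set, 'l) tens) tens \<Rightarrow>
   ('m, (nat \<Rightarrow> 'a set, 'l) tens) tens" where
  "local_frob k A L v M \<tau> =
     base_change_frob (tensor k A L) (frob k A L)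
       (tensor k (completion A v) L) (frob k (completion A v) L) (local_ring_map k A L v) M \<tau>"

definition local_hom ::
  "('k, 'x) ring_scheme \<Rightarrow> ('k, 'a) module \<Rightarrow> ('k, 'l) module \<Rightarrow> 'a set \<Rightarrow>
   (('a, 'l) tens, 'm) module \<Rightarrow> (('m, ('a, 'l) tens) tens \<Rightarrow> 'm) \<Rightarrow>
   (('a, 'l) tens, 'n) module \<Rightarrow> (('n, ('a, 'l) tens) tens \<Rightarrow> 'n) \<Rightarrow>
   (nat \<Rightarrow> 'a set,
    ('m, (nat \<Rightarrow> 'a set, 'l) tens) tens \<Rightarrow> ('n, (nat \<Rightarrow> 'a set, 'l) tens) tens) module" where
  "local_hom k A L v M \<tau> M' \<tau>' = (let Av = completion A v in
     frob_hom (\<lambda>a. pure_tensor k Av L a \<one>\<^bsub>L\<^esub>) (tensor k Av L) (frob k Av L)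
       (local_module k A L v M) (local_frob k A L v M \<tau>)
       (local_module k A L v M') (local_frob k A L v M' \<tau>'))"

definition localize_map ::
  "('k, 'x) ring_scheme \<Rightarrow> ('k, 'a) module \<Rightarrow> ('k, 'l) module \<Rightarrow> 'a set \<Rightarrow>
   (('a, 'l) tens, 'm) module \<Rightarrow> (('a, 'l) tens, 'n) module \<Rightarrow> ('m \<Rightarrow> 'n) \<Rightarrow>
   ('m, (nat \<Rightarrow> 'a set, 'l) tens) tens \<Rightarrow> ('n, (nat \<Rightarrow> 'a set, 'l) tens) tens" where
  "localize_map k A L v M M' f =
     (let T = alg_via (local_ring_map k A L v) (tensor k (completion A v) L) in
      restrict (tensor_map (tensor k A L) M T M' T f (\<lambda>t. t)) (carrier (local_module k A L v M)))"

definition motive_hom_at ::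
  "('k, 'x) ring_scheme \<Rightarrow> ('k, 'a) module \<Rightarrow> ('k, 'l) module \<Rightarrow> 'a set \<Rightarrow>
   (('a, 'l) tens, 'm) module \<Rightarrow> (('m, ('a, 'l) tens) tens \<Rightarrow> 'm) \<Rightarrow>
   (('a, 'l) tens, 'n) module \<Rightarrow> (('n, ('a, 'l) tens) tens \<Rightarrow> 'n) \<Rightarrow>
   (nat \<Rightarrow> 'a set, ('m \<Rightarrow> 'n, nat \<Rightarrow> 'a set) tens) module" where
  "motive_hom_at k A L v M \<tau> M' \<tau>' =
     extend_scalars A (motive_hom k A L M \<tau> M' \<tau>') (alg_via (completion_map A v) (completion A v))"

definition natural_map ::
  "('k, 'x) ring_scheme \<Rightarrow> ('k, 'a) module \<Rightarrow> ('k, 'l) module \<Rightarrow> 'a set \<Rightarrow>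
   (('a, 'l) tens, 'm) module \<Rightarrow> (('m, ('a, 'l) tens) tens \<Rightarrow> 'm) \<Rightarrow>
   (('a, 'l) tens, 'n) module \<Rightarrow> (('n, ('a, 'l) tens) tens \<Rightarrow> 'n) \<Rightarrow>
   ('m \<Rightarrow> 'n, nat \<Rightarrow> 'a set) tens \<Rightarrow>
   ('m, (nat \<Rightarrow> 'a set, 'l) tens) tens \<Rightarrow> ('n, (nat \<Rightarrow> 'a set, 'l) tens) tens" where
  "natural_map k A L v M \<tau> M' \<tau>' = (let H = local_hom k A L v M \<tau> M' \<tau>' in
     tensor_lift H (\<lambda>f a. a \<odot>\<^bsub>H\<^esub> localize_map k A L v M M' f))"

end

theory Submission
  imports Defs
begin

text \<open>Since \<open>L\<close> is finite over \<open>k\<close>, the module \<open>M\<close> is finitely generated projective over \<open>A\<close>, and a map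
  is a homomorphism of motives iff it is \<open>A\<close>-linear and commutes with finitely many \<open>A\<close>-linear
  operators: multiplication by a \<open>k\<close>-basis of \<open>L\<close> and the map \<open>m \<mapsto> \<tau>(m \<otimes> 1)\<close>, which is \<open>A\<close>-linear because
  \<open>\<sigma>\<close> fixes \<open>A\<close>.  The same description over \<open>A\<^sub>v\<close> computes the homomorphisms of the local shtukas.  So
  both sides are kernels of the same finite system of linear equations, over \<open>A\<close> and over \<open>A\<^sub>v\<close>, and
  the theorem is flatness of \<open>A \<rightarrow> A\<^sub>v\<close> in its equational form.  Flatness holds because \<open>A\<close> localized at
  \<open>v\<close> is a valuation ring with a uniformizer: this is where regularity of the curve and its
  dimension enter.\<close>


section \<open>Tensor products\<close>

\<comment> \<open>Descent along \<open>A\<close> to its completion works for finite systems of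
  linear equations only, so homomorphisms must become matrices. The modules are merely locally free
  and have no bases; dual bases take their place, that is, finitely many generators with linear
  coordinate functions. In these every linear map has a matrix and every matrix defines a linear
  map, even though different matrices may define the same one. To glue local bases into a dual
  basis, the powers of the denominators must be bounded over all relations at once, which forces a
  proof that the relations are finitely generated. Injectivity and surjectivity use the same
  equational statement, for the relations among given homomorphisms and for the matrices that
  commute with the operators. The second obstacle is geometric. \<open>A\<close> is an intersection
  of local rings of the curve, and nothing in its definition attaches a point to the maximal ideal
  \<open>v\<close>. The localization at a nonzero \<open>v\<close> is therefore shown to be a
  valuation ring by manipulating polynomial relations; projectivity then provides the point that it
  dominates, and regularity a generator of the maximal ideal there.\<close>
text \<open>The short index form \<open>\<otimes>\<^sub>M\<close> for a structure named by a single identifier.\<close>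

syntax "_index" :: "logic \<Rightarrow> index" (\<open>\<^sub>_\<close> [1000])

section \<open>Additive maps and balanced biadditive maps\<close>

definition additive :: "('m, 'x) ring_scheme => ('n, 'y) ring_scheme => ('m => 'n) => bool" where
 "additive M N f \<longleftrightarrow> f \<in> carrier M \<rightarrow> carrier N &
  (\<forall>x\<in>carrier M. \<forall>y\<in>carrier M. f (x \<oplus>\<^sub>M y) = f x \<oplus>\<^sub>N f y)"

lemma additiveI:
 assumes "!!x. x \<in> carrier M ==> f x \<in> carrier N"
  and "!!x y. x \<in> carrier M ==> y \<in> carrier M ==> f (x \<oplus>\<^sub>M y) = f x \<oplus>\<^sub>N f y"
 shows "additive M N f"
 using assms by (auto simp: additive_def)

lemma additive_closed: "additive M N f ==> x \<in> carrier M ==> f x \<in> carrier N"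
 by (auto simp: additive_def)

lemma additive_add:
 "additive M N f ==> x \<in> carrier M ==> y \<in> carrier M ==> f (x \<oplus>\<^sub>M y) = f x \<oplus>\<^sub>N f y"
 by (auto simp: additive_def)

lemma additive_zero:
 assumes "abelian_group M" "abelian_group N" "additive M N f"
 shows "f \<zero>\<^sub>M = \<zero>\<^sub>N"
proof -
 interpret M: abelian_group M by fact
 interpret N: abelian_group N by fact
 have "f \<zero>\<^sub>M \<in> carrier N" using assms(3) by (simp add: additive_closed)
 moreover have "f \<zero>\<^sub>M = f \<zero>\<^sub>M \<oplus>\<^sub>N f \<zero>\<^sub>M"
  using additive_add[OF assms(3), of "\<zero>\<^sub>M" "\<zero>\<^sub>M"] by simp
 ultimately show ?thesis by (metis N.add.r_cancel_one')
qed

lemma additive_minus: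
 assumes "abelian_group M" "abelian_group N" "additive M N f" "x \<in> carrier M"
 shows "f (\<ominus>\<^sub>M x) = \<ominus>\<^sub>N f x"
proof -
 interpret M: abelian_group M by fact
 interpret N: abelian_group N by fact
 have "f (\<ominus>\<^sub>M x) \<oplus>\<^sub>N f x = \<zero>\<^sub>N"
  using additive_add[OF assms(3), of "\<ominus>\<^sub>M x" x] assms additive_zero[OF assms(1-3)]
  by (simp add: M.l_neg)
 then show ?thesis
  by (metis M.a_inv_closed N.minus_equality additive_closed assms(3,4))
qed

text \<open>Infinite \<open>I\<close> is included: both sums then take the default value zero, which
  an additive map preserves.\<close>

lemma additive_finsum:
 assumes "abelian_group M" "abelian_group N" "additive M N f" "g \<in> I \<rightarrow> carrier M"
 shows "f (\<Oplus>\<^sub>M i\<in>I. g i) = (\<Oplus>\<^sub>N i\<in>I. f (g i))"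
proof -
 have fcl: "x \<in> carrier M ==> f x \<in> carrier N" for x by (rule additive_closed[OF assms(3)])
 interpret M: abelian_group M by fact
 interpret N: abelian_group N by fact
 show ?thesis using assms(4)
 proof (induction I rule: infinite_finite_induct)
  case (insert i I)
  then have "g i \<in> carrier M" "g \<in> I \<rightarrow> carrier M" by auto
  moreover have "(\<lambda>i. f (g i)) \<in> I \<rightarrow> carrier N" "f (g i) \<in> carrier N"
   using insert.prems fcl by auto
  ultimately show ?case using insert
   by (simp add: additive_add[OF assms(3)] M.finsum_closed)
 qed (use additive_zero[OF assms(1-3)] in \<open>auto simp: M.finsum_infinite N.finsum_infinite\<close>)
qed

text \<open>Many structures here are records that repackage the addition of another one, such as
  \<open>alg_via\<close>, \<open>restrict_scalars\<close> and \<open>extend_scalars\<close>; the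
  group laws pass from record to record by comparing fields.\<close>

lemma abelian_group_transfer:
 assumes "abelian_group M" "carrier N = carrier M" "add N = add M" "\<zero>\<^sub>N = \<zero>\<^sub>M"
 shows "abelian_group N"
proof -
 interpret M: abelian_group M by fact
 show ?thesis
 proof (rule abelian_groupI)
  fix x assume "x \<in> carrier N"
  then show "\<exists>y\<in>carrier N. y \<oplus>\<^sub>N x = \<zero>\<^sub>N"
   using M.l_neg M.a_inv_closed unfolding assms(2-) by blast
 qed (simp_all add: assms(2-) M.a_ac)
qed

text \<open>The condition that makes \<open>tensor_lift\<close> independent of the representative it
  chooses. Only the addition of \<open>T\<close> enters, so \<open>T\<close> may be a ring, a module
  or a module of maps.\<close>

definition balanced ::
 "('r, 'x) ring_scheme => ('r, 'm) module => ('r, 'n) module => ('t, 'z) ring_scheme =>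
 ('m => 'n => 't) => bool" where
 "balanced R M N T B \<longleftrightarrow>
  (\<forall>y\<in>carrier N. additive M T (\<lambda>x. B x y)) & (\<forall>x\<in>carrier M. additive N T (B x)) &
  (\<forall>r\<in>carrier R. \<forall>x\<in>carrier M. \<forall>y\<in>carrier N. B (r \<odot>\<^sub>M x) y = B x (r \<odot>\<^sub>N y))"

lemma balancedI:
 assumes "!!x y. x \<in> carrier M ==> y \<in> carrier N ==> B x y \<in> carrier T"
  and "!!x x' y. x \<in> carrier M ==> x' \<in> carrier M ==> y \<in> carrier N ==>
     B (x \<oplus>\<^sub>M x') y = B x y \<oplus>\<^sub>T B x' y"
  and "!!x y y'. x \<in> carrier M ==> y \<in> carrier N ==> y' \<in> carrier N ==>
     B x (y \<oplus>\<^sub>N y') = B x y \<oplus>\<^sub>T B x y'"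
  and "!!r x y. r \<in> carrier R ==> x \<in> carrier M ==> y \<in> carrier N ==>
     B (r \<odot>\<^sub>M x) y = B x (r \<odot>\<^sub>N y)"
 shows "balanced R M N T B"
 using assms by (auto simp: balanced_def additive_def)

lemma balancedD:
 assumes "balanced R M N T B"
 shows "x \<in> carrier M ==> y \<in> carrier N ==> B x y \<in> carrier T"
  and "x \<in> carrier M ==> x' \<in> carrier M ==> y \<in> carrier N ==>
     B (x \<oplus>\<^sub>M x') y = B x y \<oplus>\<^sub>T B x' y"
  and "x \<in> carrier M ==> y \<in> carrier N ==> y' \<in> carrier N ==>
     B x (y \<oplus>\<^sub>N y') = B x y \<oplus>\<^sub>T B x y'"
  and "r \<in> carrier R ==> x \<in> carrier M ==> y \<in> carrier N ==>
     B (r \<odot>\<^sub>M x) y = B x (r \<odot>\<^sub>N y)"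
 using assms by (auto simp: balanced_def additive_def Pi_def)

section \<open>The tensor product as a group and its universal property\<close>

locale tensor_pair = M: module R M + N: module R N
 for R (structure) and M :: "('a, 'm) module" and N :: "('a, 'n) module"
begin

abbreviation "FG \<equiv> free_Abelian_group (carrier M \<times> carrier N)"
abbreviation "TK \<equiv> tensor_ker R M N"
abbreviation "TT \<equiv> tensor R M N"
abbreviation "pt \<equiv> pure_tensor R M N"

lemma tensor_rels_subset: "tensor_rels R M N \<subseteq> carrier FG"
proof -
 have d: "a - b \<in> carrier FG" if "a \<in> carrier FG" "b \<in> carrier FG"
  for a b :: "('m \<times> 'n) \<Rightarrow>\<^sub>0 int"
  using that keys_diff[of a b] unfolding carrier_free_Abelian_group_iff by blast
 have f: "frag_of (x, y) \<in> carrier FG" if "x \<in> carrier M" "y \<in> carrier N" for x y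
  using that by simp
 show ?thesis
  unfolding tensor_rels_def
  by (intro Un_least subsetI; clarify; intro d f; simp)
qed

lemma subgroup_TK: "subgroup TK FG"
 unfolding tensor_ker_def
 by (rule group.generate_is_subgroup[OF group_free_Abelian_group tensor_rels_subset])

lemma normal_TK: "TK \<lhd> FG"
 by (simp add: abelian_free_Abelian_group comm_group.subgroup_imp_normal subgroup_TK)

lemma add_monoid_tensor_group: "add_monoid (tensor_group R M N) = FG Mod TK"
 by (simp add: tensor_group_def FactGroup_def)

lemma carrier_tensor: "carrier TT = rcosets\<^bsub>FG\<^esub> TK"
 by (simp add: tensor_def Let_def tensor_group_def)

lemma zero_tensor: "\<zero>\<^sub>TT = TK"
 by (simp add: tensor_def Let_def tensor_group_def)

lemma add_tensor: "Z \<oplus>\<^sub>TT Z' = Z <#>\<^sub>FG Z'"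
 by (simp add: tensor_def Let_def tensor_group_def)

lemma abelian_group_tensor: "abelian_group TT"
proof -
 have "comm_group (add_monoid (tensor_group R M N))"
  unfolding add_monoid_tensor_group
  by (simp add: abelian_free_Abelian_group comm_group.abelian_FactGroup subgroup_TK)
 then have "abelian_group (tensor_group R M N)"
  by (simp add: abelian_group_axioms_def abelian_group_def abelian_monoid_def comm_group.axioms(1))
 then show ?thesis
  by (rule abelian_group_transfer) (simp_all add: tensor_def Let_def)
qed

sublocale T: abelian_group TT
 by (rule abelian_group_tensor)

lemma coset_add:
 assumes "u \<in> carrier FG" "w \<in> carrier FG"
 shows "(TK #>\<^sub>FG u) \<oplus>\<^sub>TT (TK #>\<^sub>FG w) = TK #>\<^sub>FG (u + w)"
 using normal.rcos_sum[OF normal_TK assms] by (simp add: add_tensor)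

lemma coset_closed: "u \<in> carrier FG ==> TK #>\<^sub>FG u \<in> carrier TT"
 by (auto simp: carrier_tensor RCOSETS_def)

lemma TK_subset: "TK \<subseteq> carrier FG"
 using subgroup.subset[OF subgroup_TK] .

lemma coset_eq:
 assumes "u \<in> carrier FG" "w \<in> carrier FG" "u - w \<in> TK"
 shows "TK #>\<^sub>FG u = TK #>\<^sub>FG w"
proof -
 have d: "u - w \<in> carrier FG" using assms(3) TK_subset by blast
 have "TK #>\<^sub>FG u = TK #>\<^sub>FG ((u - w) \<otimes>\<^sub>FG w)" by simp
 also have "... = (TK #>\<^sub>FG (u - w)) #>\<^sub>FG w"
  using group.coset_mult_assoc[OF group_free_Abelian_group TK_subset d assms(2)] by simp
 also have "TK #>\<^sub>FG (u - w) = TK"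
  by (rule group.coset_join2[OF group_free_Abelian_group d subgroup_TK assms(3)])
 finally show ?thesis .
qed

lemma pt_closed [intro, simp]:
 "x \<in> carrier M ==> y \<in> carrier N ==> pt x y \<in> carrier TT"
 by (simp add: pure_tensor_def coset_closed)

lemma TK_rel: "u \<in> tensor_rels R M N ==> u \<in> TK"
 unfolding tensor_ker_def by (rule generate.incl)

lemma frag_mem: "x \<in> carrier M ==> y \<in> carrier N ==> frag_of (x, y) \<in> carrier FG"
 by simp

lemma plus_mem: "u \<in> carrier FG ==> w \<in> carrier FG ==> u + w \<in> carrier FG"
 using group.is_monoid[OF group_free_Abelian_group] monoid.m_closed mult_free_Abelian_group by metis

lemma pt_add_l:
 assumes "x \<in> carrier M" "x' \<in> carrier M" "y \<in> carrier N"
 shows "pt (x \<oplus>\<^sub>M x') y = pt x y \<oplus>\<^sub>TT pt x' y"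
proof -
 have "frag_of (x \<oplus>\<^sub>M x', y) - (frag_of (x, y) + frag_of (x', y)) \<in> TK"
  unfolding diff_diff_add[symmetric]
  by (rule TK_rel) (use assms in \<open>auto simp: tensor_rels_def\<close>)
 then show ?thesis
  unfolding pure_tensor_def coset_add[OF frag_mem[OF assms(1,3)] frag_mem[OF assms(2,3)]]
  using assms by (intro coset_eq plus_mem frag_mem) auto
qed

lemma pt_add_r:
 assumes "x \<in> carrier M" "y \<in> carrier N" "y' \<in> carrier N"
 shows "pt x (y \<oplus>\<^sub>N y') = pt x y \<oplus>\<^sub>TT pt x y'"
proof -
 have "frag_of (x, y \<oplus>\<^sub>N y') - (frag_of (x, y) + frag_of (x, y')) \<in> TK"
  unfolding diff_diff_add[symmetric]
  by (rule TK_rel) (use assms in \<open>auto simp: tensor_rels_def\<close>)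
 then show ?thesis
  unfolding pure_tensor_def coset_add[OF frag_mem[OF assms(1,2)] frag_mem[OF assms(1,3)]]
  using assms by (intro coset_eq plus_mem frag_mem) auto
qed

lemma pt_smult:
 assumes "r \<in> carrier R" "x \<in> carrier M" "y \<in> carrier N"
 shows "pt (r \<odot>\<^sub>M x) y = pt x (r \<odot>\<^sub>N y)"
proof -
 have "frag_of (r \<odot>\<^sub>M x, y) - frag_of (x, r \<odot>\<^sub>N y) \<in> TK"
  by (rule TK_rel) (use assms in \<open>auto simp: tensor_rels_def\<close>)
 then show ?thesis unfolding pure_tensor_def
  using assms by (intro coset_eq frag_mem) auto
qed

lemma balanced_pt: "balanced R M N TT pt"
 by (rule balancedI) (auto simp: pt_add_l pt_add_r pt_smult)

lemma pt_zero_l: "y \<in> carrier N ==> pt \<zero>\<^sub>M y = \<zero>\<^sub>TT"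
 using additive_zero[OF M.M.abelian_group_axioms abelian_group_tensor, of "\<lambda>x. pt x y"] balanced_pt
 by (simp add: balanced_def)

lemma pt_zero_r: "x \<in> carrier M ==> pt x \<zero>\<^sub>N = \<zero>\<^sub>TT"
 using additive_zero[OF N.M.abelian_group_axioms abelian_group_tensor, of "pt x"] balanced_pt
 by (simp add: balanced_def)

lemma pt_minus_l: "x \<in> carrier M ==> y \<in> carrier N ==> pt (\<ominus>\<^sub>M x) y = \<ominus>\<^sub>TT pt x y"
 using additive_minus[OF M.M.abelian_group_axioms abelian_group_tensor, of "\<lambda>x. pt x y"] balanced_pt
 by (simp add: balanced_def)

lemma uminus_mem: "u \<in> carrier FG ==> - u \<in> carrier FG"
 by simp

lemma coset_uminus:
 assumes "u \<in> carrier FG"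
 shows "TK #>\<^sub>FG (- u) = \<ominus>\<^sub>TT (TK #>\<^sub>FG u)"
proof -
 have "(TK #>\<^sub>FG (- u)) \<oplus>\<^sub>TT (TK #>\<^sub>FG u) = TK #>\<^sub>FG \<one>\<^sub>FG"
  using coset_add[OF uminus_mem[OF assms] assms] by simp
 also have "... = \<zero>\<^sub>TT"
  using TK_subset zero_tensor group.coset_mult_one[OF group_free_Abelian_group] by metis
 finally show ?thesis
  using assms coset_closed T.minus_equality uminus_mem by metis
qed

text \<open>Negatives are covered by the pure case: the negative of a pure tensor is the pure tensor
  with the first factor negated.\<close>

lemma tensor_induct [consumes 1, case_names pure add]:
 assumes "Z \<in> carrier TT"
  and pure: "!!x y. x \<in> carrier M ==> y \<in> carrier N ==> Q (pt x y)"
  and add: "!!Z Z'. Z \<in> carrier TT ==> Z' \<in> carrier TT ==> Q Z ==> Q Z' ==> Q (Z \<oplus>\<^sub>TT Z')"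
 shows "Q Z"
proof -
 obtain u where u: "u \<in> carrier FG" and Z: "Z = TK #>\<^sub>FG u"
  using assms(1) by (auto simp: carrier_tensor RCOSETS_def)
 have Q0: "Q (TK #>\<^sub>FG 0)"
 proof -
  have "TK #>\<^sub>FG 0 = \<zero>\<^sub>TT"
   using TK_subset zero_tensor group.coset_mult_one[OF group_free_Abelian_group] one_free_Abelian_group
   by metis
  then show ?thesis using pure[of "\<zero>\<^sub>M" "\<zero>\<^sub>N"] by (simp add: pt_zero_l)
 qed
 have "Poly_Mapping.keys u \<subseteq> carrier M \<times> carrier N" using u by simp
 \<comment> \<open>The induction rule of the free abelian group passes through differences, so the
   claim for \<open>- u\<close> is carried along with the claim for \<open>u\<close>.\<close>
 then have "Q (TK #>\<^sub>FG u) & Q (TK #>\<^sub>FG (- u))"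
 proof (induction u rule: free_Abelian_group_induct[consumes 1])
  case 1
  then show ?case using Q0 by simp
 next
  case (2 u w)
  then have uw: "u \<in> carrier FG" "w \<in> carrier FG" "- u \<in> carrier FG" "- w \<in> carrier FG" by simp_all
  have "Q (TK #>\<^sub>FG (u + - w))" "Q (TK #>\<^sub>FG (- u + w))"
   using 2 uw add[OF coset_closed coset_closed, of u "- w"] add[OF coset_closed coset_closed, of "- u" w]
   by (simp_all only: coset_add)
  then show ?case by (simp add: algebra_simps)
 next
  case (3 p)
  obtain x y where p: "p = (x, y)" "x \<in> carrier M" "y \<in> carrier N" using 3 by auto
  then have "TK #>\<^sub>FG (- frag_of p) = pt (\<ominus>\<^sub>M x) y"
   by (simp only: coset_uminus[OF frag_mem] pure_tensor_def[symmetric] pt_minus_l p)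
  then show ?case using pure p by (simp add: pure_tensor_def)
 qed
 then show ?thesis using Z by simp
qed

end

text \<open>A homomorphism on a free abelian group is determined by its values on the generators.
  Written additively, the right-hand side is the sum in the body of
  \<open>tensor_lift\<close>.\<close>

lemma (in comm_group) hom_eq_finprod_keys:
 assumes h: "h \<in> hom (free_Abelian_group S) G" and u: "Poly_Mapping.keys u \<subseteq> S"
 shows "h u = finprod G (\<lambda>p. h (frag_of p) [^] Poly_Mapping.lookup u p) (Poly_Mapping.keys u)"
proof -
 interpret h: group_hom "free_Abelian_group S" G h
  using h by (auto simp: group_hom_def group_hom_axioms_def is_group)
 have "h (\<Sum>p\<in>I. frag_cmul (Poly_Mapping.lookup u p) (frag_of p)) =
   finprod G (\<lambda>p. h (frag_of p) [^] Poly_Mapping.lookup u p) I &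
   (\<Sum>p\<in>I. frag_cmul (Poly_Mapping.lookup u p) (frag_of p)) \<in> carrier (free_Abelian_group S)"
  if "finite I" "I \<subseteq> S" for I
  using that
 proof (induction I)
  case empty
  show ?case using h.hom_one by simp
 next
  case (insert p I)
  have p: "frag_of p \<in> carrier (free_Abelian_group S)" using insert.prems by auto
  have pow: "frag_cmul (Poly_Mapping.lookup u p) (frag_of p) =
    frag_of p [^]\<^bsub>free_Abelian_group S\<^esub> Poly_Mapping.lookup u p"
   using p by (subst int_pow_free_Abelian_group) auto
  have mem: "frag_cmul (Poly_Mapping.lookup u p) (frag_of p) \<in> carrier (free_Abelian_group S)"
   unfolding pow using p by (rule group.int_pow_closed[OF group_free_Abelian_group])
  have sub: "I \<subseteq> S" using insert by auto
  note IH = conjunct1[OF insert.IH[OF sub]] conjunct2[OF insert.IH[OF sub]]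
  have hp: "(\<lambda>p. h (frag_of p) [^] Poly_Mapping.lookup u p) \<in> I \<rightarrow> carrier G"
   "h (frag_of p) [^] Poly_Mapping.lookup u p \<in> carrier G"
   using sub p h.hom_closed by (auto intro!: int_pow_closed)
  have "h (\<Sum>q\<in>insert p I. frag_cmul (Poly_Mapping.lookup u q) (frag_of q)) =
    h (frag_cmul (Poly_Mapping.lookup u p) (frag_of p) \<otimes>\<^bsub>free_Abelian_group S\<^esub>
     (\<Sum>q\<in>I. frag_cmul (Poly_Mapping.lookup u q) (frag_of q)))"
   using insert by simp
  also have "... = h (frag_cmul (Poly_Mapping.lookup u p) (frag_of p)) \<otimes>
    h (\<Sum>q\<in>I. frag_cmul (Poly_Mapping.lookup u q) (frag_of q))"
   using h.hom_mult[OF mem IH(2)] .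
  also have "h (frag_cmul (Poly_Mapping.lookup u p) (frag_of p)) = h (frag_of p) [^] Poly_Mapping.lookup u p"
   unfolding pow using p by (rule h.hom_int_pow)
  finally show ?case using insert.hyps hp IH(1)
   using monoid.m_closed[OF group.is_monoid[OF group_free_Abelian_group] mem IH(2)] by simp
 qed
 from conjunct1[OF this[OF finite_keys u]] show ?thesis
  using frag_expansion[of u] by (simp add: frag_extend_def)
qed

context tensor_pair
begin

text \<open>The free abelian group gives \<open>h\<close>, and \<open>h\<close> kills the three
  families of relations because \<open>B\<close> is balanced. Hence the value that
  \<open>tensor_lift\<close> computes from the chosen representative is the value of
  \<open>h\<close> at any representative.\<close>

lemma tensor_lift_coset:
 assumes T: "abelian_group T" and B: "balanced R M N T B"
 obtains h where "h \<in> hom FG (add_monoid T)"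
  and "!!x y. x \<in> carrier M ==> y \<in> carrier N ==> h (frag_of (x, y)) = B x y"
  and "!!u. u \<in> carrier FG ==> tensor_lift T B (TK #>\<^sub>FG u) = h u"
proof -
 interpret U: abelian_group T by fact
 have img: "(\<lambda>p. B (fst p) (snd p)) ` (carrier M \<times> carrier N) \<subseteq> carrier T"
  using balancedD(1)[OF B] by auto
 from U.add.free_Abelian_group_universal[OF img] obtain h where h: "h \<in> hom FG (add_monoid T)"
  and hp: "!!p. p \<in> carrier M \<times> carrier N ==> h (frag_of p) = B (fst p) (snd p)"
  by metis
 interpret h: group_hom FG "add_monoid T" h
  using h by (auto simp: group_hom_def group_hom_axioms_def U.add.is_group)
 have form: "h u = (\<Oplus>\<^sub>T p\<in>Poly_Mapping.keys u. [Poly_Mapping.lookup u p] \<cdot>\<^sub>T B (fst p) (snd p))"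
  if "u \<in> carrier FG" for u
 proof -
  have "h u = (\<Oplus>\<^sub>T p\<in>Poly_Mapping.keys u. [Poly_Mapping.lookup u p] \<cdot>\<^sub>T h (frag_of p))"
   using that by (intro U.add.hom_eq_finprod_keys[OF h, simplified]) simp
  also have "... = (\<Oplus>\<^sub>T p\<in>Poly_Mapping.keys u. [Poly_Mapping.lookup u p] \<cdot>\<^sub>T B (fst p) (snd p))"
   using that hp balancedD(1)[OF B]
   by (intro U.add.finprod_cong[simplified]) (auto simp: subset_iff Pi_def)
  finally show ?thesis .
 qed
 have hmul: "h (a + b) = h a \<oplus>\<^sub>T h b" if "a \<in> carrier FG" "b \<in> carrier FG" for a b
  using h.hom_mult[OF that] by simp
 have hcl: "h a \<in> carrier T" if "a \<in> carrier FG" for a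
  using h.hom_closed[OF that] by simp
 have hminus: "h (- a) = \<ominus>\<^sub>T h a" if "a \<in> carrier FG" for a
  using h.hom_inv[OF that] that by (simp add: a_inv_def)
 have hdiff: "h (a - b) = h a \<oplus>\<^sub>T \<ominus>\<^sub>T h b" if "a \<in> carrier FG" "b \<in> carrier FG" for a b
  using hmul[OF that(1) uminus_mem[OF that(2)]] hminus[OF that(2)] by simp
 have dmem: "a - b \<in> carrier FG" if "a \<in> carrier FG" "b \<in> carrier FG" for a b
  using plus_mem[OF that(1) uminus_mem[OF that(2)]] by simp
 have hxy: "h (frag_of (x, y)) = B x y" if "x \<in> carrier M" "y \<in> carrier N" for x y
  using hp that by simp
 \<comment> \<open>The value of \<open>h\<close> on a relation of one of the first two families,
   once biadditivity has been applied.\<close>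
 have cancel: "(b \<oplus>\<^sub>T c) \<oplus>\<^sub>T \<ominus>\<^sub>T b \<oplus>\<^sub>T \<ominus>\<^sub>T c = \<zero>\<^sub>T"
  if "b \<in> carrier T" "c \<in> carrier T" for b c
  using that by (metis U.a_comm U.a_inv_closed U.minus_add U.r_neg U.add.m_assoc U.add.m_closed)
 have "tensor_rels R M N \<subseteq> kernel FG (add_monoid T) h"
 proof
  fix u assume u: "u \<in> tensor_rels R M N"
  then have "u \<in> carrier FG" using tensor_rels_subset by blast
  moreover from u have "h u = \<zero>\<^sub>T"
   unfolding tensor_rels_def
   by (auto simp: hdiff hxy balancedD[OF B] cancel U.r_neg frag_mem dmem
       simp del: carrier_free_Abelian_group_iff)
  ultimately show "u \<in> kernel FG (add_monoid T) h" by (simp add: kernel_def)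
 qed
 then have ker: "TK \<subseteq> kernel FG (add_monoid T) h"
  unfolding tensor_ker_def
  using group.generate_subgroup_incl[OF group_free_Abelian_group] h.subgroup_kernel by blast
 have "tensor_lift T B (TK #>\<^sub>FG u) = h u" if u: "u \<in> carrier FG" for u
 proof -
  have "u \<in> TK #>\<^sub>FG u"
   using group.rcos_self[OF group_free_Abelian_group u subgroup_TK] .
  then have "(SOME w. w \<in> TK #>\<^sub>FG u) \<in> TK #>\<^sub>FG u" by (rule someI)
  \<comment> \<open>The chosen representative differs from \<open>u\<close> by an element of the
    kernel of \<open>h\<close>.\<close>
  then obtain z where z: "z \<in> TK" "(SOME w. w \<in> TK #>\<^sub>FG u) = z + u"
   by (auto simp: r_coset_def)
  have zc: "z \<in> carrier FG" "h z = \<zero>\<^sub>T" using z(1) ker by (auto simp: kernel_def)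
  have "h (z + u) = h u" using zc u hmul hcl by simp
  then show ?thesis using z(2) form[OF plus_mem[OF zc(1) u]] by (simp add: tensor_lift_def)
 qed
 then show thesis using that h hxy by blast
qed

lemma tensor_lift_pure:
 assumes "abelian_group T" "balanced R M N T B" "x \<in> carrier M" "y \<in> carrier N"
 shows "tensor_lift T B (pt x y) = B x y"
 using tensor_lift_coset[OF assms(1,2)] frag_mem[OF assms(3,4)] assms(3,4)
 unfolding pure_tensor_def by metis

lemma additive_tensor_lift:
 assumes "abelian_group T" "balanced R M N T B"
 shows "additive TT T (tensor_lift T B)"
proof -
 obtain h where h: "h \<in> hom FG (add_monoid T)"
  "!!u. u \<in> carrier FG ==> tensor_lift T B (TK #>\<^sub>FG u) = h u"
  using tensor_lift_coset[OF assms] by metis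
 show ?thesis
 proof (rule additiveI)
  fix Z assume "Z \<in> carrier TT"
  then obtain u where u: "u \<in> carrier FG" "Z = TK #>\<^sub>FG u"
   by (auto simp: carrier_tensor RCOSETS_def)
  show "tensor_lift T B Z \<in> carrier T"
   using h(1) u(1) unfolding u(2) h(2)[OF u(1)] hom_def Pi_def by auto
  fix Z' assume "Z' \<in> carrier TT"
  then obtain w where w: "w \<in> carrier FG" "Z' = TK #>\<^sub>FG w"
   by (auto simp: carrier_tensor RCOSETS_def)
  have "h (u \<otimes>\<^sub>FG w) = h u \<oplus>\<^sub>T h w" using h(1) u(1) w(1) by (force simp: hom_def)
  then show "tensor_lift T B (Z \<oplus>\<^sub>TT Z') = tensor_lift T B Z \<oplus>\<^sub>T tensor_lift T B Z'"
   unfolding u(2) w(2) coset_add[OF u(1) w(1)] h(2)[OF u(1)] h(2)[OF w(1)] h(2)[OF plus_mem[OF u(1) w(1)]]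
   by simp
 qed
qed

lemma additive_eqI:
 assumes "additive TT U f" "additive TT U g" "Z \<in> carrier TT"
  and "!!x y. x \<in> carrier M ==> y \<in> carrier N ==> f (pt x y) = g (pt x y)"
 shows "f Z = g Z"
 using assms(3) by (induction rule: tensor_induct) (simp_all add: assms additive_add[OF assms(1)] additive_add[OF assms(2)])

end

lemma module_homI:
 assumes "!!x. x \<in> carrier M ==> f x \<in> carrier N"
  and "!!x y. x \<in> carrier M ==> y \<in> carrier M ==> f (x \<oplus>\<^sub>M y) = f x \<oplus>\<^sub>N f y"
  and "!!r x. r \<in> carrier R ==> x \<in> carrier M ==> f (r \<odot>\<^sub>M x) = r \<odot>\<^sub>N f x"
 shows "module_hom R M N f"
 using assms by (auto simp: module_hom_def)

lemma module_homD:
 assumes "module_hom R M N f"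
 shows "x \<in> carrier M ==> f x \<in> carrier N"
  and "x \<in> carrier M ==> y \<in> carrier M ==> f (x \<oplus>\<^sub>M y) = f x \<oplus>\<^sub>N f y"
  and "r \<in> carrier R ==> x \<in> carrier M ==> f (r \<odot>\<^sub>M x) = r \<odot>\<^sub>N f x"
 using assms by (auto simp: module_hom_def)

lemma module_hom_additive: "module_hom R M N f ==> additive M N f"
 by (auto simp: module_hom_def additive_def)

lemma cring_transfer:
 assumes "cring R" "carrier S = carrier R" "add S = add R" "\<zero>\<^sub>S = \<zero>\<^sub>R"
  "monoid.mult S = monoid.mult R" "\<one>\<^sub>S = \<one>\<^sub>R"
 shows "cring S"
proof -
 interpret R: cring R by fact
 show ?thesis
 proof (rule cringI)
  show "abelian_group S"
   by (rule abelian_group_transfer[OF R.abelian_group_axioms assms(2-4)])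
  show "comm_monoid S"
   by (rule comm_monoidI) (simp_all add: assms R.m_ac)
 qed (simp add: assms R.l_distr)
qed

text \<open>\<open>alg_via\<close> turns a ring into a different record with the same operations; a
  module over the one has to be recognised as a module over the other.\<close>

lemma module_ring_transfer:
 assumes "module R M" "cring S" "carrier S = carrier R" "add S = add R"
  "monoid.mult S = monoid.mult R" "\<one>\<^sub>S = \<one>\<^sub>R"
 shows "module S M"
proof -
 interpret M: module R M by fact
 show ?thesis
  by (rule moduleI[OF assms(2) M.M.abelian_group_axioms])
   (simp_all add: assms M.smult_l_distr M.smult_r_distr M.smult_assoc1)
qed

lemma restrict_scalars_simps [simp]:
 "carrier (restrict_scalars h M) = carrier M" "add (restrict_scalars h M) = add M"
 "\<zero>\<^bsub>restrict_scalars h M\<^esub> = \<zero>\<^sub>M" "r \<odot>\<^bsub>restrict_scalars h M\<^esub> x = h r \<odot>\<^sub>M x"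
 by (simp_all add: restrict_scalars_def)

lemma alg_via_simps [simp]:
 "carrier (alg_via h S) = carrier S" "add (alg_via h S) = add S"
 "\<zero>\<^bsub>alg_via h S\<^esub> = \<zero>\<^sub>S" "\<one>\<^bsub>alg_via h S\<^esub> = \<one>\<^sub>S" "monoid.mult (alg_via h S) = monoid.mult S"
 "r \<odot>\<^bsub>alg_via h S\<^esub> x = h r \<otimes>\<^sub>S x"
 by (simp_all add: alg_via_def)

lemma self_module_simps [simp]:
 "carrier (self_module S) = carrier S" "add (self_module S) = add S"
 "\<zero>\<^bsub>self_module S\<^esub> = \<zero>\<^sub>S" "\<one>\<^bsub>self_module S\<^esub> = \<one>\<^sub>S" "monoid.mult (self_module S) = monoid.mult S"
 "smult (self_module S) = monoid.mult S"
 by (simp_all add: self_module_def)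

lemma module_self:
 assumes "cring S" shows "module S (self_module S)"
proof -
 interpret S: cring S by fact
 show ?thesis
  by (rule moduleI[OF assms abelian_group_transfer[OF S.abelian_group_axioms]])
   (simp_all add: S.l_distr S.r_distr S.m_assoc)
qed

lemma module_restrict_scalars:
 assumes "cring R" "module S M" "h \<in> ring_hom R S"
 shows "module R (restrict_scalars h M)"
proof -
 interpret R: cring R by fact
 interpret M: module S M by fact
 note h = ring_hom_closed[OF assms(3)] ring_hom_mult[OF assms(3)] ring_hom_add[OF assms(3)]
  ring_hom_one[OF assms(3)]
 show ?thesis
  by (rule moduleI[OF assms(1) abelian_group_transfer[OF M.M.abelian_group_axioms]])
   (simp_all add: h M.smult_l_distr M.smult_r_distr M.smult_assoc1)
qed

lemma algebra_alg_via:
 assumes "cring R" "cring S" "h \<in> ring_hom R S"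
 shows "algebra R (alg_via h S)"
proof -
 interpret R: cring R by fact
 interpret S: cring S by fact
 note h = ring_hom_closed[OF assms(3)] ring_hom_mult[OF assms(3)] ring_hom_add[OF assms(3)]
  ring_hom_one[OF assms(3)]
 show ?thesis
  by (rule algebraI[OF assms(1) cring_transfer[OF assms(2)]])
   (simp_all add: h S.l_distr S.r_distr S.m_assoc)
qed

lemma (in algebra) smult_assoc3:
 assumes "a \<in> carrier R" "x \<in> carrier M" "y \<in> carrier M"
 shows "x \<otimes>\<^sub>M (a \<odot>\<^sub>M y) = a \<odot>\<^sub>M (x \<otimes>\<^sub>M y)"
 using assms smult_assoc2[of a y x] by (simp add: m_comm)

section \<open>Module and algebra structures on a tensor product\<close>

context tensor_pair
begin

lemma abelian_group_tensor_group: "abelian_group (tensor_group R M N)"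
 by (rule abelian_group_transfer[OF abelian_group_tensor]) (simp_all add: tensor_def Let_def)

lemma tensor_group_simps:
 "carrier (tensor_group R M N) = carrier TT" "add (tensor_group R M N) = add TT"
 by (simp_all add: tensor_def Let_def)

lemma additive_tensor_group [simp]: "additive U (tensor_group R M N) f \<longleftrightarrow> additive U TT f"
 by (simp add: additive_def tensor_group_simps)

lemma balanced_tensor_group [simp]:
 "balanced R' M' N' (tensor_group R M N) B \<longleftrightarrow> balanced R' M' N' TT B"
 by (simp add: balanced_def)

lemma extend_scalars_simps [simp]:
 "carrier (extend_scalars R M N) = carrier TT" "add (extend_scalars R M N) = add TT"
 "\<zero>\<^bsub>extend_scalars R M N\<^esub> = \<zero>\<^sub>TT" "monoid.mult (extend_scalars R M N) = monoid.mult TT"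
 "\<one>\<^bsub>extend_scalars R M N\<^esub> = \<one>\<^sub>TT"
 by (simp_all add: extend_scalars_def Let_def)

lemma balanced_smult:
 assumes "r \<in> carrier R"
 shows "balanced R M N TT (\<lambda>x y. pt (r \<odot>\<^sub>M x) y)"
proof (rule balancedI)
 fix s x y assume "s \<in> carrier R" "x \<in> carrier M" "y \<in> carrier N"
 then show "pt (r \<odot>\<^sub>M (s \<odot>\<^sub>M x)) y = pt (r \<odot>\<^sub>M x) (s \<odot>\<^sub>N y)"
  using assms by (metis M.R.m_comm M.smult_assoc1 M.smult_closed pt_smult)
qed (use assms in \<open>simp_all add: M.smult_r_distr pt_add_l pt_add_r\<close>)

lemma tensor_smult_def: "r \<odot>\<^sub>TT Z = tensor_lift (tensor_group R M N) (\<lambda>x y. pt (r \<odot>\<^sub>M x) y) Z"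
 by (simp add: tensor_def Let_def)

lemma tensor_smult_pt:
 "r \<in> carrier R ==> x \<in> carrier M ==> y \<in> carrier N ==> r \<odot>\<^sub>TT pt x y = pt (r \<odot>\<^sub>M x) y"
 unfolding tensor_smult_def
 by (subst tensor_lift_pure[OF abelian_group_tensor_group]) (auto simp: balanced_smult)

lemma additive_tensor_smult:
 assumes "r \<in> carrier R" shows "additive TT TT (\<lambda>Z. r \<odot>\<^sub>TT Z)"
 unfolding tensor_smult_def
 using additive_tensor_lift[OF abelian_group_tensor_group, of "\<lambda>x y. pt (r \<odot>\<^sub>M x) y"] balanced_smult[OF assms]
 by simp

lemma module_tensor: "module R TT"
proof (rule moduleI)
 show "cring R" by (rule M.R.is_cring)
 show "abelian_group TT" by (rule abelian_group_tensor)
 note cl = additive_closed[OF additive_tensor_smult] and ad = additive_add[OF additive_tensor_smult]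
 show cl': "r \<odot>\<^sub>TT Z \<in> carrier TT" if "r \<in> carrier R" "Z \<in> carrier TT" for r Z
  using that by (rule cl)
 show ad': "r \<odot>\<^sub>TT (Z \<oplus>\<^sub>TT Z') = r \<odot>\<^sub>TT Z \<oplus>\<^sub>TT r \<odot>\<^sub>TT Z'"
  if "r \<in> carrier R" "Z \<in> carrier TT" "Z' \<in> carrier TT" for r Z Z'
  using that by (rule ad)
 fix r s Z assume rs: "r \<in> carrier R" "s \<in> carrier R" and Z: "Z \<in> carrier TT"
 show "(r \<oplus>\<^sub>R s) \<odot>\<^sub>TT Z = r \<odot>\<^sub>TT Z \<oplus>\<^sub>TT s \<odot>\<^sub>TT Z"
  using Z
 proof (induction rule: tensor_induct)
  case (add Z Z')
  then show ?case using rs by (simp add: ad' cl' T.a_ac)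
 qed (use rs in \<open>simp add: tensor_smult_pt M.smult_l_distr pt_add_l\<close>)
 show "(r \<otimes>\<^sub>R s) \<odot>\<^sub>TT Z = r \<odot>\<^sub>TT (s \<odot>\<^sub>TT Z)"
  using Z
 proof (induction rule: tensor_induct)
  case (add Z Z')
  then show ?case using rs by (simp add: ad' cl')
 qed (use rs in \<open>simp add: tensor_smult_pt M.smult_assoc1\<close>)
next
 fix Z assume Z: "Z \<in> carrier TT"
 show "\<one>\<^sub>R \<odot>\<^sub>TT Z = Z" using Z
  by (induction rule: tensor_induct)
   (simp_all add: tensor_smult_pt additive_add[OF additive_tensor_smult])
qed

end

locale tensor_ext = M: module R M + N: algebra R N
 for R (structure) and M :: "('a, 'm) module" and N :: "('a, 'n) module"
begin

sublocale tensor_pair R M N ..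

abbreviation "EE \<equiv> extend_scalars R M N"

lemma balanced_ext:
 assumes "s \<in> carrier N"
 shows "balanced R M N TT (\<lambda>x y. pt x (s \<otimes>\<^sub>N y))"
 by (rule balancedI)
  (use assms in \<open>simp_all add: pt_add_l pt_add_r N.r_distr pt_smult N.smult_assoc3\<close>)

lemma ext_smult_def: "s \<odot>\<^sub>EE Z = tensor_lift TT (\<lambda>x y. pt x (s \<otimes>\<^sub>N y)) Z"
 by (simp add: extend_scalars_def Let_def)

lemma ext_smult_pt:
 "s \<in> carrier N ==> x \<in> carrier M ==> y \<in> carrier N ==> s \<odot>\<^sub>EE pt x y = pt x (s \<otimes>\<^sub>N y)"
 unfolding ext_smult_def
 by (subst tensor_lift_pure[OF abelian_group_tensor]) (auto simp: balanced_ext)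

lemma additive_ext_smult:
 assumes "s \<in> carrier N" shows "additive TT TT (\<lambda>Z. s \<odot>\<^sub>EE Z)"
 unfolding ext_smult_def
 using additive_tensor_lift[OF abelian_group_tensor balanced_ext[OF assms]] by simp

lemma module_ext: "module N EE"
proof (rule moduleI)
 show "cring N" by (rule N.M_cring)
 show "abelian_group EE" by (rule abelian_group_transfer[OF abelian_group_tensor]) simp_all
 show cl': "r \<odot>\<^sub>EE Z \<in> carrier EE" if "r \<in> carrier N" "Z \<in> carrier EE" for r Z
  using additive_closed[OF additive_ext_smult] that by simp
 show ad': "r \<odot>\<^sub>EE (Z \<oplus>\<^sub>EE Z') = r \<odot>\<^sub>EE Z \<oplus>\<^sub>EE r \<odot>\<^sub>EE Z'"
  if "r \<in> carrier N" "Z \<in> carrier EE" "Z' \<in> carrier EE" for r Z Z'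
  using additive_add[OF additive_ext_smult] that by simp
 fix r s Z assume rs: "r \<in> carrier N" "s \<in> carrier N" and "Z \<in> carrier EE"
 then have Z: "Z \<in> carrier TT" by simp
 show "(r \<oplus>\<^sub>N s) \<odot>\<^sub>EE Z = r \<odot>\<^sub>EE Z \<oplus>\<^sub>EE s \<odot>\<^sub>EE Z"
  using Z
 proof (induction rule: tensor_induct)
  case (add Z Z')
  then show ?case using rs ad'[of _ Z Z'] cl' by (simp add: T.a_ac)
 qed (use rs in \<open>simp add: ext_smult_pt N.l_distr pt_add_r\<close>)
 show "(r \<otimes>\<^sub>N s) \<odot>\<^sub>EE Z = r \<odot>\<^sub>EE (s \<odot>\<^sub>EE Z)"
  using Z
 proof (induction rule: tensor_induct)
  case (add Z Z')
  then show ?case using rs ad'[of _ Z Z'] ad'[of r "s \<odot>\<^sub>EE Z" "s \<odot>\<^sub>EE Z'"] cl' by simp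
 qed (use rs in \<open>simp add: ext_smult_pt N.m_assoc\<close>)
next
 fix Z assume "Z \<in> carrier EE"
 then have Z: "Z \<in> carrier TT" by simp
 show "\<one>\<^sub>N \<odot>\<^sub>EE Z = Z" using Z
  by (induction rule: tensor_induct)
   (simp_all add: ext_smult_pt additive_add[OF additive_ext_smult])
qed

end

locale tensor_algebra = M: algebra R M + N: algebra R N
 for R (structure) and M :: "('a, 'm) module" and N :: "('a, 'n) module"
begin

sublocale tensor_ext R M N ..

lemma balanced_mult_inner:
 assumes "x \<in> carrier M" "y \<in> carrier N"
 shows "balanced R M N TT (\<lambda>x' y'. pt (x \<otimes>\<^sub>M x') (y \<otimes>\<^sub>N y'))"
 by (rule balancedI)
  (use assms in \<open>simp_all add: pt_add_l pt_add_r M.r_distr N.r_distr M.smult_assoc3 pt_smult N.smult_assoc3\<close>)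

text \<open>Multiplication by a pure tensor: the inner one of the two nested lifts in the product of
  \<open>tensor\<close>. The outer lift can be evaluated only after this expression is known to be
  balanced in \<open>x\<close> and \<open>y\<close>.\<close>

definition mult_inner :: "'m => 'n => ('m, 'n) tens => ('m, 'n) tens" where
 "mult_inner x y = tensor_lift (tensor_group R M N) (\<lambda>x' y'. pt (x \<otimes>\<^sub>M x') (y \<otimes>\<^sub>N y'))"

lemma mult_inner_pt:
 assumes "x \<in> carrier M" "y \<in> carrier N" "x' \<in> carrier M" "y' \<in> carrier N"
 shows "mult_inner x y (pt x' y') = pt (x \<otimes>\<^sub>M x') (y \<otimes>\<^sub>N y')"
 unfolding mult_inner_def
 by (subst tensor_lift_pure[OF abelian_group_tensor_group]) (auto simp: balanced_mult_inner assms)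

lemma additive_mult_inner:
 assumes "x \<in> carrier M" "y \<in> carrier N"
 shows "additive TT TT (mult_inner x y)"
 unfolding mult_inner_def
 using additive_tensor_lift[OF abelian_group_tensor_group, of "\<lambda>x' y'. pt (x \<otimes>\<^sub>M x') (y \<otimes>\<^sub>N y')"]
  balanced_mult_inner[OF assms] by simp

lemma balanced_mult_outer:
 assumes "Z \<in> carrier TT"
 shows "balanced R M N TT (\<lambda>x y. mult_inner x y Z)"
proof (rule balancedI)
 note cl = additive_closed[OF additive_mult_inner] and ad = additive_add[OF additive_mult_inner]
 fix x y assume xy: "x \<in> carrier M" "y \<in> carrier N"
 show "mult_inner x y Z \<in> carrier TT" using cl xy assms by blast
 show "mult_inner (x \<oplus>\<^sub>M x') y Z = mult_inner x y Z \<oplus>\<^sub>TT mult_inner x' y Z" if "x' \<in> carrier M" for x'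
  using assms
 proof (induction rule: tensor_induct)
  case (add Z Z')
  then show ?case using xy that by (simp add: cl ad T.a_ac)
 qed (use xy that in \<open>simp add: mult_inner_pt M.l_distr pt_add_l\<close>)
 show "mult_inner x (y \<oplus>\<^sub>N y') Z = mult_inner x y Z \<oplus>\<^sub>TT mult_inner x y' Z" if "y' \<in> carrier N" for y'
  using assms
 proof (induction rule: tensor_induct)
  case (add Z Z')
  then show ?case using xy that by (simp add: cl ad T.a_ac)
 qed (use xy that in \<open>simp add: mult_inner_pt N.l_distr pt_add_r\<close>)
 show "mult_inner (r \<odot>\<^sub>M x) y Z = mult_inner x (r \<odot>\<^sub>N y) Z" if "r \<in> carrier R" for r
  using assms
 proof (induction rule: tensor_induct)
  case (add Z Z')
  then show ?case using xy that by (simp add: ad)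
 qed (use xy that in \<open>simp add: mult_inner_pt M.smult_assoc2 N.smult_assoc2 pt_smult\<close>)
qed

lemma tensor_mult_def:
 "Z \<otimes>\<^sub>TT Z' = tensor_lift (tensor_group R M N) (\<lambda>x y. mult_inner x y Z') Z"
 by (simp add: tensor_def Let_def mult_inner_def)

lemma tensor_one: "\<one>\<^sub>TT = pt \<one>\<^sub>M \<one>\<^sub>N"
 by (simp add: tensor_def Let_def)

lemma tensor_mult_pt_l:
 assumes "x \<in> carrier M" "y \<in> carrier N" "Z \<in> carrier TT"
 shows "pt x y \<otimes>\<^sub>TT Z = mult_inner x y Z"
 unfolding tensor_mult_def
 by (subst tensor_lift_pure[OF abelian_group_tensor_group]) (auto simp: balanced_mult_outer assms)

lemma tensor_mult_pt:
 assumes "x \<in> carrier M" "y \<in> carrier N" "x' \<in> carrier M" "y' \<in> carrier N"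
 shows "pt x y \<otimes>\<^sub>TT pt x' y' = pt (x \<otimes>\<^sub>M x') (y \<otimes>\<^sub>N y')"
 using assms by (simp add: tensor_mult_pt_l mult_inner_pt)

lemma additive_mult_l: "Z' \<in> carrier TT ==> additive TT TT (\<lambda>Z. Z \<otimes>\<^sub>TT Z')"
 unfolding tensor_mult_def
 using additive_tensor_lift[OF abelian_group_tensor_group, of "\<lambda>x y. mult_inner x y Z'"]
  balanced_mult_outer by simp

lemmas tensor_mult_closed = additive_closed[OF additive_mult_l]
lemmas tensor_l_distr = additive_add[OF additive_mult_l]

lemma tensor_r_distr:
 assumes "W \<in> carrier TT" "U \<in> carrier TT" "V \<in> carrier TT"
 shows "W \<otimes>\<^sub>TT (U \<oplus>\<^sub>TT V) = W \<otimes>\<^sub>TT U \<oplus>\<^sub>TT W \<otimes>\<^sub>TT V"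
 using assms(1)
proof (induction rule: tensor_induct)
 case (pure x y)
 then show ?case using assms by (simp add: tensor_mult_pt_l additive_add[OF additive_mult_inner])
next
 case (add Z Z')
 then show ?case using assms by (simp add: tensor_l_distr tensor_mult_closed T.a_ac)
qed

lemma tensor_m_comm:
 assumes "Z \<in> carrier TT" "Z' \<in> carrier TT" shows "Z \<otimes>\<^sub>TT Z' = Z' \<otimes>\<^sub>TT Z"
proof -
 have pt_Z: "Z \<otimes>\<^sub>TT pt x y = pt x y \<otimes>\<^sub>TT Z"
  if "x \<in> carrier M" "y \<in> carrier N" "Z \<in> carrier TT" for x y Z
  using that(3)
 proof (induction rule: tensor_induct)
  case (add Z Z')
  then show ?case using that by (simp add: tensor_l_distr tensor_r_distr)
 qed (use that in \<open>simp add: tensor_mult_pt M.m_comm N.m_comm\<close>)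
 show ?thesis using assms(1)
  by (induction rule: tensor_induct) (simp_all add: pt_Z tensor_l_distr tensor_r_distr assms)
qed

text \<open>Every identity is additive in each argument, so it may be checked on pure tensors, one
  argument after the other.\<close>

lemma algebra_tensor: "algebra R TT"
proof -
 interpret mod: module R TT by (rule module_tensor)
 have assoc: "U \<otimes>\<^sub>TT V \<otimes>\<^sub>TT Z = U \<otimes>\<^sub>TT (V \<otimes>\<^sub>TT Z)"
  if "U \<in> carrier TT" "V \<in> carrier TT" "Z \<in> carrier TT" for U V Z
  using that(1)
 proof (induction rule: tensor_induct)
  case X: (pure x y)
  show ?case using that(2)
  proof (induction rule: tensor_induct)
   case Y: (pure x' y')
   show ?case using that(3)
    by (induction rule: tensor_induct)
     (use X Y in \<open>simp_all add: tensor_mult_pt tensor_r_distr tensor_mult_closed M.m_assoc N.m_assoc\<close>)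
  qed (use X that in \<open>simp add: tensor_r_distr tensor_l_distr tensor_mult_closed\<close>)
 qed (use that in \<open>simp add: tensor_l_distr tensor_mult_closed\<close>)
 have one: "\<one>\<^sub>TT \<otimes>\<^sub>TT Z = Z" if "Z \<in> carrier TT" for Z
  using that by (induction rule: tensor_induct) (simp_all add: tensor_one tensor_mult_pt tensor_r_distr)
 have cring: "cring TT"
 proof (rule cringI)
  show "comm_monoid TT"
  proof (rule comm_monoidI)
   show "\<one>\<^sub>TT \<in> carrier TT" by (simp add: tensor_one)
  qed (simp_all add: tensor_mult_closed assoc one, rule tensor_m_comm)
 qed (simp_all add: abelian_group_tensor tensor_l_distr)
 have "(r \<odot>\<^sub>TT Z) \<otimes>\<^sub>TT Z' = r \<odot>\<^sub>TT (Z \<otimes>\<^sub>TT Z')"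
  if "r \<in> carrier R" and Z: "Z \<in> carrier TT" and Z': "Z' \<in> carrier TT" for r Z Z'
  using Z
 proof (induction rule: tensor_induct)
  case X: (pure x y)
  show ?case using Z'
   by (induction rule: tensor_induct)
    (use X that in \<open>simp_all add: tensor_smult_pt tensor_mult_pt tensor_r_distr mod.smult_r_distr
     tensor_mult_closed M.smult_assoc2\<close>)
 qed (use that in \<open>simp add: tensor_l_distr mod.smult_r_distr tensor_mult_closed\<close>)
 then show ?thesis
  by (intro algebraI M.R_cring cring)
   (simp_all add: mod.smult_l_distr mod.smult_r_distr mod.smult_assoc1)
qed

lemma cring_tensor: "cring TT"
 using algebra_tensor by (rule algebra.axioms)

lemma pt_one_ring_hom: "(\<lambda>x. pt x \<one>\<^sub>N) \<in> ring_hom M TT"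
 by (rule ring_hom_memI) (simp_all add: tensor_mult_pt pt_add_l tensor_one)

end

lemma balanced_tensor_map:
 assumes "tensor_pair R M N" "tensor_pair R M1 N1" "module_hom R M M1 f" "module_hom R N N1 g"
 shows "balanced R M N (tensor R M1 N1) (\<lambda>x y. pure_tensor R M1 N1 (f x) (g y))"
proof -
 interpret A: tensor_pair R M N by fact
 interpret B: tensor_pair R M1 N1 by fact
 show ?thesis
  by (rule balancedI)
   (simp_all add: module_homD[OF assms(3)] module_homD[OF assms(4)] B.pt_add_l B.pt_add_r B.pt_smult)
qed

lemma tensor_map_pt:
 assumes "tensor_pair R M N" "tensor_pair R M1 N1" "module_hom R M M1 f" "module_hom R N N1 g"
  "x \<in> carrier M" "y \<in> carrier N"
 shows "tensor_map R M N M1 N1 f g (pure_tensor R M N x y) = pure_tensor R M1 N1 (f x) (g y)"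
 unfolding tensor_map_def
 by (rule tensor_pair.tensor_lift_pure[OF assms(1) tensor_pair.abelian_group_tensor[OF assms(2)]
    balanced_tensor_map[OF assms(1-4)] assms(5,6)])

lemma additive_tensor_map:
 assumes "tensor_pair R M N" "tensor_pair R M1 N1" "module_hom R M M1 f" "module_hom R N N1 g"
 shows "additive (tensor R M N) (tensor R M1 N1) (tensor_map R M N M1 N1 f g)"
 unfolding tensor_map_def
 by (rule tensor_pair.additive_tensor_lift[OF assms(1) tensor_pair.abelian_group_tensor[OF assms(2)]
    balanced_tensor_map[OF assms]])

lemma tensor_map_ring_hom:
 assumes "tensor_algebra R M N" "tensor_algebra R M1 N1" "module_hom R M M1 f" "module_hom R N N1 g"
  "f \<in> ring_hom M M1" "g \<in> ring_hom N N1"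
 shows "tensor_map R M N M1 N1 f g \<in> ring_hom (tensor R M N) (tensor R M1 N1)"
proof -
 interpret A: tensor_algebra R M N by fact
 interpret B: tensor_algebra R M1 N1 by fact
 let ?h = "tensor_map R M N M1 N1 f g"
 note P = A.tensor_pair_axioms B.tensor_pair_axioms assms(3,4)
 note pt = tensor_map_pt[OF P] and ad = additive_add[OF additive_tensor_map[OF P]]
  and cl = additive_closed[OF additive_tensor_map[OF P]]
 note f = ring_hom_closed[OF assms(5)] ring_hom_mult[OF assms(5)] ring_hom_one[OF assms(5)]
 note g = ring_hom_closed[OF assms(6)] ring_hom_mult[OF assms(6)] ring_hom_one[OF assms(6)]
 have "?h (Z \<otimes>\<^bsub>tensor R M N\<^esub> Z') = ?h Z \<otimes>\<^bsub>tensor R M1 N1\<^esub> ?h Z'"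
  if Z: "Z \<in> carrier (tensor R M N)" and Z': "Z' \<in> carrier (tensor R M N)" for Z Z'
  using Z
 proof (induction rule: A.tensor_induct)
  case X: (pure x y)
  show ?case using Z'
   by (induction rule: A.tensor_induct)
    (use X in \<open>simp_all add: A.tensor_mult_pt B.tensor_mult_pt pt f g A.tensor_r_distr
     A.tensor_mult_closed ad cl B.tensor_r_distr\<close>)
 qed (use Z' in \<open>simp add: A.tensor_l_distr A.tensor_mult_closed ad cl B.tensor_l_distr\<close>)
 then show ?thesis
  by (intro ring_hom_memI) (simp_all add: cl ad A.tensor_one B.tensor_one pt f g)
qed


section \<open>Equational flatness\<close>

lemma (in abelian_group) finsum_swap:
 assumes "finite I" "finite J" "!!i j. i \<in> I ==> j \<in> J ==> f i j \<in> carrier G"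
 shows "(\<Oplus>i\<in>I. \<Oplus>j\<in>J. f i j) = (\<Oplus>j\<in>J. \<Oplus>i\<in>I. f i j)"
 using assms(1,3)
proof (induction I)
 case empty
 then show ?case by simp
next
 case (insert a I)
 have "(\<Oplus>j\<in>J. \<Oplus>i\<in>insert a I. f i j) = (\<Oplus>j\<in>J. f a j \<oplus> (\<Oplus>i\<in>I. f i j))"
  using insert by (intro finsum_cong') (auto intro!: finsum_closed)
 also have "... = (\<Oplus>j\<in>J. f a j) \<oplus> (\<Oplus>j\<in>J. \<Oplus>i\<in>I. f i j)"
  using insert.prems by (intro finsum_addf) (auto intro!: finsum_closed)
 also have "... = (\<Oplus>i\<in>insert a I. \<Oplus>j\<in>J. f i j)"
  using insert by (subst finsum_insert) (auto intro!: finsum_closed)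
 finally show ?case ..
qed

lemma (in abelian_group) finsum_product:
 assumes "finite I" "finite J" "!!i j. i \<in> I ==> j \<in> J ==> f (i, j) \<in> carrier G"
 shows "(\<Oplus>i\<in>I. \<Oplus>j\<in>J. f (i, j)) = (\<Oplus>p\<in>I \<times> J. f p)"
 using assms(1,3)
proof (induction I)
 case empty
 then show ?case by simp
next
 case (insert a I)
 have "(\<Oplus>p\<in>insert a I \<times> J. f p) = (\<Oplus>p\<in>(Pair a ` J) \<union> (I \<times> J). f p)"
  by (rule arg_cong[where f="finsum G f"]) auto
 also have "... = (\<Oplus>p\<in>Pair a ` J. f p) \<oplus> (\<Oplus>p\<in>I \<times> J. f p)"
  using insert assms(2) by (intro finsum_Un_disjoint) auto
 also have "(\<Oplus>p\<in>Pair a ` J. f p) = (\<Oplus>j\<in>J. f (a, j))"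
  using insert.prems by (intro finsum_reindex) (auto simp: inj_on_def)
 finally show ?case
  using insert by (subst finsum_insert) (auto intro!: finsum_closed)
qed

lemma (in module) additive_smult: "a \<in> carrier R ==> additive M M (\<lambda>x. a \<odot>\<^sub>M x)"
 by (rule additiveI) (simp_all add: smult_r_distr)

lemma (in module) additive_smult_l: "x \<in> carrier M ==> additive R M (\<lambda>a. a \<odot>\<^sub>M x)"
 by (rule additiveI) (simp_all add: smult_l_distr)

lemma (in module) smult_finsum:
 "a \<in> carrier R ==> f \<in> I \<rightarrow> carrier M ==> a \<odot>\<^sub>M (\<Oplus>\<^sub>M i\<in>I. f i) = (\<Oplus>\<^sub>M i\<in>I. a \<odot>\<^sub>M f i)"
 using additive_finsum[OF M.abelian_group_axioms M.abelian_group_axioms additive_smult] .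

lemma (in module) finsum_smult:
 "x \<in> carrier M ==> c \<in> I \<rightarrow> carrier R ==> (\<Oplus>i\<in>I. c i) \<odot>\<^sub>M x = (\<Oplus>\<^sub>M i\<in>I. c i \<odot>\<^sub>M x)"
 using additive_finsum[OF R.abelian_group_axioms M.abelian_group_axioms additive_smult_l] .

lemma (in ring) additive_mult_left: "a \<in> carrier R ==> additive R R (\<lambda>x. a \<otimes> x)"
 by (rule additiveI) (simp_all add: r_distr)

lemma (in ring) additive_mult_right: "a \<in> carrier R ==> additive R R (\<lambda>x. x \<otimes> a)"
 by (rule additiveI) (simp_all add: l_distr)

lemma ring_hom_additive: "h \<in> ring_hom R S ==> additive R S h"
 by (rule additiveI) (simp_all add: ring_hom_closed ring_hom_add)

lemma (in ring) mult_finsum: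
 "a \<in> carrier R ==> f \<in> I \<rightarrow> carrier R ==> a \<otimes> (\<Oplus>i\<in>I. f i) = (\<Oplus>i\<in>I. a \<otimes> f i)"
 using additive_finsum[OF abelian_group_axioms abelian_group_axioms additive_mult_left] .

lemma (in ring) finsum_mult:
 "a \<in> carrier R ==> f \<in> I \<rightarrow> carrier R ==> (\<Oplus>i\<in>I. f i) \<otimes> a = (\<Oplus>i\<in>I. f i \<otimes> a)"
 using additive_finsum[OF abelian_group_axioms abelian_group_axioms additive_mult_right] .

text \<open>\<open>D\<close> stands for the elements outside a maximal ideal. Denominators from
  \<open>D\<close> are carried along instead of localizing: \<open>comparable\<close> says that of
  two elements one divides the other in the localization at \<open>D\<close>, \<open>D_unit\<close>
  that \<open>B\<close> is an algebra over this localization, and \<open>torsion_free\<close> is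
  what flatness over a valuation ring amounts to.\<close>

locale valuation_base_change = A: domain A + B: cring B
 for A (structure) and B (structure) +
 fixes \<iota> and D
 assumes hom: "\<iota> \<in> ring_hom A B"
  and D_sub: "D \<subseteq> carrier A"
  and one_D: "\<one> \<in> D"
  and zero_D: "\<zero> \<notin> D"
  and D_mult: "s \<in> D ==> t \<in> D ==> s \<otimes> t \<in> D"
  and D_unit: "s \<in> D ==> \<exists>u\<in>carrier B. u \<otimes>\<^sub>B \<iota> s = \<one>\<^sub>B"
  and comparable: "b \<in> carrier A ==> d \<in> carrier A ==>
     \<exists>s\<in>D. \<exists>a\<in>carrier A. s \<otimes> b = a \<otimes> d \<or> s \<otimes> d = a \<otimes> b"
  and torsion_free: "b \<in> carrier A ==> b ~= \<zero> ==> x \<in> carrier B ==> \<iota> b \<otimes>\<^sub>B x = \<zero>\<^sub>B ==> x = \<zero>\<^sub>B"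
begin

lemma \<iota>_closed [simp]: "a \<in> carrier A ==> \<iota> a \<in> carrier B"
 using hom by (rule ring_hom_closed)

lemma \<iota>_mult: "a \<in> carrier A ==> b \<in> carrier A ==> \<iota> (a \<otimes> b) = \<iota> a \<otimes>\<^sub>B \<iota> b"
 using hom by (rule ring_hom_mult)

lemma \<iota>_one: "\<iota> \<one> = \<one>\<^sub>B"
 using hom by (rule ring_hom_one)

lemma \<iota>_zero: "\<iota> \<zero> = \<zero>\<^sub>B"
 using additive_zero[OF A.abelian_group_axioms B.abelian_group_axioms ring_hom_additive[OF hom]] .

lemma \<iota>_minus: "a \<in> carrier A ==> \<iota> (\<ominus> a) = \<ominus>\<^sub>B \<iota> a"
 using additive_minus[OF A.abelian_group_axioms B.abelian_group_axioms ring_hom_additive[OF hom]] .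

lemma \<iota>_finsum: "f \<in> I \<rightarrow> carrier A ==> \<iota> (\<Oplus> i\<in>I. f i) = (\<Oplus>\<^sub>B i\<in>I. \<iota> (f i))"
 using additive_finsum[OF A.abelian_group_axioms B.abelian_group_axioms ring_hom_additive[OF hom]] .

text \<open>In a valuation ring divisibility is total, so one of finitely many elements divides all
  the others; \<open>s\<close> is a common denominator of the quotients.\<close>

lemma pivot:
 assumes "finite I" "I ~= {}" "c \<in> I \<rightarrow> carrier A"
 shows "\<exists>m\<in>I. \<exists>s\<in>D. \<exists>a\<in>I \<rightarrow> carrier A. \<forall>i\<in>I. s \<otimes> c i = a i \<otimes> c m"
 using assms
proof (induction I rule: finite_ne_induct)
 case (singleton i)
 then show ?case using one_D by (auto intro!: bexI[of _ "\<one>"] bexI[of _ "\<lambda>_. \<one>"])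
next
 case (insert j I)
 then obtain m s a where m: "m \<in> I" and s: "s \<in> D" and a: "a \<in> I \<rightarrow> carrier A"
  and eq: "!!i. i \<in> I ==> s \<otimes> c i = a i \<otimes> c m"
 proof -
  have "c \<in> I \<rightarrow> carrier A" using insert.prems by auto
  from insert.IH[OF this] show thesis
   by (elim bexE) (rule that, assumption+, erule (1) bspec)
 qed
 have c: "!!i. i \<in> I ==> c i \<in> carrier A" "c j \<in> carrier A" using insert.prems by auto
 have ai: "!!i. i \<in> I ==> a i \<in> carrier A" using a by auto
 have sc: "s \<in> carrier A" using s D_sub by auto
 obtain t e where t: "t \<in> D" and e: "e \<in> carrier A"
  and te: "t \<otimes> c j = e \<otimes> c m \<or> t \<otimes> c m = e \<otimes> c j"
  using comparable[OF c(2) c(1)[OF m]] by blast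
 have tc: "t \<in> carrier A" using t D_sub by auto
 have st: "s \<otimes> t \<in> D" using s t D_mult by auto
 from te show ?case
 proof
  assume 1: "t \<otimes> c j = e \<otimes> c m"
  let ?a = "\<lambda>i. if i = j then s \<otimes> e else t \<otimes> a i"
  have "s \<otimes> t \<otimes> c i = ?a i \<otimes> c m" if i: "i \<in> insert j I" for i
  proof (cases "i = j")
   case True
   then show ?thesis using 1 sc tc c m e by (simp add: A.m_assoc)
  next
   case False
   then have iI: "i \<in> I" using i by auto
   have "s \<otimes> t \<otimes> c i = t \<otimes> (s \<otimes> c i)"
    using iI sc tc c by (simp add: A.m_ac)
   then show ?thesis using False iI eq tc c m ai by (simp add: A.m_assoc)
  qed
  then show ?thesis using m st ai tc sc e insert.hyps
   by (intro bexI[of _ m] bexI[of _ "s \<otimes> t"] bexI[of _ ?a]) auto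
 next
  \<comment> \<open>The new coefficient divides the old pivot, hence everything that the old pivot
    divides, and becomes the pivot itself.\<close>
  assume 1: "t \<otimes> c m = e \<otimes> c j"
  let ?a = "\<lambda>i. if i = j then s \<otimes> t else a i \<otimes> e"
  have "s \<otimes> t \<otimes> c i = ?a i \<otimes> c j" if i: "i \<in> insert j I" for i
  proof (cases "i = j")
   case False
   then have iI: "i \<in> I" using i by auto
   have "s \<otimes> t \<otimes> c i = t \<otimes> (s \<otimes> c i)"
    using iI sc tc c by (simp add: A.m_ac)
   also have "... = a i \<otimes> (t \<otimes> c m)"
    using iI eq tc ai c m by (simp add: A.m_ac)
   finally show ?thesis using 1 False iI ai e c by (simp add: A.m_assoc)
  qed simp
  then show ?thesis using st ai tc sc e insert.hyps
   by (intro bexI[of _ j] bexI[of _ "s \<otimes> t"] bexI[of _ ?a]) auto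
 qed
qed

text \<open>Dividing by the pivot \<open>c m\<close> gives an equation in which the coefficient of
  \<open>x m\<close> is a unit of \<open>B\<close>. Thus \<open>x m\<close> is a combination of the
  other unknowns, and one solution over \<open>A\<close> for each of these suffices. Taking
  \<open>K\<close> inside \<open>I\<close> keeps the index type fixed, on which the iteration over
  several equations relies.\<close>

lemma single_equation:
 fixes I :: "'i set"
 assumes fin: "finite I" and c: "c \<in> I \<rightarrow> carrier A" and x: "x \<in> I \<rightarrow> carrier B"
  and eq: "(\<Oplus>\<^sub>B i\<in>I. \<iota> (c i) \<otimes>\<^sub>B x i) = \<zero>\<^sub>B"
 shows "\<exists>K\<subseteq>I. \<exists>a y. a \<in> K \<rightarrow> carrier B & (\<forall>k\<in>K. y k \<in> I \<rightarrow> carrier A) &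
  (\<forall>k\<in>K. (\<Oplus> i\<in>I. c i \<otimes> y k i) = \<zero>) &
  (\<forall>i\<in>I. x i = (\<Oplus>\<^sub>B k\<in>K. a k \<otimes>\<^sub>B \<iota> (y k i)))"
proof (cases "\<forall>i\<in>I. c i = \<zero>")
 case True
 \<comment> \<open>All coefficients vanish: the unit vectors are solutions, and the entries of
   \<open>x\<close> are the coefficients.\<close>
 define y :: "'i => 'i => 'a" where "y = (\<lambda>k i. if i = k then \<one> else \<zero>)"
 have "x i = (\<Oplus>\<^sub>B k\<in>I. x k \<otimes>\<^sub>B \<iota> (y k i))" if i: "i \<in> I" for i
 proof -
  have "(\<Oplus>\<^sub>B k\<in>I. x k \<otimes>\<^sub>B \<iota> (y k i)) = (\<Oplus>\<^sub>B k\<in>I. if i = k then x k else \<zero>\<^sub>B)"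
   using funcset_mem[OF x] by (intro B.finsum_cong') (auto simp: \<iota>_one \<iota>_zero y_def)
  then show ?thesis using B.finsum_singleton[OF i fin x] by simp
 qed
 moreover have y: "y k \<in> I \<rightarrow> carrier A" for k by (auto simp: y_def)
 moreover have "(\<Oplus> i\<in>I. c i \<otimes> y k i) = \<zero>" for k
  using True funcset_mem[OF y] by (intro A.add.finprod_one_eqI) auto
 ultimately have "x \<in> I \<rightarrow> carrier B & (\<forall>k\<in>I. y k \<in> I \<rightarrow> carrier A) &
  (\<forall>k\<in>I. (\<Oplus> i\<in>I. c i \<otimes> y k i) = \<zero>) &
  (\<forall>i\<in>I. x i = (\<Oplus>\<^sub>B k\<in>I. x k \<otimes>\<^sub>B \<iota> (y k i)))"
  using x by simp
 then have "\<exists>a y. a \<in> I \<rightarrow> carrier B & (\<forall>k\<in>I. y k \<in> I \<rightarrow> carrier A) &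
  (\<forall>k\<in>I. (\<Oplus> i\<in>I. c i \<otimes> y k i) = \<zero>) &
  (\<forall>i\<in>I. x i = (\<Oplus>\<^sub>B k\<in>I. a k \<otimes>\<^sub>B \<iota> (y k i)))"
  by (rule_tac exI, rule_tac exI)
 then show ?thesis by (rule_tac exI) (rule conjI[OF subset_refl])
next
 case False
 then have "I ~= {}" by auto
 then obtain m s a where m: "m \<in> I" and s: "s \<in> D"
  and a: "a \<in> I \<rightarrow> carrier A" and sa: "!!i. i \<in> I ==> s \<otimes> c i = a i \<otimes> c m"
 proof -
  have "\<exists>m\<in>I. \<exists>s\<in>D. \<exists>a\<in>I \<rightarrow> carrier A. \<forall>i\<in>I. s \<otimes> c i = a i \<otimes> c m"
   by (rule pivot[OF fin \<open>I ~= {}\<close> c])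
  then show thesis
   by (elim bexE) (rule that, assumption+, erule (1) bspec)
 qed
 have sc: "s \<in> carrier A" "s ~= \<zero>" using s D_sub zero_D by auto
 have ci: "!!i. i \<in> I ==> c i \<in> carrier A" and ai: "!!i. i \<in> I ==> a i \<in> carrier A"
  and xi: "!!i. i \<in> I ==> x i \<in> carrier B" using c a x by auto
 have cm: "c m ~= \<zero>"
 proof
  assume "c m = \<zero>"
  then have "s \<otimes> c i = \<zero>" if "i \<in> I" for i using sa that ai by simp
  then show False using False sc ci by (metis A.integral)
 qed
 \<comment> \<open>The instance \<open>i = m\<close> of \<open>sa\<close> with the nonzero
   \<open>c m\<close> cancelled; it makes the coefficient at the pivot invertible in
   \<open>B\<close>.\<close>
 have am: "a m = s"
  using sa[OF m] cm sc ai ci m by (metis A.m_rcancel)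
 obtain u where u: "u \<in> carrier B" "u \<otimes>\<^sub>B \<iota> s = \<one>\<^sub>B" using D_unit[OF s] by blast
 define K where "K = I - {m}"
 have K: "finite K" "m \<notin> K" "I = insert m K" "K \<subseteq> I" using fin m by (auto simp: K_def)
 have ax: "(\<lambda>i. \<iota> (a i) \<otimes>\<^sub>B x i) \<in> I \<rightarrow> carrier B" using ai xi by auto
 have "\<iota> (c m) \<otimes>\<^sub>B (\<Oplus>\<^sub>B i\<in>I. \<iota> (a i) \<otimes>\<^sub>B x i) = (\<Oplus>\<^sub>B i\<in>I. \<iota> (c m) \<otimes>\<^sub>B (\<iota> (a i) \<otimes>\<^sub>B x i))"
  using ci m ax by (intro B.mult_finsum) auto
 also have "... = (\<Oplus>\<^sub>B i\<in>I. \<iota> s \<otimes>\<^sub>B (\<iota> (c i) \<otimes>\<^sub>B x i))"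
 proof (intro B.finsum_cong')
  fix i assume i: "i \<in> I"
  have "\<iota> (c m) \<otimes>\<^sub>B (\<iota> (a i) \<otimes>\<^sub>B x i) = \<iota> (a i \<otimes> c m) \<otimes>\<^sub>B x i"
   using i m ci ai xi by (simp add: \<iota>_mult B.m_ac)
  also have "... = \<iota> s \<otimes>\<^sub>B (\<iota> (c i) \<otimes>\<^sub>B x i)"
   unfolding sa[OF i, symmetric] using i ci xi sc by (simp add: \<iota>_mult B.m_assoc)
  finally show "\<iota> (c m) \<otimes>\<^sub>B (\<iota> (a i) \<otimes>\<^sub>B x i) = \<iota> s \<otimes>\<^sub>B (\<iota> (c i) \<otimes>\<^sub>B x i)" .
 qed (use sc ci xi in auto)
 also have "... = \<iota> s \<otimes>\<^sub>B (\<Oplus>\<^sub>B i\<in>I. \<iota> (c i) \<otimes>\<^sub>B x i)"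
  using sc ci xi by (intro B.mult_finsum[symmetric]) auto
 finally have "\<iota> (c m) \<otimes>\<^sub>B (\<Oplus>\<^sub>B i\<in>I. \<iota> (a i) \<otimes>\<^sub>B x i) = \<zero>\<^sub>B"
  using eq sc by simp
 \<comment> \<open>Torsion-freeness removes the factor \<open>\<iota> (c m)\<close>, which division
   in \<open>A\<close> could not do.\<close>
 then have "(\<Oplus>\<^sub>B i\<in>I. \<iota> (a i) \<otimes>\<^sub>B x i) = \<zero>\<^sub>B"
  using torsion_free[OF ci[OF m] cm] ax by (simp add: B.finsum_closed)
 then have rel: "\<iota> s \<otimes>\<^sub>B x m \<oplus>\<^sub>B (\<Oplus>\<^sub>B i\<in>K. \<iota> (a i) \<otimes>\<^sub>B x i) = \<zero>\<^sub>B"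
  using K am ax by (simp add: B.finsum_insert)
 \<comment> \<open>The solution \<open>y k\<close> has the entry \<open>s\<close> at
   \<open>k\<close> and \<open>\<ominus> a k\<close> at the pivot. Its coefficient will be
   \<open>u \<otimes>\<^sub>B x k\<close>, with \<open>u\<close> inverse to
   \<open>\<iota> s\<close>.\<close>
 define y where "y = (\<lambda>k i. if i = k then s else if i = m then \<ominus> a k else \<zero>)"
 have kI: "k \<in> K ==> k \<in> I" for k using K by auto
 have ycl: "y k i \<in> carrier A" if "k \<in> K" for k i using that K sc ai kI by (auto simp: y_def)
 have 1: "(\<Oplus> i\<in>I. c i \<otimes> y k i) = \<zero>" if k: "k \<in> K" for k
 proof -
  have km: "k ~= m" using k K by auto
  have "(\<Oplus> i\<in>K. c i \<otimes> y k i) = (\<Oplus> i\<in>K. if k = i then c i \<otimes> s else \<zero>)"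
   using K ci sc kI by (intro A.finsum_cong') (auto simp: y_def)
  also have "... = c k \<otimes> s"
   using A.finsum_singleton[OF k K(1), of "\<lambda>i. c i \<otimes> s"] ci sc kI by auto
  finally have "(\<Oplus> i\<in>I. c i \<otimes> y k i) = c m \<otimes> y k m \<oplus> c k \<otimes> s"
   using K ci ycl[OF k] m by (auto simp: A.finsum_insert)
  also have "... = \<ominus> (a k \<otimes> c m) \<oplus> s \<otimes> c k"
   using km ci ai kI[OF k] m sc by (simp add: y_def A.r_minus A.m_comm)
  finally show ?thesis using sa[OF kI[OF k]] ci ai kI[OF k] m by (simp add: A.l_neg)
 qed
 have ux: "u \<otimes>\<^sub>B x k \<in> carrier B" if "k \<in> K" for k using that kI xi u by auto
 have 2: "x i = (\<Oplus>\<^sub>B k\<in>K. (u \<otimes>\<^sub>B x k) \<otimes>\<^sub>B \<iota> (y k i))" if i: "i \<in> I" for i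
 proof (cases "i = m")
  case True
  have "(\<Oplus>\<^sub>B k\<in>K. (u \<otimes>\<^sub>B x k) \<otimes>\<^sub>B \<iota> (y k i)) = (\<Oplus>\<^sub>B k\<in>K. (\<ominus>\<^sub>B u) \<otimes>\<^sub>B (\<iota> (a k) \<otimes>\<^sub>B x k))"
  proof (intro B.finsum_cong')
   fix k assume k: "k \<in> K"
   then have "y k i = \<ominus> a k" using True K by (auto simp: y_def)
   then show "(u \<otimes>\<^sub>B x k) \<otimes>\<^sub>B \<iota> (y k i) = (\<ominus>\<^sub>B u) \<otimes>\<^sub>B (\<iota> (a k) \<otimes>\<^sub>B x k)"
    using k kI ai xi u by (simp add: \<iota>_minus B.l_minus B.r_minus B.m_ac)
  qed (use kI ai xi u in auto)
  also have "... = (\<ominus>\<^sub>B u) \<otimes>\<^sub>B (\<Oplus>\<^sub>B k\<in>K. \<iota> (a k) \<otimes>\<^sub>B x k)"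
   using kI ai xi u by (intro B.mult_finsum[symmetric]) auto
  also have "(\<Oplus>\<^sub>B k\<in>K. \<iota> (a k) \<otimes>\<^sub>B x k) = \<ominus>\<^sub>B (\<iota> s \<otimes>\<^sub>B x m)"
  proof -
   have cl: "(\<Oplus>\<^sub>B k\<in>K. \<iota> (a k) \<otimes>\<^sub>B x k) \<in> carrier B" "\<iota> s \<otimes>\<^sub>B x m \<in> carrier B"
    using kI ai xi sc m by (auto intro!: B.finsum_closed)
   show ?thesis using rel cl by (metis B.a_comm B.minus_equality)
  qed
  also have "(\<ominus>\<^sub>B u) \<otimes>\<^sub>B (\<ominus>\<^sub>B (\<iota> s \<otimes>\<^sub>B x m)) = (u \<otimes>\<^sub>B \<iota> s) \<otimes>\<^sub>B x m"
   using u(1) sc xi m by (simp add: B.l_minus B.r_minus B.m_assoc)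
  finally show ?thesis using u True xi m by simp
 next
  case False
  then have iK: "i \<in> K" using i K by auto
  have "(\<Oplus>\<^sub>B k\<in>K. (u \<otimes>\<^sub>B x k) \<otimes>\<^sub>B \<iota> (y k i)) = (\<Oplus>\<^sub>B k\<in>K. if i = k then x k else \<zero>\<^sub>B)"
  proof (intro B.finsum_cong')
   fix k assume k: "k \<in> K"
   have "(u \<otimes>\<^sub>B x k) \<otimes>\<^sub>B \<iota> s = (u \<otimes>\<^sub>B \<iota> s) \<otimes>\<^sub>B x k"
    using u(1) sc xi kI[OF k] by (simp add: B.m_ac)
   then show "(u \<otimes>\<^sub>B x k) \<otimes>\<^sub>B \<iota> (y k i) = (if i = k then x k else \<zero>\<^sub>B)"
    using False k kI u xi by (simp add: y_def \<iota>_zero)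
  qed (use kI xi in auto)
  then show ?thesis using B.finsum_singleton[OF iK K(1), of x] xi kI by auto
 qed
 show ?thesis using K(4) 1 2 ycl ux
  by (intro exI[of _ K] conjI exI[of _ "\<lambda>k. u \<otimes>\<^sub>B x k"] exI[of _ y]) auto
qed

text \<open>Induction on the equations. Inserting the representation of \<open>x\<close> by
  solutions of the earlier equations into the next one leaves a single equation for the coefficients
  \<open>a k\<close>, to which \<open>single_equation\<close> applies.\<close>

lemma equational_flatness:
 assumes fin: "finite I" "finite J" and c: "!!j i. j \<in> J ==> i \<in> I ==> c j i \<in> carrier A"
  and x: "x \<in> I \<rightarrow> carrier B"
  and eq: "!!j. j \<in> J ==> (\<Oplus>\<^sub>B i\<in>I. \<iota> (c j i) \<otimes>\<^sub>B x i) = \<zero>\<^sub>B"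
 shows "\<exists>K\<subseteq>I. \<exists>a y. a \<in> K \<rightarrow> carrier B & (\<forall>k\<in>K. y k \<in> I \<rightarrow> carrier A) &
  (\<forall>j\<in>J. \<forall>k\<in>K. (\<Oplus> i\<in>I. c j i \<otimes> y k i) = \<zero>) &
  (\<forall>i\<in>I. x i = (\<Oplus>\<^sub>B k\<in>K. a k \<otimes>\<^sub>B \<iota> (y k i)))" (is "?P J")
 using fin(2) c eq
proof (induction J)
 case empty
 \<comment> \<open>With no equations left, the equation with zero coefficients supplies the
   representation by unit vectors.\<close>
 show ?case using single_equation[OF fin(1), of "\<lambda>_. \<zero>" x] x
  by (auto simp: \<iota>_zero Pi_iff B.add.finprod_one_eqI)
next
 case (insert j J)
 then obtain K a y where K: "K \<subseteq> I" and a: "a \<in> K \<rightarrow> carrier B"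
  and y: "!!k. k \<in> K ==> y k \<in> I \<rightarrow> carrier A"
  and yJ: "!!j k. j \<in> J ==> k \<in> K ==> (\<Oplus> i\<in>I. c j i \<otimes> y k i) = \<zero>"
  and xy: "!!i. i \<in> I ==> x i = (\<Oplus>\<^sub>B k\<in>K. a k \<otimes>\<^sub>B \<iota> (y k i))"
 proof -
  have "?P J"
   by (rule insert.IH) (use insert.prems in auto)
  then show thesis
   by (elim exE conjE) (rule that, assumption+, (drule (1) bspec | assumption)+)
 qed
 have finK: "finite K" using K fin finite_subset by blast
 have cj: "!!i. i \<in> I ==> c j i \<in> carrier A" using insert.prems by auto
 have yi: "!!k i. k \<in> K ==> i \<in> I ==> y k i \<in> carrier A" using y by auto
 have ak: "!!k. k \<in> K ==> a k \<in> carrier B" using a by auto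
 \<comment> \<open>The defect of the old solution \<open>y k\<close> in the new equation.\<close>
 define d where "d k = (\<Oplus> i\<in>I. c j i \<otimes> y k i)" for k
 have dcl: "d \<in> K \<rightarrow> carrier A" unfolding d_def using cj yi by (auto intro!: A.finsum_closed)
 have "(\<Oplus>\<^sub>B k\<in>K. \<iota> (d k) \<otimes>\<^sub>B a k) = (\<Oplus>\<^sub>B k\<in>K. \<Oplus>\<^sub>B i\<in>I. \<iota> (c j i) \<otimes>\<^sub>B (a k \<otimes>\<^sub>B \<iota> (y k i)))"
 proof (intro B.finsum_cong')
  fix k assume k: "k \<in> K"
  have "\<iota> (d k) \<otimes>\<^sub>B a k = (\<Oplus>\<^sub>B i\<in>I. \<iota> (c j i \<otimes> y k i)) \<otimes>\<^sub>B a k"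
   unfolding d_def using cj yi k by (subst \<iota>_finsum) auto
  also have "... = (\<Oplus>\<^sub>B i\<in>I. \<iota> (c j i \<otimes> y k i) \<otimes>\<^sub>B a k)"
   using cj yi k ak by (intro B.finsum_mult) auto
  also have "... = (\<Oplus>\<^sub>B i\<in>I. \<iota> (c j i) \<otimes>\<^sub>B (a k \<otimes>\<^sub>B \<iota> (y k i)))"
   using cj yi k ak by (intro B.finsum_cong') (auto simp: \<iota>_mult B.m_ac)
  finally show "\<iota> (d k) \<otimes>\<^sub>B a k = (\<Oplus>\<^sub>B i\<in>I. \<iota> (c j i) \<otimes>\<^sub>B (a k \<otimes>\<^sub>B \<iota> (y k i)))" .
 qed (use cj yi ak in \<open>auto intro!: B.finsum_closed\<close>)
 also have "... = (\<Oplus>\<^sub>B i\<in>I. \<Oplus>\<^sub>B k\<in>K. \<iota> (c j i) \<otimes>\<^sub>B (a k \<otimes>\<^sub>B \<iota> (y k i)))"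
  using cj yi ak finK fin by (intro B.finsum_swap) auto
 also have "... = (\<Oplus>\<^sub>B i\<in>I. \<iota> (c j i) \<otimes>\<^sub>B x i)"
 proof (intro B.finsum_cong')
  fix i assume i: "i \<in> I"
  show "(\<Oplus>\<^sub>B k\<in>K. \<iota> (c j i) \<otimes>\<^sub>B (a k \<otimes>\<^sub>B \<iota> (y k i))) = \<iota> (c j i) \<otimes>\<^sub>B x i"
   unfolding xy[OF i] using i cj yi ak by (intro B.mult_finsum[symmetric]) auto
 qed (use cj x in auto)
 finally have "(\<Oplus>\<^sub>B k\<in>K. \<iota> (d k) \<otimes>\<^sub>B a k) = \<zero>\<^sub>B" using insert.prems by auto
 from single_equation[OF finK dcl a this] obtain L b z where L: "L \<subseteq> K" and b: "b \<in> L \<rightarrow> carrier B"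
  and z: "!!l. l \<in> L ==> z l \<in> K \<rightarrow> carrier A"
  and zd: "!!l. l \<in> L ==> (\<Oplus> k\<in>K. d k \<otimes> z l k) = \<zero>"
  and az: "!!k. k \<in> K ==> a k = (\<Oplus>\<^sub>B l\<in>L. b l \<otimes>\<^sub>B \<iota> (z l k))"
  by (elim exE conjE) (rule that, assumption+, (drule (1) bspec | assumption)+)
 have finL: "finite L" using L finK finite_subset by blast
 have zk: "!!l k. l \<in> L ==> k \<in> K ==> z l k \<in> carrier A" using z by auto
 have bl: "!!l. l \<in> L ==> b l \<in> carrier B" using b by auto
 \<comment> \<open>The old solutions combined by a vector \<open>z l\<close> that solves the
   equation with coefficients \<open>d\<close>: the defects cancel in the new equation, and the
   earlier equations persist by linearity.\<close>
 define w where "w l i = (\<Oplus> k\<in>K. z l k \<otimes> y k i)" for l i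
 have wcl: "w l i \<in> carrier A" if "l \<in> L" "i \<in> I" for l i
  unfolding w_def using zk yi that by (auto intro!: A.finsum_closed)
 have zero: "(\<Oplus> i\<in>I. c j' i \<otimes> w l i) = \<zero>" if j': "j' \<in> insert j J" and l: "l \<in> L" for j' l
 proof -
  have c': "!!i. i \<in> I ==> c j' i \<in> carrier A" using insert.prems j' by auto
  have "(\<Oplus> i\<in>I. c j' i \<otimes> w l i) = (\<Oplus> i\<in>I. \<Oplus> k\<in>K. z l k \<otimes> (c j' i \<otimes> y k i))"
  proof (intro A.finsum_cong')
   fix i assume i: "i \<in> I"
   have "c j' i \<otimes> w l i = (\<Oplus> k\<in>K. c j' i \<otimes> (z l k \<otimes> y k i))"
    unfolding w_def using c' zk yi l i by (intro A.mult_finsum) auto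
   also have "... = (\<Oplus> k\<in>K. z l k \<otimes> (c j' i \<otimes> y k i))"
    using c' zk yi l i by (intro A.finsum_cong') (auto simp: A.m_ac)
   finally show "c j' i \<otimes> w l i = (\<Oplus> k\<in>K. z l k \<otimes> (c j' i \<otimes> y k i))" .
  qed (use c' zk yi l in \<open>auto intro!: A.finsum_closed\<close>)
  also have "... = (\<Oplus> k\<in>K. \<Oplus> i\<in>I. z l k \<otimes> (c j' i \<otimes> y k i))"
   using c' zk yi l fin finK by (intro A.finsum_swap) auto
  also have "... = (\<Oplus> k\<in>K. z l k \<otimes> (\<Oplus> i\<in>I. c j' i \<otimes> y k i))"
  proof (intro A.finsum_cong' A.mult_finsum[symmetric])
   show "(\<lambda>k. z l k \<otimes> (\<Oplus> i\<in>I. c j' i \<otimes> y k i)) \<in> K \<rightarrow> carrier A"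
    using c' zk yi l by (auto intro!: A.finsum_closed A.m_closed)
  qed (use c' zk yi l in auto)
  also have "... = \<zero>"
  proof (cases "j' = j")
   case True
   have "(\<Oplus> k\<in>K. z l k \<otimes> (\<Oplus> i\<in>I. c j' i \<otimes> y k i)) = (\<Oplus> k\<in>K. d k \<otimes> z l k)"
    using dcl zk l unfolding True d_def[symmetric] by (intro A.finsum_cong') (auto simp: A.m_comm Pi_iff)
   then show ?thesis using zd[OF l] by simp
  next
   case False
   then show ?thesis using j' yJ zk l by (intro A.add.finprod_one_eqI) auto
  qed
  finally show ?thesis .
 qed
 have "x i = (\<Oplus>\<^sub>B l\<in>L. b l \<otimes>\<^sub>B \<iota> (w l i))" if i: "i \<in> I" for i
 proof -
  have "x i = (\<Oplus>\<^sub>B k\<in>K. \<Oplus>\<^sub>B l\<in>L. b l \<otimes>\<^sub>B \<iota> (z l k) \<otimes>\<^sub>B \<iota> (y k i))"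
   unfolding xy[OF i]
  proof (intro B.finsum_cong')
   fix k assume k: "k \<in> K"
   show "a k \<otimes>\<^sub>B \<iota> (y k i) = (\<Oplus>\<^sub>B l\<in>L. b l \<otimes>\<^sub>B \<iota> (z l k) \<otimes>\<^sub>B \<iota> (y k i))"
    unfolding az[OF k] using bl zk yi k i by (intro B.finsum_mult) auto
  qed (use bl zk yi i in \<open>auto intro!: B.finsum_closed\<close>)
  also have "... = (\<Oplus>\<^sub>B l\<in>L. \<Oplus>\<^sub>B k\<in>K. b l \<otimes>\<^sub>B \<iota> (z l k) \<otimes>\<^sub>B \<iota> (y k i))"
   using bl zk yi i finK finL by (intro B.finsum_swap) auto
  also have "... = (\<Oplus>\<^sub>B l\<in>L. b l \<otimes>\<^sub>B \<iota> (w l i))"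
  proof (intro B.finsum_cong')
   fix l assume l: "l \<in> L"
   have "b l \<otimes>\<^sub>B \<iota> (w l i) = b l \<otimes>\<^sub>B (\<Oplus>\<^sub>B k\<in>K. \<iota> (z l k) \<otimes>\<^sub>B \<iota> (y k i))"
   proof -
    have "\<iota> (w l i) = (\<Oplus>\<^sub>B k\<in>K. \<iota> (z l k \<otimes> y k i))"
     unfolding w_def using zk yi l i by (intro \<iota>_finsum) auto
    also have "... = (\<Oplus>\<^sub>B k\<in>K. \<iota> (z l k) \<otimes>\<^sub>B \<iota> (y k i))"
     using zk yi l i by (intro B.finsum_cong') (auto simp: \<iota>_mult)
    finally show ?thesis by simp
   qed
   also have "... = (\<Oplus>\<^sub>B k\<in>K. b l \<otimes>\<^sub>B (\<iota> (z l k) \<otimes>\<^sub>B \<iota> (y k i)))"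
    using bl zk yi l i by (intro B.mult_finsum) auto
   also have "... = (\<Oplus>\<^sub>B k\<in>K. b l \<otimes>\<^sub>B \<iota> (z l k) \<otimes>\<^sub>B \<iota> (y k i))"
    using bl zk yi l i by (intro B.finsum_cong') (auto simp: B.m_assoc)
   finally show "(\<Oplus>\<^sub>B k\<in>K. b l \<otimes>\<^sub>B \<iota> (z l k) \<otimes>\<^sub>B \<iota> (y k i)) = b l \<otimes>\<^sub>B \<iota> (w l i)" ..
  qed (use bl wcl i in auto)
  finally show ?thesis .
 qed
 then show ?case using L K b wcl zero
  by (intro exI[of _ L] conjI exI[of _ b] exI[of _ w]) auto
qed

end

section \<open>Dual bases and the descent of homomorphisms\<close>

definition dual_basis ::
 "('r, 'x) ring_scheme => ('r, 'm) module => 'i set => ('i => 'm) => ('i => 'm => 'r) => bool" where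
 "dual_basis R M I e l \<longleftrightarrow> finite I & e \<in> I \<rightarrow> carrier M &
  (\<forall>i\<in>I. module_hom R M (self_module R) (l i)) &
  (\<forall>x\<in>carrier M. x = (\<Oplus>\<^sub>M i\<in>I. l i x \<odot>\<^sub>M e i))"

lemma dual_basisD:
 assumes "dual_basis R M I e l"
 shows "finite I" and "i \<in> I ==> e i \<in> carrier M"
  and "i \<in> I ==> x \<in> carrier M ==> l i x \<in> carrier R"
  and "i \<in> I ==> x \<in> carrier M ==> y \<in> carrier M ==> l i (x \<oplus>\<^sub>M y) = l i x \<oplus>\<^sub>R l i y"
  and "i \<in> I ==> a \<in> carrier R ==> x \<in> carrier M ==> l i (a \<odot>\<^sub>M x) = a \<otimes>\<^sub>R l i x"
  and "x \<in> carrier M ==> x = (\<Oplus>\<^sub>M i\<in>I. l i x \<odot>\<^sub>M e i)"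
  and "i \<in> I ==> additive M R (l i)"
 using assms by (auto simp: dual_basis_def module_hom_def additive_def Pi_def)

lemma dual_basis_zeroI:
 assumes "module R M" "dual_basis R M I e l" "x \<in> carrier M" "!!i. i \<in> I ==> l i x = \<zero>\<^sub>R"
 shows "x = \<zero>\<^sub>M"
proof -
 interpret module R M by fact
 show ?thesis
  by (subst dual_basisD(6)[OF assms(2,3)], rule M.add.finprod_one_eqI)
   (simp add: assms(4) dual_basisD(2)[OF assms(2)])
qed

lemma dual_basis_eqI:
 assumes "module R M" "dual_basis R M I e l" "x \<in> carrier M" "y \<in> carrier M"
  "!!i. i \<in> I ==> l i x = l i y"
 shows "x = y"
proof -
 interpret module R M by fact
 have "x = (\<Oplus>\<^sub>M i\<in>I. l i x \<odot>\<^sub>M e i)" by (rule dual_basisD(6)[OF assms(2,3)])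
 also have "... = (\<Oplus>\<^sub>M i\<in>I. l i y \<odot>\<^sub>M e i)"
  using dual_basisD[OF assms(2)] assms(4,5) by (intro M.finsum_cong') auto
 also have "... = y" by (rule dual_basisD(6)[OF assms(2,4), symmetric])
 finally show ?thesis .
qed

lemma dual_basis_hom_eqI:
 assumes "module R M" "module R N" "dual_basis R M I e l" "module_hom R M N f" "module_hom R M N g"
  "!!i. i \<in> I ==> f (e i) = g (e i)" "x \<in> carrier M"
 shows "f x = g x"
proof -
 interpret M: module R M by fact
 interpret N: module R N by fact
 have *: "h x = (\<Oplus>\<^sub>N i\<in>I. l i x \<odot>\<^sub>N h (e i))" if h: "module_hom R M N h" for h
 proof -
  have "h x = h (\<Oplus>\<^sub>M i\<in>I. l i x \<odot>\<^sub>M e i)"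
   using dual_basisD(6)[OF assms(3,7)] by simp
  also have "... = (\<Oplus>\<^sub>N i\<in>I. h (l i x \<odot>\<^sub>M e i))"
   using dual_basisD[OF assms(3)] assms(7)
   by (intro additive_finsum[OF M.M.abelian_group_axioms N.M.abelian_group_axioms module_hom_additive[OF h]]) auto
  also have "... = (\<Oplus>\<^sub>N i\<in>I. l i x \<odot>\<^sub>N h (e i))"
   using dual_basisD[OF assms(3)] assms(7) module_homD[OF h] by (intro N.M.finsum_cong') auto
  finally show ?thesis .
 qed
 show ?thesis unfolding *[OF assms(4)] *[OF assms(5)]
  using dual_basisD[OF assms(3)] assms(6,7) module_homD[OF assms(5)]
  by (intro N.M.finsum_cong') auto
qed

lemma module_hom_compose:
 "module_hom R M N f ==> module_hom R N N' g ==> module_hom R M N' (\<lambda>x. g (f x))"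
 by (auto simp: module_hom_def Pi_def)

text \<open>\<open>Y = B \<otimes>\<^sub>A X\<close> and \<open>Y' = B \<otimes>\<^sub>A X'\<close> enter only through semilinear maps \<open>j\<close>, \<open>j'\<close> carrying a dual
 basis to a dual basis; \<open>u w\<close>, \<open>u' w\<close> are the operators the homomorphisms have to commute with.\<close>

locale operator_base_change = valuation_base_change A B \<iota> D +
 X: module A M + X': module A M' + Y: module B Y + Y': module B Y'
 for A :: "('a, 'p) ring_scheme" (structure) and B :: "('c, 'q) ring_scheme" (structure) and \<iota> and D
  and M :: "('a, 'm) module" and M' :: "('a, 'n) module"
  and Y :: "('c, 'y) module" and Y' :: "('c, 'z) module" +
 fixes j j' and I :: "'i set" and e l lY and I' :: "'i' set" and e' l' lY'
  and Om :: "'w set" and u u' U U'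
 assumes j_add: "additive M Y j" and j_smult: "a \<in> carrier A ==> x \<in> carrier M ==> j (a \<odot>\<^sub>M x) = \<iota> a \<odot>\<^sub>Y j x"
  and j'_add: "additive M' Y' j'"
  and j'_smult: "a \<in> carrier A ==> x' \<in> carrier M' ==> j' (a \<odot>\<^sub>M' x') = \<iota> a \<odot>\<^sub>Y' j' x'"
  and db: "dual_basis A M I e l" and db': "dual_basis A M' I' e' l'"
  and dbY: "dual_basis B Y I (\<lambda>i. j (e i)) lY" and dbY': "dual_basis B Y' I' (\<lambda>i. j' (e' i)) lY'"
  and lY: "i \<in> I ==> x \<in> carrier M ==> lY i (j x) = \<iota> (l i x)"
  and lY': "i' \<in> I' ==> x' \<in> carrier M' ==> lY' i' (j' x') = \<iota> (l' i' x')"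
  and Om: "finite Om"
  and u: "w \<in> Om ==> module_hom A M M (u w)" and u': "w \<in> Om ==> module_hom A M' M' (u' w)"
  and U': "w \<in> Om ==> module_hom B Y' Y' (U' w)"
  and Uj: "w \<in> Om ==> x \<in> carrier M ==> U w (j x) = j (u w x)"
  and U'j: "w \<in> Om ==> x' \<in> carrier M' ==> U' w (j' x') = j' (u' w x')"
begin

lemmas db_simps = dual_basisD(1-5)[OF db] dual_basisD(1-5)[OF db']
 dual_basisD(2-5)[OF dbY] dual_basisD(2-5)[OF dbY']

lemma j_closed [simp]: "x \<in> carrier M ==> j x \<in> carrier Y"
 by (rule additive_closed[OF j_add])

lemma j'_closed [simp]: "x \<in> carrier M' ==> j' x \<in> carrier Y'"
 by (rule additive_closed[OF j'_add])

text \<open>For injectivity. A relation over \<open>B\<close> among the \<open>f k\<close> yields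
  finitely many linear equations for the coefficients \<open>a k\<close>, one for each pair of a
  generator and a coordinate, with coefficients in \<open>A\<close>. Conversely every solution over
  \<open>A\<close> is a relation over \<open>A\<close>, because coordinates detect zero.\<close>

lemma relations_descend:
 assumes fin: "finite K" and f: "!!k. k \<in> K ==> module_hom A M M' (f k)" and a: "a \<in> K \<rightarrow> carrier B"
  and eq: "!!x. x \<in> carrier M ==> (\<Oplus>\<^sub>Y' k\<in>K. a k \<odot>\<^sub>Y' j' (f k x)) = \<zero>\<^sub>Y'"
 shows "\<exists>L\<subseteq>K. \<exists>b z. b \<in> L \<rightarrow> carrier B & (\<forall>q\<in>L. z q \<in> K \<rightarrow> carrier A) &
  (\<forall>k\<in>K. a k = (\<Oplus>\<^sub>B q\<in>L. b q \<otimes>\<^sub>B \<iota> (z q k))) &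
  (\<forall>q\<in>L. \<forall>x\<in>carrier M. (\<Oplus>\<^sub>M' k\<in>K. z q k \<odot>\<^sub>M' f k x) = \<zero>\<^sub>M')"
proof -
 have ak: "!!k. k \<in> K ==> a k \<in> carrier B" using a by auto
 have fk: "!!k x. k \<in> K ==> x \<in> carrier M ==> f k x \<in> carrier M'" using module_homD(1)[OF f] by auto
 \<comment> \<open>Entry \<open>p\<close> of a matrix of \<open>f k\<close> with respect to the two
   dual bases.\<close>
 define c where "c p k = l' (snd p) (f k (e (fst p)))" for p k
 have c: "c p k \<in> carrier A" if "p \<in> I \<times> I'" "k \<in> K" for p k
  using that db_simps fk unfolding c_def by (auto simp: mem_Times_iff)
 have eqs: "(\<Oplus>\<^sub>B k\<in>K. \<iota> (c p k) \<otimes>\<^sub>B a k) = \<zero>\<^sub>B" if p: "p \<in> I \<times> I'" for p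
 proof -
  obtain i m where im: "p = (i, m)" "i \<in> I" "m \<in> I'" using p by auto
  have ei: "e i \<in> carrier M" using im db_simps by auto
  have "\<zero>\<^sub>B = lY' m (\<Oplus>\<^sub>Y' k\<in>K. a k \<odot>\<^sub>Y' j' (f k (e i)))"
   unfolding eq[OF ei]
   using additive_zero[OF Y'.M.abelian_group_axioms B.abelian_group_axioms dual_basisD(7)[OF dbY' im(3)]] by simp
  also have "... = (\<Oplus>\<^sub>B k\<in>K. lY' m (a k \<odot>\<^sub>Y' j' (f k (e i))))"
   using ak fk ei
   by (intro additive_finsum[OF Y'.M.abelian_group_axioms B.abelian_group_axioms dual_basisD(7)[OF dbY' im(3)]]) auto
  also have "... = (\<Oplus>\<^sub>B k\<in>K. \<iota> (c p k) \<otimes>\<^sub>B a k)"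
   using ak fk ei im c[OF p] db_simps by (intro B.finsum_cong') (auto simp: c_def lY' B.m_comm)
  finally show ?thesis ..
 qed
 have "\<exists>L\<subseteq>K. \<exists>b z. b \<in> L \<rightarrow> carrier B & (\<forall>q\<in>L. z q \<in> K \<rightarrow> carrier A) &
  (\<forall>p\<in>I \<times> I'. \<forall>q\<in>L. (\<Oplus> k\<in>K. c p k \<otimes> z q k) = \<zero>) &
  (\<forall>k\<in>K. a k = (\<Oplus>\<^sub>B q\<in>L. b q \<otimes>\<^sub>B \<iota> (z q k)))"
  by (rule equational_flatness[OF fin _ c a eqs]) (use db_simps in auto)
 then obtain L b z where L: "L \<subseteq> K" "b \<in> L \<rightarrow> carrier B" "\<forall>q\<in>L. z q \<in> K \<rightarrow> carrier A"
  and z0: "\<forall>p\<in>I \<times> I'. \<forall>q\<in>L. (\<Oplus> k\<in>K. c p k \<otimes> z q k) = \<zero>"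
  and az: "\<forall>k\<in>K. a k = (\<Oplus>\<^sub>B q\<in>L. b q \<otimes>\<^sub>B \<iota> (z q k))"
  by (elim exE conjE) (rule that)
 have "(\<Oplus>\<^sub>M' k\<in>K. z q k \<odot>\<^sub>M' f k x) = \<zero>\<^sub>M'" if q: "q \<in> L" and x: "x \<in> carrier M" for q x
 proof -
  have zk: "z q k \<in> carrier A" if "k \<in> K" for k using L(3) q that by auto
  define F where "F y = (\<Oplus>\<^sub>M' k\<in>K. z q k \<odot>\<^sub>M' f k y)" for y
  \<comment> \<open>Linearity reduces the vanishing of \<open>F\<close> to the generators
    \<open>e i\<close>, where the coordinates decide.\<close>
  have F: "module_hom A M M' F"
  proof (rule module_homI)
   fix y assume y: "y \<in> carrier M"
   show "F y \<in> carrier M'" unfolding F_def using zk fk y by (auto intro!: X'.M.finsum_closed)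
   show "F (y \<oplus>\<^sub>M y') = F y \<oplus>\<^sub>M' F y'" if "y' \<in> carrier M" for y'
   proof -
    have "F (y \<oplus>\<^sub>M y') = (\<Oplus>\<^sub>M' k\<in>K. z q k \<odot>\<^sub>M' f k y \<oplus>\<^sub>M' z q k \<odot>\<^sub>M' f k y')"
     unfolding F_def using zk fk y that module_homD[OF f]
     by (intro X'.M.finsum_cong') (auto simp: X'.smult_r_distr)
    also have "... = F y \<oplus>\<^sub>M' F y'"
     unfolding F_def using zk fk y that by (intro X'.M.finsum_addf) auto
    finally show ?thesis .
   qed
   show "F (r \<odot>\<^sub>M y) = r \<odot>\<^sub>M' F y" if "r \<in> carrier A" for r
   proof -
    have "F (r \<odot>\<^sub>M y) = (\<Oplus>\<^sub>M' k\<in>K. r \<odot>\<^sub>M' (z q k \<odot>\<^sub>M' f k y))"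
     unfolding F_def using zk fk y that module_homD[OF f]
     by (intro X'.M.finsum_cong') (auto simp: X'.smult_assoc1[symmetric] A.m_comm)
    also have "... = r \<odot>\<^sub>M' F y"
     unfolding F_def using zk fk y that by (intro X'.smult_finsum[symmetric]) auto
    finally show ?thesis .
   qed
  qed
  have zero: "module_hom A M M' (\<lambda>_. \<zero>\<^sub>M')" by (rule module_homI) auto
  have "F (e i) = \<zero>\<^sub>M'" if i: "i \<in> I" for i
  proof (rule dual_basis_zeroI[OF X'.module_axioms db'])
   have ei: "e i \<in> carrier M" using i db_simps by auto
   then show "F (e i) \<in> carrier M'" using module_homD(1)[OF F] by auto
   fix m assume m: "m \<in> I'"
   have "l' m (F (e i)) = (\<Oplus> k\<in>K. l' m (z q k \<odot>\<^sub>M' f k (e i)))"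
    unfolding F_def using zk fk ei
    by (intro additive_finsum[OF X'.M.abelian_group_axioms A.abelian_group_axioms dual_basisD(7)[OF db' m]]) auto
   also have "... = (\<Oplus> k\<in>K. c (i, m) k \<otimes> z q k)"
    using zk fk ei m i c db_simps by (intro A.finsum_cong') (auto simp: c_def A.m_comm)
   finally show "l' m (F (e i)) = \<zero>" using z0 i m q by auto
  qed
  then have "F x = \<zero>\<^sub>M'"
   using dual_basis_hom_eqI[OF X.module_axioms X'.module_axioms db F zero _ x] by blast
  then show ?thesis by (simp add: F_def)
 qed
 then have "b \<in> L \<rightarrow> carrier B & (\<forall>q\<in>L. z q \<in> K \<rightarrow> carrier A) &
  (\<forall>k\<in>K. a k = (\<Oplus>\<^sub>B q\<in>L. b q \<otimes>\<^sub>B \<iota> (z q k))) &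
  (\<forall>q\<in>L. \<forall>x\<in>carrier M. (\<Oplus>\<^sub>M' k\<in>K. z q k \<odot>\<^sub>M' f k x) = \<zero>\<^sub>M')"
  using L az by simp
 then have "\<exists>b z. b \<in> L \<rightarrow> carrier B & (\<forall>q\<in>L. z q \<in> K \<rightarrow> carrier A) &
  (\<forall>k\<in>K. a k = (\<Oplus>\<^sub>B q\<in>L. b q \<otimes>\<^sub>B \<iota> (z q k))) &
  (\<forall>q\<in>L. \<forall>x\<in>carrier M. (\<Oplus>\<^sub>M' k\<in>K. z q k \<odot>\<^sub>M' f k x) = \<zero>\<^sub>M')"
  by (rule_tac exI, rule_tac exI)
 then show ?thesis by (rule_tac exI) (rule conjI[OF L(1)])
qed

text \<open>For surjectivity. \<open>G\<close> has a matrix over \<open>B\<close>, and commuting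
  with the operators imposes a finite linear system with coefficients in \<open>A\<close> on its
  entries. The generators may be dependent, yet each matrix over \<open>A\<close> defines a linear
  map, and a matrix that solves the system defines one that commutes.\<close>

lemma hom_descends:
 assumes G: "module_hom B Y Y' G"
  and comm: "!!w y. w \<in> Om ==> y \<in> carrier Y ==> G (U w y) = U' w (G y)"
 shows "\<exists>K\<subseteq>I \<times> I'. \<exists>a f. a \<in> K \<rightarrow> carrier B &
  (\<forall>k\<in>K. module_hom A M M' (f k) & (\<forall>w\<in>Om. \<forall>x\<in>carrier M. f k (u w x) = u' w (f k x))) &
  (\<forall>x\<in>carrier M. G (j x) = (\<Oplus>\<^sub>Y' k\<in>K. a k \<odot>\<^sub>Y' j' (f k x)))"
proof -
 let ?P = "I \<times> I'"
 have finP: "finite ?P" using db_simps by auto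
 have pe: "fst p \<in> I" "snd p \<in> I'" "e (fst p) \<in> carrier M" "e' (snd p) \<in> carrier M'" if "p \<in> ?P" for p
  using that db_simps by auto
 note lcl = dual_basisD(3)[OF db] and l'cl = dual_basisD(3)[OF db']
 have jcl: "j x \<in> carrier Y" "G (j x) \<in> carrier Y'" if "x \<in> carrier M" for x
  using that module_homD(1)[OF G] by auto
 define c where "c p = lY' (snd p) (G (j (e (fst p))))" for p
 have c: "c p \<in> carrier B" if "p \<in> ?P" for p
  using that pe[OF that] jcl dual_basisD(3)[OF dbY'] unfolding c_def by auto
 have cPi: "c \<in> ?P \<rightarrow> carrier B" using c by auto
 \<comment> \<open>On the image of \<open>j\<close> the coordinates are images of coordinates over
   \<open>A\<close>, so there \<open>G\<close> is expressed by the unknown entries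
   \<open>c p\<close> and by data from \<open>A\<close>.\<close>
 have Gj: "G (j x) = (\<Oplus>\<^sub>Y' p\<in>?P. (\<iota> (l (fst p) x) \<otimes>\<^sub>B c p) \<odot>\<^sub>Y' j' (e' (snd p)))"
  if x: "x \<in> carrier M" for x
 proof -
  have "G (j x) = G (\<Oplus>\<^sub>Y i\<in>I. lY i (j x) \<odot>\<^sub>Y j (e i))"
   using dual_basisD(6)[OF dbY] jcl(1)[OF x] by simp
  also have "... = (\<Oplus>\<^sub>Y' i\<in>I. G (lY i (j x) \<odot>\<^sub>Y j (e i)))"
   using jcl x db_simps
   by (intro additive_finsum[OF Y.M.abelian_group_axioms Y'.M.abelian_group_axioms module_hom_additive[OF G]]) auto
  also have "... = (\<Oplus>\<^sub>Y' i\<in>I. \<Oplus>\<^sub>Y' m\<in>I'. (\<iota> (l i x) \<otimes>\<^sub>B c (i, m)) \<odot>\<^sub>Y' j' (e' m))"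
  proof (intro Y'.M.finsum_cong')
   fix i assume i: "i \<in> I"
   have ei: "e i \<in> carrier M" using i db_simps by auto
   have cim: "!!m. m \<in> I' ==> c (i, m) \<in> carrier B" using c i by auto
   have e'm: "!!m. m \<in> I' ==> j' (e' m) \<in> carrier Y'" using db_simps by auto
   have "G (lY i (j x) \<odot>\<^sub>Y j (e i)) = \<iota> (l i x) \<odot>\<^sub>Y' G (j (e i))"
    using i x ei lcl module_homD(3)[OF G] by (simp add: lY)
   also have "G (j (e i)) = (\<Oplus>\<^sub>Y' m\<in>I'. c (i, m) \<odot>\<^sub>Y' j' (e' m))"
    unfolding c_def fst_conv snd_conv by (rule dual_basisD(6)[OF dbY' jcl(2)[OF ei]])
   also have "\<iota> (l i x) \<odot>\<^sub>Y' ... = (\<Oplus>\<^sub>Y' m\<in>I'. \<iota> (l i x) \<odot>\<^sub>Y' (c (i, m) \<odot>\<^sub>Y' j' (e' m)))"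
    using i x lcl cim e'm by (intro Y'.smult_finsum) auto
   also have "... = (\<Oplus>\<^sub>Y' m\<in>I'. (\<iota> (l i x) \<otimes>\<^sub>B c (i, m)) \<odot>\<^sub>Y' j' (e' m))"
    using i x lcl cim e'm by (intro Y'.M.finsum_cong') (auto simp: Y'.smult_assoc1)
   finally show "G (lY i (j x) \<odot>\<^sub>Y j (e i)) = (\<Oplus>\<^sub>Y' m\<in>I'. (\<iota> (l i x) \<otimes>\<^sub>B c (i, m)) \<odot>\<^sub>Y' j' (e' m))" .
  qed (use x lcl c db_simps in \<open>auto intro!: Y'.M.finsum_closed\<close>)
  also have "... = (\<Oplus>\<^sub>Y' i\<in>I. \<Oplus>\<^sub>Y' m\<in>I'.
    (\<lambda>p. (\<iota> (l (fst p) x) \<otimes>\<^sub>B c p) \<odot>\<^sub>Y' j' (e' (snd p))) (i, m))" by simp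
  also have "... = (\<Oplus>\<^sub>Y' p\<in>?P. (\<iota> (l (fst p) x) \<otimes>\<^sub>B c p) \<odot>\<^sub>Y' j' (e' (snd p)))"
   using x lcl c db_simps by (intro Y'.M.finsum_product) auto
  finally show ?thesis .
 qed
 \<comment> \<open>For \<open>t = (w, i, m)\<close>, the coefficient of the entry \<open>p\<close>
   in coordinate \<open>m\<close> of the difference between the map applied to
   \<open>u w (e i)\<close> and \<open>u' w\<close> applied to the image of
   \<open>e i\<close>.\<close>
 define E where "E t p = l (fst p) (u (fst t) (e (fst (snd t)))) \<otimes> l' (snd (snd t)) (e' (snd p))
   \<ominus> l (fst p) (e (fst (snd t))) \<otimes> l' (snd (snd t)) (u' (fst t) (e' (snd p)))" for t p
 have ucl: "u w x \<in> carrier M" if "w \<in> Om" "x \<in> carrier M" for w x using module_homD(1)[OF u] that by auto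
 have u'cl: "u' w x \<in> carrier M'" if "w \<in> Om" "x \<in> carrier M'" for w x using module_homD(1)[OF u'] that by auto
 have Ecl: "E t p \<in> carrier A" if "t \<in> Om \<times> (I \<times> I')" "p \<in> ?P" for t p
  using that db_simps ucl u'cl unfolding E_def by auto
 have eqs: "(\<Oplus>\<^sub>B p\<in>?P. \<iota> (E t p) \<otimes>\<^sub>B c p) = \<zero>\<^sub>B" if t: "t \<in> Om \<times> (I \<times> I')" for t
 proof -
  obtain w i m where wim: "t = (w, i, m)" "w \<in> Om" "i \<in> I" "m \<in> I'" using t by auto
  have ei: "e i \<in> carrier M" and uei: "u w (e i) \<in> carrier M" using wim db_simps ucl by auto
  note addY' = additive_finsum[OF Y'.M.abelian_group_axioms B.abelian_group_axioms dual_basisD(7)[OF dbY' wim(4)]]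
  define S1 where "S1 p = \<iota> (l (fst p) (u w (e i)) \<otimes> l' m (e' (snd p))) \<otimes>\<^sub>B c p" for p
  define S2 where "S2 p = \<iota> (l (fst p) (e i) \<otimes> l' m (u' w (e' (snd p)))) \<otimes>\<^sub>B c p" for p
  have S: "S1 p \<in> carrier B" "S2 p \<in> carrier B" if "p \<in> ?P" for p
   unfolding S1_def S2_def using pe[OF that] ei uei lcl l'cl wim u'cl c[OF that] by auto
  have "lY' m (G (j (u w (e i)))) = (\<Oplus>\<^sub>B p\<in>?P. lY' m ((\<iota> (l (fst p) (u w (e i))) \<otimes>\<^sub>B c p) \<odot>\<^sub>Y' j' (e' (snd p))))"
   unfolding Gj[OF uei] using pe uei lcl c by (intro addY') auto
  also have "... = (\<Oplus>\<^sub>B p\<in>?P. S1 p)"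
  proof (intro B.finsum_cong')
   fix p assume p: "p \<in> ?P"
   show "lY' m ((\<iota> (l (fst p) (u w (e i))) \<otimes>\<^sub>B c p) \<odot>\<^sub>Y' j' (e' (snd p))) = S1 p"
    using pe[OF p] uei lcl l'cl c[OF p] wim dual_basisD(5)[OF dbY' wim(4)]
    by (simp add: S1_def lY' \<iota>_mult B.m_ac)
  qed (use S in auto)
  finally have 1: "lY' m (G (j (u w (e i)))) = (\<Oplus>\<^sub>B p\<in>?P. S1 p)" .
  have "lY' m (U' w (G (j (e i)))) = lY' m (\<Oplus>\<^sub>Y' p\<in>?P. U' w ((\<iota> (l (fst p) (e i)) \<otimes>\<^sub>B c p) \<odot>\<^sub>Y' j' (e' (snd p))))"
   unfolding Gj[OF ei] using pe ei lcl c
   by (intro arg_cong[where f="lY' m"] additive_finsum[OF Y'.M.abelian_group_axioms Y'.M.abelian_group_axioms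
      module_hom_additive[OF U'[OF wim(2)]]]) auto
  also have "... = (\<Oplus>\<^sub>B p\<in>?P. lY' m (U' w ((\<iota> (l (fst p) (e i)) \<otimes>\<^sub>B c p) \<odot>\<^sub>Y' j' (e' (snd p)))))"
   using pe ei lcl c module_homD(1)[OF U'[OF wim(2)]] by (intro addY') auto
  also have "... = (\<Oplus>\<^sub>B p\<in>?P. S2 p)"
  proof (intro B.finsum_cong')
   fix p assume p: "p \<in> ?P"
   show "lY' m (U' w ((\<iota> (l (fst p) (e i)) \<otimes>\<^sub>B c p) \<odot>\<^sub>Y' j' (e' (snd p)))) = S2 p"
    using pe[OF p] ei lcl l'cl c[OF p] wim u'cl dual_basisD(5)[OF dbY' wim(4)] module_homD(3)[OF U'[OF wim(2)]]
    by (simp add: S2_def lY' U'j \<iota>_mult B.m_ac)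
  qed (use S in auto)
  finally have 2: "lY' m (U' w (G (j (e i)))) = (\<Oplus>\<^sub>B p\<in>?P. S2 p)" .
  have "G (j (u w (e i))) = U' w (G (j (e i)))"
   using comm[OF wim(2) jcl(1)[OF ei]] Uj[OF wim(2) ei] by simp
  then have 12: "(\<Oplus>\<^sub>B p\<in>?P. S1 p) = (\<Oplus>\<^sub>B p\<in>?P. S2 p)" using 1 2 by simp
  \<comment> \<open>Subtraction is written as multiplication by minus one, so that the sum splits by
    additivity and the scalar can be taken out.\<close>
  have "(\<Oplus>\<^sub>B p\<in>?P. \<iota> (E t p) \<otimes>\<^sub>B c p) = (\<Oplus>\<^sub>B p\<in>?P. S1 p \<oplus>\<^sub>B (\<ominus>\<^sub>B \<one>\<^sub>B) \<otimes>\<^sub>B S2 p)"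
  proof (intro B.finsum_cong')
   fix p assume p: "p \<in> ?P"
   define s1 where "s1 = l (fst p) (u w (e i)) \<otimes> l' m (e' (snd p))"
   define s2 where "s2 = l (fst p) (e i) \<otimes> l' m (u' w (e' (snd p)))"
   have s: "s1 \<in> carrier A" "s2 \<in> carrier A"
    unfolding s1_def s2_def using pe[OF p] ei uei lcl l'cl wim u'cl by auto
   have "E t p = s1 \<oplus> \<ominus> s2" by (simp add: E_def wim(1) s1_def s2_def a_minus_def)
   then have "\<iota> (E t p) = \<iota> s1 \<oplus>\<^sub>B \<ominus>\<^sub>B \<iota> s2"
    using s additive_add[OF ring_hom_additive[OF hom]] by (simp add: \<iota>_minus)
   then show "\<iota> (E t p) \<otimes>\<^sub>B c p = S1 p \<oplus>\<^sub>B (\<ominus>\<^sub>B \<one>\<^sub>B) \<otimes>\<^sub>B S2 p"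
    unfolding S1_def S2_def s1_def[symmetric] s2_def[symmetric]
    using s c[OF p] by (simp add: B.l_distr B.l_minus)
  qed (use S in auto)
  also have "... = (\<Oplus>\<^sub>B p\<in>?P. S1 p) \<oplus>\<^sub>B (\<Oplus>\<^sub>B p\<in>?P. (\<ominus>\<^sub>B \<one>\<^sub>B) \<otimes>\<^sub>B S2 p)"
   using S by (intro B.finsum_addf) auto
  also have "(\<Oplus>\<^sub>B p\<in>?P. (\<ominus>\<^sub>B \<one>\<^sub>B) \<otimes>\<^sub>B S2 p) = (\<ominus>\<^sub>B \<one>\<^sub>B) \<otimes>\<^sub>B (\<Oplus>\<^sub>B p\<in>?P. S2 p)"
   using S by (intro B.mult_finsum[symmetric]) auto
  finally show ?thesis using 12 S by (simp add: B.l_minus B.r_neg B.finsum_closed)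
 qed
 have finT: "finite (Om \<times> (I \<times> I'))" using Om finP by auto
 have "\<exists>K\<subseteq>?P. \<exists>a y. a \<in> K \<rightarrow> carrier B & (\<forall>k\<in>K. y k \<in> ?P \<rightarrow> carrier A) &
  (\<forall>t\<in>Om \<times> (I \<times> I'). \<forall>k\<in>K. (\<Oplus> p\<in>?P. E t p \<otimes> y k p) = \<zero>) &
  (\<forall>p\<in>?P. c p = (\<Oplus>\<^sub>B k\<in>K. a k \<otimes>\<^sub>B \<iota> (y k p)))"
  by (rule equational_flatness[OF finP finT Ecl cPi eqs])
 then obtain K a y where K: "K \<subseteq> ?P" and a: "a \<in> K \<rightarrow> carrier B" and y: "\<forall>k\<in>K. y k \<in> ?P \<rightarrow> carrier A"
  and yE: "\<forall>t\<in>Om \<times> (I \<times> I'). \<forall>k\<in>K. (\<Oplus> p\<in>?P. E t p \<otimes> y k p) = \<zero>"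
  and cy: "\<forall>p\<in>?P. c p = (\<Oplus>\<^sub>B k\<in>K. a k \<otimes>\<^sub>B \<iota> (y k p))"
  by (elim exE conjE) (rule that)
 have finK: "finite K" using K finP finite_subset by blast
 have ak: "!!k. k \<in> K ==> a k \<in> carrier B" using a by auto
 have ykp: "!!k p. k \<in> K ==> p \<in> ?P ==> y k p \<in> carrier A" using y by blast
 \<comment> \<open>The linear map that has \<open>y k\<close> as a matrix; as a formula in
   \<open>x\<close> it is well defined even if the \<open>e'\<close> are dependent.\<close>
 define f where "f k x = (\<Oplus>\<^sub>M' p\<in>?P. (l (fst p) x \<otimes> y k p) \<odot>\<^sub>M' e' (snd p))" for k x
 have f: "module_hom A M M' (f k)" if k: "k \<in> K" for k
 proof (rule module_homI)
  fix x assume x: "x \<in> carrier M"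
  have lx: "l (fst p) x \<otimes> y k p \<in> carrier A" "l (fst p) x \<in> carrier A" if "p \<in> ?P" for p
   using pe[OF that] lcl x ykp[OF k that] by auto
  show "f k x \<in> carrier M'" unfolding f_def using lx pe by (auto intro!: X'.M.finsum_closed)
  show "f k (x \<oplus>\<^sub>M x') = f k x \<oplus>\<^sub>M' f k x'" if x': "x' \<in> carrier M" for x'
  proof -
   have lx': "l (fst p) x' \<otimes> y k p \<in> carrier A" "l (fst p) x' \<in> carrier A" if "p \<in> ?P" for p
    using pe[OF that] lcl x' ykp[OF k that] by auto
   have "f k (x \<oplus>\<^sub>M x') = (\<Oplus>\<^sub>M' p\<in>?P. (l (fst p) x \<otimes> y k p) \<odot>\<^sub>M' e' (snd p) \<oplus>\<^sub>M' (l (fst p) x' \<otimes> y k p) \<odot>\<^sub>M' e' (snd p))"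
    unfolding f_def
   proof (intro X'.M.finsum_cong')
    fix p assume p: "p \<in> ?P"
    show "(l (fst p) (x \<oplus>\<^sub>M x') \<otimes> y k p) \<odot>\<^sub>M' e' (snd p) =
     (l (fst p) x \<otimes> y k p) \<odot>\<^sub>M' e' (snd p) \<oplus>\<^sub>M' (l (fst p) x' \<otimes> y k p) \<odot>\<^sub>M' e' (snd p)"
     using pe[OF p] lx[OF p] lx'[OF p] x x' ykp[OF k p] dual_basisD(4)[OF db pe(1)[OF p]]
     by (simp add: A.l_distr X'.smult_l_distr)
   qed (use pe lx lx' in auto)
   also have "... = f k x \<oplus>\<^sub>M' f k x'"
    unfolding f_def using lx lx' pe by (intro X'.M.finsum_addf) auto
   finally show ?thesis .
  qed
  show "f k (r \<odot>\<^sub>M x) = r \<odot>\<^sub>M' f k x" if r: "r \<in> carrier A" for r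
  proof -
   have "f k (r \<odot>\<^sub>M x) = (\<Oplus>\<^sub>M' p\<in>?P. r \<odot>\<^sub>M' ((l (fst p) x \<otimes> y k p) \<odot>\<^sub>M' e' (snd p)))"
    unfolding f_def
   proof (intro X'.M.finsum_cong')
    fix p assume p: "p \<in> ?P"
    show "(l (fst p) (r \<odot>\<^sub>M x) \<otimes> y k p) \<odot>\<^sub>M' e' (snd p) = r \<odot>\<^sub>M' ((l (fst p) x \<otimes> y k p) \<odot>\<^sub>M' e' (snd p))"
     using pe[OF p] lx[OF p] x r ykp[OF k p] dual_basisD(5)[OF db pe(1)[OF p]]
     by (simp add: A.m_assoc X'.smult_assoc1)
   qed (use pe lx r in auto)
   also have "... = r \<odot>\<^sub>M' f k x"
    unfolding f_def using lx pe r by (intro X'.smult_finsum[symmetric]) auto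
   finally show ?thesis .
  qed
 qed
 have fcomm: "f k (u w x) = u' w (f k x)" if k: "k \<in> K" and w: "w \<in> Om" and x: "x \<in> carrier M" for k w x
 proof (rule dual_basis_hom_eqI[OF X.module_axioms X'.module_axioms db
    module_hom_compose[OF u[OF w] f[OF k]] module_hom_compose[OF f[OF k] u'[OF w]] _ x])
  fix i assume i: "i \<in> I"
  have ei: "e i \<in> carrier M" and uei: "u w (e i) \<in> carrier M" using i w db_simps ucl by auto
  have fc: "f k (u w (e i)) \<in> carrier M'" "f k (e i) \<in> carrier M'" "u' w (f k (e i)) \<in> carrier M'"
   using module_homD(1)[OF f[OF k]] ei uei u'cl w by auto
  \<comment> \<open>The system compares coordinates only, and these separate the elements of
    \<open>M'\<close>.\<close>
  show "f k (u w (e i)) = u' w (f k (e i))"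
  proof (rule dual_basis_eqI[OF X'.module_axioms db' fc(1,3)])
   fix m assume m: "m \<in> I'"
   note addM' = additive_finsum[OF X'.M.abelian_group_axioms A.abelian_group_axioms dual_basisD(7)[OF db' m]]
   define s1 where "s1 p = l (fst p) (u w (e i)) \<otimes> l' m (e' (snd p))" for p
   define s2 where "s2 p = l (fst p) (e i) \<otimes> l' m (u' w (e' (snd p)))" for p
   have s: "s1 p \<in> carrier A" "s2 p \<in> carrier A" if "p \<in> ?P" for p
    unfolding s1_def s2_def using pe[OF that] ei uei lcl l'cl m u'cl w by auto
   have "l' m (f k (u w (e i))) = (\<Oplus> p\<in>?P. l' m ((l (fst p) (u w (e i)) \<otimes> y k p) \<odot>\<^sub>M' e' (snd p)))"
    unfolding f_def using pe uei lcl ykp[OF k] by (intro addM') auto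
   also have "... = (\<Oplus> p\<in>?P. s1 p \<otimes> y k p)"
   proof (intro A.finsum_cong')
    fix p assume p: "p \<in> ?P"
    show "l' m ((l (fst p) (u w (e i)) \<otimes> y k p) \<odot>\<^sub>M' e' (snd p)) = s1 p \<otimes> y k p"
     using pe[OF p] uei lcl l'cl m ykp[OF k p] dual_basisD(5)[OF db' m] by (simp add: s1_def A.m_ac)
   qed (use s ykp[OF k] in auto)
   finally have 1: "l' m (f k (u w (e i))) = (\<Oplus> p\<in>?P. s1 p \<otimes> y k p)" .
   have "l' m (u' w (f k (e i))) = l' m (\<Oplus>\<^sub>M' p\<in>?P. u' w ((l (fst p) (e i) \<otimes> y k p) \<odot>\<^sub>M' e' (snd p)))"
    unfolding f_def using pe ei lcl ykp[OF k]
    by (intro arg_cong[where f="l' m"] additive_finsum[OF X'.M.abelian_group_axioms X'.M.abelian_group_axioms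
       module_hom_additive[OF u'[OF w]]]) auto
   also have "... = (\<Oplus> p\<in>?P. l' m (u' w ((l (fst p) (e i) \<otimes> y k p) \<odot>\<^sub>M' e' (snd p))))"
    using pe ei lcl ykp[OF k] u'cl w by (intro addM') auto
   also have "... = (\<Oplus> p\<in>?P. s2 p \<otimes> y k p)"
   proof (intro A.finsum_cong')
    fix p assume p: "p \<in> ?P"
    show "l' m (u' w ((l (fst p) (e i) \<otimes> y k p) \<odot>\<^sub>M' e' (snd p))) = s2 p \<otimes> y k p"
     using pe[OF p] ei lcl l'cl m ykp[OF k p] u'cl w dual_basisD(5)[OF db' m] module_homD(3)[OF u'[OF w]]
     by (simp add: s2_def A.m_ac)
   qed (use s ykp[OF k] in auto)
   finally have 2: "l' m (u' w (f k (e i))) = (\<Oplus> p\<in>?P. s2 p \<otimes> y k p)" .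
   have "\<zero> = (\<Oplus> p\<in>?P. E (w, i, m) p \<otimes> y k p)"
    using yE k w i m by auto
   also have "... = (\<Oplus> p\<in>?P. s1 p \<otimes> y k p \<oplus> (\<ominus> \<one>) \<otimes> (s2 p \<otimes> y k p))"
   proof (intro A.finsum_cong')
    fix p assume p: "p \<in> ?P"
    have "E (w, i, m) p = s1 p \<oplus> \<ominus> s2 p" by (simp add: E_def s1_def s2_def a_minus_def)
    then show "E (w, i, m) p \<otimes> y k p = s1 p \<otimes> y k p \<oplus> (\<ominus> \<one>) \<otimes> (s2 p \<otimes> y k p)"
     using s[OF p] ykp[OF k p] by (simp add: A.l_distr A.l_minus)
   qed (use s ykp[OF k] in auto)
   also have "... = (\<Oplus> p\<in>?P. s1 p \<otimes> y k p) \<oplus> (\<Oplus> p\<in>?P. (\<ominus> \<one>) \<otimes> (s2 p \<otimes> y k p))"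
    using s ykp[OF k] by (intro A.finsum_addf) auto
   also have "(\<Oplus> p\<in>?P. (\<ominus> \<one>) \<otimes> (s2 p \<otimes> y k p)) = \<ominus> (\<Oplus> p\<in>?P. s2 p \<otimes> y k p)"
   proof -
    have "(\<Oplus> p\<in>?P. (\<ominus> \<one>) \<otimes> (s2 p \<otimes> y k p)) = (\<ominus> \<one>) \<otimes> (\<Oplus> p\<in>?P. s2 p \<otimes> y k p)"
     using s ykp[OF k] by (intro A.mult_finsum[symmetric]) auto
    also have "... = \<ominus> (\<Oplus> p\<in>?P. s2 p \<otimes> y k p)"
     using s ykp[OF k] by (subst A.l_minus) (auto intro!: A.finsum_closed A.l_one)
    finally show ?thesis .
   qed
   finally have "l' m (f k (u w (e i))) \<ominus> l' m (u' w (f k (e i))) = \<zero>"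
    unfolding 1 2 a_minus_def ..
   then show "l' m (f k (u w (e i))) = l' m (u' w (f k (e i)))"
    using l'cl[OF m] fc by simp
  qed
 qed
 have "G (j x) = (\<Oplus>\<^sub>Y' k\<in>K. a k \<odot>\<^sub>Y' j' (f k x))" if x: "x \<in> carrier M" for x
 proof -
  have lx: "l (fst p) x \<in> carrier A" "j' (e' (snd p)) \<in> carrier Y'" if "p \<in> ?P" for p
   using pe[OF that] lcl x by auto
  have "G (j x) = (\<Oplus>\<^sub>Y' p\<in>?P. \<Oplus>\<^sub>Y' k\<in>K. a k \<odot>\<^sub>Y' ((\<iota> (l (fst p) x \<otimes> y k p)) \<odot>\<^sub>Y' j' (e' (snd p))))"
   unfolding Gj[OF x]
  proof (intro Y'.M.finsum_cong')
   fix p assume p: "p \<in> ?P"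
   have "(\<iota> (l (fst p) x) \<otimes>\<^sub>B c p) = (\<Oplus>\<^sub>B k\<in>K. \<iota> (l (fst p) x) \<otimes>\<^sub>B (a k \<otimes>\<^sub>B \<iota> (y k p)))"
    using bspec[OF cy p] lx[OF p] ak ykp[OF _ p] by (simp only:) (intro B.mult_finsum, auto)
   then have "(\<iota> (l (fst p) x) \<otimes>\<^sub>B c p) \<odot>\<^sub>Y' j' (e' (snd p)) =
     (\<Oplus>\<^sub>Y' k\<in>K. (\<iota> (l (fst p) x) \<otimes>\<^sub>B (a k \<otimes>\<^sub>B \<iota> (y k p))) \<odot>\<^sub>Y' j' (e' (snd p)))"
    using lx[OF p] ak ykp[OF _ p] by (simp only:) (intro Y'.finsum_smult, auto)
   also have "... = (\<Oplus>\<^sub>Y' k\<in>K. a k \<odot>\<^sub>Y' ((\<iota> (l (fst p) x \<otimes> y k p)) \<odot>\<^sub>Y' j' (e' (snd p))))"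
    using lx[OF p] ak ykp[OF _ p]
    by (intro Y'.M.finsum_cong') (auto simp: \<iota>_mult Y'.smult_assoc1[symmetric] B.m_ac)
   finally show "(\<iota> (l (fst p) x) \<otimes>\<^sub>B c p) \<odot>\<^sub>Y' j' (e' (snd p)) =
     (\<Oplus>\<^sub>Y' k\<in>K. a k \<odot>\<^sub>Y' ((\<iota> (l (fst p) x \<otimes> y k p)) \<odot>\<^sub>Y' j' (e' (snd p))))" .
  qed (use lx ak ykp in \<open>auto intro!: Y'.M.finsum_closed\<close>)
  also have "... = (\<Oplus>\<^sub>Y' k\<in>K. \<Oplus>\<^sub>Y' p\<in>?P. a k \<odot>\<^sub>Y' ((\<iota> (l (fst p) x \<otimes> y k p)) \<odot>\<^sub>Y' j' (e' (snd p))))"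
   using lx ak ykp finK finP by (intro Y'.M.finsum_swap) auto
  also have "... = (\<Oplus>\<^sub>Y' k\<in>K. a k \<odot>\<^sub>Y' j' (f k x))"
  proof (intro Y'.M.finsum_cong')
   fix k assume k: "k \<in> K"
   have "j' (f k x) = (\<Oplus>\<^sub>Y' p\<in>?P. j' ((l (fst p) x \<otimes> y k p) \<odot>\<^sub>M' e' (snd p)))"
    unfolding f_def using lx pe ykp[OF k]
    by (intro additive_finsum[OF X'.M.abelian_group_axioms Y'.M.abelian_group_axioms j'_add]) auto
   also have "... = (\<Oplus>\<^sub>Y' p\<in>?P. \<iota> (l (fst p) x \<otimes> y k p) \<odot>\<^sub>Y' j' (e' (snd p)))"
   proof (intro Y'.M.finsum_cong')
    fix p assume p: "p \<in> ?P"
    show "j' ((l (fst p) x \<otimes> y k p) \<odot>\<^sub>M' e' (snd p)) = \<iota> (l (fst p) x \<otimes> y k p) \<odot>\<^sub>Y' j' (e' (snd p))"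
     using lx[OF p] pe[OF p] ykp[OF k p] by (simp add: j'_smult)
   qed (use lx ykp[OF k] in auto)
   finally have "a k \<odot>\<^sub>Y' j' (f k x) = a k \<odot>\<^sub>Y' (\<Oplus>\<^sub>Y' p\<in>?P. \<iota> (l (fst p) x \<otimes> y k p) \<odot>\<^sub>Y' j' (e' (snd p)))"
    by simp
   also have "... = (\<Oplus>\<^sub>Y' p\<in>?P. a k \<odot>\<^sub>Y' ((\<iota> (l (fst p) x \<otimes> y k p)) \<odot>\<^sub>Y' j' (e' (snd p))))"
    using lx ykp[OF k] ak[OF k] by (intro Y'.smult_finsum) auto
   finally show "(\<Oplus>\<^sub>Y' p\<in>?P. a k \<odot>\<^sub>Y' ((\<iota> (l (fst p) x \<otimes> y k p)) \<odot>\<^sub>Y' j' (e' (snd p)))) = a k \<odot>\<^sub>Y' j' (f k x)" ..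
  qed (use ak module_homD(1)[OF f] x in auto)
  finally show ?thesis .
 qed
 then have "a \<in> K \<rightarrow> carrier B &
  (\<forall>k\<in>K. module_hom A M M' (f k) & (\<forall>w\<in>Om. \<forall>x\<in>carrier M. f k (u w x) = u' w (f k x))) &
  (\<forall>x\<in>carrier M. G (j x) = (\<Oplus>\<^sub>Y' k\<in>K. a k \<odot>\<^sub>Y' j' (f k x)))"
  using a f fcomm by simp
 then have "\<exists>a f. a \<in> K \<rightarrow> carrier B &
  (\<forall>k\<in>K. module_hom A M M' (f k) & (\<forall>w\<in>Om. \<forall>x\<in>carrier M. f k (u w x) = u' w (f k x))) &
  (\<forall>x\<in>carrier M. G (j x) = (\<Oplus>\<^sub>Y' k\<in>K. a k \<odot>\<^sub>Y' j' (f k x)))"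
  by (rule_tac exI, rule_tac exI)
 then show ?thesis by (rule_tac exI) (rule conjI[OF K])
qed

end


section \<open>Locally free modules\<close>

text \<open>Zorn's lemma on the ideals that contain \<open>I\<close> but not \<open>\<one>\<close>
  gives a maximal ideal, and maximal ideals are prime.\<close>

lemma (in cring) exists_prime_superset:
 assumes I: "ideal I R" and one: "\<one> \<notin> I"
 shows "\<exists>p. primeideal p R & I \<subseteq> p"
proof -
 let ?A = "{J. ideal J R & I \<subseteq> J & \<one> \<notin> J}"
 have "\<exists>m\<in>?A. \<forall>J\<in>?A. m \<subseteq> J --> J = m"
 proof (rule subset_Zorn_nonempty)
  show "?A ~= {}" using I one by auto
  fix C assume C: "C ~= {}" "subset.chain ?A C"
  then have sub: "C \<subseteq> ?A" and cmp: "!!a b. a \<in> C ==> b \<in> C ==> a \<subseteq> b \<or> b \<subseteq> a"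
   by (auto simp: subset.chain_def)
  have id: "!!J. J \<in> C ==> ideal J R" using sub by auto
  have "ideal (\<Union>C) R"
  proof (rule idealI[OF ring_axioms])
   show "subgroup (\<Union>C) (add_monoid R)"
   proof (rule add.subgroupI)
    show "\<Union>C \<subseteq> carrier R" using id ideal.Icarr by fast
    obtain J where "J \<in> C" using C(1) by auto
    then show "\<Union>C ~= {}" using additive_subgroup.zero_closed[OF ideal.axioms(1)[OF id]] by auto
    show "\<ominus> a \<in> \<Union>C" if "a \<in> \<Union>C" for a
     using that additive_subgroup.a_inv_closed[OF ideal.axioms(1)[OF id]] by auto
    fix a b assume "a \<in> \<Union>C" "b \<in> \<Union>C"
    then obtain J where "J \<in> C" "a \<in> J" "b \<in> J" using cmp by blast
    then show "a \<oplus> b \<in> \<Union>C" using additive_subgroup.a_closed[OF ideal.axioms(1)[OF id]] by auto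
   qed
   show "x \<otimes> a \<in> \<Union>C" if "a \<in> \<Union>C" "x \<in> carrier R" for a x
    using that ideal.I_l_closed[OF id] by auto
   show "a \<otimes> x \<in> \<Union>C" if "a \<in> \<Union>C" "x \<in> carrier R" for a x
    using that ideal.I_r_closed[OF id] by auto
  qed
  then show "\<Union>C \<in> ?A" using sub C(1) by blast
 qed
 then obtain m where m: "ideal m R" "I \<subseteq> m" "\<one> \<notin> m"
  and max: "!!J. ideal J R ==> I \<subseteq> J ==> \<one> \<notin> J ==> m \<subseteq> J ==> J = m" by auto
 have "maximalideal m R"
 proof (rule maximalidealI[OF m(1)])
  show "carrier R ~= m" using m(3) by auto
  fix J assume J: "ideal J R" "m \<subseteq> J" "J \<subseteq> carrier R"
  show "J = m \<or> J = carrier R"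
  proof (cases "\<one> \<in> J")
   case True
   then show ?thesis using ideal.one_imp_carrier[OF J(1)] by auto
  qed (use max J m in auto)
 qed
 then show ?thesis using maximalideal_prime m(2) by blast
qed

text \<open>The operations of \<open>localization\<close> are unions over all pairs of
  representatives. Such a union collapses to a single class once its members do not depend on the
  representatives.\<close>

lemma UN_UN_const:
 assumes "U ~= {}" "V ~= {}" "!!a b c d. (a, b) \<in> U ==> (c, d) \<in> V ==> F a b c d = C"
 shows "(\<Union>(a, b)\<in>U. \<Union>(c, d)\<in>V. F a b c d) = C"
proof -
 have "(\<Union>(a, b)\<in>U. \<Union>(c, d)\<in>V. F a b c d) = (\<Union>p\<in>U. \<Union>q\<in>V. C)"
  using assms(3) by (intro SUP_cong refl) auto
 then show ?thesis using assms(1,2) by simp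
qed

section \<open>Localization of modules, with fractions as classes of pairs\<close>

locale module_localization = module R M for R (structure) and M :: "('a, 'm) module" (structure) +
 fixes S
 assumes S_sub: "S \<subseteq> carrier R" and one_S: "\<one> \<in> S"
  and mult_S: "s \<in> S ==> t \<in> S ==> s \<otimes> t \<in> S"
begin

lemma S_carrier [simp]: "s \<in> S ==> s \<in> carrier R"
 using S_sub by auto

lemma smult_comm:
 "a \<in> carrier R ==> b \<in> carrier R ==> x \<in> carrier M ==> a \<odot>\<^sub>M (b \<odot>\<^sub>M x) = b \<odot>\<^sub>M (a \<odot>\<^sub>M x)"
 by (simp add: smult_assoc1[symmetric] R.m_comm)

abbreviation "fr \<equiv> fraction R S M"

text \<open>The middle denominator \<open>t\<close> has to enter the multiplier, since it can be
  cancelled only up to elements of \<open>S\<close>.\<close>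

lemma frac_trans:
 assumes "x \<in> carrier M" "y \<in> carrier M" "z \<in> carrier M" "s \<in> S" "t \<in> S" "w \<in> S"
  and xy: "\<exists>u\<in>S. u \<odot>\<^sub>M (t \<odot>\<^sub>M x) = u \<odot>\<^sub>M (s \<odot>\<^sub>M y)" and yz: "\<exists>u\<in>S. u \<odot>\<^sub>M (w \<odot>\<^sub>M y) = u \<odot>\<^sub>M (t \<odot>\<^sub>M z)"
 shows "\<exists>u\<in>S. u \<odot>\<^sub>M (w \<odot>\<^sub>M x) = u \<odot>\<^sub>M (s \<odot>\<^sub>M z)"
proof -
 obtain u1 u2 where u: "u1 \<in> S" "u2 \<in> S" and e1: "u1 \<odot>\<^sub>M (t \<odot>\<^sub>M x) = u1 \<odot>\<^sub>M (s \<odot>\<^sub>M y)"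
  and e2: "u2 \<odot>\<^sub>M (w \<odot>\<^sub>M y) = u2 \<odot>\<^sub>M (t \<odot>\<^sub>M z)" using xy yz by auto
 have "(u1 \<otimes> u2 \<otimes> t) \<odot>\<^sub>M (w \<odot>\<^sub>M x) = (u2 \<otimes> w) \<odot>\<^sub>M (u1 \<odot>\<^sub>M (t \<odot>\<^sub>M x))"
  using assms(1-6) u by (simp add: smult_assoc1[symmetric] R.m_ac)
 also have "... = (s \<otimes> u1) \<odot>\<^sub>M (u2 \<odot>\<^sub>M (w \<odot>\<^sub>M y))"
  unfolding e1 using assms(1-6) u by (simp add: smult_assoc1[symmetric] R.m_ac)
 also have "... = (u1 \<otimes> u2 \<otimes> t) \<odot>\<^sub>M (s \<odot>\<^sub>M z)"
  unfolding e2 using assms(1-6) u by (simp add: smult_assoc1[symmetric] R.m_ac)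
 finally show ?thesis using u assms(5) mult_S by blast
qed

lemma frac_refl: "x \<in> carrier M ==> s \<in> S ==> (x, s) \<in> fr x s"
 using one_S by (auto simp: fraction_def)

lemma frac_eq_iff:
 assumes "x \<in> carrier M" "y \<in> carrier M" "s \<in> S" "t \<in> S"
 shows "fr x s = fr y t \<longleftrightarrow> (\<exists>u\<in>S. u \<odot>\<^sub>M (t \<odot>\<^sub>M x) = u \<odot>\<^sub>M (s \<odot>\<^sub>M y))"
proof
 assume "fr x s = fr y t"
 then have "(y, t) \<in> fr x s" using frac_refl assms by auto
 then show "\<exists>u\<in>S. u \<odot>\<^sub>M (t \<odot>\<^sub>M x) = u \<odot>\<^sub>M (s \<odot>\<^sub>M y)" by (auto simp: fraction_def)
next
 assume e: "\<exists>u\<in>S. u \<odot>\<^sub>M (t \<odot>\<^sub>M x) = u \<odot>\<^sub>M (s \<odot>\<^sub>M y)"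
 then have e': "\<exists>u\<in>S. u \<odot>\<^sub>M (s \<odot>\<^sub>M y) = u \<odot>\<^sub>M (t \<odot>\<^sub>M x)" by metis
 show "fr x s = fr y t"
  using frac_trans[OF assms(2,1) _ assms(4,3) _ e'] frac_trans[OF assms(1,2) _ assms(3,4) _ e]
  unfolding fraction_def by blast
qed

lemma frac_mem: "(y, t) \<in> fr x s ==> x \<in> carrier M ==> s \<in> S ==> y \<in> carrier M & t \<in> S & fr y t = fr x s"
 by (subst frac_eq_iff) (auto simp: fraction_def eq_commute)

abbreviation "LM \<equiv> localization R S M"

lemma loc_carrier: "carrier LM = {fr x s | x s. x \<in> carrier M & s \<in> S}"
 by (simp add: localization_def)

lemma loc_cases:
 assumes "Z \<in> carrier LM" obtains x s where "x \<in> carrier M" "s \<in> S" "Z = fr x s"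
 using assms by (auto simp: loc_carrier)

lemma frac_closed [simp]: "x \<in> carrier M ==> s \<in> S ==> fr x s \<in> carrier LM"
 by (auto simp: loc_carrier)

lemma loc_zero: "\<zero>\<^sub>LM = fr \<zero>\<^sub>M \<one>"
 by (simp add: localization_def)

lemma loc_add:
 assumes "x \<in> carrier M" "y \<in> carrier M" "s \<in> S" "t \<in> S"
 shows "fr x s \<oplus>\<^sub>LM fr y t = fr (t \<odot>\<^sub>M x \<oplus>\<^sub>M s \<odot>\<^sub>M y) (s \<otimes> t)"
proof -
 have key: "fr (t' \<odot>\<^sub>M x' \<oplus>\<^sub>M s' \<odot>\<^sub>M y') (s' \<otimes> t') = fr (t \<odot>\<^sub>M x \<oplus>\<^sub>M s \<odot>\<^sub>M y) (s \<otimes> t)"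
  if "(x', s') \<in> fr x s" "(y', t') \<in> fr y t" for x' s' y' t'
 proof -
  have m: "x' \<in> carrier M" "y' \<in> carrier M" "s' \<in> S" "t' \<in> S" using that by (auto simp: fraction_def)
  from that obtain u1 u2 where u: "u1 \<in> S" "u2 \<in> S" and e1: "u1 \<odot>\<^sub>M (s' \<odot>\<^sub>M x) = u1 \<odot>\<^sub>M (s \<odot>\<^sub>M x')"
   and e2: "u2 \<odot>\<^sub>M (t' \<odot>\<^sub>M y) = u2 \<odot>\<^sub>M (t \<odot>\<^sub>M y')" by (auto simp: fraction_def)
  have a: "(u1 \<otimes> u2) \<odot>\<^sub>M ((s \<otimes> t) \<odot>\<^sub>M (t' \<odot>\<^sub>M x')) = (u1 \<otimes> u2) \<odot>\<^sub>M ((s' \<otimes> t') \<odot>\<^sub>M (t \<odot>\<^sub>M x))"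
  proof -
   have "(u1 \<otimes> u2) \<odot>\<^sub>M ((s \<otimes> t) \<odot>\<^sub>M (t' \<odot>\<^sub>M x')) = (u2 \<otimes> t \<otimes> t') \<odot>\<^sub>M (u1 \<odot>\<^sub>M (s \<odot>\<^sub>M x'))"
    using assms m u by (simp add: smult_assoc1[symmetric] R.m_ac)
   also have "... = (u1 \<otimes> u2) \<odot>\<^sub>M ((s' \<otimes> t') \<odot>\<^sub>M (t \<odot>\<^sub>M x))"
    unfolding e1[symmetric] using assms m u by (simp add: smult_assoc1[symmetric] R.m_ac)
   finally show ?thesis .
  qed
  have b: "(u1 \<otimes> u2) \<odot>\<^sub>M ((s \<otimes> t) \<odot>\<^sub>M (s' \<odot>\<^sub>M y')) = (u1 \<otimes> u2) \<odot>\<^sub>M ((s' \<otimes> t') \<odot>\<^sub>M (s \<odot>\<^sub>M y))"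
  proof -
   have "(u1 \<otimes> u2) \<odot>\<^sub>M ((s \<otimes> t) \<odot>\<^sub>M (s' \<odot>\<^sub>M y')) = (u1 \<otimes> s \<otimes> s') \<odot>\<^sub>M (u2 \<odot>\<^sub>M (t \<odot>\<^sub>M y'))"
    using assms m u by (simp add: smult_assoc1[symmetric] R.m_ac)
   also have "... = (u1 \<otimes> u2) \<odot>\<^sub>M ((s' \<otimes> t') \<odot>\<^sub>M (s \<odot>\<^sub>M y))"
    unfolding e2[symmetric] using assms m u by (simp add: smult_assoc1[symmetric] R.m_ac)
   finally show ?thesis .
  qed
  show ?thesis
  proof (subst frac_eq_iff)
   show "\<exists>u\<in>S. u \<odot>\<^sub>M ((s \<otimes> t) \<odot>\<^sub>M (t' \<odot>\<^sub>M x' \<oplus>\<^sub>M s' \<odot>\<^sub>M y')) =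
     u \<odot>\<^sub>M ((s' \<otimes> t') \<odot>\<^sub>M (t \<odot>\<^sub>M x \<oplus>\<^sub>M s \<odot>\<^sub>M y))"
    using a b assms m u mult_S by (intro bexI[of _ "u1 \<otimes> u2"]) (simp_all add: smult_r_distr)
  qed (use assms m u mult_S in simp_all)
 qed
 have "(\<Union>(x', s')\<in>fr x s. \<Union>(y', t')\<in>fr y t. fr (t' \<odot>\<^sub>M x' \<oplus>\<^sub>M s' \<odot>\<^sub>M y') (s' \<otimes> t'))
   = fr (t \<odot>\<^sub>M x \<oplus>\<^sub>M s \<odot>\<^sub>M y) (s \<otimes> t)"
  using frac_refl[OF assms(1,3)] frac_refl[OF assms(2,4)] by (intro UN_UN_const[OF _ _ key]) blast+
 then show ?thesis by (simp add: localization_def)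
qed

lemma frac_add:
 assumes "x \<in> carrier M" "y \<in> carrier M" "s \<in> S"
 shows "fr x s \<oplus>\<^sub>LM fr y s = fr (x \<oplus>\<^sub>M y) s"
proof -
 have "fr (s \<odot>\<^sub>M x \<oplus>\<^sub>M s \<odot>\<^sub>M y) (s \<otimes> s) = fr (x \<oplus>\<^sub>M y) s"
  using assms mult_S one_S
  by (subst frac_eq_iff) (auto simp: smult_r_distr smult_assoc1)
 then show ?thesis using loc_add[OF assms(1,2,3,3)] by simp
qed

lemma frac_cancel:
 assumes "x \<in> carrier M" "s \<in> S" "t \<in> S"
 shows "fr (t \<odot>\<^sub>M x) (t \<otimes> s) = fr x s"
proof (subst frac_eq_iff)
 show "\<exists>u\<in>S. u \<odot>\<^sub>M (s \<odot>\<^sub>M (t \<odot>\<^sub>M x)) = u \<odot>\<^sub>M ((t \<otimes> s) \<odot>\<^sub>M x)"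
  using assms one_S by (auto simp: smult_assoc1 smult_comm[of s])
qed (use assms mult_S in simp_all)

lemma common_denominator:
 assumes "Z \<in> carrier LM" "Z' \<in> carrier LM"
 obtains x y s where "x \<in> carrier M" "y \<in> carrier M" "s \<in> S" "Z = fr x s" "Z' = fr y s"
proof -
 obtain x s y t where Z: "x \<in> carrier M" "s \<in> S" "Z = fr x s" "y \<in> carrier M" "t \<in> S" "Z' = fr y t"
  using assms by (metis loc_cases)
 have "Z = fr (t \<odot>\<^sub>M x) (t \<otimes> s)" using frac_cancel Z by metis
 moreover have "Z' = fr (s \<odot>\<^sub>M y) (t \<otimes> s)" using frac_cancel Z R.m_comm S_carrier by metis
 ultimately show ?thesis
  using Z mult_S by (intro that[of "t \<odot>\<^sub>M x" "s \<odot>\<^sub>M y" "t \<otimes> s"]) simp_all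
qed

lemma abelian_group_localization: "abelian_group LM"
proof (rule abelian_groupI)
 fix X' Y' Z' assume X: "X' \<in> carrier LM" and Y: "Y' \<in> carrier LM"
 show "X' \<oplus>\<^sub>LM Y' \<in> carrier LM"
  using common_denominator[OF X Y] frac_add frac_closed M.add.m_closed by metis
 show "X' \<oplus>\<^sub>LM Y' = Y' \<oplus>\<^sub>LM X'"
  using common_denominator[OF X Y] frac_add M.a_comm by metis
 show "\<zero>\<^sub>LM \<oplus>\<^sub>LM X' = X'"
 proof -
  obtain x s where x: "x \<in> carrier M" "s \<in> S" "X' = fr x s" using X loc_cases by metis
  have "\<zero>\<^sub>LM = fr \<zero>\<^sub>M s"
   using x one_S unfolding loc_zero by (subst frac_eq_iff) auto
  then show ?thesis using x by (simp add: frac_add)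
 qed
 show "\<exists>y\<in>carrier LM. y \<oplus>\<^sub>LM X' = \<zero>\<^sub>LM"
 proof -
  obtain x s where x: "x \<in> carrier M" "s \<in> S" "X' = fr x s" using X loc_cases by metis
  have "\<zero>\<^sub>LM = fr \<zero>\<^sub>M s"
   using x one_S unfolding loc_zero by (subst frac_eq_iff) auto
  then show ?thesis using x by (intro bexI[of _ "fr (\<ominus>\<^sub>M x) s"]) (auto simp: frac_add M.l_neg)
 qed
 assume Z: "Z' \<in> carrier LM"
 show "X' \<oplus>\<^sub>LM Y' \<oplus>\<^sub>LM Z' = X' \<oplus>\<^sub>LM (Y' \<oplus>\<^sub>LM Z')"
 proof -
  obtain x y s where x: "x \<in> carrier M" "y \<in> carrier M" "s \<in> S" "X' = fr x s" "Y' = fr y s"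
   using common_denominator[OF X Y] by metis
  obtain z t where z: "z \<in> carrier M" "t \<in> S" "Z' = fr z t" using Z loc_cases by metis
  have "X' = fr (t \<odot>\<^sub>M x) (t \<otimes> s)" "Y' = fr (t \<odot>\<^sub>M y) (t \<otimes> s)" "Z' = fr (s \<odot>\<^sub>M z) (t \<otimes> s)"
   using frac_cancel x z R.m_comm S_carrier by metis+
  then show ?thesis using x z mult_S by (simp add: frac_add M.a_assoc)
 qed
qed (simp add: loc_zero one_S)

abbreviation "frR \<equiv> fraction R S (self_module R)"
abbreviation "LR \<equiv> localization R S (self_module R)"

lemma localization_self: "module_localization R (self_module R) S"
 by (intro module_localization.intro module_self R.is_cring module_localization_axioms.intro)
  (use S_sub one_S mult_S in auto)

lemma loc_smult:
 assumes "a \<in> carrier R" "s \<in> S" "y \<in> carrier M" "t \<in> S"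
 shows "frR a s \<odot>\<^sub>LM fr y t = fr (a \<odot>\<^sub>M y) (s \<otimes> t)"
proof -
 have key: "fr (a' \<odot>\<^sub>M y') (s' \<otimes> t') = fr (a \<odot>\<^sub>M y) (s \<otimes> t)"
  if "(a', s') \<in> frR a s" "(y', t') \<in> fr y t" for a' s' y' t'
 proof -
  have m: "a' \<in> carrier R" "y' \<in> carrier M" "s' \<in> S" "t' \<in> S" using that by (auto simp: fraction_def)
  from that obtain u1 u2 where u: "u1 \<in> S" "u2 \<in> S" and e1: "u1 \<otimes> (s' \<otimes> a) = u1 \<otimes> (s \<otimes> a')"
   and e2: "u2 \<odot>\<^sub>M (t' \<odot>\<^sub>M y) = u2 \<odot>\<^sub>M (t \<odot>\<^sub>M y')" by (auto simp: fraction_def)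
  have "(u1 \<otimes> u2) \<odot>\<^sub>M ((s \<otimes> t) \<odot>\<^sub>M (a' \<odot>\<^sub>M y')) = (u1 \<otimes> (s \<otimes> a')) \<odot>\<^sub>M (u2 \<odot>\<^sub>M (t \<odot>\<^sub>M y'))"
   using assms m u by (simp add: smult_assoc1[symmetric] R.m_ac)
  also have "... = (u1 \<otimes> u2) \<odot>\<^sub>M ((s' \<otimes> t') \<odot>\<^sub>M (a \<odot>\<^sub>M y))"
   unfolding e1[symmetric] e2[symmetric] using assms m u by (simp add: smult_assoc1[symmetric] R.m_ac)
  finally have "\<exists>u\<in>S. u \<odot>\<^sub>M ((s \<otimes> t) \<odot>\<^sub>M (a' \<odot>\<^sub>M y')) = u \<odot>\<^sub>M ((s' \<otimes> t') \<odot>\<^sub>M (a \<odot>\<^sub>M y))"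
   using u mult_S by blast
  then show ?thesis using assms m mult_S by (subst frac_eq_iff) simp_all
 qed
 have "(\<Union>(a', s')\<in>frR a s. \<Union>(y', t')\<in>fr y t. fr (a' \<odot>\<^sub>M y') (s' \<otimes> t'))
   = fr (a \<odot>\<^sub>M y) (s \<otimes> t)"
  using module_localization.frac_refl[OF localization_self, of a s] assms(1,2) frac_refl[OF assms(3,4)]
  by (intro UN_UN_const[OF _ _ key]) auto
 then show ?thesis by (simp add: localization_def)
qed

lemma frac_finsum:
 assumes "finite I" "!!i. i \<in> I ==> x i \<in> carrier M" "s \<in> S"
 shows "(\<Oplus>\<^sub>LM i\<in>I. fr (x i) s) = fr (\<Oplus>\<^sub>M i\<in>I. x i) s"
proof -
 interpret L: abelian_group LM by (rule abelian_group_localization)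
 have "additive M LM (\<lambda>x. fr x s)" using assms(3) by (intro additiveI) (simp_all add: frac_add)
 from additive_finsum[OF M.abelian_group_axioms L.abelian_group_axioms this, of x I] assms
 show ?thesis by simp
qed

text \<open>The product of all denominators works. The cofactors \<open>w\<close> are kept in
  \<open>S\<close>, because fractions may be expanded by elements of \<open>S\<close> only.\<close>

lemma prod_S: "finite I ==> (!!i. i \<in> I ==> s i \<in> S) ==> \<exists>t\<in>S. \<forall>i\<in>I. \<exists>w\<in>S. t = w \<otimes> s i"
proof (induction I rule: finite_induct)
 case empty
 then show ?case using one_S by auto
next
 case (insert a I)
 then obtain t where t: "t \<in> S" "\<forall>i\<in>I. \<exists>w\<in>S. t = w \<otimes> s i" by auto
 have sa: "s a \<in> S" using insert.prems by auto
 have "\<exists>w\<in>S. t \<otimes> s a = w \<otimes> s i" if "i \<in> insert a I" for i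
 proof (cases "i = a")
  case False
  then obtain w where "w \<in> S" "t = w \<otimes> s i" using t \<open>i \<in> insert a I\<close> by auto
  moreover have "s i \<in> S" using insert.prems \<open>i \<in> insert a I\<close> by auto
  ultimately show ?thesis using sa mult_S by (intro bexI[of _ "w \<otimes> s a"]) (simp_all add: R.m_ac)
 qed (use t in auto)
 then show ?case using t sa mult_S by (intro bexI[of _ "t \<otimes> s a"]) auto
qed

text \<open>Clears the denominators of a basis of the localized module: existence of coordinates
  becomes generation, and uniqueness becomes independence, both up to a factor from
  \<open>S\<close>. The classes of fractions do not survive in the result.\<close>

lemma free_localization:
 assumes "free_of_rank LR LM r"
 shows "\<exists>x\<in>{..<r} \<rightarrow> carrier M.
  (\<forall>m\<in>carrier M. \<exists>s\<in>S. \<exists>c\<in>{..<r} \<rightarrow> carrier R. s \<odot>\<^sub>M m = (\<Oplus>\<^sub>M i\<in>{..<r}. c i \<odot>\<^sub>M x i)) &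
  (\<forall>c\<in>{..<r} \<rightarrow> carrier R. (\<Oplus>\<^sub>M i\<in>{..<r}. c i \<odot>\<^sub>M x i) = \<zero>\<^sub>M --> (\<exists>s\<in>S. \<forall>i<r. s \<otimes> c i = \<zero>))"
proof -
 interpret L: abelian_group LM by (rule abelian_group_localization)
 interpret RL: module_localization R "self_module R" S by (rule localization_self)
 obtain b where b: "b \<in> {..<r} \<rightarrow> carrier LM"
  and uniq: "!!Z. Z \<in> carrier LM ==>
   \<exists>!a. a \<in> {..<r} \<rightarrow>\<^sub>E carrier LR & Z = (\<Oplus>\<^sub>LM i\<in>{..<r}. a i \<odot>\<^sub>LM b i)"
  using assms by (auto simp: free_of_rank_def is_basis_def)
 have "\<forall>i\<in>{..<r}. \<exists>p. fst p \<in> carrier M & snd p \<in> S & b i = fr (fst p) (snd p)"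
  using b loc_cases by (metis PiE fst_conv snd_conv)
 then obtain p where p: "!!i. i < r ==> fst (p i) \<in> carrier M & snd (p i) \<in> S & b i = fr (fst (p i)) (snd (p i))"
  by (metis lessThan_iff)
 define x where "x i = fst (p i)" for i
 define s where "s i = snd (p i)" for i
 have xs: "x i \<in> carrier M" "s i \<in> S" "b i = fr (x i) (s i)" if "i < r" for i
  using p[OF that] by (auto simp: x_def s_def)
 have 1: "\<exists>t\<in>S. \<exists>c\<in>{..<r} \<rightarrow> carrier R. t \<odot>\<^sub>M m = (\<Oplus>\<^sub>M i\<in>{..<r}. c i \<odot>\<^sub>M x i)" if m: "m \<in> carrier M" for m
 proof -
  obtain a where a: "a \<in> {..<r} \<rightarrow>\<^sub>E carrier LR" and eq: "fr m \<one> = (\<Oplus>\<^sub>LM i\<in>{..<r}. a i \<odot>\<^sub>LM b i)"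
   using ex1_implies_ex[OF uniq[OF frac_closed[OF m one_S]]] by (elim exE conjE) (rule that)
  have "\<forall>i\<in>{..<r}. \<exists>p. fst p \<in> carrier R & snd p \<in> S & a i = frR (fst p) (snd p)"
   using a RL.loc_cases by (metis PiE_mem fst_conv snd_conv self_module_simps(1))
  then obtain p' where p': "!!i. i < r ==> fst (p' i) \<in> carrier R & snd (p' i) \<in> S & a i = frR (fst (p' i)) (snd (p' i))"
   by (metis lessThan_iff)
  define q where "q i = snd (p' i) \<otimes> s i" for i
  have q: "q i \<in> S" if "i < r" for i using p' xs mult_S that by (auto simp: q_def)
  have ab: "a i \<odot>\<^sub>LM b i = fr (fst (p' i) \<odot>\<^sub>M x i) (q i)" if "i < r" for i
   using p'[OF that] xs[OF that] by (simp add: loc_smult q_def)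
  \<comment> \<open>A common denominator of the summands, so that their sum is one fraction and can
    be compared with that of \<open>m\<close>.\<close>
  obtain t where t: "t \<in> S" "\<forall>i\<in>{..<r}. \<exists>w\<in>S. t = w \<otimes> q i" using prod_S[of "{..<r}" q] q by auto
  then obtain w where w: "!!i. i < r ==> w i \<in> S" "!!i. i < r ==> t = w i \<otimes> q i" by (metis lessThan_iff)
  define d where "d i = w i \<otimes> fst (p' i)" for i
  have d: "d i \<in> carrier R" if "i < r" for i using w p' that by (auto simp: d_def)
  have dx: "a i \<odot>\<^sub>LM b i = fr (d i \<odot>\<^sub>M x i) t" if "i < r" for i
   unfolding ab[OF that]
   using frac_cancel[of "fst (p' i) \<odot>\<^sub>M x i" "q i" "w i"] that w p' xs q by (simp add: d_def smult_assoc1)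
  have "fr m \<one> = (\<Oplus>\<^sub>LM i\<in>{..<r}. fr (d i \<odot>\<^sub>M x i) t)"
   unfolding eq using dx d xs t by (intro L.finsum_cong') auto
  also have "... = fr (\<Oplus>\<^sub>M i\<in>{..<r}. d i \<odot>\<^sub>M x i) t"
   using d xs t by (intro frac_finsum) auto
  finally obtain u where u: "u \<in> S" "u \<odot>\<^sub>M (t \<odot>\<^sub>M m) = u \<odot>\<^sub>M (\<one> \<odot>\<^sub>M (\<Oplus>\<^sub>M i\<in>{..<r}. d i \<odot>\<^sub>M x i))"
   using m t d xs one_S by (subst (asm) frac_eq_iff) (auto intro!: M.finsum_closed)
  have "(u \<otimes> t) \<odot>\<^sub>M m = u \<odot>\<^sub>M (\<Oplus>\<^sub>M i\<in>{..<r}. d i \<odot>\<^sub>M x i)"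
   using u t m d xs by (simp add: smult_assoc1 Pi_def)
  also have "... = (\<Oplus>\<^sub>M i\<in>{..<r}. u \<odot>\<^sub>M (d i \<odot>\<^sub>M x i))"
   using u d xs by (intro smult_finsum) auto
  also have "... = (\<Oplus>\<^sub>M i\<in>{..<r}. (u \<otimes> d i) \<odot>\<^sub>M x i)"
   using u d xs by (intro M.finsum_cong') (auto simp: smult_assoc1)
  finally show ?thesis using u t d mult_S
   by (intro bexI[of _ "u \<otimes> t"] bexI[of _ "\<lambda>i. u \<otimes> d i"]) auto
 qed
 have 2: "\<exists>t\<in>S. \<forall>i<r. t \<otimes> c i = \<zero>"
  if c: "c \<in> {..<r} \<rightarrow> carrier R" and z: "(\<Oplus>\<^sub>M i\<in>{..<r}. c i \<odot>\<^sub>M x i) = \<zero>\<^sub>M" for c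
 proof -
  have ci: "!!i. i < r ==> c i \<in> carrier R" using c by auto
  \<comment> \<open>The basis vector is \<open>x i\<close> over \<open>s i\<close>, so the
    coordinate belonging to \<open>c i \<odot>\<^sub>M x i\<close> is
    \<open>c i \<otimes> s i\<close>. Uniqueness is then applied against the zero coordinates
    \<open>a0\<close>.\<close>
  define a where "a = (\<lambda>i\<in>{..<r}. frR (c i \<otimes> s i) \<one>)"
  define a0 where "a0 = (\<lambda>i\<in>{..<r}. frR \<zero> \<one>)"
  have a: "a \<in> {..<r} \<rightarrow>\<^sub>E carrier LR" "a0 \<in> {..<r} \<rightarrow>\<^sub>E carrier LR"
   unfolding a_def a0_def using ci xs one_S RL.frac_closed by auto
  have ai: "a i \<odot>\<^sub>LM b i = fr (c i \<odot>\<^sub>M x i) \<one>" if "i < r" for i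
  proof -
   have "a i \<odot>\<^sub>LM b i = fr (s i \<odot>\<^sub>M (c i \<odot>\<^sub>M x i)) (s i \<otimes> \<one>)"
    using that xs[OF that] ci one_S by (simp add: a_def loc_smult smult_assoc1 smult_comm)
   then show ?thesis using frac_cancel[of "c i \<odot>\<^sub>M x i" \<one> "s i"] xs[OF that] ci[OF that] one_S by simp
  qed
  have a0i: "a0 i \<odot>\<^sub>LM b i = fr \<zero>\<^sub>M \<one>" if "i < r" for i
  proof -
   have "a0 i \<odot>\<^sub>LM b i = fr (s i \<odot>\<^sub>M \<zero>\<^sub>M) (s i \<otimes> \<one>)"
    using that xs[OF that] one_S by (simp add: a0_def loc_smult)
   then show ?thesis using frac_cancel[of "\<zero>\<^sub>M" \<one> "s i"] xs[OF that] one_S by simp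
  qed
  have "(\<Oplus>\<^sub>LM i\<in>{..<r}. a i \<odot>\<^sub>LM b i) = (\<Oplus>\<^sub>LM i\<in>{..<r}. fr (c i \<odot>\<^sub>M x i) \<one>)"
   using ai ci xs one_S by (intro L.finsum_cong') auto
  also have "... = fr (\<Oplus>\<^sub>M i\<in>{..<r}. c i \<odot>\<^sub>M x i) \<one>"
   using ci xs one_S by (intro frac_finsum) auto
  finally have A: "fr \<zero>\<^sub>M \<one> = (\<Oplus>\<^sub>LM i\<in>{..<r}. a i \<odot>\<^sub>LM b i)" using z by simp
  have "(\<Oplus>\<^sub>LM i\<in>{..<r}. a0 i \<odot>\<^sub>LM b i) = \<zero>\<^sub>LM"
   using a0i by (intro L.add.finprod_one_eqI) (auto simp: loc_zero)
  then have A0: "fr \<zero>\<^sub>M \<one> = (\<Oplus>\<^sub>LM i\<in>{..<r}. a0 i \<odot>\<^sub>LM b i)" by (simp add: loc_zero)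
  have "a = a0"
  proof -
   from uniq[OF frac_closed[OF M.zero_closed one_S]] obtain a' where
    a': "!!d. d \<in> {..<r} \<rightarrow>\<^sub>E carrier LR & fr \<zero>\<^sub>M \<one> = (\<Oplus>\<^sub>LM i\<in>{..<r}. d i \<odot>\<^sub>LM b i) ==> d = a'"
    by (elim ex1E) (rule that, erule allE, erule (1) mp)
   show ?thesis using a'[OF conjI[OF a(1) A]] a'[OF conjI[OF a(2) A0]] by simp
  qed
  then have e: "frR (c i \<otimes> s i) \<one> = frR \<zero> \<one>" if "i < r" for i
   using that by (auto simp: a_def a0_def dest!: fun_cong[of _ _ i])
  have "\<exists>t\<in>S. t \<otimes> c i = \<zero>" if i: "i < r" for i
  proof -
   have cl: "c i \<in> carrier R" "s i \<in> S" using i ci xs by auto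
   have "\<exists>u\<in>S. u \<otimes> (\<one> \<otimes> (c i \<otimes> s i)) = u \<otimes> (\<one> \<otimes> \<zero>)"
    using e[OF i] cl one_S by (subst (asm) RL.frac_eq_iff) auto
   then obtain u where "u \<in> S" "u \<otimes> (\<one> \<otimes> (c i \<otimes> s i)) = u \<otimes> (\<one> \<otimes> \<zero>)" by auto
   then show ?thesis using cl mult_S
    by (intro bexI[of _ "u \<otimes> s i"]) (auto simp: R.m_ac)
  qed
  then obtain t where t: "!!i. i < r ==> t i \<in> S" "!!i. i < r ==> t i \<otimes> c i = \<zero>" by metis
  obtain t' where t': "t' \<in> S" "\<forall>i\<in>{..<r}. \<exists>w\<in>S. t' = w \<otimes> t i" using prod_S[of "{..<r}" t] t by auto
  have "t' \<otimes> c i = \<zero>" if i: "i < r" for i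
  proof -
   obtain w where "w \<in> S" "t' = w \<otimes> t i" using t' i by auto
   then show ?thesis using t i ci by (simp add: R.m_assoc)
  qed
  then show ?thesis using t' by auto
 qed
 show ?thesis using 1 2 xs by (intro bexI[of _ x]) auto
qed

end

lemma (in primeideal) pow_prime: "a \<in> carrier R ==> a [^] (n::nat) \<in> I ==> a \<in> I"
proof (induction n)
 case 0
 then have "\<one> \<in> I" by simp
 then show ?case using one_imp_carrier I_notcarr by auto
next
 case (Suc n)
 then show ?case using I_prime[of "a [^] n" a] by auto
qed

lemma (in abelian_group) finsum_slice:
 assumes "finite I" "finite J" "i \<in> I" "h \<in> J \<rightarrow> carrier G"
 shows "(\<Oplus>p\<in>I \<times> J. if fst p = i then h (snd p) else \<zero>) = (\<Oplus>j\<in>J. h j)"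
proof -
 have hj: "!!j. j \<in> J ==> h j \<in> carrier G" using assms(4) by auto
 have "(\<Oplus>p\<in>I \<times> J. if fst p = i then h (snd p) else \<zero>) =
   (\<Oplus>i'\<in>I. \<Oplus>j\<in>J. (\<lambda>p. if fst p = i then h (snd p) else \<zero>) (i', j))"
  by (rule finsum_product[symmetric]) (use assms hj in auto)
 also have "... = (\<Oplus>i'\<in>I. if i = i' then (\<Oplus>j\<in>J. h j) else \<zero>)"
  using hj by (intro finsum_cong') (auto intro!: finsum_closed add.finprod_one_eqI)
 also have "... = (\<Oplus>j\<in>J. h j)"
  using finsum_singleton[OF assms(3,1), of "\<lambda>_. \<Oplus>j\<in>J. h j"] hj by (simp add: finsum_closed)
 finally show ?thesis .
qed

section \<open>Gluing local bases into a dual basis\<close>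

definition covering :: "('r, 'x) ring_scheme => 'r set => bool" where
 "covering R \<Phi> \<longleftrightarrow> \<Phi> \<subseteq> carrier R & (\<forall>J. ideal J R & \<Phi> \<subseteq> J --> J = carrier R)"

text \<open>The scalars \<open>s\<close> for which \<open>s v\<close> is in the span form an ideal, contained in no prime.\<close>

lemma (in module) span_cover:
 assumes cov: "covering R \<Phi>" and fin: "finite I"
  and v: "!!q. q \<in> Q ==> v q \<in> carrier M" and w: "!!i q. i \<in> I ==> q \<in> Q ==> w i q \<in> carrier M"
  and loc: "!!f. f \<in> \<Phi> ==> \<exists>n::nat. \<exists>c\<in>I \<rightarrow> carrier R. \<forall>q\<in>Q. (f [^] n) \<odot>\<^sub>M v q = (\<Oplus>\<^sub>M i\<in>I. c i \<odot>\<^sub>M w i q)"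
 shows "\<exists>c\<in>I \<rightarrow> carrier R. \<forall>q\<in>Q. v q = (\<Oplus>\<^sub>M i\<in>I. c i \<odot>\<^sub>M w i q)"
proof -
 \<comment> \<open>The same coefficients \<open>c\<close> must serve all \<open>q\<close>. With
   \<open>q\<close> ranging over the entries of a vector, this expresses membership of the vector in
   a span.\<close>
 define J where "J = {s \<in> carrier R. \<exists>c\<in>I \<rightarrow> carrier R. \<forall>q\<in>Q. s \<odot>\<^sub>M v q = (\<Oplus>\<^sub>M i\<in>I. c i \<odot>\<^sub>M w i q)}"
 have mult: "a \<otimes> s \<in> J" if s: "s \<in> J" and a: "a \<in> carrier R" for a s
 proof -
  obtain c where c: "c \<in> I \<rightarrow> carrier R" "s \<in> carrier R"
   and eq: "!!q. q \<in> Q ==> s \<odot>\<^sub>M v q = (\<Oplus>\<^sub>M i\<in>I. c i \<odot>\<^sub>M w i q)" using s by (auto simp: J_def)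
  have ci: "!!i. i \<in> I ==> c i \<in> carrier R" using c by auto
  have "(a \<otimes> s) \<odot>\<^sub>M v q = (\<Oplus>\<^sub>M i\<in>I. (a \<otimes> c i) \<odot>\<^sub>M w i q)" if q: "q \<in> Q" for q
  proof -
   have "(a \<otimes> s) \<odot>\<^sub>M v q = a \<odot>\<^sub>M (\<Oplus>\<^sub>M i\<in>I. c i \<odot>\<^sub>M w i q)"
    using a c v[OF q] eq[OF q] by (simp add: smult_assoc1)
   also have "... = (\<Oplus>\<^sub>M i\<in>I. a \<odot>\<^sub>M (c i \<odot>\<^sub>M w i q))"
    using a ci w q by (intro smult_finsum) auto
   also have "... = (\<Oplus>\<^sub>M i\<in>I. (a \<otimes> c i) \<odot>\<^sub>M w i q)"
    using a ci w q by (intro M.finsum_cong') (auto simp: smult_assoc1)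
   finally show ?thesis .
  qed
  then show ?thesis unfolding J_def using a c ci by (auto intro!: bexI[of _ "\<lambda>i. a \<otimes> c i"])
 qed
 have add: "s \<oplus> t \<in> J" if s: "s \<in> J" and t: "t \<in> J" for s t
 proof -
  obtain c where c: "c \<in> I \<rightarrow> carrier R" "s \<in> carrier R"
   and eq: "!!q. q \<in> Q ==> s \<odot>\<^sub>M v q = (\<Oplus>\<^sub>M i\<in>I. c i \<odot>\<^sub>M w i q)" using s by (auto simp: J_def)
  obtain d where d: "d \<in> I \<rightarrow> carrier R" "t \<in> carrier R"
   and eq': "!!q. q \<in> Q ==> t \<odot>\<^sub>M v q = (\<Oplus>\<^sub>M i\<in>I. d i \<odot>\<^sub>M w i q)" using t by (auto simp: J_def)
  have ci: "!!i. i \<in> I ==> c i \<in> carrier R" "!!i. i \<in> I ==> d i \<in> carrier R" using c d by auto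
  have "(s \<oplus> t) \<odot>\<^sub>M v q = (\<Oplus>\<^sub>M i\<in>I. (c i \<oplus> d i) \<odot>\<^sub>M w i q)" if q: "q \<in> Q" for q
  proof -
   have "(s \<oplus> t) \<odot>\<^sub>M v q = (\<Oplus>\<^sub>M i\<in>I. c i \<odot>\<^sub>M w i q) \<oplus>\<^sub>M (\<Oplus>\<^sub>M i\<in>I. d i \<odot>\<^sub>M w i q)"
    using c d v[OF q] eq[OF q] eq'[OF q] by (simp add: smult_l_distr)
   also have "... = (\<Oplus>\<^sub>M i\<in>I. c i \<odot>\<^sub>M w i q \<oplus>\<^sub>M d i \<odot>\<^sub>M w i q)"
    using ci w q by (intro M.finsum_addf[symmetric]) auto
   also have "... = (\<Oplus>\<^sub>M i\<in>I. (c i \<oplus> d i) \<odot>\<^sub>M w i q)"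
    using ci w q by (intro M.finsum_cong') (auto simp: smult_l_distr)
   finally show ?thesis .
  qed
  then show ?thesis unfolding J_def using c d ci by (auto intro!: bexI[of _ "\<lambda>i. c i \<oplus> d i"])
 qed
 have sub: "J \<subseteq> carrier R" by (auto simp: J_def)
 have zero: "\<zero> \<in> J" unfolding J_def using v w
  by (auto intro!: bexI[of _ "\<lambda>_. \<zero>"] M.add.finprod_one_eqI[symmetric])
 have id: "ideal J R"
 proof (rule idealI[OF R.ring_axioms])
  show "subgroup J (add_monoid R)"
  proof (rule R.add.subgroupI[OF sub])
   show "J ~= {}" using zero by auto
   show "\<ominus> a \<in> J" if "a \<in> J" for a
    using mult[OF that, of "\<ominus> \<one>"] sub that by (auto simp: R.l_minus)
  qed (use add in auto)
  show "x \<otimes> a \<in> J" if "a \<in> J" "x \<in> carrier R" for a x using mult that by auto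
  show "a \<otimes> x \<in> J" if "a \<in> J" "x \<in> carrier R" for a x
   using mult[OF that] that sub by (auto simp: R.m_comm)
 qed
 have one: "\<one> \<in> J"
 proof (rule ccontr)
  assume "\<one> \<notin> J"
  from R.exists_prime_superset[OF id this] obtain p where p: "primeideal p R" "J \<subseteq> p" by auto
  interpret p: primeideal p R by fact
  have "f \<in> p" if f: "f \<in> \<Phi>" for f
  proof -
   have fc: "f \<in> carrier R" using f cov by (auto simp: covering_def)
   obtain n :: nat where "f [^] n \<in> J" using loc[OF f] fc by (auto simp: J_def)
   then show ?thesis using p(2) fc p.pow_prime by blast
  qed
  then have "p = carrier R" using cov p.is_ideal by (auto simp: covering_def)
  then show False using p.I_notcarr by simp
 qed
 then obtain c where "c \<in> I \<rightarrow> carrier R" "!!q. q \<in> Q ==> \<one> \<odot>\<^sub>M v q = (\<Oplus>\<^sub>M i\<in>I. c i \<odot>\<^sub>M w i q)"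
  by (auto simp: J_def)
 then show ?thesis using v by (intro bexI[of _ c]) auto
qed

text \<open>The elements \<open>x f i\<close> become a basis after inverting \<open>f\<close>. The
  exponents in \<open>gen\<close> and \<open>indep\<close> depend on \<open>m\<close> and on
  \<open>c\<close>; most of what follows serves to make them uniform.\<close>

locale local_bases = module R M for R (structure) and M :: "('a, 'm) module" (structure) +
 fixes \<Phi> :: "'a set" and r :: nat and x :: "'a => nat => 'm"
 assumes fin: "finite \<Phi>" and cov: "covering R \<Phi>"
  and x: "f \<in> \<Phi> ==> i < r ==> x f i \<in> carrier M"
  and gen: "f \<in> \<Phi> ==> m \<in> carrier M ==>
   \<exists>n::nat. \<exists>c\<in>{..<r} \<rightarrow> carrier R. (f [^] n) \<odot>\<^sub>M m = (\<Oplus>\<^sub>M i\<in>{..<r}. c i \<odot>\<^sub>M x f i)"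
  and indep: "f \<in> \<Phi> ==> c \<in> {..<r} \<rightarrow> carrier R ==> (\<Oplus>\<^sub>M i\<in>{..<r}. c i \<odot>\<^sub>M x f i) = \<zero>\<^sub>M ==>
   \<exists>n::nat. \<forall>i<r. (f [^] n) \<otimes> c i = \<zero>"
begin

text \<open>The members of all local bases are taken together as global generators; that they
  generate is a local question on the cover.\<close>

definition I0 where "I0 = \<Phi> \<times> {..<r}"
definition g where "g p = x (fst p) (snd p)"

lemma fin0: "finite I0"
 using fin by (simp add: I0_def)

lemma g_closed [simp]: "p \<in> I0 ==> g p \<in> carrier M"
 using x by (auto simp: I0_def g_def)

lemma \<Phi>_closed [simp]: "f \<in> \<Phi> ==> f \<in> carrier R"
 using cov by (auto simp: covering_def)

definition rel where
 "rel \<kappa> \<longleftrightarrow> \<kappa> \<in> I0 \<rightarrow> carrier R & (\<Oplus>\<^sub>M p\<in>I0. \<kappa> p \<odot>\<^sub>M g p) = \<zero>\<^sub>M"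

lemma slice:
 assumes "f \<in> \<Phi>" "c \<in> {..<r} \<rightarrow> carrier R"
 shows "(\<Oplus>\<^sub>M p\<in>I0. (if fst p = f then c (snd p) else \<zero>) \<odot>\<^sub>M g p) = (\<Oplus>\<^sub>M i\<in>{..<r}. c i \<odot>\<^sub>M x f i)"
proof -
 have ci: "!!i. i < r ==> c i \<in> carrier R" using assms by auto
 have "(\<Oplus>\<^sub>M p\<in>I0. (if fst p = f then c (snd p) else \<zero>) \<odot>\<^sub>M g p) =
   (\<Oplus>\<^sub>M p\<in>\<Phi> \<times> {..<r}. if fst p = f then (\<lambda>i. c i \<odot>\<^sub>M x f i) (snd p) else \<zero>\<^sub>M)"
  unfolding I0_def using ci x assms(1) by (intro M.finsum_cong') (auto simp: g_def)
 also have "... = (\<Oplus>\<^sub>M i\<in>{..<r}. c i \<odot>\<^sub>M x f i)"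
  using fin assms(1) ci x by (intro M.finsum_slice) auto
 finally show ?thesis .
qed

lemma generators:
 assumes m: "m \<in> carrier M"
 shows "\<exists>c\<in>I0 \<rightarrow> carrier R. m = (\<Oplus>\<^sub>M p\<in>I0. c p \<odot>\<^sub>M g p)"
proof -
 have "\<exists>c\<in>I0 \<rightarrow> carrier R. \<forall>q\<in>{()}. m = (\<Oplus>\<^sub>M p\<in>I0. c p \<odot>\<^sub>M g p)"
 proof (rule span_cover[OF cov fin0])
  fix f assume f: "f \<in> \<Phi>"
  obtain n :: nat and c where c: "c \<in> {..<r} \<rightarrow> carrier R"
   and eq: "(f [^] n) \<odot>\<^sub>M m = (\<Oplus>\<^sub>M i\<in>{..<r}. c i \<odot>\<^sub>M x f i)" using gen[OF f m] by auto
  show "\<exists>n::nat. \<exists>c\<in>I0 \<rightarrow> carrier R. \<forall>q\<in>{()}. (f [^] n) \<odot>\<^sub>M m = (\<Oplus>\<^sub>M p\<in>I0. c p \<odot>\<^sub>M g p)"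
   using c eq slice[OF f c]
   by (intro exI[of _ n] bexI[of _ "\<lambda>p. if fst p = f then c (snd p) else \<zero>"]) (auto simp: I0_def)
 qed (use m in auto)
 then show ?thesis by auto
qed

text \<open>There are finitely many generators, so the sum of their exponents serves all of
  them.\<close>

lemma uniform_coords:
 assumes f: "f \<in> \<Phi>"
 shows "\<exists>N::nat. \<exists>c. \<forall>p\<in>I0. c p \<in> {..<r} \<rightarrow> carrier R &
  (f [^] N) \<odot>\<^sub>M g p = (\<Oplus>\<^sub>M i\<in>{..<r}. c p i \<odot>\<^sub>M x f i)"
proof -
 have "\<forall>p\<in>I0. \<exists>n::nat. \<exists>c. c \<in> {..<r} \<rightarrow> carrier R & (f [^] n) \<odot>\<^sub>M g p = (\<Oplus>\<^sub>M i\<in>{..<r}. c i \<odot>\<^sub>M x f i)"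
  using gen[OF f] g_closed by blast
 then obtain n :: "'a \<times> nat => nat" where n: "\<forall>p\<in>I0. \<exists>c. c \<in> {..<r} \<rightarrow> carrier R & (f [^] n p) \<odot>\<^sub>M g p = (\<Oplus>\<^sub>M i\<in>{..<r}. c i \<odot>\<^sub>M x f i)"
  by (drule_tac bchoice) (elim exE, rule that)
 from bchoice[OF n] obtain c where c: "\<forall>p\<in>I0. c p \<in> {..<r} \<rightarrow> carrier R & (f [^] n p) \<odot>\<^sub>M g p = (\<Oplus>\<^sub>M i\<in>{..<r}. c p i \<odot>\<^sub>M x f i)"
  by (elim exE) (rule that)
 define N where "N = (\<Sum>p\<in>I0. n p)"
 have "(f [^] N) \<odot>\<^sub>M g p = (\<Oplus>\<^sub>M i\<in>{..<r}. (f [^] (N - n p) \<otimes> c p i) \<odot>\<^sub>M x f i)" if p: "p \<in> I0" for p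
 proof -
  have ci: "!!i. i < r ==> c p i \<in> carrier R" using c p by auto
  have "n p \<le> N" unfolding N_def using p fin0 by (simp add: member_le_sum)
  then have "f [^] N = f [^] (N - n p) \<otimes> f [^] n p" using f by (simp add: R.nat_pow_mult)
  then have "(f [^] N) \<odot>\<^sub>M g p = f [^] (N - n p) \<odot>\<^sub>M (\<Oplus>\<^sub>M i\<in>{..<r}. c p i \<odot>\<^sub>M x f i)"
   using f p c by (simp add: smult_assoc1)
  also have "... = (\<Oplus>\<^sub>M i\<in>{..<r}. f [^] (N - n p) \<odot>\<^sub>M (c p i \<odot>\<^sub>M x f i))"
   using f ci x by (intro smult_finsum) auto
  also have "... = (\<Oplus>\<^sub>M i\<in>{..<r}. (f [^] (N - n p) \<otimes> c p i) \<odot>\<^sub>M x f i)"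
   using f ci x by (intro M.finsum_cong') (auto simp: smult_assoc1)
  finally show ?thesis .
 qed
 moreover have "(\<lambda>i. f [^] (N - n p) \<otimes> c p i) \<in> {..<r} \<rightarrow> carrier R" if "p \<in> I0" for p
  using funcset_mem[OF conjunct1[OF bspec[OF c that]]] f by auto
 ultimately show ?thesis by (intro exI[of _ N] exI[of _ "\<lambda>p i. f [^] (N - n p) \<otimes> c p i"]) simp
qed

definition N :: "'a => nat" where
 "N f = (SOME N. \<exists>c. \<forall>p\<in>I0. c p \<in> {..<r} \<rightarrow> carrier R &
  (f [^] N) \<odot>\<^sub>M g p = (\<Oplus>\<^sub>M i\<in>{..<r}. c p i \<odot>\<^sub>M x f i))"

definition co :: "'a => 'a \<times> nat => nat => 'a" where
 "co f = (SOME c. \<forall>p\<in>I0. c p \<in> {..<r} \<rightarrow> carrier R &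
  (f [^] N f) \<odot>\<^sub>M g p = (\<Oplus>\<^sub>M i\<in>{..<r}. c p i \<odot>\<^sub>M x f i))"

lemma co:
 assumes "f \<in> \<Phi>" "p \<in> I0"
 shows "co f p \<in> {..<r} \<rightarrow> carrier R"
  and "(f [^] N f) \<odot>\<^sub>M g p = (\<Oplus>\<^sub>M i\<in>{..<r}. co f p i \<odot>\<^sub>M x f i)"
proof -
 have 1: "\<exists>c. \<forall>p\<in>I0. c p \<in> {..<r} \<rightarrow> carrier R &
  (f [^] N f) \<odot>\<^sub>M g p = (\<Oplus>\<^sub>M i\<in>{..<r}. c p i \<odot>\<^sub>M x f i)"
  unfolding N_def by (rule someI_ex[OF uniform_coords[OF assms(1)]])
 have "\<forall>p\<in>I0. co f p \<in> {..<r} \<rightarrow> carrier R &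
  (f [^] N f) \<odot>\<^sub>M g p = (\<Oplus>\<^sub>M i\<in>{..<r}. co f p i \<odot>\<^sub>M x f i)"
  unfolding co_def by (rule someI_ex[OF 1])
 then show "co f p \<in> {..<r} \<rightarrow> carrier R"
  "(f [^] N f) \<odot>\<^sub>M g p = (\<Oplus>\<^sub>M i\<in>{..<r}. co f p i \<odot>\<^sub>M x f i)" using assms(2) by auto
qed

lemma co_closed [simp]: "f \<in> \<Phi> ==> p \<in> I0 ==> i < r ==> co f p i \<in> carrier R"
 using funcset_mem[OF co(1)] by simp

text \<open>On the free module over \<open>I0\<close>, the coordinate \<open>i\<close> at
  \<open>f\<close> scaled by \<open>f [^] N f\<close>. It passes to \<open>M\<close> only up to a
  power of \<open>f\<close>, since a relation may have a nonzero value that a power of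
  \<open>f\<close> kills.\<close>

definition fc :: "'a => nat => ('a \<times> nat => 'a) => 'a" where
 "fc f i \<kappa> = (\<Oplus>p\<in>I0. \<kappa> p \<otimes> co f p i)"

lemma fc_closed [simp]: "f \<in> \<Phi> ==> i < r ==> \<kappa> \<in> I0 \<rightarrow> carrier R ==> fc f i \<kappa> \<in> carrier R"
 unfolding fc_def by (intro R.finsum_closed) auto

lemma fc_expand:
 assumes f: "f \<in> \<Phi>" and \<kappa>: "\<kappa> \<in> I0 \<rightarrow> carrier R"
 shows "(\<Oplus>\<^sub>M i\<in>{..<r}. fc f i \<kappa> \<odot>\<^sub>M x f i) = (f [^] N f) \<odot>\<^sub>M (\<Oplus>\<^sub>M p\<in>I0. \<kappa> p \<odot>\<^sub>M g p)"
proof -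
 have k: "!!p. p \<in> I0 ==> \<kappa> p \<in> carrier R" using \<kappa> by auto
 have "(\<Oplus>\<^sub>M i\<in>{..<r}. fc f i \<kappa> \<odot>\<^sub>M x f i) = (\<Oplus>\<^sub>M i\<in>{..<r}. \<Oplus>\<^sub>M p\<in>I0. (\<kappa> p \<otimes> co f p i) \<odot>\<^sub>M x f i)"
  unfolding fc_def using k x f
  by (intro M.finsum_cong' finsum_smult) (auto intro!: M.finsum_closed)
 also have "... = (\<Oplus>\<^sub>M p\<in>I0. \<Oplus>\<^sub>M i\<in>{..<r}. (\<kappa> p \<otimes> co f p i) \<odot>\<^sub>M x f i)"
  using k x f fin0 by (intro M.finsum_swap) auto
 also have "... = (\<Oplus>\<^sub>M p\<in>I0. (f [^] N f) \<odot>\<^sub>M (\<kappa> p \<odot>\<^sub>M g p))"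
 proof (intro M.finsum_cong')
  fix p assume p: "p \<in> I0"
  have "(\<Oplus>\<^sub>M i\<in>{..<r}. (\<kappa> p \<otimes> co f p i) \<odot>\<^sub>M x f i) = (\<Oplus>\<^sub>M i\<in>{..<r}. \<kappa> p \<odot>\<^sub>M (co f p i \<odot>\<^sub>M x f i))"
   using k[OF p] p x f by (intro M.finsum_cong') (auto simp: smult_assoc1)
  also have "... = \<kappa> p \<odot>\<^sub>M (\<Oplus>\<^sub>M i\<in>{..<r}. co f p i \<odot>\<^sub>M x f i)"
   using k[OF p] p x f by (intro smult_finsum[symmetric]) auto
  also have "... = (f [^] N f) \<odot>\<^sub>M (\<kappa> p \<odot>\<^sub>M g p)"
   unfolding co(2)[OF f p, symmetric] using k[OF p] p f by (simp add: smult_assoc1[symmetric] R.m_comm)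
  finally show "(\<Oplus>\<^sub>M i\<in>{..<r}. (\<kappa> p \<otimes> co f p i) \<odot>\<^sub>M x f i) = (f [^] N f) \<odot>\<^sub>M (\<kappa> p \<odot>\<^sub>M g p)" .
 qed (use k f in auto)
 also have "... = (f [^] N f) \<odot>\<^sub>M (\<Oplus>\<^sub>M p\<in>I0. \<kappa> p \<odot>\<^sub>M g p)"
  using k f by (intro smult_finsum[symmetric]) auto
 finally show ?thesis .
qed

lemma fc_rel:
 assumes f: "f \<in> \<Phi>" and \<kappa>: "rel \<kappa>"
 shows "\<exists>n::nat. \<forall>i<r. (f [^] n) \<otimes> fc f i \<kappa> = \<zero>"
proof -
 have "(\<Oplus>\<^sub>M i\<in>{..<r}. fc f i \<kappa> \<odot>\<^sub>M x f i) = \<zero>\<^sub>M"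
  using fc_expand[OF f, of \<kappa>] \<kappa> f by (simp add: rel_def)
 then show ?thesis using indep[OF f, of "\<lambda>i. fc f i \<kappa>"] f \<kappa> by (auto simp: rel_def)
qed

text \<open>The relations expressing \<open>f\<^sup>N g\<^sub>p\<close> through the local basis at \<open>f\<close>, whose members are among the
 generators; they generate all relations.\<close>

definition kk :: "'a \<times> 'a \<times> nat => 'a \<times> nat => 'a" where
 "kk t q = (if q = snd t then fst t [^] N (fst t) else \<zero>) \<oplus>
  \<ominus> (if fst q = fst t then co (fst t) (snd t) (snd q) else \<zero>)"

abbreviation "I1 \<equiv> \<Phi> \<times> I0"

lemma kk_closed [simp]: "t \<in> I1 ==> q \<in> I0 ==> kk t q \<in> carrier R"
 by (auto simp: kk_def I0_def)

lemma rel_kk: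
 assumes t: "t \<in> I1" shows "rel (kk t)"
proof -
 obtain f p where fp: "t = (f, p)" "f \<in> \<Phi>" "p \<in> I0" using t by auto
 have pr: "snd q < r" if "q \<in> I0" for q using that by (auto simp: I0_def)
 have "(\<Oplus>\<^sub>M q\<in>I0. kk t q \<odot>\<^sub>M g q) =
  (\<Oplus>\<^sub>M q\<in>I0. (if p = q then (f [^] N f) \<odot>\<^sub>M g q else \<zero>\<^sub>M) \<oplus>\<^sub>M
    (if fst q = f then \<ominus> co f p (snd q) else \<zero>) \<odot>\<^sub>M g q)"
  using fp pr by (intro M.finsum_cong') (auto simp: kk_def smult_l_distr)
 also have "... = (\<Oplus>\<^sub>M q\<in>I0. (if p = q then (f [^] N f) \<odot>\<^sub>M g q else \<zero>\<^sub>M)) \<oplus>\<^sub>M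
    (\<Oplus>\<^sub>M q\<in>I0. (if fst q = f then \<ominus> co f p (snd q) else \<zero>) \<odot>\<^sub>M g q)"
  using fp pr by (intro M.finsum_addf) auto
 also have "(\<Oplus>\<^sub>M q\<in>I0. (if p = q then (f [^] N f) \<odot>\<^sub>M g q else \<zero>\<^sub>M)) = (f [^] N f) \<odot>\<^sub>M g p"
  using fp fin0 by (intro M.finsum_singleton) auto
 also have "(\<Oplus>\<^sub>M q\<in>I0. (if fst q = f then \<ominus> co f p (snd q) else \<zero>) \<odot>\<^sub>M g q)
   = (\<Oplus>\<^sub>M i\<in>{..<r}. (\<ominus> co f p i) \<odot>\<^sub>M x f i)"
  using fp by (intro slice) auto
 also have "... = (\<Oplus>\<^sub>M i\<in>{..<r}. (\<ominus> \<one>) \<odot>\<^sub>M (co f p i \<odot>\<^sub>M x f i))"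
  using fp x by (intro M.finsum_cong') (auto simp: smult_assoc1[symmetric] R.l_minus)
 also have "... = (\<ominus> \<one>) \<odot>\<^sub>M (\<Oplus>\<^sub>M i\<in>{..<r}. co f p i \<odot>\<^sub>M x f i)"
  using fp x by (intro smult_finsum[symmetric]) auto
 also have "... = \<ominus>\<^sub>M ((f [^] N f) \<odot>\<^sub>M g p)"
  unfolding co(2)[OF fp(2,3), symmetric] using fp by (simp add: smult_l_minus)
 finally show ?thesis using fp t by (auto simp: rel_def M.r_neg)
qed

text \<open>Finite presentation of \<open>M\<close>. A multiple of the relation by a power of
  \<open>f\<close> is combined explicitly from the \<open>kk t\<close>, and
  \<open>span_cover\<close>, applied in the free module over \<open>I0\<close>, glues these local
  statements.\<close>

lemma relations_generated:
 assumes \<kappa>: "rel \<kappa>"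
 shows "\<exists>d\<in>I1 \<rightarrow> carrier R. \<forall>q\<in>I0. \<kappa> q = (\<Oplus>t\<in>I1. d t \<otimes> kk t q)"
proof -
 interpret self: module R "self_module R" by (rule module_self) (rule R.is_cring)
 have fsum: "finsum (self_module R) h J = finsum R h J" for h and J :: "'z set"
  by (simp add: finsum_def finprod_def)
 have k: "!!p. p \<in> I0 ==> \<kappa> p \<in> carrier R" using \<kappa> by (auto simp: rel_def)
 have "\<exists>d\<in>I1 \<rightarrow> carrier R. \<forall>q\<in>I0. \<kappa> q = (\<Oplus>\<^bsub>self_module R\<^esub>t\<in>I1. d t \<odot>\<^bsub>self_module R\<^esub> kk t q)"
 proof (rule self.span_cover[OF cov])
  show "finite I1" using fin fin0 by auto
  fix f assume f: "f \<in> \<Phi>"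
  obtain n :: nat where n: "!!i. i < r ==> (f [^] n) \<otimes> fc f i \<kappa> = \<zero>" using fc_rel[OF f \<kappa>] by auto
  define d where "d t = (if fst t = f then f [^] n \<otimes> \<kappa> (snd t) else \<zero>)" for t :: "'a \<times> 'a \<times> nat"
  have d: "d \<in> I1 \<rightarrow> carrier R" using f k by (auto simp: d_def)
  \<comment> \<open>The first terms of the \<open>kk (f, p)\<close>, weighted by
    \<open>f [^] n \<otimes> \<kappa> p\<close>, reproduce \<open>\<kappa>\<close> times a power of
    \<open>f\<close>. Their second terms add up to a multiple of
    \<open>f [^] n \<otimes> fc f (snd q) \<kappa>\<close>, which is zero.\<close>
  have "f [^] (n + N f) \<otimes> \<kappa> q = (\<Oplus>t\<in>I1. d t \<otimes> kk t q)" if q: "q \<in> I0" for q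
  proof -
   have qr: "snd q < r" using q by (auto simp: I0_def)
   have "(\<Oplus>t\<in>I1. d t \<otimes> kk t q) = (\<Oplus>t\<in>I1. if fst t = f then (\<lambda>p. f [^] n \<otimes> \<kappa> p \<otimes> kk (f, p) q) (snd t) else \<zero>)"
    using f k q by (intro R.finsum_cong') (auto simp: d_def)
   also have "... = (\<Oplus>p\<in>I0. f [^] n \<otimes> \<kappa> p \<otimes> kk (f, p) q)"
    using f k q fin fin0 by (intro R.finsum_slice) auto
   also have "... = (\<Oplus>p\<in>I0. (if q = p then f [^] n \<otimes> \<kappa> p \<otimes> f [^] N f else \<zero>) \<oplus>
     (if fst q = f then \<ominus> (f [^] n) else \<zero>) \<otimes> (\<kappa> p \<otimes> co f p (snd q)))"
    using f k q qr by (intro R.finsum_cong') (auto simp: kk_def R.r_distr R.r_minus R.l_minus R.m_assoc)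
   also have "... = (\<Oplus>p\<in>I0. (if q = p then f [^] n \<otimes> \<kappa> p \<otimes> f [^] N f else \<zero>)) \<oplus>
     (\<Oplus>p\<in>I0. (if fst q = f then \<ominus> (f [^] n) else \<zero>) \<otimes> (\<kappa> p \<otimes> co f p (snd q)))"
    using f k q qr by (intro R.finsum_addf) auto
   also have "(\<Oplus>p\<in>I0. (if q = p then f [^] n \<otimes> \<kappa> p \<otimes> f [^] N f else \<zero>)) = f [^] n \<otimes> \<kappa> q \<otimes> f [^] N f"
    using f k q fin0 by (intro R.finsum_singleton) auto
   also have "(\<Oplus>p\<in>I0. (if fst q = f then \<ominus> (f [^] n) else \<zero>) \<otimes> (\<kappa> p \<otimes> co f p (snd q))) =
     (if fst q = f then \<ominus> (f [^] n) else \<zero>) \<otimes> fc f (snd q) \<kappa>"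
    unfolding fc_def using f k q qr by (intro R.mult_finsum[symmetric]) auto
   also have "... = \<zero>" using n[OF qr] f qr \<kappa> by (simp add: R.l_minus rel_def)
   finally show ?thesis using f k q by (simp add: R.nat_pow_mult[symmetric] R.m_ac)
  qed
  then show "\<exists>n::nat. \<exists>c\<in>I1 \<rightarrow> carrier R. \<forall>q\<in>I0. f [^] n \<odot>\<^bsub>self_module R\<^esub> \<kappa> q =
    (\<Oplus>\<^bsub>self_module R\<^esub>t\<in>I1. c t \<odot>\<^bsub>self_module R\<^esub> kk t q)"
   using d by (intro exI[of _ "n + N f"] bexI[of _ d]) (auto simp: fsum)
 qed (use k in auto)
 then show ?thesis by (simp add: fsum)
qed

text \<open>In \<open>fc_rel\<close> the exponent depends on the relation. Finitely many relations
  generate all of them and \<open>fc\<close> is linear, so the sum of finitely many exponents serves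
  every relation.\<close>

lemma uniform_rel:
 assumes f: "f \<in> \<Phi>"
 shows "\<exists>n::nat. \<forall>\<kappa>. rel \<kappa> --> (\<forall>i<r. (f [^] n) \<otimes> fc f i \<kappa> = \<zero>)"
proof -
 have "\<forall>t\<in>I1. \<exists>n::nat. \<forall>i<r. (f [^] n) \<otimes> fc f i (kk t) = \<zero>" using fc_rel[OF f rel_kk] by blast
 from bchoice[OF this] obtain n :: "'a \<times> 'a \<times> nat => nat"
  where n: "!!t i. t \<in> I1 ==> i < r ==> (f [^] n t) \<otimes> fc f i (kk t) = \<zero>" by blast
 define n' where "n' = (\<Sum>t\<in>I1. n t)"
 have kkc: "kk t \<in> I0 \<rightarrow> carrier R" if "t \<in> I1" for t using that by auto
 have n': "(f [^] n') \<otimes> fc f i (kk t) = \<zero>" if t: "t \<in> I1" and i: "i < r" for t i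
 proof -
  have "n t \<le> n'" unfolding n'_def using t fin fin0 by (intro member_le_sum) auto
  then have "f [^] n' = f [^] (n' - n t) \<otimes> f [^] n t" using f by (simp add: R.nat_pow_mult)
  then show ?thesis using n[OF t i] f i kkc[OF t] by (simp add: R.m_assoc)
 qed
 have "(f [^] n') \<otimes> fc f i \<kappa> = \<zero>" if \<kappa>: "rel \<kappa>" and i: "i < r" for \<kappa> i
 proof -
  obtain d where d: "d \<in> I1 \<rightarrow> carrier R" and eq: "!!q. q \<in> I0 ==> \<kappa> q = (\<Oplus>t\<in>I1. d t \<otimes> kk t q)"
   using relations_generated[OF \<kappa>] by auto
  have dt: "!!t. t \<in> I1 ==> d t \<in> carrier R" using d by auto
  have "fc f i \<kappa> = (\<Oplus>p\<in>I0. \<Oplus>t\<in>I1. d t \<otimes> kk t p \<otimes> co f p i)"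
   unfolding fc_def
  proof (intro R.finsum_cong')
   fix p assume p: "p \<in> I0"
   show "\<kappa> p \<otimes> co f p i = (\<Oplus>t\<in>I1. d t \<otimes> kk t p \<otimes> co f p i)"
    unfolding eq[OF p] using dt p f i by (intro R.finsum_mult) auto
  qed (use dt f i in \<open>auto intro!: R.finsum_closed\<close>)
  also have "... = (\<Oplus>t\<in>I1. \<Oplus>p\<in>I0. d t \<otimes> kk t p \<otimes> co f p i)"
   using dt f i fin fin0 by (intro R.finsum_swap) auto
  also have "... = (\<Oplus>t\<in>I1. d t \<otimes> fc f i (kk t))"
  proof (intro R.finsum_cong')
   fix t assume t: "t \<in> I1"
   have "d t \<otimes> fc f i (kk t) = (\<Oplus>p\<in>I0. d t \<otimes> (kk t p \<otimes> co f p i))"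
    unfolding fc_def using dt[OF t] t f i by (intro R.mult_finsum) auto
   also have "... = (\<Oplus>p\<in>I0. d t \<otimes> kk t p \<otimes> co f p i)"
    using dt[OF t] t f i by (intro R.finsum_cong') (auto simp: R.m_assoc)
   finally show "(\<Oplus>p\<in>I0. d t \<otimes> kk t p \<otimes> co f p i) = d t \<otimes> fc f i (kk t)" ..
  qed (use dt f i kkc in auto)
  finally have "(f [^] n') \<otimes> fc f i \<kappa> = (\<Oplus>t\<in>I1. (f [^] n') \<otimes> (d t \<otimes> fc f i (kk t)))"
   using dt f i kkc by (simp only:) (intro R.mult_finsum, auto)
  also have "... = \<zero>"
  proof (intro R.add.finprod_one_eqI)
   fix t assume t: "t \<in> I1"
   have "(f [^] n') \<otimes> (d t \<otimes> fc f i (kk t)) = d t \<otimes> ((f [^] n') \<otimes> fc f i (kk t))"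
    using dt[OF t] f i kkc[OF t] by (simp add: R.m_ac)
   then show "(f [^] n') \<otimes> (d t \<otimes> fc f i (kk t)) = \<zero>" using n'[OF t i] dt[OF t] by simp
  qed
  finally show ?thesis .
 qed
 then show ?thesis by blast
qed

definition N' :: "'a => nat" where
 "N' f = (SOME n. \<forall>\<kappa>. rel \<kappa> --> (\<forall>i<r. (f [^] n) \<otimes> fc f i \<kappa> = \<zero>))"

lemma N': "f \<in> \<Phi> ==> rel \<kappa> ==> i < r ==> (f [^] N' f) \<otimes> fc f i \<kappa> = \<zero>"
 using someI_ex[OF uniform_rel] unfolding N'_def by blast

definition rp :: "'m => 'a \<times> nat => 'a" where
 "rp m = (SOME c. c \<in> I0 \<rightarrow> carrier R & m = (\<Oplus>\<^sub>M p\<in>I0. c p \<odot>\<^sub>M g p))"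

lemma rp:
 assumes "m \<in> carrier M"
 shows "rp m \<in> I0 \<rightarrow> carrier R" "(\<Oplus>\<^sub>M p\<in>I0. rp m p \<odot>\<^sub>M g p) = m"
proof -
 have "\<exists>c. c \<in> I0 \<rightarrow> carrier R & m = (\<Oplus>\<^sub>M p\<in>I0. c p \<odot>\<^sub>M g p)" using generators[OF assms] by auto
 from someI_ex[OF this] have "rp m \<in> I0 \<rightarrow> carrier R & m = (\<Oplus>\<^sub>M p\<in>I0. rp m p \<odot>\<^sub>M g p)"
  unfolding rp_def .
 then show "rp m \<in> I0 \<rightarrow> carrier R" "(\<Oplus>\<^sub>M p\<in>I0. rp m p \<odot>\<^sub>M g p) = m" by auto
qed

text \<open>The coordinate \<open>i\<close> at \<open>f\<close> as a functional on all of
  \<open>M\<close>. The extra power of \<open>f\<close> removes the dependence on the arbitrary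
  representation \<open>rp m\<close>.\<close>

definition lam :: "'a => nat => 'm => 'a" where
 "lam f i m = (f [^] N' f) \<otimes> fc f i (rp m)"

lemma fc_lin:
 assumes f: "f \<in> \<Phi>" "i < r" and c: "c \<in> I0 \<rightarrow> carrier R" "d \<in> I0 \<rightarrow> carrier R" and a: "a \<in> carrier R"
 shows "fc f i (\<lambda>p. c p \<oplus> a \<otimes> d p) = fc f i c \<oplus> a \<otimes> fc f i d"
proof -
 have cp: "!!p. p \<in> I0 ==> c p \<in> carrier R" "!!p. p \<in> I0 ==> d p \<in> carrier R" using c by auto
 have "fc f i (\<lambda>p. c p \<oplus> a \<otimes> d p) = (\<Oplus>p\<in>I0. c p \<otimes> co f p i \<oplus> a \<otimes> (d p \<otimes> co f p i))"
  unfolding fc_def using f cp a by (intro R.finsum_cong') (auto simp: R.l_distr R.m_assoc)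
 also have "... = (\<Oplus>p\<in>I0. c p \<otimes> co f p i) \<oplus> (\<Oplus>p\<in>I0. a \<otimes> (d p \<otimes> co f p i))"
  using f cp a by (intro R.finsum_addf) auto
 also have "(\<Oplus>p\<in>I0. a \<otimes> (d p \<otimes> co f p i)) = a \<otimes> (\<Oplus>p\<in>I0. d p \<otimes> co f p i)"
  using f cp a by (intro R.mult_finsum[symmetric]) auto
 finally show ?thesis by (simp add: fc_def)
qed

lemma sum_lin:
 assumes c: "c \<in> I0 \<rightarrow> carrier R" "d \<in> I0 \<rightarrow> carrier R" and a: "a \<in> carrier R"
 shows "(\<Oplus>\<^sub>M p\<in>I0. (c p \<oplus> a \<otimes> d p) \<odot>\<^sub>M g p) =
  (\<Oplus>\<^sub>M p\<in>I0. c p \<odot>\<^sub>M g p) \<oplus>\<^sub>M a \<odot>\<^sub>M (\<Oplus>\<^sub>M p\<in>I0. d p \<odot>\<^sub>M g p)"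
proof -
 have cp: "!!p. p \<in> I0 ==> c p \<in> carrier R" "!!p. p \<in> I0 ==> d p \<in> carrier R" using c by auto
 have "(\<Oplus>\<^sub>M p\<in>I0. (c p \<oplus> a \<otimes> d p) \<odot>\<^sub>M g p) = (\<Oplus>\<^sub>M p\<in>I0. c p \<odot>\<^sub>M g p \<oplus>\<^sub>M a \<odot>\<^sub>M (d p \<odot>\<^sub>M g p))"
  using cp a by (intro M.finsum_cong') (auto simp: smult_l_distr smult_assoc1)
 also have "... = (\<Oplus>\<^sub>M p\<in>I0. c p \<odot>\<^sub>M g p) \<oplus>\<^sub>M (\<Oplus>\<^sub>M p\<in>I0. a \<odot>\<^sub>M (d p \<odot>\<^sub>M g p))"
  using cp a by (intro M.finsum_addf) auto
 also have "(\<Oplus>\<^sub>M p\<in>I0. a \<odot>\<^sub>M (d p \<odot>\<^sub>M g p)) = a \<odot>\<^sub>M (\<Oplus>\<^sub>M p\<in>I0. d p \<odot>\<^sub>M g p)"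
  using cp a by (intro smult_finsum[symmetric]) auto
 finally show ?thesis .
qed

text \<open>Two representations of the same element differ by a relation, and
  \<open>f [^] N' f\<close> kills \<open>fc\<close> of every relation.\<close>

lemma lam_eqI:
 assumes f: "f \<in> \<Phi>" "i < r" and c: "c \<in> I0 \<rightarrow> carrier R"
 shows "lam f i (\<Oplus>\<^sub>M p\<in>I0. c p \<odot>\<^sub>M g p) = (f [^] N' f) \<otimes> fc f i c"
proof -
 define m where "m = (\<Oplus>\<^sub>M p\<in>I0. c p \<odot>\<^sub>M g p)"
 have m: "m \<in> carrier M" unfolding m_def using c by (auto intro!: M.finsum_closed simp: Pi_def)
 have one: "\<ominus> \<one> \<in> carrier R" by simp
 define \<kappa> where "\<kappa> = (\<lambda>p. rp m p \<oplus> (\<ominus> \<one>) \<otimes> c p)"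
 have \<kappa>: "\<kappa> \<in> I0 \<rightarrow> carrier R" unfolding \<kappa>_def using rp(1)[OF m] c by auto
 have "(\<Oplus>\<^sub>M p\<in>I0. \<kappa> p \<odot>\<^sub>M g p) = m \<oplus>\<^sub>M (\<ominus> \<one>) \<odot>\<^sub>M m"
  unfolding \<kappa>_def sum_lin[OF rp(1)[OF m] c one] rp(2)[OF m] m_def[symmetric] ..
 then have "rel \<kappa>" using \<kappa> m by (simp add: rel_def smult_l_minus M.r_neg)
 from N'[OF f(1) this f(2)] have "(f [^] N' f) \<otimes> (fc f i (rp m) \<oplus> (\<ominus> \<one>) \<otimes> fc f i c) = \<zero>"
  unfolding \<kappa>_def fc_lin[OF f rp(1)[OF m] c one] .
 then have "(f [^] N' f) \<otimes> fc f i (rp m) \<ominus> (f [^] N' f) \<otimes> fc f i c = \<zero>"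
  using f rp(1)[OF m] c by (simp add: R.r_distr R.l_minus R.r_minus a_minus_def)
 then show ?thesis
  unfolding m_def[symmetric] lam_def using f rp(1)[OF m] c by (simp add: )
qed

lemma lam_closed [simp]: "f \<in> \<Phi> ==> i < r ==> m \<in> carrier M ==> lam f i m \<in> carrier R"
 unfolding lam_def using rp(1) by simp

lemma lam_lin:
 assumes f: "f \<in> \<Phi>" "i < r" and m: "m \<in> carrier M" "m' \<in> carrier M" and a: "a \<in> carrier R"
 shows "lam f i (m \<oplus>\<^sub>M a \<odot>\<^sub>M m') = lam f i m \<oplus> a \<otimes> lam f i m'"
proof -
 have cl: "(\<lambda>p. rp m p \<oplus> a \<otimes> rp m' p) \<in> I0 \<rightarrow> carrier R" using rp(1)[OF m(1)] rp(1)[OF m(2)] a by auto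
 have "lam f i (m \<oplus>\<^sub>M a \<odot>\<^sub>M m') = (f [^] N' f) \<otimes> (fc f i (rp m) \<oplus> a \<otimes> fc f i (rp m'))"
  using lam_eqI[OF f cl] sum_lin[OF rp(1)[OF m(1)] rp(1)[OF m(2)] a] fc_lin[OF f rp(1)[OF m(1)] rp(1)[OF m(2)] a]
  by (simp add: rp(2) m)
 then show ?thesis unfolding lam_def using f rp(1)[OF m(1)] rp(1)[OF m(2)] a
  by (simp add: R.r_distr R.m_lcomm)
qed

lemma lam_expand:
 assumes f: "f \<in> \<Phi>" and m: "m \<in> carrier M"
 shows "(\<Oplus>\<^sub>M i\<in>{..<r}. lam f i m \<odot>\<^sub>M x f i) = (f [^] (N' f + N f)) \<odot>\<^sub>M m"
proof -
 have "(\<Oplus>\<^sub>M i\<in>{..<r}. lam f i m \<odot>\<^sub>M x f i) = (\<Oplus>\<^sub>M i\<in>{..<r}. (f [^] N' f) \<odot>\<^sub>M (fc f i (rp m) \<odot>\<^sub>M x f i))"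
  using f m rp(1)[OF m] x by (intro M.finsum_cong') (auto simp: lam_def smult_assoc1)
 also have "... = (f [^] N' f) \<odot>\<^sub>M (\<Oplus>\<^sub>M i\<in>{..<r}. fc f i (rp m) \<odot>\<^sub>M x f i)"
  using f m rp(1)[OF m] x by (intro smult_finsum[symmetric]) auto
 also have "... = (f [^] N' f) \<odot>\<^sub>M ((f [^] N f) \<odot>\<^sub>M m)"
  using fc_expand[OF f rp(1)[OF m]] rp(2)[OF m] by simp
 finally show ?thesis using f m by (simp add: smult_assoc1[symmetric] R.nat_pow_mult)
qed

text \<open>A partition of unity: the powers \<open>f [^] (N' f + N f)\<close>, which
  \<open>lam_expand\<close> produces, still generate the unit ideal. If the \<open>a f\<close> are
  coefficients that express \<open>\<one>\<close> through them, the functionals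
  \<open>lam f i\<close> multiplied by \<open>a f\<close> are dual to the generators.\<close>

lemma dual_basis_exists: "\<exists>l. dual_basis R M I0 g l"
proof -
 interpret self: module R "self_module R" by (rule module_self) (rule R.is_cring)
 have fsum: "finsum (self_module R) h J = finsum R h J" for h and J :: "'z set"
  by (simp add: finsum_def finprod_def)
 have "\<exists>a\<in>\<Phi> \<rightarrow> carrier R. \<forall>q\<in>{()}. \<one> = (\<Oplus>\<^bsub>self_module R\<^esub>f\<in>\<Phi>. a f \<odot>\<^bsub>self_module R\<^esub> (f [^] (N' f + N f)))"
 proof (rule self.span_cover[OF cov fin])
  fix f assume f: "f \<in> \<Phi>"
  have "(\<Oplus>h\<in>\<Phi>. (if f = h then \<one> else \<zero>) \<otimes> h [^] (N' h + N h)) = (\<Oplus>h\<in>\<Phi>. if f = h then h [^] (N' h + N h) else \<zero>)"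
   by (intro R.finsum_cong') auto
  also have "... = f [^] (N' f + N f)" using f fin by (intro R.finsum_singleton) auto
  finally show "\<exists>n::nat. \<exists>c\<in>\<Phi> \<rightarrow> carrier R. \<forall>q\<in>{()}. f [^] n \<odot>\<^bsub>self_module R\<^esub> \<one> =
    (\<Oplus>\<^bsub>self_module R\<^esub>h\<in>\<Phi>. c h \<odot>\<^bsub>self_module R\<^esub> (h [^] (N' h + N h)))"
   using f by (intro exI[of _ "N' f + N f"] bexI[of _ "\<lambda>h. if f = h then \<one> else \<zero>"]) (auto simp: fsum)
 qed auto
 then obtain a where a: "a \<in> \<Phi> \<rightarrow> carrier R" and one: "\<one> = (\<Oplus>f\<in>\<Phi>. a f \<otimes> (f [^] (N' f + N f)))"
  by (auto simp: fsum)
 have af: "!!f. f \<in> \<Phi> ==> a f \<in> carrier R" using a by auto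
 define l where "l p m = a (fst p) \<otimes> lam (fst p) (snd p) m" for p m
 have p: "fst p \<in> \<Phi>" "snd p < r" if "p \<in> I0" for p using that by (auto simp: I0_def)
 have add: "lam f i (m \<oplus>\<^sub>M m') = lam f i m \<oplus> lam f i m'" if "f \<in> \<Phi>" "i < r" "m \<in> carrier M" "m' \<in> carrier M" for f i m m'
  using lam_lin[OF that R.one_closed] that by simp
 have zero: "lam f i \<zero>\<^sub>M = \<zero>" if "f \<in> \<Phi>" "i < r" for f i
  using add[OF that M.zero_closed M.zero_closed] that by (metis M.l_zero M.zero_closed R.add.r_cancel_one' lam_closed)
 have smult: "lam f i (b \<odot>\<^sub>M m) = b \<otimes> lam f i m" if "f \<in> \<Phi>" "i < r" "m \<in> carrier M" "b \<in> carrier R" for f i m b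
  using lam_lin[OF that(1,2) M.zero_closed that(3,4)] that zero by simp
 have "dual_basis R M I0 g l"
  unfolding dual_basis_def
 proof (intro conjI ballI)
  show "module_hom R M (self_module R) (l q)" if "q \<in> I0" for q
   unfolding l_def using p[OF that] af
   by (intro module_homI) (simp_all add: add smult R.r_distr R.m_lcomm)
  fix m assume m: "m \<in> carrier M"
  have "(\<Oplus>\<^sub>M p\<in>I0. l p m \<odot>\<^sub>M g p) = (\<Oplus>\<^sub>M f\<in>\<Phi>. \<Oplus>\<^sub>M i\<in>{..<r}. (\<lambda>p. l p m \<odot>\<^sub>M g p) (f, i))"
   unfolding I0_def
  proof (rule M.finsum_product[symmetric, OF fin])
   fix f i assume "f \<in> \<Phi>" "i \<in> {..<r}"
   then show "l (f, i) m \<odot>\<^sub>M g (f, i) \<in> carrier M" using m af x by (simp add: l_def g_def)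
  qed simp
  also have "... = (\<Oplus>\<^sub>M f\<in>\<Phi>. (a f \<otimes> f [^] (N' f + N f)) \<odot>\<^sub>M m)"
  proof (intro M.finsum_cong')
   fix f assume f: "f \<in> \<Phi>"
   have "(\<Oplus>\<^sub>M i\<in>{..<r}. (\<lambda>p. l p m \<odot>\<^sub>M g p) (f, i)) = (\<Oplus>\<^sub>M i\<in>{..<r}. a f \<odot>\<^sub>M (lam f i m \<odot>\<^sub>M x f i))"
    using f m af x by (intro M.finsum_cong') (auto simp: l_def g_def smult_assoc1)
   also have "... = a f \<odot>\<^sub>M (\<Oplus>\<^sub>M i\<in>{..<r}. lam f i m \<odot>\<^sub>M x f i)"
    using f m af x by (intro smult_finsum[symmetric]) auto
   finally show "(\<Oplus>\<^sub>M i\<in>{..<r}. (\<lambda>p. l p m \<odot>\<^sub>M g p) (f, i)) = (a f \<otimes> f [^] (N' f + N f)) \<odot>\<^sub>M m"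
    using f m af by (simp add: lam_expand smult_assoc1)
  qed (use af m in auto)
  also have "... = (\<Oplus>f\<in>\<Phi>. a f \<otimes> f [^] (N' f + N f)) \<odot>\<^sub>M m"
   using af m by (intro finsum_smult[symmetric]) auto
  also have "... = m" unfolding one[symmetric] using m by simp
  finally show "m = (\<Oplus>\<^sub>M p\<in>I0. l p m \<odot>\<^sub>M g p)" ..
 qed (use fin0 in auto)
 then show ?thesis by blast
qed

end

lemma locally_free_dual_basis:
 fixes R :: "('a, 'x) ring_scheme" and M :: "('a, 'm) module"
 assumes lf: "locally_free R M r"
 shows "\<exists>I (e :: 'a \<times> nat => 'm) l. dual_basis R M I e l"
proof -
 interpret module R M using lf by (simp add: locally_free_def)
 \<comment> \<open>The outcome of \<open>free_localization\<close> for the powers of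
   \<open>f\<close>.\<close>
 define good where "good f x \<longleftrightarrow> x \<in> {..<r} \<rightarrow> carrier M &
  (\<forall>m\<in>carrier M. \<exists>n::nat. \<exists>c\<in>{..<r} \<rightarrow> carrier R. (f [^]\<^sub>R n) \<odot>\<^sub>M m = (\<Oplus>\<^sub>M i\<in>{..<r}. c i \<odot>\<^sub>M x i)) &
  (\<forall>c\<in>{..<r} \<rightarrow> carrier R. (\<Oplus>\<^sub>M i\<in>{..<r}. c i \<odot>\<^sub>M x i) = \<zero>\<^sub>M --> (\<exists>n::nat. \<forall>i<r. (f [^]\<^sub>R n) \<otimes>\<^sub>R c i = \<zero>\<^sub>R))"
  for f x
 define G where "G = {f \<in> carrier R. \<exists>x. good f x}"
 have ex: "\<exists>f\<in>G. f \<notin> p" if prime: "primeideal p R" for p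
 proof -
  obtain f where f: "f \<in> carrier R" "f \<notin> p"
   and free: "free_of_rank (localization R {f [^]\<^sub>R n | n::nat. True} (self_module R))
    (localization R {f [^]\<^sub>R n | n::nat. True} M) r"
   using lf prime by (auto simp: locally_free_def Let_def)
  interpret L: module_localization R M "{f [^]\<^sub>R n | n::nat. True}"
  proof
   show "{f [^]\<^sub>R n | n::nat. True} \<subseteq> carrier R" using f by auto
   show "\<one>\<^sub>R \<in> {f [^]\<^sub>R n | n::nat. True}" by (auto intro: exI[of _ 0])
   show "s \<otimes>\<^sub>R t \<in> {f [^]\<^sub>R n | n::nat. True}"
    if "s \<in> {f [^]\<^sub>R n | n::nat. True}" "t \<in> {f [^]\<^sub>R n | n::nat. True}" for s t
    using that f R.nat_pow_mult by auto
  qed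
  have ex_pow: "(\<exists>s\<in>{f [^]\<^sub>R n | n::nat. True}. Q s) \<longleftrightarrow> (\<exists>n::nat. Q (f [^]\<^sub>R n))" for Q
   by auto
  from L.free_localization[OF free, unfolded ex_pow] have "\<exists>x. good f x"
   unfolding good_def by (elim bexE) (rule exI, rule conjI, assumption+)
  then show ?thesis using f by (auto simp: G_def)
 qed
 have GR: "G \<subseteq> carrier R" by (auto simp: G_def)
 \<comment> \<open>Quasi-compactness of the spectrum: the ideal generated by all good elements lies
   in no prime ideal, so it contains the unit, which already belongs to the ideal generated by
   finitely many of them.\<close>
 define J where "J = \<Union> {Idl\<^bsub>R\<^esub> \<Phi> | \<Phi>. \<Phi> \<subseteq> G & finite \<Phi>}"
 have mem: "\<exists>\<Phi>. \<Phi> \<subseteq> G & finite \<Phi> & a \<in> Idl\<^bsub>R\<^esub> \<Phi>" if "a \<in> J" for a using that by (auto simp: J_def)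
 have memI: "a \<in> J" if "\<Phi> \<subseteq> G" "finite \<Phi>" "a \<in> Idl\<^bsub>R\<^esub> \<Phi>" for a \<Phi> using that by (auto simp: J_def)
 have id: "ideal (Idl\<^bsub>R\<^esub> \<Phi>) R" if "\<Phi> \<subseteq> G" for \<Phi> using R.genideal_ideal that GR by blast
 have mono: "Idl\<^bsub>R\<^esub> \<Phi> \<subseteq> Idl\<^bsub>R\<^esub> \<Phi>'" if "\<Phi> \<subseteq> \<Phi>'" "\<Phi>' \<subseteq> G" for \<Phi> \<Phi>'
  using R.genideal_minimal[OF id[OF that(2)]] R.genideal_self[of \<Phi>'] that GR by (meson order_trans)
 have idJ: "ideal J R"
 proof (rule idealI[OF R.ring_axioms])
  show "subgroup J (add_monoid R)"
  proof (rule R.add.subgroupI)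
   show "J \<subseteq> carrier R"
   proof
    fix a assume "a \<in> J"
    then obtain \<Phi> where "\<Phi> \<subseteq> G" "a \<in> Idl\<^bsub>R\<^esub> \<Phi>" using mem by meson
    then show "a \<in> carrier R" using ideal.Icarr[OF id] by simp
   qed
   have "Idl\<^bsub>R\<^esub> {} \<subseteq> J" by (auto simp: J_def)
   then show "J ~= {}" using additive_subgroup.zero_closed[OF ideal.axioms(1)[OF id]] by blast
   show "\<ominus>\<^sub>R a \<in> J" if "a \<in> J" for a
    using mem[OF that] additive_subgroup.a_inv_closed[OF ideal.axioms(1)[OF id]] memI by meson
   fix a b assume "a \<in> J" "b \<in> J"
   then obtain \<Phi> \<Phi>' where "\<Phi> \<subseteq> G" "finite \<Phi>" "a \<in> Idl\<^bsub>R\<^esub> \<Phi>" "\<Phi>' \<subseteq> G" "finite \<Phi>'" "b \<in> Idl\<^bsub>R\<^esub> \<Phi>'"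
    using mem by meson
   then have "\<Phi> \<union> \<Phi>' \<subseteq> G" "finite (\<Phi> \<union> \<Phi>')" "a \<in> Idl\<^bsub>R\<^esub> (\<Phi> \<union> \<Phi>')" "b \<in> Idl\<^bsub>R\<^esub> (\<Phi> \<union> \<Phi>')"
    using subsetD[OF mono[of \<Phi> "\<Phi> \<union> \<Phi>'"]] subsetD[OF mono[of \<Phi>' "\<Phi> \<union> \<Phi>'"]] by simp_all
   then show "a \<oplus>\<^sub>R b \<in> J"
    using additive_subgroup.a_closed[OF ideal.axioms(1)[OF id]] by (intro memI)
  qed
  show "b \<otimes>\<^sub>R a \<in> J" if "a \<in> J" "b \<in> carrier R" for a b
   using mem[OF that(1)] that(2) ideal.I_l_closed[OF id] memI by meson
  show "a \<otimes>\<^sub>R b \<in> J" if "a \<in> J" "b \<in> carrier R" for a b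
   using mem[OF that(1)] that(2) ideal.I_r_closed[OF id] memI by meson
 qed
 have GJ: "G \<subseteq> J"
 proof
  fix f assume "f \<in> G"
  then show "f \<in> J" using R.genideal_self'[of f] GR by (intro memI[of "{f}"]) auto
 qed
 have "\<one>\<^sub>R \<in> J"
 proof (rule ccontr)
  assume "\<one>\<^sub>R \<notin> J"
  from R.exists_prime_superset[OF idJ this] obtain p where p: "primeideal p R" "J \<subseteq> p" by auto
  from ex[OF p(1)] obtain f where "f \<in> G" "f \<notin> p" by auto
  then show False using GJ p(2) by auto
 qed
 then obtain \<Phi> where \<Phi>: "\<Phi> \<subseteq> G" "finite \<Phi>" "\<one>\<^sub>R \<in> Idl\<^bsub>R\<^esub> \<Phi>" using mem by meson
 have cov: "covering R \<Phi>"
  unfolding covering_def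
 proof (intro conjI allI impI)
  fix K assume K: "ideal K R & \<Phi> \<subseteq> K"
  then have "\<one>\<^sub>R \<in> K" using R.genideal_minimal[of K \<Phi>] \<Phi>(3) by blast
  then show "K = carrier R" using K ideal.one_imp_carrier by blast
 qed (use \<Phi> GR in auto)
 define x where "x f = (SOME x. good f x)" for f
 have x: "good f (x f)" if "f \<in> \<Phi>" for f
 proof -
  have "\<exists>x. good f x" using that \<Phi>(1) by (auto simp: G_def)
  then show ?thesis unfolding x_def by (rule someI_ex)
 qed
 interpret local_bases R M \<Phi> r x
 proof
  fix f assume f: "f \<in> \<Phi>"
  note gx = x[OF f, unfolded good_def]
  show "x f i \<in> carrier M" if "i < r" for i using gx that by auto
  show "\<exists>n::nat. \<exists>c\<in>{..<r} \<rightarrow> carrier R. (f [^]\<^sub>R n) \<odot>\<^sub>M m = (\<Oplus>\<^sub>M i\<in>{..<r}. c i \<odot>\<^sub>M x f i)"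
   if "m \<in> carrier M" for m using gx that by blast
  show "\<exists>n::nat. \<forall>i<r. (f [^]\<^sub>R n) \<otimes>\<^sub>R c i = \<zero>\<^sub>R"
   if "c \<in> {..<r} \<rightarrow> carrier R" "(\<Oplus>\<^sub>M i\<in>{..<r}. c i \<odot>\<^sub>M x f i) = \<zero>\<^sub>M" for c
   using gx that by blast
 qed (use \<Phi>(2) cov in auto)
 show ?thesis using dual_basis_exists by blast
qed


section \<open>Completion at a maximal ideal\<close>

locale completion_at_maximal = A: domain A + v: maximalideal v A
 for A :: "('k, 'a) module" (structure) and v :: "'a set"
begin

abbreviation "V \<equiv> ideal_power A v"
declare ideal_power.simps(2) [simp del]

abbreviation "Q n \<equiv> A Quot (V n)"
abbreviation "C \<equiv> completion A v"
abbreviation "\<iota> \<equiv> completion_map A v"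

lemma ideal_V: "ideal (V n) A"
proof (induction n)
 case 0
 then show ?case by (simp add: A.oneideal)
next
 case (Suc n)
 then show ?case using A.ideal_prod_is_ideal[OF Suc v.is_ideal] by (simp add: ideal_power.simps(2))
qed

lemma cring_Q: "cring (Q n)"
 by (rule ideal.quotient_is_cring[OF ideal_V A.is_cring])

lemma coset_hom: "(\<lambda>a. V n +> a) \<in> ring_hom A (Q n)"
 using ideal.rcos_ring_hom[OF ideal_V] by simp

lemmas coset_simps = ring_hom_closed[OF coset_hom] ring_hom_mult[OF coset_hom, symmetric]
 ring_hom_add[OF coset_hom, symmetric] ring_hom_one[OF coset_hom]

lemma coset_eq_iff: "a \<in> carrier A ==> b \<in> carrier A ==> V n +> a = V n +> b \<longleftrightarrow> a \<ominus> b \<in> V n"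
 using A.quotient_eq_iff_same_a_r_cos[OF ideal_V] by blast

lemma V_decreasing: "V (Suc n) \<subseteq> V n"
 using A.ideal_prod_inter[OF ideal_V v.is_ideal, of n] by (simp add: ideal_power.simps(2))

lemma V_sub: "V n \<subseteq> carrier A"
 using ideal.Icarr[OF ideal_V] by auto

lemma coset_Suc_subset: "a \<in> carrier A ==> V (Suc n) +> a \<subseteq> V n +> a"
 using V_decreasing by (auto simp: a_r_coset_def r_coset_def)

lemma coset_self: "a \<in> carrier A ==> a \<in> V n +> a"
proof -
 interpret ideal "V n" A by (rule ideal_V)
 show "a \<in> carrier A ==> a \<in> V n +> a" by (rule a_rcos_self)
qed

lemma coset_rep: "Z \<in> carrier (Q n) ==> a \<in> Z ==> a \<in> carrier A & Z = V n +> a"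
proof -
 assume "Z \<in> carrier (Q n)" "a \<in> Z"
 then obtain b where b: "b \<in> carrier A" "Z = V n +> b" by (auto simp: FactRing_def A_RCOSETS_def')
 then have a: "a \<in> carrier A" using \<open>a \<in> Z\<close> V_sub by (auto simp: a_r_coset_def')
 interpret ideal "V n" A by (rule ideal_V)
 have "V n +> b = V n +> a"
  using b \<open>a \<in> Z\<close> by (intro a_repr_independence') auto
 then show ?thesis using a b by simp
qed

lemma C_carrier: "carrier C = {x. \<forall>n. x n \<in> carrier (Q n) & x (Suc n) \<subseteq> x n}"
 and C_mult: "x \<otimes>\<^sub>C y = (\<lambda>n. x n \<otimes>\<^bsub>Q n\<^esub> y n)" and C_one: "\<one>\<^sub>C = (\<lambda>n. \<one>\<^bsub>Q n\<^esub>)"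
 and C_add: "x \<oplus>\<^sub>C y = (\<lambda>n. x n \<oplus>\<^bsub>Q n\<^esub> y n)" and C_zero: "\<zero>\<^sub>C = (\<lambda>n. \<zero>\<^bsub>Q n\<^esub>)"
 and C_smult: "c \<odot>\<^sub>C x = \<iota> (c \<odot> \<one>) \<otimes>\<^sub>C x"
 by (simp_all add: completion_def Let_def)

text \<open>Elements of the completion are subject to a condition on consecutive levels only, so one
  representative for two consecutive levels is what the ring operations have to be checked
  on.\<close>

lemma C_rep:
 assumes "x \<in> carrier C"
 obtains a where "a \<in> carrier A" "x n = V n +> a" "x (Suc n) = V (Suc n) +> a"
proof -
 have x: "x n \<in> carrier (Q n)" "x (Suc n) \<in> carrier (Q (Suc n))" "x (Suc n) \<subseteq> x n"
  using assms by (auto simp: C_carrier)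
 obtain a where a: "a \<in> x (Suc n)"
  using x(2) coset_self by (force simp: FactRing_def A_RCOSETS_def')
 then show ?thesis using that coset_rep[OF x(2) a] coset_rep[OF x(1)] x(3) by blast
qed

lemma C_memI:
 assumes "!!n. \<exists>a\<in>carrier A. x n = V n +> a & x (Suc n) = V (Suc n) +> a"
 shows "x \<in> carrier C"
 unfolding C_carrier
proof (intro CollectI allI)
 fix n
 obtain a where "a \<in> carrier A" "x n = V n +> a" "x (Suc n) = V (Suc n) +> a" using assms by blast
 then show "x n \<in> carrier (Q n) & x (Suc n) \<subseteq> x n"
  using coset_Suc_subset coset_simps(1) by simp
qed

lemma \<iota>_closed: "a \<in> carrier A ==> \<iota> a \<in> carrier C"
 by (intro C_memI) (auto simp: completion_map_def)

lemma cring_C: "cring C"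
proof -
 interpret Q: cring "Q n" for n by (rule cring_Q)
 have xn: "x n \<in> carrier (Q n)" if "x \<in> carrier C" for x n using that by (simp add: C_carrier)
 have mult: "x \<otimes>\<^sub>C y \<in> carrier C" if x: "x \<in> carrier C" and y: "y \<in> carrier C" for x y
 proof (rule C_memI)
  fix n
  obtain a where a: "a \<in> carrier A" "x n = V n +> a" "x (Suc n) = V (Suc n) +> a"
   using C_rep[OF x] .
  obtain b where "b \<in> carrier A" "y n = V n +> b" "y (Suc n) = V (Suc n) +> b"
   using C_rep[OF y] .
  with a show "\<exists>a\<in>carrier A. (x \<otimes>\<^sub>C y) n = V n +> a & (x \<otimes>\<^sub>C y) (Suc n) = V (Suc n) +> a"
   by (intro bexI[of _ "a \<otimes> b"]) (simp_all add: C_mult coset_simps)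
 qed
 have add: "x \<oplus>\<^sub>C y \<in> carrier C" if x: "x \<in> carrier C" and y: "y \<in> carrier C" for x y
 proof (rule C_memI)
  fix n
  obtain a where a: "a \<in> carrier A" "x n = V n +> a" "x (Suc n) = V (Suc n) +> a"
   using C_rep[OF x] .
  obtain b where "b \<in> carrier A" "y n = V n +> b" "y (Suc n) = V (Suc n) +> b"
   using C_rep[OF y] .
  with a show "\<exists>a\<in>carrier A. (x \<oplus>\<^sub>C y) n = V n +> a & (x \<oplus>\<^sub>C y) (Suc n) = V (Suc n) +> a"
   by (intro bexI[of _ "a \<oplus> b"]) (simp_all add: C_add coset_simps)
 qed
 have one: "\<one>\<^sub>C = \<iota> \<one>" by (simp add: C_one completion_map_def coset_simps)
 have zero_Q: "\<zero>\<^bsub>Q n\<^esub> = V n +> \<zero>" for n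
  using additive_zero[OF A.abelian_group_axioms Q.abelian_group_axioms ring_hom_additive[OF coset_hom]] by simp
 have zero: "\<zero>\<^sub>C = \<iota> \<zero>" by (simp add: C_zero completion_map_def zero_Q)
 have neg: "\<exists>y\<in>carrier C. y \<oplus>\<^sub>C x = \<zero>\<^sub>C" if x: "x \<in> carrier C" for x
 proof (rule bexI)
  show "(\<lambda>n. \<ominus>\<^bsub>Q n\<^esub> x n) \<oplus>\<^sub>C x = \<zero>\<^sub>C" using xn[OF x] by (simp add: C_add C_zero Q.l_neg)
  show "(\<lambda>n. \<ominus>\<^bsub>Q n\<^esub> x n) \<in> carrier C"
  proof (rule C_memI)
   fix n
   have m: "\<ominus>\<^bsub>Q m\<^esub> (V m +> a) = V m +> (\<ominus> a)" if "a \<in> carrier A" for a m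
    using additive_minus[OF A.abelian_group_axioms Q.abelian_group_axioms ring_hom_additive[OF coset_hom] that] by simp
   obtain a where "a \<in> carrier A" "x n = V n +> a" "x (Suc n) = V (Suc n) +> a"
    using C_rep[OF x] .
   then show "\<exists>a\<in>carrier A. \<ominus>\<^bsub>Q n\<^esub> x n = V n +> a & \<ominus>\<^bsub>Q (Suc n)\<^esub> x (Suc n) = V (Suc n) +> a"
    by (intro bexI[of _ "\<ominus> a"]) (simp_all only: m A.a_inv_closed simp_thms)
  qed
 qed
 show ?thesis
 proof (rule cringI)
  show "abelian_group C"
  proof (rule abelian_groupI)
   show "\<zero>\<^sub>C \<in> carrier C" unfolding zero by (simp add: \<iota>_closed)
  qed (auto simp: add neg, auto simp: C_add C_zero xn Q.a_ac)
  show "comm_monoid C"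
  proof (rule comm_monoidI)
   show "\<one>\<^sub>C \<in> carrier C" unfolding one by (simp add: \<iota>_closed)
  qed (auto simp: mult, auto simp: C_mult C_one xn Q.m_ac)
 qed (simp add: C_add C_mult xn Q.l_distr)
qed

lemma \<iota>_hom: "\<iota> \<in> ring_hom A C"
 by (rule ring_hom_memI) (simp_all add: \<iota>_closed, simp_all add: completion_map_def C_mult C_add C_one coset_simps)

text \<open>Scalars act on the completion through the images of the constants, so the record is
  literally the one that \<open>alg_via\<close> builds from this map.\<close>

lemma algebra_C:
 assumes "algebra k A"
 shows "algebra k C"
proof -
 interpret k: algebra k A by fact
 have "(\<lambda>c. c \<odot> \<one>) \<in> ring_hom k A"
  by (rule ring_hom_memI) (simp_all add: k.smult_l_distr k.smult_assoc1 k.smult_assoc2)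
 then have h: "(\<lambda>c. \<iota> (c \<odot> \<one>)) \<in> ring_hom k C"
  using ring_hom_trans[OF _ \<iota>_hom] by (fastforce simp: comp_def)
 have "alg_via (\<lambda>c. \<iota> (c \<odot> \<one>)) C = C"
  by (simp add: alg_via_def completion_def Let_def)
 then show ?thesis using algebra_alg_via[OF k.R_cring cring_C h] by simp
qed

lemma \<iota>_smult:
 assumes "algebra k A" "c \<in> carrier k" "a \<in> carrier A"
 shows "\<iota> (c \<odot> a) = c \<odot>\<^sub>C \<iota> a"
proof -
 interpret k: algebra k A by fact
 have "c \<odot> a = (c \<odot> \<one>) \<otimes> a" using assms by (simp add: k.smult_assoc2)
 then show ?thesis using assms by (simp add: C_smult ring_hom_mult[OF \<iota>_hom])
qed

section \<open>Elements outside the maximal ideal become units in the completion\<close>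

lemma inverse_mod_v: "s \<in> carrier A ==> s \<notin> v ==> \<exists>y\<in>carrier A. \<one> \<ominus> s \<otimes> y \<in> v"
proof -
 assume s: "s \<in> carrier A" "s \<notin> v"
 interpret Qv: field "A Quot v" by (rule v.quotient_is_field[OF A.is_cring])
 have h: "(\<lambda>a. v +> a) \<in> ring_hom A (A Quot v)" using v.rcos_ring_hom by simp
 have eq: "v +> a = v +> b \<longleftrightarrow> a \<ominus> b \<in> v" if "a \<in> carrier A" "b \<in> carrier A" for a b
  using A.quotient_eq_iff_same_a_r_cos[OF v.is_ideal] that by blast
 have z: "v +> \<zero> = \<zero>\<^bsub>A Quot v\<^esub>"
  using additive_zero[OF A.abelian_group_axioms Qv.abelian_group_axioms ring_hom_additive[OF h]] .
 have "v +> s ~= \<zero>\<^bsub>A Quot v\<^esub>"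
  using s eq[of s "\<zero>"] unfolding z[symmetric] by (simp add: a_minus_def)
 then have "v +> s \<in> Units (A Quot v)" using Qv.field_Units ring_hom_closed[OF h s(1)] by auto
 then obtain Z where Z: "Z \<in> carrier (A Quot v)" "(v +> s) \<otimes>\<^bsub>A Quot v\<^esub> Z = \<one>\<^bsub>A Quot v\<^esub>"
  by (auto simp: Units_def)
 then obtain y where y: "y \<in> carrier A" "Z = v +> y" by (auto simp: FactRing_def A_RCOSETS_def')
 have "v +> \<one> = v +> (s \<otimes> y)"
  using Z y s by (simp add: ring_hom_mult[OF h] ring_hom_one[OF h])
 then show ?thesis using eq y s by auto
qed

lemma inverse_mod: "s \<in> carrier A ==> s \<notin> v ==> \<exists>y\<in>carrier A. \<one> \<ominus> s \<otimes> y \<in> V n"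
proof (induction n)
 case 0
 then show ?case by (auto intro!: bexI[of _ "\<zero>"])
next
 case (Suc n)
 then obtain y where y: "y \<in> carrier A" "\<one> \<ominus> s \<otimes> y \<in> V n" by auto
 obtain z where z: "z \<in> carrier A" "\<one> \<ominus> s \<otimes> z \<in> v" using inverse_mod_v Suc.prems by auto
 \<comment> \<open>An error in \<open>V n\<close> times an error in \<open>v\<close> lies in the
   next power, and the product is again \<open>\<one>\<close> minus a multiple of
   \<open>s\<close>.\<close>
 have "(\<one> \<ominus> s \<otimes> y) \<otimes> (\<one> \<ominus> s \<otimes> z) \<in> V (Suc n)"
  using ideal_prod.prod[OF y(2) z(2)] by (simp add: ideal_power.simps(2))
 moreover have "(\<one> \<ominus> s \<otimes> y) \<otimes> (\<one> \<ominus> s \<otimes> z) =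
   \<one> \<ominus> s \<otimes> (y \<oplus> z \<ominus> s \<otimes> y \<otimes> z)"
  using Suc.prems(1) y(1) z(1) by algebra
 ultimately show ?case using y z Suc.prems by (auto intro!: bexI[of _ "y \<oplus> z \<ominus> s \<otimes> y \<otimes> z"])
qed

text \<open>If \<open>y\<close> is inverse to \<open>s\<close> modulo \<open>V n\<close>, then
  \<open>a\<close> is the sum of \<open>(\<one> \<ominus> s \<otimes> y) \<otimes> a\<close> and
  \<open>y \<otimes> (s \<otimes> a)\<close>, both of which lie in \<open>V n\<close>.\<close>

lemma V_cancel:
 assumes s: "s \<in> carrier A" "s \<notin> v" and a: "a \<in> carrier A" "s \<otimes> a \<in> V n"
 shows "a \<in> V n"
proof -
 obtain y where y: "y \<in> carrier A" "\<one> \<ominus> s \<otimes> y \<in> V n" using inverse_mod s by blast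
 interpret Vn: ideal "V n" A by (rule ideal_V)
 have "a = (\<one> \<ominus> s \<otimes> y) \<otimes> a \<oplus> y \<otimes> (s \<otimes> a)"
  using s(1) a(1) y(1) by algebra
 moreover have "(\<one> \<ominus> s \<otimes> y) \<otimes> a \<in> V n" using Vn.I_r_closed y a by blast
 moreover have "y \<otimes> (s \<otimes> a) \<in> V n" using Vn.I_l_closed y a by blast
 ultimately show ?thesis using Vn.a_closed by metis
qed

text \<open>Inverses modulo a power of \<open>v\<close> are unique by \<open>V_cancel\<close>; hence
  those chosen independently at all levels are compatible and define an element of the
  completion.\<close>

lemma \<iota>_unit:
 assumes s: "s \<in> carrier A" "s \<notin> v"
 shows "\<exists>u\<in>carrier C. u \<otimes>\<^sub>C \<iota> s = \<one>\<^sub>C"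
proof -
 have "\<forall>n. \<exists>y. y \<in> carrier A & \<one> \<ominus> s \<otimes> y \<in> V n" using inverse_mod[OF s] by blast
 then obtain y where y: "!!n. y n \<in> carrier A" "!!n. \<one> \<ominus> s \<otimes> y n \<in> V n" by metis
 have eq: "V n +> y n = V n +> y (Suc n)" for n
 proof -
  interpret Vn: ideal "V n" A by (rule ideal_V)
  have 1: "\<one> \<ominus> s \<otimes> y n \<in> V n" "\<one> \<ominus> s \<otimes> y (Suc n) \<in> V n" using y V_decreasing by blast+
  have c: "y n \<in> carrier A" "y (Suc n) \<in> carrier A" using y by auto
  have "s \<otimes> (y n \<ominus> y (Suc n)) = (\<one> \<ominus> s \<otimes> y (Suc n)) \<oplus> \<ominus> (\<one> \<ominus> s \<otimes> y n)"
   using s(1) c by algebra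
  then have "s \<otimes> (y n \<ominus> y (Suc n)) \<in> V n" using 1 Vn.a_closed Vn.a_inv_closed by metis
  then show ?thesis using V_cancel[OF s] c coset_eq_iff by auto
 qed
 define u where "u n = V n +> y n" for n
 have u: "u \<in> carrier C"
  by (rule C_memI) (use y eq in \<open>auto simp: u_def intro!: bexI[of _ "y (Suc _)"]\<close>)
 have "(u \<otimes>\<^sub>C \<iota> s) n = \<one>\<^bsub>Q n\<^esub>" for n
 proof -
  interpret Vn: ideal "V n" A by (rule ideal_V)
  have c: "y n \<in> carrier A" using y by auto
  have "y n \<otimes> s \<ominus> \<one> = \<ominus> (\<one> \<ominus> s \<otimes> y n)" using s(1) c by algebra
  then have "y n \<otimes> s \<ominus> \<one> \<in> V n" using y Vn.a_inv_closed by metis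
  then have "V n +> (y n \<otimes> s) = V n +> \<one>" using s c coset_eq_iff by auto
  then show ?thesis using s c by (simp add: C_mult completion_map_def u_def coset_simps)
 qed
 then show ?thesis using u by (auto simp: C_one intro!: bexI[of _ u])
qed

end

section \<open>The completion in the presence of a uniformizer\<close>

locale completion_uniformizer = completion_at_maximal +
 fixes t
 assumes t: "t \<in> v"
  and unif: "c \<in> carrier A ==> c ~= \<zero> ==>
   \<exists>(n::nat) s s'. s \<in> carrier A - v & s' \<in> carrier A - v & s \<otimes> c = s' \<otimes> t [^] n"
begin

interpretation prime: primeideal v A
 by (rule A.maximalideal_prime[OF v.maximalideal_axioms])

lemma t_closed [simp]: "t \<in> carrier A"
 using t v.Icarr by auto

lemma D_mult: "s \<in> carrier A - v ==> s' \<in> carrier A - v ==> s \<otimes> s' \<in> carrier A - v"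
 using prime.I_prime by auto

text \<open>After localization at \<open>v\<close> the maximal ideal is generated by
  \<open>t\<close>, hence its powers by the powers of \<open>t\<close>; \<open>w\<close> collects
  the denominators that this costs.\<close>

lemma V_divisible: "z \<in> V m ==> \<exists>w\<in>carrier A - v. \<exists>a\<in>carrier A. w \<otimes> z = a \<otimes> t [^] m"
proof (induction m arbitrary: z)
 case 0
 have "\<one> \<in> carrier A - v" using v.I_notcarr v.one_imp_carrier by auto
 then show ?case using 0 by (intro bexI[of _ "\<one>"] bexI[of _ z]) auto
next
 case (Suc m)
 have sub: "i \<in> carrier A" if "i \<in> ideal_prod A (V m) v" for i
  using that V_sub[of "Suc m"] by (auto simp: ideal_power.simps(2))
 have "z \<in> ideal_prod A (V m) v" using Suc.prems by (simp add: ideal_power.simps(2))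
 then show ?case
 proof (induction z rule: ideal_prod.induct)
  case (prod i j)
  obtain w a where w: "w \<in> carrier A - v" "a \<in> carrier A" "w \<otimes> i = a \<otimes> t [^] m" using Suc.IH[OF prod(1)] by auto
  have ic: "i \<in> carrier A" "j \<in> carrier A" using prod V_sub v.Icarr by auto
  have "\<exists>s\<in>carrier A - v. \<exists>b\<in>carrier A. s \<otimes> j = b \<otimes> t"
  proof (cases "j = \<zero>")
   case True
   then show ?thesis using w by (intro bexI[of _ w] bexI[of _ "\<zero>"]) auto
  next
   case False
   obtain n :: nat and s s' where s: "s \<in> carrier A - v" "s' \<in> carrier A - v" "s \<otimes> j = s' \<otimes> t [^] n"
    using unif[OF ic(2) False] by blast
   \<comment> \<open>With exponent zero, \<open>s'\<close> would be a multiple of \<open>j\<close>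
     and lie in \<open>v\<close>.\<close>
   have "n ~= 0"
   proof
    assume "n = 0"
    then have "s \<otimes> j = s'" using s by simp
    then show False using s v.I_l_closed[OF prod(2)] by auto
   qed
   then obtain m' where "n = Suc m'" using not0_implies_Suc by blast
   then show ?thesis using s by (intro bexI[of _ s] bexI[of _ "s' \<otimes> t [^] m'"]) (auto simp: A.m_assoc)
  qed
  then obtain s b where s: "s \<in> carrier A - v" "b \<in> carrier A" "s \<otimes> j = b \<otimes> t" by auto
  have "(w \<otimes> s) \<otimes> (i \<otimes> j) = (w \<otimes> i) \<otimes> (s \<otimes> j)"
   using w(1,2) s(1,2) ic by (simp add: A.m_ac)
  also have "... = (a \<otimes> b) \<otimes> t [^] Suc m"
   unfolding w(3) s(3) using w(2) s(2) by (simp add: A.m_ac)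
  finally show ?case using D_mult[OF w(1) s(1)] w(2) s(2)
   by (intro bexI[of _ "w \<otimes> s"] bexI[of _ "a \<otimes> b"]) auto
 next
  case (sum s1 s2)
  obtain w a where w: "w \<in> carrier A - v" "a \<in> carrier A" "w \<otimes> s1 = a \<otimes> t [^] Suc m" using sum by auto
  obtain w' a' where w': "w' \<in> carrier A - v" "a' \<in> carrier A" "w' \<otimes> s2 = a' \<otimes> t [^] Suc m" using sum by auto
  have c: "s1 \<in> carrier A" "s2 \<in> carrier A" "w \<in> carrier A" "w' \<in> carrier A" "t [^] Suc m \<in> carrier A"
   using sum sub w w' by auto
  have "(w \<otimes> w') \<otimes> (s1 \<oplus> s2) = w' \<otimes> (w \<otimes> s1) \<oplus> w \<otimes> (w' \<otimes> s2)"
   using c by algebra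
  also have "... = (w' \<otimes> a \<oplus> w \<otimes> a') \<otimes> t [^] Suc m"
   unfolding w(3) w'(3) using c w(2) w'(2) by algebra
  finally show ?case using D_mult[OF w(1) w'(1)] w(2) w'(2) c
   by (intro bexI[of _ "w \<otimes> w'"] bexI[of _ "w' \<otimes> a \<oplus> w \<otimes> a'"]) auto
 qed
qed

lemma pow_t_V: "t [^] n \<in> V n"
proof (induction n)
 case (Suc n)
 then show ?case using ideal_prod.prod[OF Suc t] by (simp add: ideal_power.simps(2))
qed simp

text \<open>Up to elements outside \<open>v\<close>, the factor \<open>c\<close> is
  \<open>t [^] N\<close>, and cancelling it costs \<open>N\<close> levels: for a representative
  \<open>y\<close> at level \<open>n + N\<close>, divisibility of \<open>c \<otimes> y\<close> by
  \<open>t [^] (n + N)\<close> gives divisibility of \<open>y\<close> by \<open>t [^] n\<close>,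
  because \<open>A\<close> is a domain.\<close>

lemma C_torsion_free:
 assumes c: "c \<in> carrier A" "c ~= \<zero>" and x: "x \<in> carrier C" "\<iota> c \<otimes>\<^sub>C x = \<zero>\<^sub>C"
 shows "x = \<zero>\<^sub>C"
proof
 fix n
 obtain N :: nat and s s' where s: "s \<in> carrier A - v" "s' \<in> carrier A - v" "s \<otimes> c = s' \<otimes> t [^] N"
  using unif[OF c] by blast
 have sc: "s \<in> carrier A" "s' \<in> carrier A" "s ~= \<zero>" using s v.zero_closed by auto
 have tN: "t [^] N ~= \<zero>" using s sc c A.integral[of s c] by auto
 have mono: "x (n + m) \<subseteq> x n" for m using x(1) by (induction m) (auto simp: C_carrier)
 obtain y where y: "y \<in> carrier A" "x (n + N) = V (n + N) +> y"
  "x (Suc (n + N)) = V (Suc (n + N)) +> y" using C_rep[OF x(1)] .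
 have "y \<in> x n" using mono[of N] y coset_self by blast
 then have xn: "x n = V n +> y" using coset_rep x(1) by (auto simp: C_carrier)
 have z: "\<zero>\<^bsub>Q m\<^esub> = V m +> \<zero>" for m
  using additive_zero[OF A.abelian_group_axioms ring.is_abelian_group[OF cring.axioms(1)[OF cring_Q]] ring_hom_additive[OF coset_hom]] by simp
 have "V (n + N) +> (c \<otimes> y) = V (n + N) +> \<zero>"
  using fun_cong[OF x(2), of "n + N"] y c by (simp add: C_mult C_zero completion_map_def coset_simps z)
 then have cy: "c \<otimes> y \<in> V (n + N)" using coset_eq_iff[of "c \<otimes> y" "\<zero>"] c y by (simp add: a_minus_def)
 obtain w a where w: "w \<in> carrier A - v" "a \<in> carrier A" "w \<otimes> (c \<otimes> y) = a \<otimes> t [^] (n + N)"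
  using V_divisible[OF cy] by auto
 have "t [^] N \<otimes> ((w \<otimes> s') \<otimes> y) = w \<otimes> (s' \<otimes> t [^] N) \<otimes> y"
  using w sc y by (simp add: A.m_ac)
 also have "... = s \<otimes> (w \<otimes> (c \<otimes> y))" unfolding s(3)[symmetric] using w(1,2) sc y c by (simp add: A.m_ac)
 also have "... = t [^] N \<otimes> ((s \<otimes> a) \<otimes> t [^] n)"
  unfolding w(3) using w(1,2) sc by (simp add: A.nat_pow_mult[symmetric] A.m_ac)
 finally have "(w \<otimes> s') \<otimes> y = (s \<otimes> a) \<otimes> t [^] n"
  using A.m_lcancel[OF tN] w sc y by simp
 moreover have "(s \<otimes> a) \<otimes> t [^] n \<in> V n"
  using ideal.I_l_closed[OF ideal_V pow_t_V] w sc by simp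
 ultimately have "y \<in> V n" using V_cancel[of "w \<otimes> s'" y n] D_mult[OF w(1) s(2)] y by simp
 then show "x n = \<zero>\<^sub>C n"
  unfolding xn C_zero z using coset_eq_iff[of y "\<zero>"] y by (simp add: a_minus_def)
qed

text \<open>Comparability is the comparison of two exponents of \<open>t\<close>; torsion-freeness
  and units of the completion have been prepared for this purpose.\<close>

lemma valuation_base_change: "valuation_base_change A C \<iota> (carrier A - v)"
proof (intro valuation_base_change.intro A.domain_axioms cring_C valuation_base_change_axioms.intro)
 show "\<one> \<in> carrier A - v" using v.I_notcarr v.one_imp_carrier by auto
 show "\<exists>s\<in>carrier A - v. \<exists>a\<in>carrier A. s \<otimes> b = a \<otimes> d \<or> s \<otimes> d = a \<otimes> b"
  if bd: "b \<in> carrier A" "d \<in> carrier A" for b d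
 proof -
  have one: "\<one> \<in> carrier A - v" using v.I_notcarr v.one_imp_carrier by auto
  consider "b = \<zero>" | "d = \<zero>" | "b ~= \<zero>" "d ~= \<zero>" by blast
  then show ?thesis
  proof cases
   case 3
   obtain n :: nat and s s' where s: "s \<in> carrier A - v" "s' \<in> carrier A - v" "s \<otimes> b = s' \<otimes> t [^] n"
    using unif[OF bd(1) 3(1)] by blast
   obtain m :: nat and u u' where u: "u \<in> carrier A - v" "u' \<in> carrier A - v" "u \<otimes> d = u' \<otimes> t [^] m"
    using unif[OF bd(2) 3(2)] by blast
   \<comment> \<open>Stated for generic data, to be used a second time with the roles of
     \<open>b\<close> and \<open>d\<close> exchanged.\<close>
   have gen: "(s \<otimes> u') \<otimes> b = (s' \<otimes> t [^] (n - m) \<otimes> u) \<otimes> d"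
    if "m \<le> n" "s \<in> carrier A - v" "s' \<in> carrier A - v" "s \<otimes> b = s' \<otimes> t [^] n"
     "u \<in> carrier A - v" "u' \<in> carrier A - v" "u \<otimes> d = u' \<otimes> t [^] m" "b \<in> carrier A" "d \<in> carrier A"
    for s s' u u' b d and n m :: nat
   proof -
    have pow: "t [^] n = t [^] (n - m) \<otimes> t [^] m" using that(1) by (simp add: A.nat_pow_mult)
    have "(s \<otimes> u') \<otimes> b = u' \<otimes> (s \<otimes> b)" using that(2,3,5,6,8,9) by (simp add: A.m_ac)
    also have "... = u' \<otimes> (s' \<otimes> (t [^] (n - m) \<otimes> t [^] m))"
     unfolding that(4) pow ..
    also have "... = s' \<otimes> t [^] (n - m) \<otimes> (u' \<otimes> t [^] m)" using that(2,3,5,6,8,9) by (simp add: A.m_ac)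
    also have "... = (s' \<otimes> t [^] (n - m) \<otimes> u) \<otimes> d"
     unfolding that(7)[symmetric] using that(2,3,5,6,8,9) by (simp add: A.m_assoc)
    finally show ?thesis .
   qed
   show ?thesis
   proof (cases "m \<le> n")
    case True
    have "s' \<otimes> t [^] (n - m) \<otimes> u \<in> carrier A" using s(2) u(1) by simp
    then show ?thesis using gen[OF True s u bd] D_mult[OF s(1) u(2)] by blast
   next
    case False
    then have nm: "n \<le> m" by simp
    have "u' \<otimes> t [^] (m - n) \<otimes> s \<in> carrier A" using u(2) s(1) by simp
    then show ?thesis using gen[OF nm u s bd(2,1)] D_mult[OF u(1) s(2)] by blast
   qed
  qed (use one bd in \<open>intro bexI[OF _ one] bexI[OF _ A.zero_closed], simp\<close>)+
 qed
qed (use \<iota>_hom \<iota>_unit v.zero_closed C_torsion_free D_mult in auto)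

end


section \<open>Algebraic dependence in fields\<close>

context field
begin

text \<open>The formula of \<open>local_subring\<close>, for an arbitrary set \<open>p\<close>: a
  prime ideal gives the localization, \<open>{\<zero>}\<close> the field of fractions.\<close>

definition fractions :: "'a set => 'a set => 'a set" where
 "fractions B p = {a \<otimes> inv b | a b. a \<in> B & b \<in> B - p}"

abbreviation "frac_field B \<equiv> fractions B {\<zero>}"

lemma inv_nonzero: "b \<in> carrier R ==> b ~= \<zero> ==> inv b \<in> carrier R & inv b ~= \<zero> & b \<otimes> inv b = \<one> & inv b \<otimes> b = \<one>"
 using field_Units by (metis Diff_iff Units_inv_Units Units_inv_closed Units_l_inv Units_r_inv singletonD singletonI)

lemma inv_mult_field:
 assumes "a \<in> carrier R" "a ~= \<zero>" "b \<in> carrier R" "b ~= \<zero>"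
 shows "inv (a \<otimes> b) = inv a \<otimes> inv b"
proof (rule comm_inv_char)
 note ia = inv_nonzero[OF assms(1,2)] and ib = inv_nonzero[OF assms(3,4)]
 have "a \<otimes> b \<otimes> (inv a \<otimes> inv b) = (a \<otimes> inv a) \<otimes> (b \<otimes> inv b)"
  using assms ia ib by (simp add: m_ac del: inv_nonzero)
 then show "a \<otimes> b \<otimes> (inv a \<otimes> inv b) = \<one>" using ia ib by simp
qed (use assms inv_nonzero in auto)

lemma
 assumes B: "subring B R" and p: "\<zero> \<in> p" "\<one> \<notin> p" "!!b d. b \<in> B - p ==> d \<in> B - p ==> b \<otimes> d \<notin> p"
 shows subring_fractions: "subring (fractions B p) R" and subset_fractions: "B \<subseteq> fractions B p"
proof -
 note Bc = subringE[OF B]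
 have c: "b \<in> carrier R" if "b \<in> B" for b using that Bc(1) by auto
 have memI: "a \<otimes> inv b \<in> fractions B p" if "a \<in> B" "b \<in> B - p" for a b
  using that by (auto simp: fractions_def)
 show sub: "B \<subseteq> fractions B p"
 proof
  fix b assume b: "b \<in> B"
  have "inv \<one> = \<one>" by simp
  then show "b \<in> fractions B p" using memI[OF b, of \<one>] Bc(3) p(2) c[OF b] by simp
 qed
 show "subring (fractions B p) R"
 proof (rule subringI)
  show "fractions B p \<subseteq> carrier R"
  proof
   fix h assume "h \<in> fractions B p"
   then obtain a b where ab: "h = a \<otimes> inv b" "a \<in> B" "b \<in> B" "b ~= \<zero>" using p(1) by (auto simp: fractions_def)
   then show "h \<in> carrier R" using c inv_nonzero[of b] by simp
  qed
  show "\<one> \<in> fractions B p" using sub Bc(3) by auto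
  fix h assume "h \<in> fractions B p"
  then obtain a b where ab: "h = a \<otimes> inv b" "a \<in> B" "b \<in> B - p" by (auto simp: fractions_def)
  have b: "b \<in> B" "b ~= \<zero>" using ab p(1) by auto
  note ib = inv_nonzero[OF c[OF b(1)] b(2)]
  have "\<ominus> h = (\<ominus> a) \<otimes> inv b" using ab c ib by (simp add: l_minus)
  then show "\<ominus> h \<in> fractions B p" using memI ab Bc(5) by simp
  fix h' assume "h' \<in> fractions B p"
  then obtain a' b' where ab': "h' = a' \<otimes> inv b'" "a' \<in> B" "b' \<in> B - p" by (auto simp: fractions_def)
  have b': "b' \<in> B" "b' ~= \<zero>" using ab' p(1) by auto
  note ib' = inv_nonzero[OF c[OF b'(1)] b'(2)]
  have bb: "b \<otimes> b' \<in> B - p" using p(3)[OF ab(3) ab'(3)] Bc(6) b b' by simp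
  note cs = c[OF ab(2)] c[OF b(1)] c[OF ab'(2)] c[OF b'(1)] ib ib'
  have i: "inv (b \<otimes> b') = inv b \<otimes> inv b'" using b b' c by (intro inv_mult_field) auto
  have "h \<otimes> h' = (a \<otimes> a') \<otimes> inv (b \<otimes> b')" unfolding i using ab(1) ab'(1) cs by (simp add: m_ac)
  then show "h \<otimes> h' \<in> fractions B p" using memI[OF _ bb] ab ab' Bc(6) by simp
  have "h \<oplus> h' = a \<otimes> inv b \<otimes> (b' \<otimes> inv b') \<oplus> a' \<otimes> inv b' \<otimes> (b \<otimes> inv b)"
   using ab(1) ab'(1) cs by simp
  also have "... = (a \<otimes> b' \<oplus> a' \<otimes> b) \<otimes> inv (b \<otimes> b')" unfolding i using cs(1-4) conjunct1[OF ib] conjunct1[OF ib'] by algebra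
  finally show "h \<oplus> h' \<in> fractions B p" using memI[OF _ bb] ab(2) ab'(2) b b' Bc(6,7) by simp
 qed
qed

lemma subfield_frac_field:
 assumes B: "subring B R"
 shows "subfield (frac_field B) R" "B \<subseteq> frac_field B"
proof -
 have c: "b \<in> carrier R" if "b \<in> B" for b using that subringE(1)[OF B] by auto
 have nz: "b \<otimes> d \<notin> {\<zero>}" if "b \<in> B - {\<zero>}" "d \<in> B - {\<zero>}" for b d using that c integral by blast
 show "B \<subseteq> frac_field B" by (rule subset_fractions[OF B]) (use nz in auto)
 have "subring (frac_field B) R" by (rule subring_fractions[OF B]) (use nz in auto)
 then show "subfield (frac_field B) R"
 proof (rule subfieldI')
  fix h assume "h \<in> frac_field B - {\<zero>}"
  then obtain a b where ab: "h = a \<otimes> inv b" "a \<in> B" "b \<in> B" "b ~= \<zero>" "h ~= \<zero>" by (auto simp: fractions_def)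
  note ib = inv_nonzero[OF c[OF ab(3)] ab(4)]
  have a0: "a ~= \<zero>" using ab ib by auto
  note ia = inv_nonzero[OF c[OF ab(2)] a0]
  have "h \<otimes> (b \<otimes> inv a) = (a \<otimes> inv a) \<otimes> (b \<otimes> inv b)"
   using ab(1) c[OF ab(2)] c[OF ab(3)] conjunct1[OF ia] conjunct1[OF ib] by (simp add: m_ac)
  then have "inv h = b \<otimes> inv a" using ab c ia ib by (intro comm_inv_char) auto
  then show "inv h \<in> frac_field B" using ab(2,3) a0 by (auto simp: fractions_def)
 qed
qed

text \<open>The value of a polynomial given by a coefficient function instead of a list. Shifting
  coefficients, padding with zeros and exchanging the order of summation then act on functions and
  sums.\<close>

definition psum :: "(nat => 'a) => nat => 'a => 'a" where
 "psum c n x = (\<Oplus>i\<in>{..<n}. c i \<otimes> x [^] i)"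

lemma psum_0 [simp]: "psum c 0 x = \<zero>"
 by (simp add: psum_def)

lemma psum_Suc:
 assumes "!!i. i < Suc n ==> c i \<in> carrier R" "x \<in> carrier R"
 shows "psum c (Suc n) x = c n \<otimes> x [^] n \<oplus> psum c n x"
 unfolding psum_def lessThan_Suc using assms by (subst finsum_insert) auto

lemma psum_closed [simp]: "(!!i. i < n ==> c i \<in> carrier R) ==> x \<in> carrier R ==> psum c n x \<in> carrier R"
 unfolding psum_def by (auto intro!: finsum_closed)

lemma psum_cong: "(!!i. i < n ==> c i = d i) ==> (!!i. i < n ==> d i \<in> carrier R) ==> x \<in> carrier R ==> psum c n x = psum d n x"
 unfolding psum_def by (intro finsum_cong') auto

text \<open>Horner's rule: the constant term is split off, where \<open>psum_Suc\<close> splits off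
  the leading one.\<close>

lemma psum_Suc2:
 assumes "!!i. i < Suc n ==> c i \<in> carrier R" "x \<in> carrier R"
 shows "psum c (Suc n) x = c 0 \<oplus> x \<otimes> psum (\<lambda>i. c (Suc i)) n x"
 using assms
proof (induction n)
 case 0
 then show ?case by (subst psum_Suc) auto
next
 case (Suc n)
 have c: "!!i. i < Suc n ==> c (Suc i) \<in> carrier R" "c 0 \<in> carrier R" using Suc.prems by auto
 have "psum c (Suc (Suc n)) x = c (Suc n) \<otimes> x [^] Suc n \<oplus> (c 0 \<oplus> x \<otimes> psum (\<lambda>i. c (Suc i)) n x)"
  using Suc by (subst psum_Suc) auto
 also have "... = c 0 \<oplus> x \<otimes> (c (Suc n) \<otimes> x [^] n \<oplus> psum (\<lambda>i. c (Suc i)) n x)"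
 proof -
  have "psum (\<lambda>i. c (Suc i)) n x \<in> carrier R" "x [^] n \<in> carrier R" "c (Suc n) \<in> carrier R" using c Suc.prems by auto
  then show ?thesis using c(2) Suc.prems(2) by (simp add: r_distr a_ac m_ac)
 qed
 also have "... = c 0 \<oplus> x \<otimes> psum (\<lambda>i. c (Suc i)) (Suc n) x"
  using c Suc.prems by (subst psum_Suc[of n]) auto
 finally show ?case .
qed

lemma psum_mem:
 assumes "subring B R" "!!i. i < n ==> c i \<in> B" "x \<in> B"
 shows "psum c n x \<in> B"
proof -
 have xp: "x [^] (i::nat) \<in> B" for i
  by (induction i) (use assms subringE(3,6)[OF assms(1)] in auto)
 have BR: "B \<subseteq> carrier R" using subringE(1)[OF assms(1)] .
 show ?thesis using assms(2)
 proof (induction n)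
  case 0
  then show ?case using subringE(2)[OF assms(1)] by simp
 next
  case (Suc n)
  have "psum c (Suc n) x = c n \<otimes> x [^] n \<oplus> psum c n x"
   using Suc.prems BR assms(3) by (intro psum_Suc) auto
  then show ?case using Suc subringE(6,7)[OF assms(1)] xp by auto
 qed
qed

lemma psum_shift:
 assumes "!!i. i < n ==> c i \<in> carrier R" "x \<in> carrier R" "n \<le> m"
 shows "psum (\<lambda>i. if i < n then c i else \<zero>) m x = psum c n x"
 using assms(3)
proof (induction m rule: dec_induct)
 case base
 show ?case using assms by (intro psum_cong) auto
next
 case (step m)
 then show ?case using assms by (subst psum_Suc) auto
qed

section \<open>Algebraic elements and transcendence degree one\<close>

lemma eval_eq_psum:
 assumes "set p \<subseteq> carrier R" "x \<in> carrier R"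
 shows "eval p x = psum (coeff p) (length p) x"
 using assms(1)
proof (induction p)
 case Nil
 then show ?case by simp
next
 case (Cons a p)
 have c: "coeff p i \<in> carrier R" for i using Cons.prems by (intro coeff_in_carrier) auto
 have "psum (coeff (a # p)) (length (a # p)) x = a \<otimes> x [^] length p \<oplus> psum (coeff (a # p)) (length p) x"
  using Cons.prems assms(2) c by (simp add: psum_Suc del: coeff.simps) simp
 also have "psum (coeff (a # p)) (length p) x = psum (coeff p) (length p) x"
  using c assms(2) by (intro psum_cong) auto
 finally show ?case using Cons by simp
qed

lemma eval_list_of_coeffs:
 assumes "!!i. i < n ==> c i \<in> carrier R" "x \<in> carrier R"
 shows "eval (map c (rev [0..<n])) x = psum c n x"
 using assms(1)
proof (induction n)
 case (Suc n)
 then show ?case using assms(2) by (subst psum_Suc) auto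
qed simp

lemma algebraic_psumI:
 assumes B: "subring B R" and c: "!!i. i < n ==> c i \<in> B" and i: "i < n" "c i ~= \<zero>"
  and x: "x \<in> carrier R" and z: "psum c n x = \<zero>"
 shows "algebraic B x"
proof -
 let ?p = "map c (rev [0..<n])"
 have pB: "set ?p \<subseteq> B" using c by auto
 have BR: "B \<subseteq> carrier R" using subringE(1)[OF B] .
 have "normalize ?p \<in> carrier (B[X])"
  using normalize_gives_polynomial[OF pB] univ_poly_carrier by blast
 moreover have "normalize ?p ~= []"
 proof
  \<comment> \<open>Normalizing only strips leading zeros, so an empty result means that all
    coefficients are zero.\<close>
  assume "normalize ?p = []"
  then have "?p = replicate (length ?p) \<zero>" using normalize_def'(1)[of ?p] by simp
  then have "\<forall>a\<in>set ?p. a = \<zero>" by (metis in_set_replicate)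
  then show False using i by auto
 qed
 moreover have "eval (normalize ?p) x = \<zero>"
  using eval_normalize[of ?p x] eval_list_of_coeffs[of n c x] pB BR x z c by (auto simp: subset_iff)
 ultimately show ?thesis using algebraicI by (simp add: over_def)
qed

lemma algebraic_psumE:
 assumes B: "subring B R" and x: "x \<in> carrier R" and alg: "algebraic B x"
 shows "\<exists>c n. (\<forall>i<n. c i \<in> B) & (\<exists>i<n. c i ~= \<zero>) & psum c n x = \<zero>"
proof -
 obtain p where p: "p \<in> carrier (B[X])" "p ~= []" "eval p x = \<zero>"
  using algebraicE[OF B x] alg by (auto simp: over_def)
 then have pol: "set p \<subseteq> B" "lead_coeff p ~= \<zero>"
  by (auto simp: univ_poly_carrier[symmetric] polynomial_def)
 have BR: "B \<subseteq> carrier R" using subringE(1)[OF B] .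
 show ?thesis
 proof (rule exI[of _ "coeff p"], rule exI[of _ "length p"], intro conjI allI impI)
  show "coeff p i \<in> B" if "i < length p" for i
   using that pol(1) by (induction p) auto
  show "\<exists>i<length p. coeff p i ~= \<zero>" using p(2) pol(2) by (cases p) auto
  show "psum (coeff p) (length p) x = \<zero>" using eval_eq_psum[of p x] pol(1) BR x p(3) by auto
 qed
qed

lemma simple_extension_psum:
 assumes K: "subring K R" and x: "x \<in> carrier R" and a: "a \<in> simple_extension K x"
 shows "\<exists>c n. (\<forall>i<n. c i \<in> K) & a = psum c n x"
 using a
proof (induction rule: simple_extension.induct)
 case zero
 show ?case by (intro exI[of _ "\<lambda>_. \<zero>"] exI[of _ 0]) simp
next
 case (lin k1 k2)
 then obtain c n where c: "\<forall>i<n. c i \<in> K" "k1 = psum c n x" by auto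
 have KR: "K \<subseteq> carrier R" using subringE(1)[OF K] .
 let ?c = "\<lambda>i. case i of 0 => k2 | Suc j => c j"
 have c': "\<forall>i<Suc n. ?c i \<in> K" using c lin by (auto split: nat.split)
 have "psum ?c (Suc n) x = k2 \<oplus> x \<otimes> psum c n x"
  using c(1) lin(2) KR x by (subst psum_Suc2) (auto split: nat.split)
 also have "... = k1 \<otimes> x \<oplus> k2"
 proof -
  have "k2 \<in> carrier R" "k1 \<in> carrier R"
   using KR lin(1,2) simple_extension_in_carrier[OF KR x] by auto
  then show ?thesis using c(2) x by (simp add: m_comm a_comm)
 qed
 finally show ?case using c' by metis
qed

text \<open>Multiplying a relation by a common denominator \<open>d\<close> of its coefficients
  moves them into \<open>B\<close> and keeps a nonzero one nonzero.\<close>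

lemma algebraic_frac_field:
 assumes B: "subring B R" and x: "x \<in> carrier R" and alg: "algebraic (frac_field B) x"
 shows "algebraic B x"
proof -
 have BR: "B \<subseteq> carrier R" using subringE(1)[OF B] .
 obtain c n where c: "!!i. i < n ==> c i \<in> frac_field B" "\<exists>i<n. c i ~= \<zero>" "psum c n x = \<zero>"
  using algebraic_psumE[OF subfieldE(1)[OF subfield_frac_field(1)[OF B]] x alg] by blast
 have cR: "!!i. i < n ==> c i \<in> carrier R"
  using c(1) subfieldE(3)[OF subfield_frac_field(1)[OF B]] by auto
 have "\<exists>d\<in>B. d ~= \<zero> & (\<forall>i<m. d \<otimes> c i \<in> B)" if "m \<le> n" for m
  using that
 proof (induction m)
  case 0
  show ?case using subringE(3)[OF B] by (intro bexI[of _ \<one>]) auto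
 next
  case (Suc m)
  then obtain d where d: "d \<in> B" "d ~= \<zero>" "\<forall>i<m. d \<otimes> c i \<in> B" by auto
  have "c m \<in> frac_field B" using c(1) Suc.prems by auto
  then obtain a b where ab: "c m = a \<otimes> inv b" "a \<in> B" "b \<in> B" "b ~= \<zero>" by (auto simp: fractions_def)
  have carr: "a \<in> carrier R" "b \<in> carrier R" "d \<in> carrier R" using ab d BR by auto
  note ib = inv_nonzero[OF carr(2) ab(4)]
  have "b \<otimes> c m = a \<otimes> (b \<otimes> inv b)" unfolding ab(1) using carr ib by (simp add: m_ac)
  then have bc: "b \<otimes> c m = a" using carr ib by simp
  have "d \<otimes> b \<otimes> c i \<in> B" if "i < Suc m" for i
  proof (cases "i = m")
   case True
   have "d \<otimes> b \<otimes> c m = d \<otimes> (b \<otimes> c m)" using carr cR[of m] Suc.prems by (simp add: m_assoc)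
   then show ?thesis using True bc ab(2) d(1) subringE(6)[OF B] by simp
  next
   case False
   then have "d \<otimes> c i \<in> B" using d(3) that by auto
   moreover have "d \<otimes> b \<otimes> c i = b \<otimes> (d \<otimes> c i)" using carr cR[of i] that Suc.prems by (simp add: m_ac)
   ultimately show ?thesis using ab(3) subringE(6)[OF B] by simp
  qed
  moreover have "d \<otimes> b \<in> B" "d \<otimes> b ~= \<zero>" using d ab subringE(6)[OF B] carr integral by blast+
  ultimately show ?case by blast
 qed
 then obtain d where d: "d \<in> B" "d ~= \<zero>" "!!i. i < n ==> d \<otimes> c i \<in> B" by blast
 obtain i where i: "i < n" "c i ~= \<zero>" using c(2) by auto
 have dR: "d \<in> carrier R" using d BR by auto
 have "psum (\<lambda>i. d \<otimes> c i) n x = d \<otimes> psum c n x"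
 proof -
  have "d \<otimes> psum c n x = (\<Oplus>i\<in>{..<n}. d \<otimes> (c i \<otimes> x [^] i))"
   unfolding psum_def using cR dR x by (intro mult_finsum) auto
  also have "... = psum (\<lambda>i. d \<otimes> c i) n x"
   unfolding psum_def using cR dR x by (intro finsum_cong') (auto simp: m_assoc)
  finally show ?thesis ..
 qed
 then have z: "psum (\<lambda>i. d \<otimes> c i) n x = \<zero>" using c(3) dR by simp
 have "d \<otimes> c i ~= \<zero>" using i d dR cR integral by blast
 then show ?thesis using algebraic_psumI[OF B d(3) i(1) _ x z] by blast
qed

text \<open>A relation for \<open>u\<close> whose coefficients are polynomials in \<open>t\<close>
  is a polynomial in both elements, and can be read as a relation for \<open>t\<close>. It stays
  nontrivial: if all its new coefficients were zero, transcendence of \<open>u\<close> would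
  annihilate every \<open>c i j\<close>.\<close>

lemma algebraic_exchange:
 assumes K: "subring K R" and t: "t \<in> carrier R" and u: "u \<in> carrier R"
  and tr: "transcendental K u" and alg: "algebraic (simple_extension K t) u"
 shows "algebraic (simple_extension K u) t"
proof -
 have KR: "K \<subseteq> carrier R" using subringE(1)[OF K] .
 obtain a n where a: "!!i. i < n ==> a i \<in> simple_extension K t" "\<exists>i<n. a i ~= \<zero>" "psum a n u = \<zero>"
  using algebraic_psumE[OF simple_extension_is_subring[OF K t] u alg] by blast
 have "\<forall>i\<in>{..<n}. \<exists>cm. (\<forall>j<snd cm. fst cm j \<in> K) & a i = psum (fst cm) (snd cm) t"
  using simple_extension_psum[OF K t a(1)] by fastforce
 from bchoice[OF this] obtain cm where cm: "\<forall>i\<in>{..<n}. (\<forall>j<snd (cm i). fst (cm i) j \<in> K) & a i = psum (fst (cm i)) (snd (cm i)) t" ..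
 define m where "m = (\<Sum>i<n. snd (cm i))"
 have le: "snd (cm i) \<le> m" if "i < n" for i unfolding m_def using that by (intro member_le_sum) auto
 \<comment> \<open>Pads the coefficients of all \<open>a i\<close> to the common length
   \<open>m\<close>, so that the double sum can be exchanged.\<close>
 define c where "c i j = (if j < snd (cm i) then fst (cm i) j else \<zero>)" for i j
 have cK: "c i j \<in> K" if "i < n" for i j using that cm subringE(2)[OF K] by (auto simp: c_def)
 have cR: "c i j \<in> carrier R" if "i < n" for i j using cK[OF that] KR by auto
 have ac: "a i = psum (c i) m t" if "i < n" for i
  unfolding c_def using that cm le[OF that] KR t by (subst psum_shift) auto
 define Q where "Q j = psum (\<lambda>i. c i j) n u" for j
 have QK: "Q j \<in> simple_extension K u" for j
  unfolding Q_def
  by (rule psum_mem[OF simple_extension_is_subring[OF K u]])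
   (use cK simple_extension_incl[OF KR u] simple_extension_mem[OF K u] in auto)
 have "psum Q m t = (\<Oplus>j\<in>{..<m}. \<Oplus>i\<in>{..<n}. c i j \<otimes> u [^] i \<otimes> t [^] j)"
  unfolding psum_def Q_def using cR t u by (intro finsum_cong' finsum_mult) (auto intro!: finsum_closed)
 also have "... = (\<Oplus>i\<in>{..<n}. \<Oplus>j\<in>{..<m}. c i j \<otimes> u [^] i \<otimes> t [^] j)"
  using cR t u by (intro finsum_swap) auto
 also have "... = psum a n u"
  unfolding psum_def
 proof (intro finsum_cong')
  fix i assume i: "i \<in> {..<n}"
  have "a i \<otimes> u [^] i = (\<Oplus>j\<in>{..<m}. c i j \<otimes> t [^] j \<otimes> u [^] i)"
   using i ac[of i] cR t u unfolding psum_def by (simp only: lessThan_iff) (intro finsum_mult, auto)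
  also have "... = (\<Oplus>j\<in>{..<m}. c i j \<otimes> u [^] i \<otimes> t [^] j)"
   using i cR t u by (intro finsum_cong') (auto simp: m_ac)
  finally show "(\<Oplus>j\<in>{..<m}. c i j \<otimes> u [^] i \<otimes> t [^] j) = a i \<otimes> u [^] i" ..
 qed (use a(1) simple_extension_in_carrier[OF KR t] u in auto)
 finally have z: "psum Q m t = \<zero>" using a(3) by simp
 have "\<exists>j<m. Q j ~= \<zero>"
 proof (rule ccontr)
  assume "\<not> (\<exists>j<m. Q j ~= \<zero>)"
  then have Q0: "!!j. j < m ==> psum (\<lambda>i. c i j) n u = \<zero>" by (auto simp: Q_def)
  have c0: "c i j = \<zero>" if "i < n" "j < m" for i j
  proof (rule ccontr)
   assume "c i j ~= \<zero>"
   then have "algebraic K u"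
    using algebraic_psumI[OF K _ that(1) _ u Q0[OF that(2)]] cK by blast
   then show False using tr by simp
  qed
  obtain i where i: "i < n" "a i ~= \<zero>" using a(2) by auto
  have "psum (c i) m t = \<zero>"
   unfolding psum_def using c0[OF i(1)] t by (intro add.finprod_one_eqI) auto
  then show False using ac[OF i(1)] i(2) by simp
 qed
 then show ?thesis
  using algebraic_psumI[OF simple_extension_is_subring[OF K u] _ _ _ t z] QK by blast
qed

text \<open>Any transcendental \<open>u\<close> can take the place of the given \<open>t\<close>: by
  exchange \<open>t\<close> is algebraic over \<open>K(u)\<close>, and \<open>w\<close> then lies in
  a tower of two finite extensions of \<open>K(u)\<close>. Clearing denominators puts the
  coefficients into the polynomial ring in \<open>u\<close>, where divisibility by \<open>u\<close>
  makes sense.\<close>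

lemma algebraic_over_one_variable:
 assumes K: "subfield K R" and t: "t \<in> carrier R"
  and alg: "!!y. y \<in> carrier R ==> algebraic (generate_field R (insert t K)) y"
  and u: "u \<in> carrier R" and tr: "transcendental K u" and w: "w \<in> carrier R"
 shows "algebraic (simple_extension K u) w"
proof -
 note Ks = subfieldE(1)[OF K] and KR = subfieldE(3)[OF K]
 note Bt = simple_extension_is_subring[OF Ks t] and Bu = simple_extension_is_subring[OF Ks u]
 define Fu where "Fu = frac_field (simple_extension K u)"
 have Fu: "subfield Fu R" "simple_extension K u \<subseteq> Fu" unfolding Fu_def using subfield_frac_field[OF Bu] by auto
 have "generate_field R (insert t K) \<subseteq> frac_field (simple_extension K t)"
  using t KR subfield_frac_field[OF Bt] simple_extension_incl[OF KR t] simple_extension_mem[OF Ks t]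
  by (intro generate_field_min_subfield1) auto
 then have algt: "algebraic (simple_extension K t) y" if "y \<in> carrier R" for y
  using algebraic_frac_field[OF Bt that] algebraic_mono alg[OF that] unfolding over_def by blast
 have "algebraic (simple_extension K u) t" by (rule algebraic_exchange[OF Ks t u tr algt[OF u]])
 then have tFu: "algebraic Fu t" using algebraic_mono[OF Fu(2)] unfolding over_def by blast
 define F1 where "F1 = simple_extension Fu t"
 have F1: "subfield F1 R"
  unfolding F1_def using simple_extension_is_subfield[OF Fu(1) t] tFu by (simp add: over_def)
 have f1: "finite_dimension Fu F1"
  unfolding F1_def using finite_dimension_simple_extension[OF Fu(1) t] tFu by (simp add: over_def)
 have "K \<subseteq> Fu" using Fu(2) simple_extension_incl[OF KR u] by blast
 then have "simple_extension K t \<subseteq> F1" unfolding F1_def by (rule mono_simple_extension)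
 then have wF1: "algebraic F1 w" using algebraic_mono algt[OF w] unfolding over_def by blast
 have "finite_dimension F1 (simple_extension F1 w)"
  using finite_dimension_simple_extension[OF F1 w] wF1 by (simp add: over_def)
 then have fd: "finite_dimension Fu (simple_extension F1 w)"
  using telescopic_base_dim(1)[OF Fu(1) F1 f1] by blast
 have sub: "subring (simple_extension F1 w) R" using simple_extension_is_subring[OF subfieldE(1)[OF F1] w] .
 have "w \<in> simple_extension F1 w" using simple_extension_mem[OF subfieldE(1)[OF F1] w] .
 then have "algebraic Fu w" using finite_dimension_imp_algebraic[OF Fu(1) sub fd] by (simp add: over_def)
 then show ?thesis unfolding Fu_def by (rule algebraic_frac_field[OF Bu w])
qed

text \<open>Splits off the power of \<open>x\<close> that belongs to the lowest nonzero coefficient.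
  If \<open>K\<close> is a field and \<open>x\<close> lies in a proper ideal of \<open>B\<close>,
  the remaining factor with constant term \<open>k\<close> stays outside that ideal, so
  \<open>j\<close> measures divisibility by \<open>x\<close>.\<close>

lemma psum_split_power:
 assumes K: "subring K R" "K \<subseteq> B" and B: "subring B R" and x: "x \<in> B"
  and c: "!!i. i < n ==> c i \<in> K" "\<exists>i<n. c i ~= \<zero>"
 shows "\<exists>(j::nat) k b. k \<in> K & k ~= \<zero> & b \<in> B & psum c n x = x [^] j \<otimes> (k \<oplus> x \<otimes> b)"
 using c
proof (induction n arbitrary: c)
 case 0
 then show ?case by simp
next
 case (Suc n)
 have BR: "B \<subseteq> carrier R" using subringE(1)[OF B] .
 have xR: "x \<in> carrier R" using x BR by auto
 have cR: "!!i. i < Suc n ==> c i \<in> carrier R" using Suc.prems K(2) BR by blast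
 have s: "psum c (Suc n) x = c 0 \<oplus> x \<otimes> psum (\<lambda>i. c (Suc i)) n x"
  using cR xR by (rule psum_Suc2)
 show ?case
 proof (cases "c 0 = \<zero>")
  case False
  have "psum (\<lambda>i. c (Suc i)) n x \<in> B" using Suc.prems(1) K(2) x by (intro psum_mem[OF B]) auto
  then show ?thesis using s False Suc.prems(1)[of 0] cR[of 0] xR BR
   by (intro exI[of _ 0] exI[of _ "c 0"] exI[of _ "psum (\<lambda>i. c (Suc i)) n x"]) auto
 next
  case True
  have "\<exists>i<n. c (Suc i) ~= \<zero>" using Suc.prems(2) True by (metis less_Suc_eq_0_disj)
  then obtain j :: nat and k b where jkb: "k \<in> K" "k ~= \<zero>" "b \<in> B"
   "psum (\<lambda>i. c (Suc i)) n x = x [^] j \<otimes> (k \<oplus> x \<otimes> b)"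
   using Suc.IH[of "\<lambda>i. c (Suc i)"] Suc.prems(1) by auto
  have kb: "k \<in> carrier R" "b \<in> carrier R" using jkb K(2) BR by auto
  have "psum c (Suc n) x = x \<otimes> (x [^] j \<otimes> (k \<oplus> x \<otimes> b))" using s True jkb(4) xR kb by simp
  also have "... = x [^] Suc j \<otimes> (k \<oplus> x \<otimes> b)" using xR kb by (simp add: m_ac)
  finally show ?thesis using jkb(1-3) by blast
 qed
qed

end


section \<open>Valuations on a regular curve\<close>

context field
begin

lemma inv_cancel:
 assumes "a \<in> carrier R" "a ~= \<zero>" "b \<in> carrier R"
 shows "b \<otimes> a \<otimes> inv a = b" "b \<otimes> inv a \<otimes> a = b"
 using inv_nonzero[OF assms(1,2)] assms by (simp_all add: m_assoc)

lemma inv_inv_field: "a \<in> carrier R ==> a ~= \<zero> ==> inv (inv a) = a"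
 by (simp add: field_Units)

lemma pow_nonzero: "a \<in> carrier R ==> a ~= \<zero> ==> a [^] (n::nat) ~= \<zero>"
 by (induction n) (auto simp: integral_iff)

lemma subring_pow: "subring B R ==> a \<in> B ==> a [^] (n::nat) \<in> B"
 by (induction n) (auto simp: subringE(3,6))

text \<open>A local ring of a curve whose maximal ideal is \<open>(t)\<close> is a valuation ring with uniformizer \<open>t\<close>.\<close>

lemma principal_local_ring:
 assumes K: "subfield K R" and V: "subring V R" "K \<subseteq> V" and frac: "carrier R \<subseteq> frac_field V"
  and t: "t \<in> V" and nonunit: "!!y. y \<in> V ==> (y = \<zero> \<or> inv y \<notin> V) \<longleftrightarrow> (\<exists>z\<in>V. y = z \<otimes> t)"
  and alg: "!!u w. u \<in> carrier R ==> w \<in> carrier R ==> transcendental K u ==> algebraic (simple_extension K u) w"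
  and f: "f \<in> carrier R" "f ~= \<zero>"
 shows "\<exists>(n::nat) u. u \<in> V & u ~= \<zero> & inv u \<in> V & (f = u \<otimes> t [^] n \<or> f \<otimes> t [^] n = u)"
proof -
 have VR: "V \<subseteq> carrier R" using subringE(1)[OF V(1)] .
 have Vc: "y \<in> carrier R" if "y \<in> V" for y using that VR by auto
 note Vcl = subringE(2,3,5,6,7)[OF V(1)]
 have tR: "t \<in> carrier R" using t VR by auto
 have KR: "K \<subseteq> carrier R" using V(2) VR by auto
 \<comment> \<open>Otherwise the nonzero constant \<open>k\<close> would be a multiple of
   \<open>t\<close>, hence a nonunit.\<close>
 have unit: "k \<oplus> t \<otimes> b ~= z \<otimes> t" if k: "k \<in> K" "k ~= \<zero>" and b: "b \<in> V" and z: "z \<in> V" for k b z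
 proof
  assume e: "k \<oplus> t \<otimes> b = z \<otimes> t"
  have cs: "k \<in> carrier R" "b \<in> carrier R" "z \<in> carrier R" using k b z KR Vc by auto
  have "k = (k \<oplus> t \<otimes> b) \<ominus> t \<otimes> b" using cs tR by algebra
  also have "... = (z \<ominus> b) \<otimes> t" unfolding e using cs tR by algebra
  finally have "k = (z \<ominus> b) \<otimes> t" .
  moreover have "z \<ominus> b \<in> V" using z b Vcl by (simp add: a_minus_def)
  ultimately have "inv k \<notin> V" using nonunit[of k] k V(2) by auto
  moreover have "inv k \<in> K" using subfield_m_inv(1)[OF K] k by auto
  ultimately show False using V(2) by auto
 qed
 \<comment> \<open>If this fails, \<open>y\<close> is divisible by every power of \<open>t\<close>;
   an algebraic relation between \<open>y\<close> and \<open>t\<close> will contradict that.\<close>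
 have dec: "\<exists>(n::nat) u. u \<in> V & u ~= \<zero> & inv u \<in> V & y = u \<otimes> t [^] n"
  if y: "y \<in> V" "y ~= \<zero>" for y
 proof (rule ccontr)
  assume no: "\<not> ?thesis"
  have yR: "y \<in> carrier R" using y VR by auto
  have div: "\<exists>z\<in>V. y = z \<otimes> t [^] n" for n :: nat
  proof (induction n)
   case 0
   then show ?case using y Vc by auto
  next
   case (Suc n)
   then obtain z where z: "z \<in> V" "y = z \<otimes> t [^] n" by auto
   have "z ~= \<zero>" using z(2) y(2) tR by auto
   then have "inv z \<notin> V" using no z by blast
   then obtain z' where z': "z' \<in> V" "z = z' \<otimes> t" using nonunit[OF z(1)] by auto
   have "y = z' \<otimes> t [^] Suc n" unfolding z(2) z'(2) using tR Vc[OF z'(1)] by (simp add: m_ac)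
   then show ?case using z'(1) by auto
  qed
  have t0: "t ~= \<zero>" using div[of 1] y tR VR by (metis nat_pow_eone r_null subsetD)
  \<comment> \<open>A relation for \<open>t\<close> over \<open>K\<close> would make
    \<open>t [^] j \<otimes> (k \<oplus> t \<otimes> b)\<close> zero, against
    \<open>unit\<close>.\<close>
  have tr: "transcendental K t"
  proof (rule ccontr)
   assume "algebraic K t"
   then obtain c n where c: "\<forall>i<n. c i \<in> K" "\<exists>i<n. c i ~= \<zero>" "psum c n t = \<zero>"
    using algebraic_psumE[OF subfieldE(1)[OF K] tR] by blast
   obtain j :: nat and k b where kb: "k \<in> K" "k ~= \<zero>" "b \<in> V" "psum c n t = t [^] j \<otimes> (k \<oplus> t \<otimes> b)"
    using psum_split_power[OF subfieldE(1)[OF K] V(2,1) t _ c(2)] c(1) by blast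
   have cs: "k \<in> carrier R" "b \<in> carrier R" using kb KR Vc by auto
   have "t [^] j \<otimes> (k \<oplus> t \<otimes> b) = \<zero>" using kb(4) c(3) by simp
   then have "k \<oplus> t \<otimes> b = \<zero>" using pow_nonzero[OF tR t0] cs tR by (simp add: integral_iff)
   then show False using unit[OF kb(1-3), of \<zero>] Vcl(1) tR by simp
  qed
  note Bt = simple_extension_is_subring[OF subfieldE(1)[OF K] tR]
  have BtO: "simple_extension K t \<subseteq> V" using simple_extension_subring_incl[OF V(1,2) t] .
  have ex: "\<exists>n a. (\<forall>i<n. a i \<in> simple_extension K t) & (\<exists>i<n. a i ~= \<zero>) & psum a n y = \<zero>"
   using algebraic_psumE[OF Bt yR alg[OF tR yR tr]] by blast
  \<comment> \<open>Minimal length makes the constant coefficient \<open>a 0\<close> nonzero, since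
    otherwise the relation could be divided by \<open>y\<close>.\<close>
  define n where "n = (LEAST n. \<exists>a. (\<forall>i<n. a i \<in> simple_extension K t) & (\<exists>i<n. a i ~= \<zero>) & psum a n y = \<zero>)"
  obtain a where a: "\<forall>i<n. a i \<in> simple_extension K t" "\<exists>i<n. a i ~= \<zero>" "psum a n y = \<zero>"
   using LeastI_ex[OF ex] unfolding n_def by blast
  obtain m where m: "n = Suc m" using a(2) by (cases n) auto
  have aO: "a i \<in> V" if "i < n" for i using a(1) that BtO by auto
  have aR: "a i \<in> carrier R" if "i < n" for i using aO[OF that] VR by auto
  have s: "a 0 \<oplus> y \<otimes> psum (\<lambda>i. a (Suc i)) m y = \<zero>"
   using psum_Suc2[of m a y] aR a(3) yR m by simp
  have rest: "psum (\<lambda>i. a (Suc i)) m y \<in> V" using aO m y(1) by (intro psum_mem[OF V(1)]) auto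
  have a0: "a 0 ~= \<zero>"
  proof
   assume z: "a 0 = \<zero>"
   then have "psum (\<lambda>i. a (Suc i)) m y = \<zero>" using s yR y(2) rest VR by (auto simp: integral_iff)
   moreover have "\<exists>i<m. a (Suc i) ~= \<zero>" using a(2) z m by (metis less_Suc_eq_0_disj)
   moreover have "\<forall>i<m. a (Suc i) \<in> simple_extension K t" using a(1) m by auto
   ultimately have "n \<le> m" unfolding n_def by (intro Least_le exI[of _ "\<lambda>i. a (Suc i)"]) auto
   then show False using m by simp
  qed
  obtain c l where c: "\<forall>i<l. c i \<in> K" "a 0 = psum c l t"
   using simple_extension_psum[OF subfieldE(1)[OF K] tR] a(1) m by blast
  have "\<exists>i<l. c i ~= \<zero>"
  proof (rule ccontr)
   assume "\<not> (\<exists>i<l. c i ~= \<zero>)"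
   then have "psum c l t = \<zero>" unfolding psum_def using tR by (intro add.finprod_one_eqI) auto
   then show False using a0 c(2) by simp
  qed
  then obtain j :: nat and k b where kb: "k \<in> K" "k ~= \<zero>" "b \<in> V" "a 0 = t [^] j \<otimes> (k \<oplus> t \<otimes> b)"
   using psum_split_power[OF subfieldE(1)[OF K] V(2,1) t, of l c] c by auto
  have cs: "k \<in> carrier R" "b \<in> carrier R" using kb KR Vc by auto
  \<comment> \<open>One power more than the \<open>j\<close> that occurs in \<open>a 0\<close>. By
    the relation \<open>a 0\<close> is a multiple of \<open>y\<close>, so it would be divisible by
    one power of \<open>t\<close> too many.\<close>
  obtain z where z: "z \<in> V" "y = z \<otimes> t [^] Suc j" using div by blast
  define r where "r = psum (\<lambda>i. a (Suc i)) m y"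
  have rV: "r \<in> V" using rest by (simp add: r_def)
  have cr: "r \<in> carrier R" "z \<in> carrier R" using rV z Vc by auto
  have "a 0 = \<ominus> (y \<otimes> r)" using s aR[of 0] m yR cr unfolding r_def[symmetric] by (simp add: minus_equality)
  also have "... = t [^] j \<otimes> ((\<ominus> (z \<otimes> r)) \<otimes> t)" unfolding z(2) using cr tR by (simp add: l_minus r_minus m_ac)
  finally have "t [^] j \<otimes> (k \<oplus> t \<otimes> b) = t [^] j \<otimes> ((\<ominus> (z \<otimes> r)) \<otimes> t)" using kb(4) by simp
  then have "k \<oplus> t \<otimes> b = (\<ominus> (z \<otimes> r)) \<otimes> t"
   using m_lcancel[OF pow_nonzero[OF tR t0]] cs cr tR by simp
  then show False using unit[OF kb(1-3)] z(1) rV Vcl(3,4) by blast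
 qed
 \<comment> \<open>A general \<open>f\<close> is a quotient of two elements of \<open>V\<close>; the
   sign of the difference of their exponents decides between the two alternatives of the
   conclusion.\<close>
 obtain a b where ab: "f = a \<otimes> inv b" "a \<in> V" "b \<in> V" "b ~= \<zero>" using f(1) frac by (auto simp: fractions_def)
 have abR: "a \<in> carrier R" "b \<in> carrier R" using ab Vc by auto
 have a0: "a ~= \<zero>" using ab f(2) inv_nonzero[OF abR(2) ab(4)] by auto
 obtain n :: nat and u where u: "u \<in> V" "u ~= \<zero>" "inv u \<in> V" "a = u \<otimes> t [^] n" using dec[OF ab(2) a0] by auto
 obtain m :: nat and w where w: "w \<in> V" "w ~= \<zero>" "inv w \<in> V" "b = w \<otimes> t [^] m" using dec[OF ab(3,4)] by auto
 have uw: "u \<in> carrier R" "w \<in> carrier R" using u w Vc by auto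
 note iu = inv_nonzero[OF uw(1) u(2)] and iw = inv_nonzero[OF uw(2) w(2)]
 have tm: "t [^] m ~= \<zero>" using w(4) ab(4) uw by auto
 have fb: "f \<otimes> b = a" using ab abR inv_cancel(2) by simp
 define e where "e = u \<otimes> inv w"
 have eR: "e \<in> carrier R" unfolding e_def using uw iw by simp
 have e: "e \<in> V" "e ~= \<zero>" unfolding e_def using u w Vcl uw iw by (auto simp: integral_iff)
 have "inv e = inv u \<otimes> w"
  unfolding e_def using inv_mult_field[OF uw(1) u(2)] iw inv_inv_field[OF uw(2) w(2)] by simp
 then have ie: "inv e \<in> V" using u w Vcl by simp
 have ew: "e \<otimes> w = u" unfolding e_def using uw w inv_cancel(2) by simp
 have fw: "w \<otimes> (f \<otimes> t [^] m) = w \<otimes> (e \<otimes> t [^] n)"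
  using fb u(4) w(4) ew[symmetric] f(1) uw eR tR by (simp add: m_ac)
 have fe: "f \<otimes> t [^] m = e \<otimes> t [^] n" using m_lcancel[OF w(2) uw(2)] fw f(1) eR tR by simp
 show ?thesis
 proof (cases "m \<le> n")
  case True
  then have "t [^] n = t [^] (n - m) \<otimes> t [^] m" using tR by (simp add: nat_pow_mult)
  then have "t [^] m \<otimes> f = t [^] m \<otimes> (e \<otimes> t [^] (n - m))" using fe f(1) eR tR by (simp add: m_ac)
  then have "f = e \<otimes> t [^] (n - m)" using m_lcancel[OF tm] f(1) eR tR by simp
  then show ?thesis using e ie by blast
 next
  case False
  then have s: "t [^] m = t [^] (m - n) \<otimes> t [^] n" using tR by (simp add: nat_pow_mult)
  have tn: "t [^] n ~= \<zero>" using s tm tR by auto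
  have "t [^] n \<otimes> (f \<otimes> t [^] (m - n)) = t [^] n \<otimes> e" using fe s f(1) eR tR by (simp add: m_ac)
  then have "f \<otimes> t [^] (m - n) = e" using m_lcancel[OF tn] f(1) eR tR by simp
  then show ?thesis using e ie by blast
 qed
qed

text \<open>An intersection \<open>A\<close> of valuation rings: dividing a relation \<open>\<Sum> a\<^sub>i f\<^sup>i = 0\<close> by the gcd of its
 coefficients with respect to \<open>x\<close> makes some \<open>a\<^sub>i\<close> a unit at \<open>v\<close>.  The Horner partial sums \<open>\<beta>\<^sub>i\<close> and
 \<open>\<beta>\<^sub>i f\<close> lie in every valuation ring, hence in \<open>A\<close>, and \<open>a\<^sub>i = \<beta>\<^sub>i - \<beta>\<^sub>i\<^sub>+\<^sub>1 f\<close>.\<close>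

lemma quotient_not_both_in:
 assumes K: "subfield K R" and A: "subring A R" "K \<subseteq> A"
  and Os: "A = {y \<in> carrier R. \<forall>V\<in>Os. y \<in> V}"
  and val: "!!V. V \<in> Os ==> subring V R" "!!V g. V \<in> Os ==> g \<in> carrier R ==> g ~= \<zero> ==> g \<in> V \<or> inv g \<in> V"
  and v: "v \<subseteq> A" "\<zero> \<in> v" "\<one> \<notin> v" "!!a b. a \<in> v ==> b \<in> v ==> a \<oplus> b \<in> v"
   "!!a b. a \<in> A ==> b \<in> v ==> a \<otimes> b \<in> v"
  and x: "x \<in> v" "x ~= \<zero>"
  and alg: "!!u w. u \<in> carrier R ==> w \<in> carrier R ==> transcendental K u ==> algebraic (simple_extension K u) w"
  and f: "f \<in> carrier R" "f ~= \<zero>"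
 shows "\<exists>q\<in>A. q \<otimes> f \<in> A & (q \<notin> v \<or> q \<otimes> f \<notin> v)"
proof -
 note Acl = subringE(2,3,5,6,7)[OF A(1)]
 have AR: "y \<in> carrier R" if "y \<in> A" for y using that subringE(1)[OF A(1)] by auto
 have KR: "K \<subseteq> carrier R" using A(2) AR by auto
 have vA: "a \<in> A" if "a \<in> v" for a using that v(1) by auto
 have xR: "x \<in> carrier R" using x vA AR by auto
 have vminus: "a \<ominus> b \<in> v" if "a \<in> v" "b \<in> v" for a b
 proof -
  have "\<ominus> b = (\<ominus> \<one>) \<otimes> b" using that vA AR by (simp add: l_minus)
  then show ?thesis using v(4)[OF that(1)] v(5)[of "\<ominus> \<one>" b] Acl that by (simp add: a_minus_def)
 qed
 \<comment> \<open>Otherwise the unit \<open>k\<close> would lie in the proper ideal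
   \<open>v\<close>.\<close>
 have unit: "k \<oplus> x \<otimes> b \<notin> v" if k: "k \<in> K" "k ~= \<zero>" and b: "b \<in> A" for k b
 proof
  assume kb: "k \<oplus> x \<otimes> b \<in> v"
  have cs: "k \<in> carrier R" "b \<in> carrier R" using k b KR AR by auto
  have "x \<otimes> b \<in> v" using v(5)[OF b x(1)] xR cs by (simp add: m_comm)
  then have "(k \<oplus> x \<otimes> b) \<ominus> x \<otimes> b \<in> v" using vminus kb by blast
  moreover have "(k \<oplus> x \<otimes> b) \<ominus> x \<otimes> b = k" using cs xR by algebra
  ultimately have "k \<in> v" by simp
  moreover have "inv k \<in> A" using subfield_m_inv(1)[OF K] k A(2) by auto
  ultimately have "inv k \<otimes> k \<in> v" using v(5) by blast
  then show False using v(3) inv_nonzero[OF cs(1) k(2)] by simp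
 qed
 have split: "\<exists>(j::nat) k b. k \<in> K & k ~= \<zero> & b \<in> A & g = x [^] j \<otimes> (k \<oplus> x \<otimes> b)"
  if g: "g \<in> simple_extension K x" "g ~= \<zero>" for g
 proof -
  obtain c l where c: "\<forall>i<l. c i \<in> K" "g = psum c l x"
   using simple_extension_psum[OF subfieldE(1)[OF K] xR g(1)] by blast
  have "\<exists>i<l. c i ~= \<zero>"
  proof (rule ccontr)
   assume "\<not> (\<exists>i<l. c i ~= \<zero>)"
   then have "psum c l x = \<zero>" unfolding psum_def using xR by (intro add.finprod_one_eqI) auto
   then show False using g(2) c(2) by simp
  qed
  then show ?thesis using psum_split_power[OF subfieldE(1)[OF K] A(2,1) vA[OF x(1)], of l c] c by auto
 qed
 have tr: "transcendental K x"
 proof (rule ccontr)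
  assume "algebraic K x"
  then obtain c n where c: "\<forall>i<n. c i \<in> K" "\<exists>i<n. c i ~= \<zero>" "psum c n x = \<zero>"
   using algebraic_psumE[OF subfieldE(1)[OF K] xR] by blast
  obtain j :: nat and k b where kb: "k \<in> K" "k ~= \<zero>" "b \<in> A" "psum c n x = x [^] j \<otimes> (k \<oplus> x \<otimes> b)"
   using psum_split_power[OF subfieldE(1)[OF K] A(2,1) vA[OF x(1)] _ c(2)] c(1) by blast
  have cs: "k \<in> carrier R" "b \<in> carrier R" using kb KR AR by auto
  have "x [^] j \<otimes> (k \<oplus> x \<otimes> b) = \<zero>" using kb(4) c(3) by simp
  then have "k \<oplus> x \<otimes> b = \<zero>" using pow_nonzero[OF xR x(2)] cs xR by (simp add: integral_iff)
  then show False using unit[OF kb(1-3)] v(2) by simp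
 qed
 note Bx = simple_extension_is_subring[OF subfieldE(1)[OF K] xR]
 obtain a n where a: "\<forall>i<n. a i \<in> simple_extension K x" "\<exists>i<n. a i ~= \<zero>" "psum a n f = \<zero>"
  using algebraic_psumE[OF Bx f(1) alg[OF xR f(1) tr]] by blast
 define I where "I = {i. i < n & a i ~= \<zero>}"
 have I: "finite I" "I ~= {}" using a(2) by (auto simp: I_def)
 have "\<forall>i\<in>I. \<exists>jkb. fst (snd jkb) \<in> K & fst (snd jkb) ~= \<zero> & snd (snd jkb) \<in> A &
   a i = x [^] (fst jkb :: nat) \<otimes> (fst (snd jkb) \<oplus> x \<otimes> snd (snd jkb))"
  using split a(1) by (fastforce simp: I_def)
 from bchoice[OF this] obtain jkb where jkb: "\<forall>i\<in>I. fst (snd (jkb i)) \<in> K & fst (snd (jkb i)) ~= \<zero> & snd (snd (jkb i)) \<in> A &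
   a i = x [^] (fst (jkb i) :: nat) \<otimes> (fst (snd (jkb i)) \<oplus> x \<otimes> snd (snd (jkb i)))" ..
 define j where "j i = fst (jkb i)" for i
 define k where "k i = fst (snd (jkb i))" for i
 define b where "b i = snd (snd (jkb i))" for i
 have kb: "k i \<in> K" "k i ~= \<zero>" "b i \<in> A" "a i = x [^] j i \<otimes> (k i \<oplus> x \<otimes> b i)" if "i \<in> I" for i
  using bspec[OF jkb that] by (simp_all add: j_def k_def b_def)
 \<comment> \<open>The least power of \<open>x\<close> among the nonzero coefficients; it plays the
   part of their gcd, and the coefficient at \<open>i0\<close> attains it.\<close>
 define j0 where "j0 = Min (j ` I)"
 have j0: "j0 \<le> j i" if "i \<in> I" for i unfolding j0_def using I that by simp
 have "j0 \<in> j ` I" unfolding j0_def using I by (intro Min_in) auto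
 then obtain i0 where i0: "i0 \<in> I" "j i0 = j0" by auto
 define d where "d i = (if i \<in> I then x [^] (j i - j0) \<otimes> (k i \<oplus> x \<otimes> b i) else \<zero>)" for i
 have dA: "d i \<in> A" for i
  unfolding d_def using kb[of i] A(2) Acl subring_pow[OF A(1) vA[OF x(1)]] vA[OF x(1)] by auto
 have dR: "d i \<in> carrier R" for i using dA AR by auto
 have ad: "a i = x [^] j0 \<otimes> d i" if "i < n" for i
 proof (cases "i \<in> I")
  case True
  have "x [^] j i = x [^] j0 \<otimes> x [^] (j i - j0)" using j0[OF True] xR by (simp add: nat_pow_mult)
  moreover have "k i \<oplus> x \<otimes> b i \<in> carrier R" using kb[OF True] KR AR xR by auto
  ultimately show ?thesis using kb(4)[OF True] True xR by (simp add: d_def m_assoc)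
 qed (use that xR in \<open>simp add: I_def d_def\<close>)
 have "psum a n f = x [^] j0 \<otimes> psum d n f"
 proof -
  have "x [^] j0 \<otimes> psum d n f = (\<Oplus>i\<in>{..<n}. x [^] j0 \<otimes> (d i \<otimes> f [^] i))"
   unfolding psum_def using dR xR f by (intro mult_finsum) auto
  also have "... = psum a n f"
   unfolding psum_def using dR xR f ad by (intro finsum_cong') (auto simp: m_assoc)
  finally show ?thesis ..
 qed
 then have "x [^] j0 \<otimes> psum d n f = \<zero>" using a(3) by simp
 then have d0: "psum d n f = \<zero>" using integral[of "x [^] j0" "psum d n f"] pow_nonzero[OF xR x(2)] dR xR f by auto
 \<comment> \<open>At \<open>i0\<close> no power of \<open>x\<close> is left, only the factor that
   \<open>unit\<close> keeps outside \<open>v\<close>.\<close>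
 have di0: "d i0 \<notin> v" using unit[OF kb(1-3)[OF i0(1)]] i0 kb[OF i0(1)] KR AR xR by (auto simp: d_def)
 define \<beta> where "\<beta> = rec_nat \<zero> (\<lambda>i y. (y \<ominus> d i) \<otimes> inv f)"
 have \<beta>0: "\<beta> 0 = \<zero>" and \<beta>S: "\<beta> (Suc i) = (\<beta> i \<ominus> d i) \<otimes> inv f" for i by (simp_all add: \<beta>_def)
 note if' = inv_nonzero[OF f]
 have \<beta>R: "\<beta> i \<in> carrier R" for i by (induction i) (use \<beta>0 \<beta>S dR if' in auto)
 have \<beta>f: "\<beta> (Suc i) \<otimes> f = \<beta> i \<ominus> d i" for i
  unfolding \<beta>S using inv_cancel(2)[OF f] \<beta>R dR by simp
 have "\<beta> i \<otimes> f [^] i = \<ominus> psum d i f" for i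
 proof (induction i)
  case (Suc i)
  have p: "psum d i f \<in> carrier R" using dR f by simp
  have "\<beta> (Suc i) \<otimes> f [^] Suc i = (\<beta> i \<ominus> d i) \<otimes> f [^] i"
   unfolding \<beta>f[symmetric] using \<beta>R f by (simp add: m_ac)
  also have "... = \<beta> i \<otimes> f [^] i \<ominus> d i \<otimes> f [^] i" using \<beta>R dR f by (simp add: a_minus_def l_distr l_minus)
  also have "... = \<ominus> (d i \<otimes> f [^] i \<oplus> psum d i f)"
   unfolding Suc using p dR f by (simp add: a_minus_def minus_add a_comm)
  finally show ?case using dR f by (simp add: psum_Suc)
 qed (simp add: \<beta>0)
 then have "\<beta> n \<otimes> f [^] n = \<zero>" using d0 by simp
 then have \<beta>n: "\<beta> n = \<zero>" using pow_nonzero[OF f] \<beta>R f by (simp add: integral_iff)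
 \<comment> \<open>If \<open>f\<close> lies in \<open>V\<close>, the recursion is followed downwards
   from \<open>\<beta> n = \<zero>\<close>, which involves multiplication by \<open>f\<close> only.
   Otherwise \<open>inv f\<close> lies in \<open>V\<close>, and it is followed upwards from
   \<open>\<beta> 0 = \<zero>\<close>.\<close>
 have mem: "\<beta> i \<in> V & \<beta> i \<otimes> f \<in> V" if i: "i \<le> n" and V: "V \<in> Os" for i V
 proof -
  note Vcl = subringE(2,3,5,6,7)[OF val(1)[OF V]]
  have dV: "d i \<in> V" for i using dA V Os by auto
  have minus: "y \<ominus> z \<in> V" if "y \<in> V" "z \<in> V" for y z using that Vcl by (simp add: a_minus_def)
  show ?thesis
  proof (cases "f \<in> V")
   case True
   have "\<beta> i \<in> V" using i
   proof (induction i rule: inc_induct)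
    case base
    show ?case using \<beta>n Vcl(1) by simp
   next
    case (step i)
    have "\<beta> i = \<beta> (Suc i) \<otimes> f \<oplus> d i" unfolding \<beta>f using \<beta>R[of i] dR[of i] by algebra
    then show ?case using step True dV Vcl by simp
   qed
   then show ?thesis using True Vcl by simp
  next
   case False
   then have iV: "inv f \<in> V" using val(2)[OF V f] by auto
   have \<beta>V: "\<beta> i \<in> V" for i by (induction i) (use \<beta>0 \<beta>S Vcl iV dV minus in auto)
   moreover have "\<beta> i \<otimes> f \<in> V"
   proof (cases i)
    case 0
    then show ?thesis using \<beta>0 f Vcl(1) by simp
   next
    case (Suc i')
    then show ?thesis using \<beta>f \<beta>V dV minus by simp
   qed
   ultimately show ?thesis by simp
  qed
 qed
 have memA: "\<beta> i \<in> A" "\<beta> i \<otimes> f \<in> A" if "i \<le> n" for i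
  using mem[OF that] \<beta>R f unfolding Os by auto
 have n0: "i0 \<le> n" "Suc i0 \<le> n" using i0(1) by (auto simp: I_def)
 have "d i0 = \<beta> i0 \<ominus> \<beta> (Suc i0) \<otimes> f" unfolding \<beta>f using \<beta>R[of i0] dR[of i0] by algebra
 then have "\<beta> i0 \<notin> v \<or> \<beta> (Suc i0) \<otimes> f \<notin> v" using di0 vminus by metis
 then show ?thesis using memA n0 by blast
qed

end

section \<open>Constants and localizations inside the function field\<close>

lemma (in algebra) constant_mult:
 "a \<in> carrier R ==> x \<in> carrier M ==> (a \<odot>\<^sub>M \<one>\<^sub>M) \<otimes>\<^sub>M x = a \<odot>\<^sub>M x"
 by (simp add: smult_assoc2)

lemma (in algebra) constants_hom: "(\<lambda>c. c \<odot>\<^sub>M \<one>\<^sub>M) \<in> ring_hom R M"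
 by (intro ring_hom_memI) (auto simp: constant_mult smult_assoc1 smult_l_distr)

lemma subfield_constants:
 assumes "field K" "field E" "algebra K E"
 shows "subfield (constants K E) E"
proof -
 interpret K: field K by (rule assms)
 interpret E: field E by (rule assms)
 interpret algebra K E by (rule assms)
 interpret h: ring_hom_ring K E "\<lambda>c. c \<odot>\<^sub>E \<one>\<^sub>E"
  using constants_hom K.ring_axioms E.ring_axioms by (simp add: ring_hom_ring_def ring_hom_ring_axioms_def)
 show ?thesis
  using h.img_is_subfield(2)[OF K.carrier_is_subfield] E.one_not_zero
  by (simp add: constants_def image_def Setcompr_eq_image)
qed

lemma algebra_subring:
 assumes "algebra K E" "subring A E" "constants K E \<subseteq> A"
 shows "algebra K (E\<lparr>carrier := A\<rparr>)"
proof -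
 interpret algebra K E by (rule assms)
 have E: "cring E" using assms(1) by (rule algebra.axioms)
 have A: "y \<in> carrier E" if "y \<in> A" for y using that subringE(1)[OF assms(2)] by auto
 have sm: "c \<odot>\<^sub>E y \<in> A" if "c \<in> carrier K" "y \<in> A" for c y
 proof -
  have "c \<odot>\<^sub>E \<one>\<^sub>E \<in> A" using assms(3) that(1) by (auto simp: constants_def)
  then show ?thesis using constant_mult[OF that(1) A[OF that(2)]] subringE(6)[OF assms(2)] that(2) by metis
 qed
 have "cring (E\<lparr>carrier := A\<rparr>)"
  using ring.subring_is_ring[OF cring.axioms(1)[OF E] assms(2)] A
  by (auto simp: cring_def cring.cring_simprules(14)[OF E] intro!: monoid.monoid_comm_monoidI[OF ring.is_monoid])
 then interpret S: cring "E\<lparr>carrier := A\<rparr>" .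
 show ?thesis
  by (intro algebra.intro module.intro algebra_axioms.intro module_axioms.intro R.cring_axioms S.cring_axioms S.abelian_group_axioms)
   (auto simp: sm A smult_l_distr smult_r_distr smult_assoc1 smult_assoc2)
qed

context field
begin

lemma inv_of_factor:
 assumes g: "g \<in> carrier R" "g ~= \<zero>" and y: "y \<in> carrier R" and u: "y \<otimes> g ~= \<zero>"
 shows "inv g = y \<otimes> inv (y \<otimes> g)"
proof -
 have "y ~= \<zero>" using u g by auto
 then have "inv (y \<otimes> g) = inv y \<otimes> inv g" using inv_mult_field[OF y _ g] by simp
 then show ?thesis using inv_nonzero[OF y \<open>y ~= \<zero>\<close>] inv_nonzero[OF g] y by (simp add: m_assoc[symmetric])
qed

text \<open>If \<open>u\<close> is \<open>a\<close> over \<open>b\<close> and its inverse is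
  \<open>e\<close> over \<open>d\<close>, then \<open>e \<otimes> a = b \<otimes> d\<close> lies
  outside \<open>p\<close>, and so does its factor \<open>a\<close>.\<close>

lemma fractions_in_prime:
 assumes A: "subring A R" and p: "\<zero> \<in> p" "!!a b. a \<in> A - p ==> b \<in> A - p ==> a \<otimes> b \<notin> p"
  "!!a b. a \<in> A ==> b \<in> p ==> a \<otimes> b \<in> p"
  and u: "u \<in> fractions A p" "u ~= \<zero>" "inv u \<in> fractions A p" 
 shows "\<exists>a\<in>A - p. \<exists>b\<in>A - p. u = a \<otimes> inv b"
proof -
 have c: "y \<in> carrier R" if "y \<in> A" for y using that subringE(1)[OF A] by auto
 obtain a b where ab: "u = a \<otimes> inv b" "a \<in> A" "b \<in> A - p" using u(1) by (auto simp: fractions_def)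
 obtain e d where ed: "inv u = e \<otimes> inv d" "e \<in> A" "d \<in> A - p" using u(3) by (auto simp: fractions_def)
 have cs: "a \<in> carrier R" "b \<in> carrier R" "e \<in> carrier R" "d \<in> carrier R" using ab ed c by auto
 have nz: "b ~= \<zero>" "d ~= \<zero>" using ab ed p(1) by auto
 have ub: "u \<otimes> b = a" using ab(1) inv_cancel(2)[OF cs(2) nz(1) cs(1)] by simp
 have ud: "inv u \<otimes> d = e" using ed(1) inv_cancel(2)[OF cs(4) nz(2) cs(3)] by simp
 have uR: "u \<in> carrier R" using ab inv_nonzero[OF cs(2) nz(1)] cs by simp
 note iu = inv_nonzero[OF uR u(2)]
 have "a \<otimes> e = (u \<otimes> inv u) \<otimes> (b \<otimes> d)" unfolding ub[symmetric] ud[symmetric] using uR iu cs by (simp add: m_ac)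
 then have "e \<otimes> a = b \<otimes> d" using iu cs by (simp add: m_comm)
 then have "e \<otimes> a \<notin> p" using p(2) ab(3) ed(3) by auto
 then have "a \<notin> p" using p(3) ed(2) by blast
 then show ?thesis using ab by blast
qed

text \<open>If \<open>v\<close> is the trivial ideal then \<open>t = 0\<close> and \<open>n = 0\<close>.  Otherwise \<open>A\<^sub>v\<close> is a valuation ring, and
 its center on the curve provides the uniformizer.\<close>

lemma uniformizer_exists:
 assumes K: "subfield K R"
  and alg: "!!u w. u \<in> carrier R ==> w \<in> carrier R ==> transcendental K u ==> algebraic (simple_extension K u) w"
  and Q: "!!Q. Q \<in> Qs ==> subring Q R" "!!Q. Q \<in> Qs ==> K \<subseteq> Q" "!!Q. Q \<in> Qs ==> carrier R \<subseteq> frac_field Q"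
   "!!Q. Q \<in> Qs ==> \<exists>t\<in>Q. \<forall>y\<in>Q. (y = \<zero> \<or> inv y \<notin> Q) \<longleftrightarrow> (\<exists>z\<in>Q. y = z \<otimes> t)"
  and center: "!!V. subring V R ==> K \<subseteq> V ==> (!!f. f \<in> carrier R ==> f ~= \<zero> ==> f \<in> V \<or> inv f \<in> V) ==>
   \<exists>Q\<in>Qs. Q \<subseteq> V & (\<forall>y\<in>Q. y ~= \<zero> --> inv y \<notin> Q --> inv y \<notin> V)"
  and A: "A = {y \<in> carrier R. \<forall>Q\<in>Qs - Ps. y \<in> Q}"
  and v: "v \<subseteq> A" "\<zero> \<in> v" "\<one> \<notin> v" "!!a b. a \<in> v ==> b \<in> v ==> a \<oplus> b \<in> v"
   "!!a b. a \<in> A ==> b \<in> v ==> a \<otimes> b \<in> v" "!!a b. a \<in> A - v ==> b \<in> A - v ==> a \<otimes> b \<notin> v"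
 shows "\<exists>t\<in>v. \<forall>c\<in>A. c ~= \<zero> --> (\<exists>(n::nat) s s'. s \<in> A - v & s' \<in> A - v & s \<otimes> c = s' \<otimes> t [^] n)"
proof -
 have sA: "subring A R"
 proof -
  note Q' = subringE(2,3,5,6,7)[OF Q(1)]
  show ?thesis unfolding A using Q' by (intro subringI) auto
 qed
 note Acl = subringE(2,3,5,6,7)[OF sA]
 have KA: "K \<subseteq> A" unfolding A using Q(2) subfieldE(3)[OF K] by auto
 have AR: "y \<in> carrier R" if "y \<in> A" for y using that A by auto
 have v1: "\<one> \<in> A - v" using Acl v(3) by auto
 show ?thesis
 proof (cases "v = {\<zero>}")
  case True
  show ?thesis
  proof (intro bexI[of _ \<zero>] ballI impI exI[of _ "0::nat"])
   fix c assume c: "c \<in> A" "c ~= \<zero>"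
   show "\<exists>s s'. s \<in> A - v & s' \<in> A - v & s \<otimes> c = s' \<otimes> \<zero> [^] (0::nat)"
    by (rule exI[of _ \<one>], rule exI[of _ c]) (use c v1 True AR in auto)
  qed (use True in simp)
 next
  case False
  then obtain x where x: "x \<in> v" "x ~= \<zero>" using v(2) by auto
  define V where "V = fractions A v"
  have sV: "subring V R" and AV: "A \<subseteq> V" unfolding V_def
   by (auto intro!: subring_fractions[OF sA] subset_fractions[OF sA, THEN subsetD] simp: v)
  have Vc: "y \<in> carrier R" if "y \<in> V" for y using that subringE(1)[OF sV] by auto
  \<comment> \<open>The local rings of the curve are valuation rings: the exponent of the generator
    \<open>t\<close> is nonnegative for \<open>g\<close> or for its inverse.\<close>
  have val: "g \<in> Q \<or> inv g \<in> Q" if Qg: "Q \<in> Qs" "g \<in> carrier R" "g ~= \<zero>" for Q g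
  proof -
   obtain t where t: "t \<in> Q" "\<forall>y\<in>Q. (y = \<zero> \<or> inv y \<notin> Q) \<longleftrightarrow> (\<exists>z\<in>Q. y = z \<otimes> t)"
    using Q(4)[OF Qg(1)] by blast
   note Qcl = subringE(6)[OF Q(1)[OF Qg(1)]]
   have c: "y \<in> carrier R" if "y \<in> Q" for y using that subringE(1)[OF Q(1)[OF Qg(1)]] by auto
   have tp: "t [^] (n::nat) \<in> Q" for n using subring_pow[OF Q(1)[OF Qg(1)] t(1)] .
   obtain n :: nat and u where u: "u \<in> Q" "u ~= \<zero>" "inv u \<in> Q" "g = u \<otimes> t [^] n \<or> g \<otimes> t [^] n = u"
    using principal_local_ring[OF K Q(1-3)[OF Qg(1)] t(1) _ alg Qg(2,3)] t(2) by blast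
   show ?thesis
   proof (cases "g = u \<otimes> t [^] n")
    case True
    then show ?thesis using Qcl u tp by auto
   next
    case False
    then have e: "g \<otimes> t [^] n = u" using u by auto
    then have "inv g = t [^] n \<otimes> inv u"
     using inv_of_factor[OF Qg(2,3) c[OF tp], of n] u(2) Qg(2) c[OF tp] by (simp add: m_comm)
    then show ?thesis using Qcl tp u(3) by auto
   qed
  qed
  \<comment> \<open>Whichever of \<open>q\<close> and \<open>q \<otimes> f\<close> is outside
    \<open>v\<close> serves as a denominator, for \<open>f\<close> or for its inverse.\<close>
  have Vval: "f \<in> V \<or> inv f \<in> V" if f: "f \<in> carrier R" "f ~= \<zero>" for f
  proof -
   obtain q where q: "q \<in> A" "q \<otimes> f \<in> A" "q \<notin> v \<or> q \<otimes> f \<notin> v"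
    using quotient_not_both_in[OF K sA KA A _ _ v(1-5) x alg f] Q(1) val by blast
   from q(3) show ?thesis
   proof
    assume qv: "q \<notin> v"
    then have "q ~= \<zero>" using v(2) by auto
    then have "f = (q \<otimes> f) \<otimes> inv q" using q(1) AR f inv_cancel(1)[of q f] by (simp add: m_comm)
    then show ?thesis unfolding V_def fractions_def using q qv by blast
   next
    assume qv: "q \<otimes> f \<notin> v"
    then have q0: "q \<otimes> f ~= \<zero>" using v(2) by auto
    then have "inv f = q \<otimes> inv (q \<otimes> f)" using inv_of_factor[OF f AR[OF q(1)]] by simp
    then show ?thesis unfolding V_def fractions_def using q qv by blast
   qed
  qed
  \<comment> \<open>The point dominated by \<open>V\<close>: a generator of its maximal ideal
    remains a nonunit in \<open>V\<close>.\<close>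
  obtain Q' where Q': "Q' \<in> Qs" "Q' \<subseteq> V" "\<forall>y\<in>Q'. y ~= \<zero> --> inv y \<notin> Q' --> inv y \<notin> V"
   using center[OF sV order_trans[OF KA AV] Vval] by blast
  obtain t where t: "t \<in> Q'" "\<forall>y\<in>Q'. (y = \<zero> \<or> inv y \<notin> Q') \<longleftrightarrow> (\<exists>z\<in>Q'. y = z \<otimes> t)"
   using Q(4)[OF Q'(1)] by blast
  have tR: "t \<in> carrier R" using t Q' Vc by auto
  have "t = \<one> \<otimes> t" using tR by simp
  then have "t = \<zero> \<or> inv t \<notin> Q'" using t(2) t(1) subringE(3)[OF Q(1)[OF Q'(1)]] by blast
  then have tV: "t = \<zero> \<or> inv t \<notin> V" using Q'(3) t(1) by blast
  obtain t1 s1 where ts: "t = t1 \<otimes> inv s1" "t1 \<in> A" "s1 \<in> A - v"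
   using t(1) Q'(2) unfolding V_def fractions_def by blast
  have cs: "t1 \<in> carrier R" "s1 \<in> carrier R" "s1 ~= \<zero>" using ts AR v(2) by auto
  note is1 = inv_nonzero[OF cs(2,3)]
  \<comment> \<open>A numerator outside \<open>v\<close> would make \<open>t\<close> a unit of
    \<open>V\<close>. So \<open>t1\<close>, which lies in \<open>A\<close>, can replace
    \<open>t\<close> at the cost of powers of the denominator \<open>s1\<close>.\<close>
  have t1: "t1 \<in> v"
  proof (rule ccontr)
   assume n: "t1 \<notin> v"
   then have "t1 ~= \<zero>" using v(2) by auto
   moreover from this have "inv (t1 \<otimes> inv s1) = inv t1 \<otimes> s1"
    using inv_mult_field[OF cs(1) \<open>t1 ~= \<zero>\<close>] is1 inv_inv_field[OF cs(2,3)] by simp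
   ultimately have "inv t = s1 \<otimes> inv t1" "t ~= \<zero>"
    unfolding ts(1) using is1 inv_nonzero[OF cs(1)] cs by (auto simp: m_comm integral_iff)
   moreover have "s1 \<otimes> inv t1 \<in> V" unfolding V_def fractions_def using ts n by blast
   ultimately show False using tV by simp
  qed
  have s1p: "s1 [^] (n::nat) \<in> A - v" for n
   by (induction n) (use v1 v(6) ts(3) Acl(4) in auto)
  show ?thesis
  proof (intro bexI[OF _ t1] ballI impI)
   fix c assume c: "c \<in> A" "c ~= \<zero>"
   have cR: "c \<in> carrier R" using c AR by auto
   obtain n :: nat and u where u: "u \<in> Q'" "u ~= \<zero>" "inv u \<in> Q'" "c = u \<otimes> t [^] n \<or> c \<otimes> t [^] n = u"
    using principal_local_ring[OF K Q(1-3)[OF Q'(1)] t(1) _ alg cR c(2)] t(2) by blast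
   have uV: "u \<in> V" "inv u \<in> V" using u Q' by auto
   \<comment> \<open>A negative exponent is impossible: \<open>c\<close> lies in \<open>V\<close>,
     and the inverse of \<open>t\<close> would then lie in \<open>V\<close> as well.\<close>
   have "\<exists>m. c = u \<otimes> t [^] (m::nat)"
   proof (cases "c = u \<otimes> t [^] n")
    case False
    then have e: "c \<otimes> t [^] n = u" using u by auto
    show ?thesis
    proof (cases n)
     case 0
     then show ?thesis using e cR by (intro exI[of _ 0]) auto
    next
     case (Suc m)
     have tz: "t ~= \<zero>" using e u(2) Suc cR by auto
     note it = inv_nonzero[OF tR tz]
     have tm: "t [^] m \<in> V" using subring_pow[OF sV] t(1) Q'(2) by blast
     have e2: "(c \<otimes> t [^] m) \<otimes> t = u" using e Suc cR tR by (simp add: m_ac)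
     have "inv t = (c \<otimes> t [^] m) \<otimes> inv u" using inv_of_factor[OF tR tz _ , of "c \<otimes> t [^] m"] e2 u(2) cR tR by simp
     then have "inv t \<in> V" using uV tm AV c(1) subringE(6)[OF sV] by auto
     then show ?thesis using tV tz by blast
    qed
   qed blast
   then obtain m :: nat where m: "c = u \<otimes> t [^] m" by blast
   obtain a b where ab: "a \<in> A - v" "b \<in> A - v" "u = a \<otimes> inv b"
    using fractions_in_prime[OF sA v(2) v(6) v(5), of u] uV u(2) unfolding V_def by blast
   have abc: "a \<in> carrier R" "b \<in> carrier R" "b ~= \<zero>" using ab AR v(2) by auto
   note ib = inv_nonzero[OF abc(2,3)]
   have "s1 [^] m \<otimes> t [^] m = (s1 \<otimes> t) [^] m" using cs tR by (simp add: nat_pow_distrib)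
   also have "s1 \<otimes> t = t1" unfolding ts(1) using cs inv_cancel(2)[OF cs(2,3,1)] is1 by (simp add: m_comm m_assoc)
   finally have st: "s1 [^] m \<otimes> t [^] m = t1 [^] m" .
   have ub: "u \<otimes> b = a" unfolding ab(3) using inv_cancel(2)[OF abc(2,3,1)] .
   have uR: "u \<in> carrier R" using uV Vc by auto
   have "(b \<otimes> s1 [^] m) \<otimes> c = (u \<otimes> b) \<otimes> (s1 [^] m \<otimes> t [^] m)" 
    unfolding m using abc cs tR uR by (simp add: m_ac)
   then have "(b \<otimes> s1 [^] m) \<otimes> c = a \<otimes> t1 [^] m" using ub st by simp
   moreover have "b \<otimes> s1 [^] m \<in> A - v" using ab s1p v(6) Acl(4) by auto
   ultimately show "\<exists>(n::nat) s s'. s \<in> A - v & s' \<in> A - v & s \<otimes> c = s' \<otimes> t1 [^] n"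
    using ab(1) by blast
  qed
 qed
qed

end

section \<open>Points of the curve and centers of valuation rings\<close>

lemma local_subring_fractions:
 assumes "field E" shows "local_subring E C p = field.fractions E C p"
 by (simp add: local_subring_def field.fractions_def[OF assms])

lemma (in field) Units_subring:
 assumes "subring Q R" shows "Units (R\<lparr>carrier := Q\<rparr>) = {y \<in> Q. y ~= \<zero> & inv y \<in> Q}"
proof -
 have c: "y \<in> carrier R" if "y \<in> Q" for y using that subringE(1)[OF assms] by auto
 show ?thesis
 proof (intro equalityI subsetI)
  fix y assume "y \<in> Units (R\<lparr>carrier := Q\<rparr>)"
  then obtain z where z: "y \<in> Q" "z \<in> Q" "z \<otimes> y = \<one>" "y \<otimes> z = \<one>" by (auto simp: Units_def)
  then have "inv y = z" using comm_inv_char[of y z] c by auto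
  moreover have "y ~= \<zero>" using z c by auto
  ultimately show "y \<in> {y \<in> Q. y ~= \<zero> & inv y \<in> Q}" using z by auto
 next
  fix y assume "y \<in> {y \<in> Q. y ~= \<zero> & inv y \<in> Q}"
  then show "y \<in> Units (R\<lparr>carrier := Q\<rparr>)" using inv_nonzero[OF c, of y] by (auto simp: Units_def)
 qed
qed

lemma primeideal_subringD:
 assumes "primeideal p (E\<lparr>carrier := C\<rparr>)"
 shows "p \<subseteq> C" "\<zero>\<^sub>E \<in> p" "\<one>\<^sub>E \<notin> p" "!!a b. a \<in> p ==> b \<in> p ==> a \<oplus>\<^sub>E b \<in> p"
  "!!a b. a \<in> C ==> b \<in> p ==> a \<otimes>\<^sub>E b \<in> p" "!!a b. a \<in> C - p ==> b \<in> C - p ==> a \<otimes>\<^sub>E b \<notin> p"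
proof -
 interpret primeideal p "E\<lparr>carrier := C\<rparr>" by (rule assms)
 show "p \<subseteq> C" using a_subset by simp
 show "\<zero>\<^sub>E \<in> p" using additive_subgroup.zero_closed[OF is_additive_subgroup] by simp
 show "\<one>\<^sub>E \<notin> p" using one_imp_carrier I_notcarr by auto
 show "!!a b. a \<in> p ==> b \<in> p ==> a \<oplus>\<^sub>E b \<in> p" using additive_subgroup.a_closed[OF is_additive_subgroup] by simp
 show "!!a b. a \<in> C ==> b \<in> p ==> a \<otimes>\<^sub>E b \<in> p" using I_l_closed by simp
 show "!!a b. a \<in> C - p ==> b \<in> C - p ==> a \<otimes>\<^sub>E b \<notin> p" using I_prime by auto
qed

lemma (in domain) primeideal_subringI:
 assumes C: "subring C R" and p: "p \<subseteq> C" "\<zero> \<in> p" "\<one> \<notin> p" "!!a b. a \<in> p ==> b \<in> p ==> a \<oplus> b \<in> p"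
  "!!a b. a \<in> C ==> b \<in> p ==> a \<otimes> b \<in> p" "!!a b. a \<in> C - p ==> b \<in> C - p ==> a \<otimes> b \<notin> p"
 shows "primeideal p (R\<lparr>carrier := C\<rparr>)"
proof -
 interpret S: domain "R\<lparr>carrier := C\<rparr>" by (rule subring_is_domain[OF C])
 note Ccl = subringE[OF C]
 have "\<ominus>\<^bsub>R\<lparr>carrier := C\<rparr>\<^esub> a \<in> p" if a: "a \<in> p" for a
 proof -
  have "\<ominus>\<^bsub>R\<lparr>carrier := C\<rparr>\<^esub> a = (\<ominus>\<^bsub>R\<lparr>carrier := C\<rparr>\<^esub> \<one>\<^bsub>R\<lparr>carrier := C\<rparr>\<^esub>) \<otimes>\<^bsub>R\<lparr>carrier := C\<rparr>\<^esub> a"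
   using a p(1) Ccl(1,3) by (subst S.l_minus) auto
  then show ?thesis using p(5)[OF _ a, of "\<ominus>\<^bsub>R\<lparr>carrier := C\<rparr>\<^esub> \<one>\<^bsub>R\<lparr>carrier := C\<rparr>\<^esub>"] S.a_inv_closed[of "\<one>"] Ccl(3) by simp
 qed
 then have grp: "subgroup p (add_monoid (R\<lparr>carrier := C\<rparr>))"
  using p(1,2,4) by (intro S.add.subgroupI) (auto simp: a_inv_def)
 have "b \<otimes> a \<in> p" if "a \<in> C" "b \<in> p" for a b
  using p(5)[OF that] m_comm[of a b] that p(1) Ccl(1) by (metis subsetD)
 moreover have "a \<in> p \<or> b \<in> p" if "a \<in> C" "b \<in> C" "a \<otimes> b \<in> p" for a b using p(6)[of a b] that by blast
 ultimately show ?thesis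
  by (intro primeidealI idealI S.ring_axioms S.cring_axioms grp) (use p(1-5) Ccl(3) in auto)
qed

lemma (in field) ratio_change:
 assumes "a \<in> carrier R" "b \<in> carrier R" "b ~= \<zero>" "c \<in> carrier R" "c ~= \<zero>"
 shows "(a \<otimes> inv b) \<otimes> (inv c \<otimes> b) = a \<otimes> inv c"
proof -
 note ib = inv_nonzero[OF assms(2,3)] and ic = inv_nonzero[OF assms(4,5)]
 have "(a \<otimes> inv b) \<otimes> (inv c \<otimes> b) = (a \<otimes> inv b \<otimes> b) \<otimes> inv c"
  using assms(1,2,4) ib[THEN conjunct1] ic[THEN conjunct1] by (simp add: m_ac)
 then show ?thesis using inv_cancel(2)[OF assms(2,3,1)] by simp
qed

text \<open>Dividing by a coordinate of least value with respect to \<open>V\<close> puts all ratios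
  into \<open>V\<close>; this is how projectivity enters, as in the valuative criterion. The bound
  \<open>m\<close> is there for the induction over the coordinates.\<close>

lemma (in field) chart_of_valuation_ring:
 assumes V: "subring V R" "!!f. f \<in> carrier R ==> f ~= \<zero> ==> f \<in> V \<or> inv f \<in> V"
  and xs: "set xs \<subseteq> carrier R" and m: "m \<le> length xs" "\<exists>i<m. xs ! i ~= \<zero>"
 shows "\<exists>i<m. xs ! i ~= \<zero> & (\<forall>j<m. xs ! j \<otimes> inv (xs ! i) \<in> V)"
 using m
proof (induction m)
 case (Suc m)
 have c: "xs ! j \<in> carrier R" if "j < length xs" for j using xs that by auto
 note Vcl = subringE(2,3,6)[OF V(1)]
 show ?case
 proof (cases "\<exists>i<m. xs ! i ~= \<zero>")
  case False
  then have "xs ! m ~= \<zero>" using Suc.prems(2) by (auto simp: less_Suc_eq)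
  moreover have "xs ! j \<otimes> inv (xs ! m) \<in> V" if "j < Suc m" for j
   using that False inv_nonzero[OF c \<open>xs ! m ~= \<zero>\<close>] Suc.prems(1) Vcl by (auto simp: less_Suc_eq)
  ultimately show ?thesis by blast
 next
  case True
  then obtain i where i: "i < m" "xs ! i ~= \<zero>" "\<forall>j<m. xs ! j \<otimes> inv (xs ! i) \<in> V"
   using Suc by auto
  have cs: "xs ! i \<in> carrier R" "xs ! m \<in> carrier R" using c i Suc.prems by auto
  note ii = inv_nonzero[OF cs(1) i(2)]
  show ?thesis
  proof (cases "xs ! m \<otimes> inv (xs ! i) \<in> V")
   case True
   then show ?thesis using i by (intro exI[of _ i]) (auto simp: less_Suc_eq)
  next
   case False
   \<comment> \<open>The new coordinate has smaller value than the previous choice and takes its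
     place.\<close>
   then have m0: "xs ! m ~= \<zero>" using ii Vcl by auto
   note im = inv_nonzero[OF cs(2) m0]
   have "inv (xs ! m \<otimes> inv (xs ! i)) \<in> V" using V(2)[of "xs ! m \<otimes> inv (xs ! i)"] False cs ii m0 by (auto simp: integral_iff)
   then have r: "inv (xs ! m) \<otimes> xs ! i \<in> V"
    using inv_mult_field[OF cs(2) m0] ii inv_inv_field[OF cs(1) i(2)] by simp
   have "xs ! j \<otimes> inv (xs ! m) \<in> V" if j: "j < m" for j
   proof -
    have cj: "xs ! j \<in> carrier R" using c j Suc.prems by auto
    have "(xs ! j \<otimes> inv (xs ! i)) \<otimes> (inv (xs ! m) \<otimes> xs ! i) = xs ! j \<otimes> inv (xs ! m)"
     by (rule ratio_change[OF cj cs(1) i(2) cs(2) m0])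
    moreover have "(xs ! j \<otimes> inv (xs ! i)) \<otimes> (inv (xs ! m) \<otimes> xs ! i) \<in> V" using i(3) j r Vcl(3) by auto
    ultimately show ?thesis by simp
   qed
   then show ?thesis using m0 im Vcl by (intro exI[of _ m]) (auto simp: less_Suc_eq)
  qed
 qed
qed simp

text \<open>Supplies what \<open>uniformizer_exists\<close> asks of the points of the curve: the
  field of fractions, a principal maximal ideal, and a center for every valuation ring over the
  constants.\<close>

lemma regular_curve_uniformizer:
 assumes curve: "integral_projective_curve k F xs" and regular: "regular_curve k F xs"
  and A: "A = coord_ring k F xs P"
 shows "domain A" "algebra k A"
  and "maximalideal v A ==> \<exists>t\<in>v. \<forall>c\<in>carrier A. c ~= \<zero>\<^sub>A -->
   (\<exists>(n::nat) s s'. s \<in> carrier A - v & s' \<in> carrier A - v & s \<otimes>\<^sub>A c = s' \<otimes>\<^sub>A t [^]\<^sub>A n)"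
proof -
 have ax: "field k" "field F" "algebra k F" and xs: "set xs \<subseteq> carrier F"
  and chart: "\<exists>i<length xs. xs ! i ~= \<zero>\<^sub>F & generate_field F (constants k F \<union> coord_ratios F xs i) = carrier F"
  and tr: "\<exists>t\<in>carrier F. ring.transcendental F (constants k F) t &
    (\<forall>y\<in>carrier F. \<not> ring.transcendental F (generate_field F (insert t (constants k F))) y)"
  using curve unfolding integral_projective_curve_def by auto
 interpret F: field F by (rule ax)
 let ?K = "constants k F"
 have K: "subfield ?K F" by (rule subfield_constants[OF ax])
 note Kcl = subringE(2,3)[OF subfieldE(1)[OF K]]
 obtain t0 where t0: "t0 \<in> carrier F" "!!y. y \<in> carrier F ==> F.algebraic (generate_field F (insert t0 ?K)) y"
  using tr by blast
 have alg: "F.algebraic (F.simple_extension ?K u) w"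
  if "u \<in> carrier F" "w \<in> carrier F" "F.transcendental ?K u" for u w
  using F.algebraic_over_one_variable[OF K t0 that(1,3,2)] .
 have xc: "xs ! j \<in> carrier F" if "j < length xs" for j using xs that by auto
 have ratios: "coord_ratios F xs i \<subseteq> carrier F" if "i < length xs" "xs ! i ~= \<zero>\<^sub>F" for i
  using F.inv_nonzero[OF xc[OF that(1)] that(2)] xc by (auto simp: coord_ratios_def)
 have gens: "?K \<union> coord_ratios F xs i \<subseteq> carrier F" if "i < length xs" "xs ! i ~= \<zero>\<^sub>F" for i
  using ratios[OF that] subfieldE(3)[OF K] by auto
 have C: "subring (chart_ring k F xs i) F" "?K \<union> coord_ratios F xs i \<subseteq> chart_ring k F xs i"
  if i: "i < length xs" "xs ! i ~= \<zero>\<^sub>F" for i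
  using F.generate_ring_is_subring[OF gens[OF i]] by (auto simp: chart_ring_def intro: generate_ring.incl)
 \<comment> \<open>The definition of the curve provides this for a single chart \<open>i0\<close>.
   The ratios of that chart are quotients of ratios of any other chart, so they lie in the fraction
   field of the latter.\<close>
 have Cfrac: "carrier F \<subseteq> F.frac_field (chart_ring k F xs i)" if i: "i < length xs" "xs ! i ~= \<zero>\<^sub>F" for i
 proof -
  note S = F.subfield_frac_field[OF C(1)[OF i]]
  note Scl = subringE(6)[OF subfieldE(1)[OF S(1)]]
  obtain i0 where i0: "i0 < length xs" "xs ! i0 ~= \<zero>\<^sub>F" "generate_field F (?K \<union> coord_ratios F xs i0) = carrier F"
   using chart by auto
  note ii = F.inv_nonzero[OF xc[OF i(1)] i(2)] and ii0 = F.inv_nonzero[OF xc[OF i0(1)] i0(2)]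
  have rS: "xs ! j \<otimes>\<^sub>F inv\<^bsub>F\<^esub> (xs ! i) \<in> F.frac_field (chart_ring k F xs i)" if "j < length xs" for j
   using C(2)[OF i] S(2) that by (auto simp: coord_ratios_def)
  have "coord_ratios F xs i0 \<subseteq> F.frac_field (chart_ring k F xs i)"
  proof
   fix y assume "y \<in> coord_ratios F xs i0"
   then obtain j where j: "j < length xs" "y = xs ! j \<otimes>\<^sub>F inv\<^bsub>F\<^esub> (xs ! i0)" by (auto simp: coord_ratios_def)
   let ?r = "xs ! i0 \<otimes>\<^sub>F inv\<^bsub>F\<^esub> (xs ! i)"
   have r0: "?r ~= \<zero>\<^sub>F" "?r \<in> carrier F" using ii i0 xc by (auto simp: F.integral_iff)
   have ir: "inv\<^bsub>F\<^esub> ?r = inv\<^bsub>F\<^esub> (xs ! i0) \<otimes>\<^sub>F xs ! i"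
    using F.inv_mult_field[OF xc[OF i0(1)] i0(2)] ii F.inv_inv_field[OF xc[OF i(1)] i(2)] by simp
   have "inv\<^bsub>F\<^esub> ?r \<in> F.frac_field (chart_ring k F xs i)"
    using F.subfield_m_inv(1)[OF S(1)] rS[OF i0(1)] r0 by auto
   then have "(xs ! j \<otimes>\<^sub>F inv\<^bsub>F\<^esub> (xs ! i)) \<otimes>\<^sub>F (inv\<^bsub>F\<^esub> (xs ! i0) \<otimes>\<^sub>F xs ! i) \<in> F.frac_field (chart_ring k F xs i)"
    using Scl[OF rS[OF j(1)]] ir by simp
   then show "y \<in> F.frac_field (chart_ring k F xs i)"
    unfolding j(2) F.ratio_change[OF xc[OF j(1)] xc[OF i(1)] i(2) xc[OF i0(1)] i0(2)] .
  qed
  moreover have "?K \<subseteq> F.frac_field (chart_ring k F xs i)" using C(2)[OF i] S(2) by auto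
  ultimately show ?thesis
   using F.generate_field_min_subfield1[OF gens[OF i0(1,2)] S(1)] i0(3) by auto
 qed
 have Q: "subring Q F & ?K \<subseteq> Q & carrier F \<subseteq> F.frac_field Q" if QP: "Q \<in> points k F xs" for Q
 proof -
  obtain i p where Q: "Q = local_subring F (chart_ring k F xs i) p" and i: "i < length xs" "xs ! i ~= \<zero>\<^sub>F"
   and p: "primeideal p (F\<lparr>carrier := chart_ring k F xs i\<rparr>)"
   using QP by (auto simp: points_def)
  note pD = primeideal_subringD[OF p]
  have Q': "Q = F.fractions (chart_ring k F xs i) p" using Q local_subring_fractions[OF ax(2)] by simp
  have s: "subring Q F" unfolding Q' by (rule F.subring_fractions[OF C(1)[OF i]]) (use pD in auto)
  have "chart_ring k F xs i \<subseteq> Q" unfolding Q' by (rule F.subset_fractions[OF C(1)[OF i]]) (use pD in auto)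
  moreover from this have "F.frac_field (chart_ring k F xs i) \<subseteq> F.frac_field Q" unfolding F.fractions_def by blast
  ultimately show ?thesis using s C(2)[OF i] Cfrac[OF i] by auto
 qed
 \<comment> \<open>Regularity, with nonunits described by inverses in the function field and the
   principal ideal written out.\<close>
 have Qt: "\<exists>t\<in>Q. \<forall>y\<in>Q. (y = \<zero>\<^sub>F \<or> inv\<^bsub>F\<^esub> y \<notin> Q) \<longleftrightarrow> (\<exists>z\<in>Q. y = z \<otimes>\<^sub>F t)" if QP: "Q \<in> points k F xs" for Q
 proof -
  obtain t where t: "t \<in> Q" "maximal_ideal_at F Q = PIdl\<^bsub>F\<lparr>carrier := Q\<rparr>\<^esub> t"
   using regular QP by (auto simp: regular_curve_def)
  have "maximal_ideal_at F Q = {y \<in> Q. y = \<zero>\<^sub>F \<or> inv\<^bsub>F\<^esub> y \<notin> Q}"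
   unfolding maximal_ideal_at_def using F.Units_subring[of Q] Q[OF QP] by auto
  then have "{y \<in> Q. y = \<zero>\<^sub>F \<or> inv\<^bsub>F\<^esub> y \<notin> Q} = {z \<otimes>\<^sub>F t | z. z \<in> Q}"
   using t(2) by (auto simp: cgenideal_def)
  then have "(y \<in> Q & (y = \<zero>\<^sub>F \<or> inv\<^bsub>F\<^esub> y \<notin> Q)) \<longleftrightarrow> (\<exists>z. y = z \<otimes>\<^sub>F t & z \<in> Q)" for y
   by (simp add: set_eq_iff)
  then show ?thesis using t(1) by blast
 qed
 have center: "\<exists>Q\<in>points k F xs. Q \<subseteq> V & (\<forall>y\<in>Q. y ~= \<zero>\<^sub>F --> inv\<^bsub>F\<^esub> y \<notin> Q --> inv\<^bsub>F\<^esub> y \<notin> V)"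
  if V: "subring V F" "?K \<subseteq> V" "!!f. f \<in> carrier F ==> f ~= \<zero>\<^sub>F ==> f \<in> V \<or> inv\<^bsub>F\<^esub> f \<in> V" for V
 proof -
  obtain i where i: "i < length xs" "xs ! i ~= \<zero>\<^sub>F" "\<forall>j<length xs. xs ! j \<otimes>\<^sub>F inv\<^bsub>F\<^esub> (xs ! i) \<in> V"
   using F.chart_of_valuation_ring[OF V(1,3) xs order_refl] chart by blast
  let ?C = "chart_ring k F xs i"
  note Vcl = subringE(1,2,3,5,6,7)[OF V(1)] and Ccl = subringE(1,2,3,5,6,7)[OF C(1)[OF i(1,2)]]
  have CV: "?C \<subseteq> V" unfolding chart_ring_def
   by (rule F.generate_ring_min_subring1[OF gens[OF i(1,2)] V(1)]) (use i(3) V(2) in \<open>auto simp: coord_ratios_def\<close>)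
  have Cc: "y \<in> carrier F" if "y \<in> ?C" for y using Ccl that by auto
  \<comment> \<open>The nonunits of \<open>V\<close> inside the chart; the localization at this
    prime is the center of \<open>V\<close>.\<close>
  define p where "p = {y \<in> ?C. y = \<zero>\<^sub>F \<or> inv\<^bsub>F\<^esub> y \<notin> V}"
  have mult: "a \<otimes>\<^sub>F b \<in> p" if a: "a \<in> ?C" and b: "b \<in> p" for a b
  proof (cases "a \<otimes>\<^sub>F b = \<zero>\<^sub>F")
   case False
   have bC: "b \<in> ?C" using b by (simp add: p_def)
   have nz: "a ~= \<zero>\<^sub>F" "b ~= \<zero>\<^sub>F" using False Cc a bC by auto
   have "inv\<^bsub>F\<^esub> b = a \<otimes>\<^sub>F inv\<^bsub>F\<^esub> (a \<otimes>\<^sub>F b)" by (rule F.inv_of_factor) (use nz False Cc a bC in auto)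
   then have "inv\<^bsub>F\<^esub> (a \<otimes>\<^sub>F b) \<notin> V" using b nz Vcl(5)[of a "inv\<^bsub>F\<^esub> (a \<otimes>\<^sub>F b)"] a CV by (auto simp: p_def)
   then show ?thesis using a bC Ccl(5) by (simp add: p_def)
  qed (use a b Ccl in \<open>auto simp: p_def\<close>)
  have nadd: "a \<oplus>\<^sub>F b \<in> p" if a: "a \<in> p" and b: "b \<in> p" for a b
  proof (rule ccontr)
   assume n: "a \<oplus>\<^sub>F b \<notin> p"
   have ab: "a \<in> ?C" "b \<in> ?C" "a \<in> carrier F" "b \<in> carrier F" using a b Cc by (auto simp: p_def)
   have s: "a \<oplus>\<^sub>F b ~= \<zero>\<^sub>F" "inv\<^bsub>F\<^esub> (a \<oplus>\<^sub>F b) \<in> V" using n Ccl(6) ab by (auto simp: p_def)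
   let ?s = "a \<oplus>\<^sub>F b"
   \<comment> \<open>If \<open>x\<close> divides \<open>y\<close> in \<open>V\<close>, it divides
     the sum. Were the sum a unit of \<open>V\<close>, then \<open>x\<close> would be a unit
     too.\<close>
   have key: False if x: "x \<in> p" "y \<in> p" "x \<oplus>\<^sub>F y = ?s" "x ~= \<zero>\<^sub>F" "y \<otimes>\<^sub>F inv\<^bsub>F\<^esub> x \<in> V" for x y
   proof -
    have xy: "x \<in> carrier F" "y \<in> carrier F" using x Cc by (auto simp: p_def)
    note ix = F.inv_nonzero[OF xy(1) x(4)] and is' = F.inv_nonzero[OF _ s(1)]
    have "?s \<otimes>\<^sub>F inv\<^bsub>F\<^esub> x = \<one>\<^sub>F \<oplus>\<^sub>F y \<otimes>\<^sub>F inv\<^bsub>F\<^esub> x"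
     unfolding x(3)[symmetric] using xy ix by (simp add: F.l_distr)
    then have "?s \<otimes>\<^sub>F inv\<^bsub>F\<^esub> x \<in> V" using x(5) Vcl(3,6) by simp
    then have "inv\<^bsub>F\<^esub> ?s \<otimes>\<^sub>F (?s \<otimes>\<^sub>F inv\<^bsub>F\<^esub> x) \<in> V" using s(2) Vcl(5) by blast
    moreover have "inv\<^bsub>F\<^esub> ?s \<otimes>\<^sub>F (?s \<otimes>\<^sub>F inv\<^bsub>F\<^esub> x) = inv\<^bsub>F\<^esub> x"
     using is' ab ix by (simp add: F.m_assoc[symmetric])
    ultimately show False using x(1,4) by (simp add: p_def)
   qed
   have nz: "a ~= \<zero>\<^sub>F" "b ~= \<zero>\<^sub>F" using n a b ab by auto
   note ia = F.inv_nonzero[OF ab(3) nz(1)] and ib = F.inv_nonzero[OF ab(4) nz(2)]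
   have "b \<otimes>\<^sub>F inv\<^bsub>F\<^esub> a \<in> V \<or> a \<otimes>\<^sub>F inv\<^bsub>F\<^esub> b \<in> V"
    using V(3)[of "b \<otimes>\<^sub>F inv\<^bsub>F\<^esub> a"] ia ib ab nz F.inv_mult_field[OF ab(4) nz(2), of "inv\<^bsub>F\<^esub> a"] F.inv_inv_field[OF ab(3) nz(1)]
    by (auto simp: F.integral_iff F.m_comm)
   then show False using key[OF a b refl nz(1)] key[OF b a F.a_comm nz(2)] ab by auto
  qed
  have one: "\<one>\<^sub>F \<notin> p" using Vcl(3) by (simp add: p_def)
  have prime: "a \<in> p \<or> b \<in> p" if ab: "a \<in> ?C" "b \<in> ?C" "a \<otimes>\<^sub>F b \<in> p" for a b
  proof (rule ccontr)
   assume "\<not> (a \<in> p \<or> b \<in> p)"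
   then have nz: "a ~= \<zero>\<^sub>F" "b ~= \<zero>\<^sub>F" "inv\<^bsub>F\<^esub> a \<in> V" "inv\<^bsub>F\<^esub> b \<in> V" using ab by (auto simp: p_def)
   then have "inv\<^bsub>F\<^esub> (a \<otimes>\<^sub>F b) \<in> V" using F.inv_mult_field[OF Cc[OF ab(1)] nz(1) Cc[OF ab(2)] nz(2)] Vcl(5) by simp
   then show False using ab nz Cc by (auto simp: p_def F.integral_iff)
  qed
  have pi: "primeideal p (F\<lparr>carrier := ?C\<rparr>)"
  proof (rule F.primeideal_subringI[OF C(1)[OF i(1,2)] _ _ one nadd mult])
   show "p \<subseteq> ?C" "\<zero>\<^sub>F \<in> p" using Ccl(2) by (auto simp: p_def)
  qed (use prime in blast)+
  note pD = primeideal_subringD[OF pi]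
  define Q where "Q = F.fractions ?C p"
  have Qp: "Q \<in> points k F xs"
   unfolding points_def Q_def using local_subring_fractions[OF ax(2)] i pi by blast
  have QV: "Q \<subseteq> V"
   using CV Vcl(5) by (auto simp: Q_def F.fractions_def p_def)
  \<comment> \<open>Domination: if an element of \<open>Q\<close> is a unit of \<open>V\<close>, its
    numerator is outside \<open>p\<close>, so it is already a unit of \<open>Q\<close>.\<close>
  have "inv\<^bsub>F\<^esub> y \<in> Q" if y: "y \<in> Q" "inv\<^bsub>F\<^esub> y \<in> V" "y ~= \<zero>\<^sub>F" for y
  proof -
   obtain a b where ab: "y = a \<otimes>\<^sub>F inv\<^bsub>F\<^esub> b" "a \<in> ?C" "b \<in> ?C - p" using y(1) by (auto simp: Q_def F.fractions_def)
   have bF: "b \<in> carrier F" "b ~= \<zero>\<^sub>F" "a \<in> carrier F" using ab pD(2) Cc by auto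
   note ib = F.inv_nonzero[OF bF(1,2)]
   have a0: "a ~= \<zero>\<^sub>F" using ab(1) ib y(3) by auto
   show ?thesis
   proof -
    have e: "inv\<^bsub>F\<^esub> y = inv\<^bsub>F\<^esub> a \<otimes>\<^sub>F b"
     unfolding ab(1) using F.inv_mult_field[OF bF(3) a0] ib F.inv_inv_field[OF bF(1,2)] by simp
    note ia = F.inv_nonzero[OF bF(3) a0]
    have "inv\<^bsub>F\<^esub> a = inv\<^bsub>F\<^esub> y \<otimes>\<^sub>F inv\<^bsub>F\<^esub> b" unfolding e using F.inv_cancel(1)[OF bF(1,2)] ia by simp
    moreover have "inv\<^bsub>F\<^esub> b \<in> V" using ab(3) by (simp add: p_def)
    ultimately have "a \<notin> p" using y(2) Vcl(5) a0 by (auto simp: p_def)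
    then show ?thesis unfolding Q_def F.fractions_def e using ab ia bF by (auto simp: F.m_comm)
   qed
  qed
  then show ?thesis using Qp QV by blast
 qed
 have Ac: "carrier A = {y \<in> carrier F. \<forall>Q\<in>points k F xs - {P}. y \<in> Q}" and Aeq: "A = F\<lparr>carrier := carrier A\<rparr>"
  by (simp_all add: A coord_ring_def regular_functions_def)
 have sA: "subring (carrier A) F"
  unfolding Ac using subringE(2,3,5,6,7)[of _ F] Q by (intro F.subringI) auto
 show "domain A" using F.subring_is_domain[OF sA] Aeq by simp
 have "?K \<subseteq> carrier A" unfolding Ac using Q subfieldE(3)[OF K] by auto
 then show "algebra k A" using algebra_subring[OF ax(3) sA] Aeq by simp
 assume v: "maximalideal v A"
 interpret A: domain A by fact
 have "primeideal v (F\<lparr>carrier := carrier A\<rparr>)" using A.maximalideal_prime[OF v] Aeq by simp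
 note vD = primeideal_subringD[OF this]
 have eqs: "\<zero>\<^sub>A = \<zero>\<^sub>F" "monoid.mult A = monoid.mult F" "a [^]\<^sub>A (n::nat) = a [^]\<^sub>F n" for a n
  using F.nat_pow_consistent[of a n "carrier A"] by (subst Aeq; simp)+
 show "\<exists>t\<in>v. \<forall>c\<in>carrier A. c ~= \<zero>\<^sub>A -->
   (\<exists>(n::nat) s s'. s \<in> carrier A - v & s' \<in> carrier A - v & s \<otimes>\<^sub>A c = s' \<otimes>\<^sub>A t [^]\<^sub>A n)"
  unfolding eqs
  by (rule F.uniformizer_exists[OF K alg _ _ _ Qt center Ac vD]) (use Q in auto)
qed

text \<open>Regularity is part of the structure that an isomorphism of function fields respecting the
 constants and the coordinates transports.\<close>

lemma regular_curve_iso: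
 assumes F: "field F" and G: "field G" and \<theta>: "\<theta> \<in> ring_hom F G" "bij_betw \<theta> (carrier F) (carrier G)"
  and const: "\<theta> ` constants k F = constants K G" "constants k F \<subseteq> carrier F"
  and xs: "set xs \<subseteq> carrier F" and reg: "regular_curve K G (map \<theta> xs)"
 shows "regular_curve k F xs"
proof -
 interpret F: field F by fact
 interpret G: field G by fact
 interpret h: ring_hom_ring F G \<theta>
  using \<theta>(1) F.ring_axioms G.ring_axioms by (simp add: ring_hom_ring_def ring_hom_ring_axioms_def)
 have inj: "inj_on \<theta> (carrier F)" using \<theta>(2) by (auto simp: bij_betw_def)
 have zero: "\<theta> x = \<zero>\<^sub>G \<longleftrightarrow> x = \<zero>\<^sub>F" if "x \<in> carrier F" for x
  using inj_onD[OF inj _ that F.zero_closed] h.hom_zero by auto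
 have inv: "\<theta> (inv\<^bsub>F\<^esub> x) = inv\<^bsub>G\<^esub> (\<theta> x)" if x: "x \<in> carrier F" "x ~= \<zero>\<^sub>F" for x
 proof -
  note ix = F.inv_nonzero[OF x]
  have "\<theta> x \<otimes>\<^sub>G \<theta> (inv\<^bsub>F\<^esub> x) = \<one>\<^sub>G" using h.hom_mult[of x "inv\<^bsub>F\<^esub> x"] ix x by simp
  then show ?thesis using G.comm_inv_char[of "\<theta> x" "\<theta> (inv\<^bsub>F\<^esub> x)"] x ix by simp
 qed
 have sub: "subring (\<theta> ` B) G" if "subring B F" for B by (rule h.img_is_subring[OF that])
 have img: "\<theta> y \<in> \<theta> ` B \<longleftrightarrow> y \<in> B" if "B \<subseteq> carrier F" "y \<in> carrier F" for y B
  using that inj by (auto dest: inj_onD)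
 show ?thesis
  unfolding regular_curve_def
 proof
  fix Q assume "Q \<in> points k F xs"
  then obtain i p where Q: "Q = local_subring F (chart_ring k F xs i) p" and i: "i < length xs" "xs ! i ~= \<zero>\<^sub>F"
   and p: "primeideal p (F\<lparr>carrier := chart_ring k F xs i\<rparr>)" by (auto simp: points_def)
  define C where "C = chart_ring k F xs i"
  have xc: "xs ! j \<in> carrier F" if "j < length xs" for j using xs that by auto
  have rat: "coord_ratios F xs i \<subseteq> carrier F"
   using F.inv_nonzero[OF xc[OF i(1)] i(2)] xc by (auto simp: coord_ratios_def)
  have H: "constants k F \<union> coord_ratios F xs i \<subseteq> carrier F" using const rat by auto
  have C: "subring C F" unfolding C_def chart_ring_def by (rule F.generate_ring_is_subring[OF H])
  note CF = subringE(1)[OF C]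
  have "\<theta> ` coord_ratios F xs i = coord_ratios G (map \<theta> xs) i"
  proof -
   have "\<theta> (xs ! j \<otimes>\<^sub>F inv\<^bsub>F\<^esub> (xs ! i)) = map \<theta> xs ! j \<otimes>\<^sub>G inv\<^bsub>G\<^esub> (map \<theta> xs ! i)" if "j < length xs" for j
    using F.inv_nonzero[OF xc[OF i(1)] i(2)] xc[OF that] inv[OF xc[OF i(1)] i(2)] i that by simp
   then show ?thesis by (force simp: coord_ratios_def)
  qed
  then have hH: "\<theta> ` (constants k F \<union> coord_ratios F xs i) = constants K G \<union> coord_ratios G (map \<theta> xs) i"
   using const by (simp add: image_Un)
  have hHG: "\<theta> ` (constants k F \<union> coord_ratios F xs i) \<subseteq> carrier G" using H h.hom_closed by auto
  \<comment> \<open>Forming the generated subring commutes with the image under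
    \<open>\<theta>\<close>, so a chart goes to the chart with the same index.\<close>
  have \<theta>C: "\<theta> ` C = chart_ring K G (map \<theta> xs) i"
   unfolding chart_ring_def hH[symmetric]
  proof
   show "generate_ring G (\<theta> ` (constants k F \<union> coord_ratios F xs i)) \<subseteq> \<theta> ` C"
    by (rule G.generate_ring_min_subring1[OF hHG sub[OF C]])
     (auto simp: C_def chart_ring_def intro!: imageI generate_ring.incl)
   show "\<theta> ` C \<subseteq> generate_ring G (\<theta> ` (constants k F \<union> coord_ratios F xs i))"
   proof
    fix y assume "y \<in> \<theta> ` C"
    then obtain z where z: "z \<in> generate_ring F (constants k F \<union> coord_ratios F xs i)" "y = \<theta> z"
     by (auto simp: C_def chart_ring_def)
    have "\<theta> z \<in> generate_ring G (\<theta> ` (constants k F \<union> coord_ratios F xs i))"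
     using z(1)
    proof (induction rule: generate_ring.induct)
     case (a_inv h)
     then show ?case using F.generate_ring_in_carrier[OF H] generate_ring.a_inv by fastforce
    next
     case (eng_add h1 h2)
     then show ?case using F.generate_ring_in_carrier[OF H] generate_ring.eng_add by fastforce
    next
     case (eng_mult h1 h2)
     then show ?case using F.generate_ring_in_carrier[OF H] generate_ring.eng_mult by fastforce
    qed (auto simp: generate_ring.one intro: generate_ring.incl)
    then show "y \<in> generate_ring G (\<theta> ` (constants k F \<union> coord_ratios F xs i))" using z(2) by simp
   qed
  qed
  note pD = primeideal_subringD[OF p, folded C_def]
  have pF: "p \<subseteq> carrier F" using pD(1) CF by auto
  have hp: "primeideal (\<theta> ` p) (G\<lparr>carrier := \<theta> ` C\<rparr>)"
  proof (rule G.primeideal_subringI[OF sub[OF C]])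
   show "\<theta> ` p \<subseteq> \<theta> ` C" using pD(1) by auto
   show "\<zero>\<^sub>G \<in> \<theta> ` p" using pD(2) h.hom_zero by (metis imageI)
   show "\<one>\<^sub>G \<notin> \<theta> ` p" using img[OF pF, of "\<one>\<^sub>F"] pD(3) by simp
   show "a \<oplus>\<^sub>G b \<in> \<theta> ` p" if ab: "a \<in> \<theta> ` p" "b \<in> \<theta> ` p" for a b
   proof -
    obtain a' b' where e: "a = \<theta> a'" "b = \<theta> b'" "a' \<in> p" "b' \<in> p" using ab by auto
    have "a' \<in> carrier F" "b' \<in> carrier F" using e pF by auto
    then have "a \<oplus>\<^sub>G b = \<theta> (a' \<oplus>\<^sub>F b')" using e by simp
    then show ?thesis using pD(4) e by simp
   qed
   show "a \<otimes>\<^sub>G b \<in> \<theta> ` p" if ab: "a \<in> \<theta> ` C" "b \<in> \<theta> ` p" for a b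
   proof -
    obtain a' b' where e: "a = \<theta> a'" "b = \<theta> b'" "a' \<in> C" "b' \<in> p" using ab by auto
    then have "a \<otimes>\<^sub>G b = \<theta> (a' \<otimes>\<^sub>F b')" using pF CF by (auto dest!: subsetD)
    then show ?thesis using pD(5) e by simp
   qed
   show "a \<otimes>\<^sub>G b \<notin> \<theta> ` p" if ab: "a \<in> \<theta> ` C - \<theta> ` p" "b \<in> \<theta> ` C - \<theta> ` p" for a b
   proof -
    obtain a' b' where e: "a = \<theta> a'" "b = \<theta> b'" "a' \<in> C - p" "b' \<in> C - p" using ab by auto
    then have c: "a' \<in> carrier F" "b' \<in> carrier F" using CF by auto
    then show ?thesis using pD(6)[OF e(3,4)] img[OF pF, of "a' \<otimes>\<^sub>F b'"] e by simp
   qed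
  qed
  have frac: "\<theta> (a \<otimes>\<^sub>F inv\<^bsub>F\<^esub> b) = \<theta> a \<otimes>\<^sub>G inv\<^bsub>G\<^esub> (\<theta> b)" if "a \<in> C" "b \<in> C - p" for a b
  proof -
   have "b ~= \<zero>\<^sub>F" "a \<in> carrier F" "b \<in> carrier F" using that pD(2) CF by auto
   then show ?thesis using F.inv_nonzero[of b] inv[of b] by simp
  qed
  have diff: "\<theta> ` C - \<theta> ` p = \<theta> ` (C - p)" using img[OF pF] CF by auto
  have \<theta>Q: "\<theta> ` Q = local_subring G (\<theta> ` C) (\<theta> ` p)"
   unfolding Q C_def[symmetric] local_subring_def diff
   using frac by (intro equalityI subsetI) (auto 4 4 simp: image_iff)
  have "\<theta> ` Q \<in> points K G (map \<theta> xs)"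
   unfolding points_def \<theta>Q \<theta>C
   using i hp[unfolded \<theta>C] zero[OF xc[OF i(1)]] by (intro CollectI exI[of _ i] exI[of _ "\<theta> ` p"]) simp
  then obtain t' where t': "t' \<in> \<theta> ` Q" "maximal_ideal_at G (\<theta> ` Q) = PIdl\<^bsub>G\<lparr>carrier := \<theta> ` Q\<rparr>\<^esub> t'"
   using reg unfolding regular_curve_def by blast
  obtain t where t: "t \<in> Q" "t' = \<theta> t" using t'(1) by auto
  have sQ: "subring Q F"
   unfolding Q C_def[symmetric] local_subring_fractions[OF F] by (rule F.subring_fractions[OF C]) (use pD in auto)
  note QF = subringE(1)[OF sQ]
  \<comment> \<open>Units correspond, because \<open>\<theta>\<close> preserves inverses and
    injectivity reflects membership in \<open>Q\<close>.\<close>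
  have inQ: "inv\<^bsub>G\<^esub> (\<theta> y) \<in> \<theta> ` Q \<longleftrightarrow> inv\<^bsub>F\<^esub> y \<in> Q" if "y \<in> Q" "y ~= \<zero>\<^sub>F" for y
   using inv[of y] img[OF QF, of "inv\<^bsub>F\<^esub> y"] F.inv_nonzero[of y] that QF by auto
  have "(y \<in> Q - Units (F\<lparr>carrier := Q\<rparr>)) \<longleftrightarrow> y \<in> PIdl\<^bsub>F\<lparr>carrier := Q\<rparr>\<^esub> t" if y: "y \<in> Q" for y
  proof -
   have yF: "y \<in> carrier F" "t \<in> carrier F" using y t QF by auto
   have "y \<in> Q - Units (F\<lparr>carrier := Q\<rparr>) \<longleftrightarrow> \<theta> y \<in> maximal_ideal_at G (\<theta> ` Q)"
    unfolding maximal_ideal_at_def F.Units_subring[OF sQ] G.Units_subring[OF sub[OF sQ]]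
    using y zero[OF yF(1)] inQ[OF y] by auto
   also have "... \<longleftrightarrow> (\<exists>z\<in>Q. \<theta> y = \<theta> z \<otimes>\<^sub>G \<theta> t)" unfolding t'(2) t(2) by (auto simp: cgenideal_def)
   also have "... \<longleftrightarrow> (\<exists>z\<in>Q. y = z \<otimes>\<^sub>F t)"
   proof (intro bex_cong refl)
    fix z assume "z \<in> Q"
    then have z: "z \<in> carrier F" using QF by auto
    show "\<theta> y = \<theta> z \<otimes>\<^sub>G \<theta> t \<longleftrightarrow> y = z \<otimes>\<^sub>F t"
     using inj_onD[OF inj, of y "z \<otimes>\<^sub>F t"] yF z by auto
   qed
   finally show ?thesis by (auto simp: cgenideal_def)
  qed
  moreover have "PIdl\<^bsub>F\<lparr>carrier := Q\<rparr>\<^esub> t \<subseteq> Q" using t(1) subringE(6)[OF sQ] by (auto simp: cgenideal_def)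
  ultimately have "maximal_ideal_at F Q = PIdl\<^bsub>F\<lparr>carrier := Q\<rparr>\<^esub> t" unfolding maximal_ideal_at_def by blast
  then show "\<exists>t\<in>Q. maximal_ideal_at F Q = PIdl\<^bsub>F\<lparr>carrier := Q\<rparr>\<^esub> t" using t(1) by blast
 qed
qed

text \<open>The finite extension is a copy of \<open>k\<close> itself, so that \<open>F \<otimes>\<^sub>k K = F\<close>.\<close>

lemma smooth_projective_curve_regular:
 fixes k :: "'k ring" and F :: "('k, 'f) module"
 assumes "smooth_projective_curve k F xs"
 shows "regular_curve k F xs"
proof -
 have fin: "finite (carrier k)" and curve: "field k" "field F" "algebra k F" "set xs \<subseteq> carrier F"
  and irr: "geometrically_irreducible k F" and sm: "smooth k F xs"
  using assms unfolding smooth_projective_curve_def integral_projective_curve_def by auto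
 interpret k: field k by (rule curve)
 interpret F: field F by (rule curve)
 interpret kF: algebra k F by (rule curve)
 \<comment> \<open>\<open>smooth\<close> speaks about extensions whose carrier consists of natural
   numbers, so \<open>k\<close> is copied there along an enumeration \<open>\<psi>\<close> with
   inverse \<open>g\<close>.\<close>
 obtain n :: nat and \<psi> where \<psi>: "bij_betw \<psi> {0..<n} (carrier k)"
  using ex_bij_betw_nat_finite[OF fin] by blast
 define g where "g = inv_into {0..<n} \<psi>"
 have g: "bij_betw g (carrier k) {0..<n}" unfolding g_def by (rule bij_betw_inv_into[OF \<psi>])
 have \<psi>g: "\<psi> (g c) = c" if "c \<in> carrier k" for c unfolding g_def by (rule bij_betw_inv_into_right[OF \<psi> that])
 have g\<psi>: "g (\<psi> a) = a" if "a < n" for a unfolding g_def using bij_betw_inv_into_left[OF \<psi>, of a] that by simp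
 have gn: "g c < n" if "c \<in> carrier k" for c using g that by (auto simp: bij_betw_def)
 have \<psi>k: "\<psi> a \<in> carrier k" if "a < n" for a using \<psi> that by (auto simp: bij_betw_def)
 define N :: "nat ring" where "N = \<lparr>carrier = {0..<n}, monoid.mult = (\<lambda>a b. g (\<psi> a \<otimes>\<^sub>k \<psi> b)), one = g \<one>\<^sub>k,
  ring.zero = g \<zero>\<^sub>k, add = (\<lambda>a b. g (\<psi> a \<oplus>\<^sub>k \<psi> b))\<rparr>"
 define K where "K = alg_via g N"
 have Kc: "carrier K = {0..<n}" by (simp add: K_def N_def)
 have isoN: "g \<in> ring_iso k N" and isoK: "g \<in> ring_iso k K"
  using g by (auto intro!: ring_iso_memI simp: N_def K_def \<psi>g gn)
 \<comment> \<open>The transfer of the field axioms speaks about the image ring with its zero reset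
   to \<open>g \<zero>\<^sub>k\<close>, which is the zero already.\<close>
 have "N\<lparr>zero := g \<zero>\<^sub>k \<rparr> = N" "K\<lparr>zero := g \<zero>\<^sub>k \<rparr> = K" by (simp_all add: N_def K_def alg_via_def)
 then have fN: "field N" and fK: "field K"
  using k.ring_iso_imp_img_field[OF isoN] k.ring_iso_imp_img_field[OF isoK] by simp_all
 interpret fN: field N by fact
 interpret fK: field K by fact
 have algK: "algebra k K" unfolding K_def
  by (rule algebra_alg_via) (use isoN k.cring_axioms fN.cring_axioms in \<open>auto simp: ring_iso_def\<close>)
 interpret kK: algebra k K by (rule algK)
 interpret t: tensor_algebra k F K ..
 have smK: "c \<odot>\<^sub>K a = g c \<otimes>\<^sub>K a" for c a by (simp add: K_def)
 have oneK: "\<one>\<^sub>K = g \<one>\<^sub>k" by (simp add: K_def N_def)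
 have fe: "finite_extension_nat k K" using fK algK Kc by (simp add: finite_extension_nat_def)
 let ?G = "base_field k F K"
 have G: "field ?G" using irr fe by (simp add: geometrically_irreducible_def)
 define \<theta> where "\<theta> = (\<lambda>y. pure_tensor k F K y \<one>\<^sub>K)"
 have \<theta>: "\<theta> \<in> ring_hom F ?G"
  using t.pt_one_ring_hom by (simp add: \<theta>_def ring_hom_def)
 have gK: "c \<odot>\<^sub>K \<one>\<^sub>K = g c" if "c \<in> carrier k" for c
  using fK.r_one[of "g c"] gn[OF that] Kc by (simp add: smK)
 \<comment> \<open>The inverse of \<open>\<theta>\<close>: a scalar in the copy of \<open>k\<close>
   is carried back and moved to the first factor.\<close>
 define \<rho> where "\<rho> = tensor_lift F (\<lambda>y a. \<psi> a \<odot>\<^sub>F y)"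
 have bal: "balanced k F K F (\<lambda>y a. \<psi> a \<odot>\<^sub>F y)"
 proof (rule balancedI)
  fix y a b assume "y \<in> carrier F" "a \<in> carrier K" "b \<in> carrier K"
  then show "\<psi> (a \<oplus>\<^sub>K b) \<odot>\<^sub>F y = \<psi> a \<odot>\<^sub>F y \<oplus>\<^sub>F \<psi> b \<odot>\<^sub>F y"
   using \<psi>k by (simp add: K_def N_def \<psi>g kF.smult_l_distr)
 next
  fix c y a assume "c \<in> carrier k" "y \<in> carrier F" "a \<in> carrier K"
  then show "\<psi> a \<odot>\<^sub>F (c \<odot>\<^sub>F y) = \<psi> (c \<odot>\<^sub>K a) \<odot>\<^sub>F y"
   using \<psi>k gn by (simp add: K_def N_def \<psi>g k.m_comm[of c] kF.smult_assoc1)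
 qed (use \<psi>k Kc in \<open>auto simp: kF.smult_r_distr\<close>)
 have F_ab: "abelian_group F" by (rule F.abelian_group_axioms)
 have \<rho>: "\<rho> (pure_tensor k F K y a) = \<psi> a \<odot>\<^sub>F y" if "y \<in> carrier F" "a \<in> carrier K" for y a
  unfolding \<rho>_def by (rule t.tensor_lift_pure[OF F_ab bal that])
 have \<rho>add: "additive (tensor k F K) F \<rho>" unfolding \<rho>_def by (rule t.additive_tensor_lift[OF F_ab bal])
 have \<rho>\<theta>: "\<rho> (\<theta> y) = y" if "y \<in> carrier F" for y
  unfolding \<theta>_def using \<rho>[OF that fK.one_closed] that by (simp add: oneK \<psi>g)
 have \<theta>c: "\<theta> y \<in> carrier (tensor k F K)" if "y \<in> carrier F" for y unfolding \<theta>_def using that by (intro t.pt_closed) auto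
 have \<theta>add: "additive F (tensor k F K) \<theta>"
  using \<theta>c by (auto intro!: additiveI simp: \<theta>_def t.pt_add_l)
 have \<theta>\<rho>: "\<theta> (\<rho> Z) = Z" if Z: "Z \<in> carrier (tensor k F K)" for Z
  using Z
 proof (induction rule: t.tensor_induct)
  case (pure y a)
  have a: "a < n" using pure Kc by simp
  have "\<theta> (\<psi> a \<odot>\<^sub>F y) = pure_tensor k F K y (\<psi> a \<odot>\<^sub>K \<one>\<^sub>K)"
   unfolding \<theta>_def using pure \<psi>k[OF a] by (intro t.pt_smult) auto
  then show ?case using pure gK[OF \<psi>k[OF a]] g\<psi>[OF a] by (simp add: \<rho>)
 next
  case (add Z Z')
  then show ?case using additive_add[OF \<rho>add] additive_closed[OF \<rho>add] additive_add[OF \<theta>add] by simp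
 qed
 have bij: "bij_betw \<theta> (carrier F) (carrier ?G)"
  by (rule bij_betw_byWitness[where f' = \<rho>]) (use \<rho>\<theta> \<theta>\<rho> \<theta>c additive_closed[OF \<rho>add] in auto)
 have const: "\<theta> ` constants k F = constants K ?G"
 proof -
  have 1: "\<theta> (c \<odot>\<^sub>F \<one>\<^sub>F) = g c \<odot>\<^bsub>?G\<^esub> \<one>\<^bsub>?G\<^esub>" if c: "c \<in> carrier k" for c
  proof -
   have gc: "g c \<in> carrier K" using gn[OF c] Kc by simp
   have "\<theta> (c \<odot>\<^sub>F \<one>\<^sub>F) = pure_tensor k F K \<one>\<^sub>F (g c)"
    unfolding \<theta>_def gK[OF c, symmetric] using c by (intro t.pt_smult) auto
   also have "... = g c \<odot>\<^bsub>?G\<^esub> \<one>\<^bsub>?G\<^esub>"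
    using t.ext_smult_pt[OF gc F.one_closed fK.one_closed] gc by (simp add: t.tensor_one)
   finally show ?thesis .
  qed
  have "carrier K = g ` carrier k" using g Kc by (auto simp: bij_betw_def)
  then show ?thesis unfolding constants_def using 1 by (auto simp: image_iff)
 qed
 have "regular_curve K ?G (map \<theta> xs)"
  using sm fe unfolding smooth_def base_coords_def \<theta>_def by simp
 moreover have "constants k F \<subseteq> carrier F" by (auto simp: constants_def)
 ultimately show ?thesis using regular_curve_iso[OF curve(2) G \<theta> bij const _ curve(4)] by blast
qed


section \<open>Modules with Frobenius\<close>

lemma finsum_transfer:
 "carrier N = carrier M ==> add N = add M ==> \<zero>\<^sub>N = \<zero>\<^sub>M ==> finsum N f I = finsum M f I"
 by (simp add: finsum_def finprod_def)

lemma frob_hom_simps [simp]: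
 "\<zero>\<^bsub>frob_hom i S \<sigma> M \<phi> M' \<phi>'\<^esub> = (\<lambda>x\<in>carrier M. \<zero>\<^sub>M')"
 "f \<oplus>\<^bsub>frob_hom i S \<sigma> M \<phi> M' \<phi>'\<^esub> g = (\<lambda>x\<in>carrier M. f x \<oplus>\<^sub>M' g x)"
 "b \<odot>\<^bsub>frob_hom i S \<sigma> M \<phi> M' \<phi>'\<^esub> f = (\<lambda>x\<in>carrier M. i b \<odot>\<^sub>M' f x)"
 by (simp_all add: frob_hom_def)

text \<open>Transitivity of finite projectivity: expand in \<open>M\<close> over \<open>S\<close>,
  then expand the coordinates in \<open>S\<close> over \<open>R\<close>. Generators are multiplied
  and coordinate functions composed.\<close>

lemma restrict_dual_basis:
 assumes "cring R" "i \<in> ring_hom R S" and M: "module S M" and db: "dual_basis S M I e l"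
  and dbS: "dual_basis R (alg_via i S) J \<beta> \<kappa>"
 shows "dual_basis R (restrict_scalars i M) (I \<times> J) (\<lambda>p. \<beta> (snd p) \<odot>\<^sub>M e (fst p)) (\<lambda>p x. \<kappa> (snd p) (l (fst p) x))"
proof -
 interpret M: module S M by fact
 note d = dual_basisD[OF db] and s = dual_basisD(1-6)[OF dbS, simplified]
 have sum: "x = (\<Oplus>\<^sub>M p\<in>I \<times> J. i (\<kappa> (snd p) (l (fst p) x)) \<odot>\<^sub>M (\<beta> (snd p) \<odot>\<^sub>M e (fst p)))" if x: "x \<in> carrier M" for x
 proof -
  have cl: "i (\<kappa> b (l a x)) \<in> carrier S" if "a \<in> I" "b \<in> J" for a b
   using d(3) s(3) x that ring_hom_closed[OF assms(2)] by blast
  have "x = (\<Oplus>\<^sub>M a\<in>I. l a x \<odot>\<^sub>M e a)" by (rule d(6)[OF x])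
  also have "... = (\<Oplus>\<^sub>M a\<in>I. \<Oplus>\<^sub>M b\<in>J. i (\<kappa> b (l a x)) \<odot>\<^sub>M (\<beta> b \<odot>\<^sub>M e a))"
  proof (rule M.finsum_cong')
   fix a assume a: "a \<in> I"
   have la: "l a x \<in> carrier S" by (rule d(3)[OF a x])
   have "l a x = (\<Oplus>\<^sub>S b\<in>J. i (\<kappa> b (l a x)) \<otimes>\<^sub>S \<beta> b)"
    using s(6)[OF la] by (simp add: finsum_transfer[of "alg_via i S" S])
   then have "l a x \<odot>\<^sub>M e a = (\<Oplus>\<^sub>S b\<in>J. i (\<kappa> b (l a x)) \<otimes>\<^sub>S \<beta> b) \<odot>\<^sub>M e a" by simp
   also have "... = (\<Oplus>\<^sub>M b\<in>J. (i (\<kappa> b (l a x)) \<otimes>\<^sub>S \<beta> b) \<odot>\<^sub>M e a)"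
    using cl[OF a] s(2) by (intro M.finsum_smult[OF d(2)[OF a]]) auto
   also have "... = (\<Oplus>\<^sub>M b\<in>J. i (\<kappa> b (l a x)) \<odot>\<^sub>M (\<beta> b \<odot>\<^sub>M e a))"
    using cl[OF a] s(2) d(2)[OF a] by (intro M.finsum_cong') (auto simp: M.smult_assoc1)
   finally show "l a x \<odot>\<^sub>M e a = (\<Oplus>\<^sub>M b\<in>J. i (\<kappa> b (l a x)) \<odot>\<^sub>M (\<beta> b \<odot>\<^sub>M e a))" .
  qed (use cl s(2) d(2) in \<open>auto intro!: M.finsum_closed\<close>)
  also have "... = (\<Oplus>\<^sub>M p\<in>I \<times> J. i (\<kappa> (snd p) (l (fst p) x)) \<odot>\<^sub>M (\<beta> (snd p) \<odot>\<^sub>M e (fst p)))"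
   using M.finsum_product[OF d(1) s(1), of "\<lambda>p. i (\<kappa> (snd p) (l (fst p) x)) \<odot>\<^sub>M (\<beta> (snd p) \<odot>\<^sub>M e (fst p))"] cl s(2) d(2)
   by auto
  finally show ?thesis .
 qed
 show ?thesis
  unfolding dual_basis_def
 proof (intro conjI ballI)
  fix p assume p: "p \<in> I \<times> J"
  show "module_hom R (restrict_scalars i M) (self_module R) (\<lambda>x. \<kappa> (snd p) (l (fst p) x))"
   using p d s ring_hom_closed[OF assms(2)] by (intro module_homI) auto
 next
  fix x assume "x \<in> carrier (restrict_scalars i M)"
  then show "x = (\<Oplus>\<^bsub>restrict_scalars i M\<^esub>p\<in>I \<times> J. \<kappa> (snd p) (l (fst p) x) \<odot>\<^bsub>restrict_scalars i M\<^esub> (\<beta> (snd p) \<odot>\<^sub>M e (fst p)))"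
   using sum[of x] by (simp add: finsum_transfer[of "restrict_scalars i M" M])
 qed (use d s in auto)
qed

text \<open>Every element of \<open>S\<close> is an \<open>R\<close>-combination of the
  \<open>\<beta> b\<close>, so commuting with multiplication by these finitely many elements
  promotes \<open>R\<close>-linearity to \<open>S\<close>-linearity.\<close>

lemma module_hom_extend_scalars:
 assumes "i \<in> ring_hom R S" and M: "module S M" and M': "module S M'" and dbS: "dual_basis R (alg_via i S) J \<beta> \<kappa>"
  and g: "module_hom R (restrict_scalars i M) (restrict_scalars i M') g"
  and \<beta>: "!!b m. b \<in> J ==> m \<in> carrier M ==> g (\<beta> b \<odot>\<^sub>M m) = \<beta> b \<odot>\<^sub>M' g m"
 shows "module_hom S M M' g"
proof -
 interpret M: module S M by fact
 interpret M': module S M' by fact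
 note s = dual_basisD(1-6)[OF dbS, simplified] and g' = module_homD[OF g, simplified]
 have ad: "additive M M' g" using g' by (intro additiveI) auto
 have exp: "c \<odot>\<^sub>N n = (\<Oplus>\<^sub>N b\<in>J. i (\<kappa> b c) \<odot>\<^sub>N (\<beta> b \<odot>\<^sub>N n))"
  if N: "module S N" and c: "c \<in> carrier S" and n: "n \<in> carrier N" for N :: "('b, 'z) module" and c n
 proof -
  interpret N: module S N by fact
  have cl: "i (\<kappa> b c) \<in> carrier S" if "b \<in> J" for b
   using s(3)[OF that c] ring_hom_closed[OF assms(1)] by blast
  have "c = (\<Oplus>\<^sub>S b\<in>J. i (\<kappa> b c) \<otimes>\<^sub>S \<beta> b)"
   using s(6)[OF c] by (simp add: finsum_transfer[of "alg_via i S" S])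
  then have "c \<odot>\<^sub>N n = (\<Oplus>\<^sub>S b\<in>J. i (\<kappa> b c) \<otimes>\<^sub>S \<beta> b) \<odot>\<^sub>N n" by simp
  also have "... = (\<Oplus>\<^sub>N b\<in>J. (i (\<kappa> b c) \<otimes>\<^sub>S \<beta> b) \<odot>\<^sub>N n)" using cl s(2) by (intro N.finsum_smult n) auto
  also have "... = (\<Oplus>\<^sub>N b\<in>J. i (\<kappa> b c) \<odot>\<^sub>N (\<beta> b \<odot>\<^sub>N n))"
   using cl s(2) n by (intro N.finsum_cong') (auto simp: N.smult_assoc1)
  finally show ?thesis .
 qed
 show ?thesis
 proof (rule module_homI)
  fix c m assume c: "c \<in> carrier S" and m: "m \<in> carrier M"
  have cl: "i (\<kappa> b c) \<in> carrier S" if "b \<in> J" for b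
   using s(3)[OF that c] ring_hom_closed[OF assms(1)] by blast
  have "g (c \<odot>\<^sub>M m) = g (\<Oplus>\<^sub>M b\<in>J. i (\<kappa> b c) \<odot>\<^sub>M (\<beta> b \<odot>\<^sub>M m))"
   using exp[OF M c m] by simp
  also have "... = (\<Oplus>\<^sub>M' b\<in>J. g (i (\<kappa> b c) \<odot>\<^sub>M (\<beta> b \<odot>\<^sub>M m)))"
   using cl s(2) m by (intro additive_finsum[OF M.abelian_group_axioms M'.abelian_group_axioms ad]) auto
  also have "... = (\<Oplus>\<^sub>M' b\<in>J. i (\<kappa> b c) \<odot>\<^sub>M' (\<beta> b \<odot>\<^sub>M' g m))"
   using cl s(2,3) m c g' \<beta> by (intro M'.finsum_cong') auto
  also have "... = c \<odot>\<^sub>M' g m" using exp[OF M' c] g'(1)[OF m] by simp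
  finally show "g (c \<odot>\<^sub>M m) = c \<odot>\<^sub>M' g m" .
 qed (use g' in auto)
qed

section \<open>Homomorphisms compatible with Frobenius, described by a semilinear operator\<close>

locale frob_ring = R: cring R + S: cring S
 for R (structure) and S :: "('s, 'x) ring_scheme" +
 fixes i and \<sigma>
 assumes i: "i \<in> ring_hom R S" and \<sigma>: "\<sigma> \<in> ring_hom S S" and \<sigma>i: "r \<in> carrier R ==> \<sigma> (i r) = i r"
begin

lemmas i_simps [simp] = ring_hom_closed[OF i] ring_hom_closed[OF \<sigma>]

lemma tensor_ext_pullback: "module S M ==> tensor_ext S M (alg_via \<sigma> S)"
 by (rule tensor_ext.intro[OF _ algebra_alg_via[OF S.cring_axioms S.cring_axioms \<sigma>]])

lemma tensor_pair_pullback: "module S M ==> tensor_pair S M (alg_via \<sigma> S)"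
 by (rule tensor_pair.intro[OF _ algebra.axioms(1)[OF algebra_alg_via[OF S.cring_axioms S.cring_axioms \<sigma>]]])

lemma module_pullback: "module S M ==> module S (pullback S \<sigma> M)"
 unfolding pullback_def
 by (rule module_ring_transfer[OF tensor_ext.module_ext[OF tensor_ext_pullback] S.cring_axioms]) simp_all

abbreviation pb where "pb M \<equiv> pure_tensor S M (alg_via \<sigma> S)"

lemma carrier_pullback: "carrier (pullback S \<sigma> M) = carrier (tensor S M (alg_via \<sigma> S))"
 and add_pullback: "add (pullback S \<sigma> M) = add (tensor S M (alg_via \<sigma> S))"
 by (simp_all add: pullback_def extend_scalars_def Let_def)

lemma pb_closed: "module S M ==> m \<in> carrier M ==> s \<in> carrier S ==> pb M m s \<in> carrier (pullback S \<sigma> M)"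
 unfolding carrier_pullback using tensor_pair.pt_closed[OF tensor_pair_pullback, of M m s] by simp

lemma pullback_smult_pb:
 assumes "module S M" "m \<in> carrier M" "s \<in> carrier S" "t \<in> carrier S"
 shows "s \<odot>\<^bsub>pullback S \<sigma> M\<^esub> pb M m t = pb M m (s \<otimes>\<^sub>S t)"
 using tensor_ext.ext_smult_pt[OF tensor_ext_pullback[OF assms(1)], of s m t] assms by (simp add: pullback_def)

lemma pullback_map_pb:
 assumes "module S M" "module S M'" "module_hom S M M' g" "m \<in> carrier M" "s \<in> carrier S"
 shows "pullback_map S \<sigma> M M' g (pb M m s) = pb M' (g m) s"
 unfolding pullback_map_def
 by (rule tensor_map_pt[OF tensor_pair_pullback tensor_pair_pullback]) (use assms in \<open>auto intro: module_homI\<close>)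

context
 fixes M :: "('s, 'm) module" and \<tau>
 assumes M: "module S M" and \<tau>: "module_hom S (pullback S \<sigma> M) M \<tau>"
begin

interpretation M: module S M by (rule M)
interpretation p: tensor_pair S M "alg_via \<sigma> S" by (rule tensor_pair_pullback[OF M])

lemma semilinear_closed: "m \<in> carrier M ==> semilinear S \<sigma> M \<tau> m \<in> carrier M"
 unfolding semilinear_def using module_homD(1)[OF \<tau>] pb_closed[OF M] by simp

lemma frob_pb:
 assumes "m \<in> carrier M" "s \<in> carrier S"
 shows "\<tau> (pb M m s) = s \<odot>\<^sub>M semilinear S \<sigma> M \<tau> m"
proof -
 have "pb M m s = s \<odot>\<^bsub>pullback S \<sigma> M\<^esub> pb M m \<one>\<^sub>S" using pullback_smult_pb[OF M assms S.one_closed] assms by simp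
 then show ?thesis unfolding semilinear_def using module_homD(3)[OF \<tau> assms(2)] pb_closed[OF M assms(1)] by simp
qed

lemma semilinear_add:
 "m \<in> carrier M ==> m' \<in> carrier M ==>
  semilinear S \<sigma> M \<tau> (m \<oplus>\<^sub>M m') = semilinear S \<sigma> M \<tau> m \<oplus>\<^sub>M semilinear S \<sigma> M \<tau> m'"
 unfolding semilinear_def
 using p.pt_add_l[of m m' "\<one>\<^sub>S"] module_homD(2)[OF \<tau>, of "pb M m \<one>\<^sub>S" "pb M m' \<one>\<^sub>S"] pb_closed[OF M]
 by (simp add: add_pullback)

lemma semilinear_smult:
 assumes "m \<in> carrier M" "s \<in> carrier S"
 shows "semilinear S \<sigma> M \<tau> (s \<odot>\<^sub>M m) = \<sigma> s \<odot>\<^sub>M semilinear S \<sigma> M \<tau> m"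
 unfolding semilinear_def[of _ _ _ _ "s \<odot>\<^sub>M m"]
 using p.pt_smult[of s m "\<one>\<^sub>S"] frob_pb[of m "\<sigma> s"] assms by simp

lemma semilinear_hom: "module_hom R (restrict_scalars i M) (restrict_scalars i M) (semilinear S \<sigma> M \<tau>)"
 by (rule module_homI) (simp_all add: semilinear_closed semilinear_add semilinear_smult \<sigma>i)

end

context
 fixes M :: "('s, 'm) module" and \<tau> and M' :: "('s, 'n) module" and \<tau>'
 assumes M: "module S M" and \<tau>: "module_hom S (pullback S \<sigma> M) M \<tau>"
  and M': "module S M'" and \<tau>': "module_hom S (pullback S \<sigma> M') M' \<tau>'"
begin

interpretation M: module S M by (rule M)
interpretation M': module S M' by (rule M')
interpretation p: tensor_pair S M "alg_via \<sigma> S" by (rule tensor_pair_pullback[OF M])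

abbreviation "FH \<equiv> frob_hom i S \<sigma> M \<tau> M' \<tau>'"

text \<open>Both sides of the condition on the pullback are additive and linear in the second tensor
  factor, so comparing them on tensors with second factor \<open>\<one>\<^sub>S\<close> is enough.
  The condition thereby concerns the operator \<open>semilinear\<close> alone.\<close>

lemma frob_hom_iff:
 "g \<in> carrier FH \<longleftrightarrow> g \<in> extensional (carrier M) & module_hom S M M' g &
  (\<forall>m\<in>carrier M. g (semilinear S \<sigma> M \<tau> m) = semilinear S \<sigma> M' \<tau>' (g m))" (is "_ \<longleftrightarrow> ?r")
proof
 assume g: "g \<in> carrier FH"
 then have gh: "module_hom S M M' g" by (simp add: frob_hom_def)
 have "g (semilinear S \<sigma> M \<tau> m) = semilinear S \<sigma> M' \<tau>' (g m)" if m: "m \<in> carrier M" for m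
  using g pb_closed[OF M m S.one_closed] pullback_map_pb[OF M M' gh m S.one_closed]
  by (simp add: frob_hom_def semilinear_def)
 then show ?r using g by (simp add: frob_hom_def)
next
 assume r: ?r
 then have gh: "module_hom S M M' g" by simp
 have pm: "additive p.TT (tensor S M' (alg_via \<sigma> S)) (pullback_map S \<sigma> M M' g)"
  unfolding pullback_map_def
  by (rule additive_tensor_map[OF tensor_pair_pullback[OF M] tensor_pair_pullback[OF M'] gh]) (auto intro: module_homI)
 have "g (\<tau> x) = \<tau>' (pullback_map S \<sigma> M M' g x)" if x: "x \<in> carrier (pullback S \<sigma> M)" for x
 proof (rule p.additive_eqI)
  show "additive p.TT M' (\<lambda>x. g (\<tau> x))"
   using module_homD[OF gh] module_homD[OF \<tau>] unfolding carrier_pullback add_pullback by (intro additiveI) auto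
  show "additive p.TT M' (\<lambda>x. \<tau>' (pullback_map S \<sigma> M M' g x))"
   using additive_closed[OF pm] additive_add[OF pm] module_homD[OF \<tau>'] unfolding carrier_pullback add_pullback
   by (intro additiveI) auto
  show "x \<in> carrier p.TT" using x unfolding carrier_pullback .
  fix m s assume ms: "m \<in> carrier M" "s \<in> carrier (alg_via \<sigma> S)"
  then show "g (\<tau> (pb M m s)) = \<tau>' (pullback_map S \<sigma> M M' g (pb M m s))"
   using r module_homD[OF gh] frob_pb[OF M \<tau>] frob_pb[OF M' \<tau>'] semilinear_closed[OF M \<tau>] pullback_map_pb[OF M M' gh]
   by simp
 qed
 then show "g \<in> carrier FH" using r by (simp add: frob_hom_def)
qed

lemma frob_homD:
 assumes "g \<in> carrier FH"
 shows "g \<in> extensional (carrier M)" "x \<in> carrier M ==> g x \<in> carrier M'" 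
  "x \<in> carrier M ==> y \<in> carrier M ==> g (x \<oplus>\<^sub>M y) = g x \<oplus>\<^sub>M' g y"
  "s \<in> carrier S ==> x \<in> carrier M ==> g (s \<odot>\<^sub>M x) = s \<odot>\<^sub>M' g x"
  "x \<in> carrier M ==> g (semilinear S \<sigma> M \<tau> x) = semilinear S \<sigma> M' \<tau>' (g x)"
  "module_hom S M M' g"
 using assms module_homD[of S M M' g] unfolding frob_hom_iff by auto

lemma frob_homI:
 assumes "g \<in> extensional (carrier M)" "module_hom S M M' g"
  "!!m. m \<in> carrier M ==> g (semilinear S \<sigma> M \<tau> m) = semilinear S \<sigma> M' \<tau>' (g m)"
 shows "g \<in> carrier FH"
 using assms unfolding frob_hom_iff by auto

text \<open>Scalars from \<open>R\<close> preserve the condition because \<open>\<sigma>\<close>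
  fixes their images in \<open>S\<close>. The maps are extensional, so identities are checked on the
  carrier; negatives are multiples by minus one.\<close>

lemma module_frob_hom: "module R FH"
proof -
 note s = semilinear_closed[OF M \<tau>] semilinear_closed[OF M' \<tau>'] semilinear_add[OF M' \<tau>'] semilinear_smult[OF M' \<tau>']
 have add: "(\<lambda>x\<in>carrier M. f x \<oplus>\<^sub>M' g x) \<in> carrier FH" if f: "f \<in> carrier FH" and g: "g \<in> carrier FH" for f g
  by (rule frob_homI)
   (use frob_homD(2-5)[OF f] frob_homD(2-5)[OF g] s in \<open>auto intro!: module_homI simp: M'.a_ac M'.smult_r_distr\<close>)
 have smult: "(\<lambda>x\<in>carrier M. i b \<odot>\<^sub>M' f x) \<in> carrier FH" if b: "b \<in> carrier R" and f: "f \<in> carrier FH" for b f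
  by (rule frob_homI)
   (use b frob_homD(2-5)[OF f] s \<sigma>i[OF b] in \<open>auto intro!: module_homI simp: M'.smult_r_distr M'.smult_assoc1[symmetric] S.m_comm\<close>)
 have zero: "(\<lambda>x\<in>carrier M. \<zero>\<^sub>M') \<in> carrier FH"
 proof (rule frob_homI)
  have "semilinear S \<sigma> M' \<tau>' \<zero>\<^sub>M' = \<zero>\<^sub>M'"
   by (rule additive_zero[OF M'.M.abelian_group_axioms M'.M.abelian_group_axioms additiveI]) (use s in auto)
  then show "(\<lambda>x\<in>carrier M. \<zero>\<^sub>M') (semilinear S \<sigma> M \<tau> m) = semilinear S \<sigma> M' \<tau>' ((\<lambda>x\<in>carrier M. \<zero>\<^sub>M') m)"
   if "m \<in> carrier M" for m using that s by simp
 qed (auto intro!: module_homI)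
 note cl = frob_homD(2) 
 have ext: "f = (\<lambda>x\<in>carrier M. f x)" if "f \<in> carrier FH" for f
  using frob_homD(1)[OF that] by (simp add: extensional_restrict)
 have ab: "abelian_group FH"
 proof (rule abelian_groupI)
  fix f assume f: "f \<in> carrier FH"
  let ?n = "\<lambda>x\<in>carrier M. i (\<ominus> \<one>) \<odot>\<^sub>M' f x"
  have "i (\<ominus> \<one>) \<oplus>\<^sub>S \<one>\<^sub>S = \<zero>\<^sub>S"
   using ring_hom_add[OF i, of "\<ominus> \<one>" \<one>] ring_hom_one[OF i] ring_hom_zero[OF i R.ring_axioms S.ring_axioms] by (simp add: R.l_neg)
  then have "i (\<ominus> \<one>) \<odot>\<^sub>M' f x \<oplus>\<^sub>M' f x = \<zero>\<^sub>M'" if "x \<in> carrier M" for x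
   using M'.smult_l_distr[of "i (\<ominus> \<one>)" "\<one>\<^sub>S" "f x"] cl[OF f that] by simp
  then have "?n \<oplus>\<^sub>FH f = \<zero>\<^sub>FH" by (auto intro: restrict_ext)
  then show "\<exists>g\<in>carrier FH. g \<oplus>\<^sub>FH f = \<zero>\<^sub>FH" using smult[OF _ f, of "\<ominus> \<one>"] by blast
 next
  fix f assume f: "f \<in> carrier FH"
  show "\<zero>\<^sub>FH \<oplus>\<^sub>FH f = f" using cl[OF f] by (subst (2) ext[OF f]) (auto intro: restrict_ext)
 qed (use add zero cl in \<open>auto intro!: restrict_ext simp: M'.a_ac\<close>)
 show ?thesis
 proof (rule moduleI[OF R.cring_axioms ab])
  fix f assume f: "f \<in> carrier FH"
  show "\<one> \<odot>\<^sub>FH f = f" using cl[OF f] by (subst (2) ext[OF f]) (auto intro: restrict_ext simp: ring_hom_one[OF i])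
 qed (use smult cl in \<open>auto intro!: restrict_ext
   simp: ring_hom_add[OF i] ring_hom_mult[OF i] M'.smult_l_distr M'.smult_r_distr M'.smult_assoc1\<close>)
qed

lemma finsum_frob_hom:
 assumes "finite K" "f \<in> K \<rightarrow> carrier FH" "x \<in> carrier M"
 shows "(\<Oplus>\<^sub>FH k\<in>K. f k) x = (\<Oplus>\<^sub>M' k\<in>K. f k x)"
proof -
 interpret H: module R FH by (rule module_frob_hom)
 have "additive FH M' (\<lambda>g. g x)" using assms(3) frob_homD(2) by (intro additiveI) auto
 from additive_finsum[OF H.M.abelian_group_axioms M'.M.abelian_group_axioms this assms(2)]
 show ?thesis .
qed

end

end

section \<open>Base change of modules with Frobenius\<close>

lemma dual_basis_cong:
 assumes "module R M" "dual_basis R M I e l" "!!i. i \<in> I ==> e' i = e i"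
 shows "dual_basis R M I e' l"
proof -
 interpret M: module R M by fact
 note d = dual_basisD[OF assms(2)]
 have "x = (\<Oplus>\<^sub>M i\<in>I. l i x \<odot>\<^sub>M e' i)" if x: "x \<in> carrier M" for x
 proof -
  have "(\<Oplus>\<^sub>M i\<in>I. l i x \<odot>\<^sub>M e' i) = (\<Oplus>\<^sub>M i\<in>I. l i x \<odot>\<^sub>M e i)"
   using assms(3) d x by (intro M.M.finsum_cong') auto
  then show ?thesis using d(6)[OF x] by simp
 qed
 then show ?thesis using assms(2,3) by (auto simp: dual_basis_def)
qed

text \<open>The square formed by \<open>A\<close>, \<open>B\<close> and their extensions
  \<open>S\<close>, \<open>T\<close>. One index set \<open>J\<close> serves both extensions, with
  generators mapped by \<open>h\<close> and coordinates extending each other; in this way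
  \<open>T\<close> behaves like the base change of \<open>S\<close> to \<open>B\<close>.\<close>

locale frob_base_change = valuation_base_change A B \<iota> D + SA: frob_ring A S iA \<sigma> + TB: frob_ring B T iB \<sigma>T
 for A (structure) and B (structure) and \<iota> D and S :: "('s, 'x) ring_scheme" and T :: "('t, 'y) ring_scheme"
  and iA \<sigma> iB \<sigma>T +
 fixes h and J :: "'j set" and \<beta> \<kappa> \<kappa>T
 assumes h: "h \<in> ring_hom S T" and h_i: "a \<in> carrier A ==> h (iA a) = iB (\<iota> a)"
  and h_\<sigma>: "s \<in> carrier S ==> h (\<sigma> s) = \<sigma>T (h s)"
  and dbS: "dual_basis A (alg_via iA S) J \<beta> \<kappa>" and dbT: "dual_basis B (alg_via iB T) J (\<lambda>b. h (\<beta> b)) \<kappa>T"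
  and \<kappa>T: "b \<in> J ==> s \<in> carrier S ==> \<kappa>T b (h s) = \<iota> (\<kappa> b s)"
begin

abbreviation "hT \<equiv> alg_via h T"
abbreviation Y where "Y M \<equiv> extend_scalars S M hT"
abbreviation j where "j M m \<equiv> pure_tensor S M hT m \<one>\<^sub>T"

lemmas h_simps [simp] = ring_hom_closed[OF h]

lemma tensor_ext_Y: "module S M ==> tensor_ext S M hT"
 by (rule tensor_ext.intro[OF _ algebra_alg_via[OF SA.S.cring_axioms TB.S.cring_axioms h]])

lemma tensor_pair_Y: "module S M ==> tensor_pair S M hT"
 by (rule tensor_pair.intro[OF _ algebra.axioms(1)[OF algebra_alg_via[OF SA.S.cring_axioms TB.S.cring_axioms h]]])

lemma module_Y: "module S M ==> module T (Y M)"
 by (rule module_ring_transfer[OF tensor_ext.module_ext[OF tensor_ext_Y] TB.S.cring_axioms]) simp_all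

lemma carrier_Y: "carrier (Y M) = carrier (tensor S M hT)" and add_Y: "add (Y M) = add (tensor S M hT)"
 by (simp_all add: extend_scalars_def Let_def)

lemma ptY_closed: "module S M ==> m \<in> carrier M ==> t \<in> carrier T ==> pure_tensor S M hT m t \<in> carrier (Y M)"
 using tensor_pair.pt_closed[OF tensor_pair_Y, of M m t] by (simp add: carrier_Y)

lemma smult_ptY:
 assumes "module S M" "m \<in> carrier M" "r \<in> carrier T" "t \<in> carrier T"
 shows "r \<odot>\<^bsub>Y M\<^esub> pure_tensor S M hT m t = pure_tensor S M hT m (r \<otimes>\<^sub>T t)"
 using tensor_ext.ext_smult_pt[OF tensor_ext_Y[OF assms(1)], of r m t] assms by simp

lemma ptY_eq:
 "module S M ==> m \<in> carrier M ==> t \<in> carrier T ==> pure_tensor S M hT m t = t \<odot>\<^bsub>Y M\<^esub> j M m"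
 using smult_ptY[of M m t "\<one>\<^sub>T"] by simp

lemma j_closed: "module S M ==> m \<in> carrier M ==> j M m \<in> carrier (Y M)"
 by (rule ptY_closed) simp_all

lemma j_additive: "module S M ==> additive M (Y M) (j M)"
 using tensor_pair.pt_add_l[OF tensor_pair_Y, of M _ _ "\<one>\<^sub>T"] j_closed
 by (intro additiveI) (auto simp: add_Y)

lemma j_smult:
 assumes "module S M" "m \<in> carrier M" "s \<in> carrier S"
 shows "j M (s \<odot>\<^sub>M m) = h s \<odot>\<^bsub>Y M\<^esub> j M m"
 using tensor_pair.pt_smult[OF tensor_pair_Y[OF assms(1)], of s m "\<one>\<^sub>T"] assms ptY_eq[of M m "h s"] by simp

lemma Y_induct [consumes 2, case_names pure add]:
 assumes M: "module S M" and y: "y \<in> carrier (Y M)"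
  and "!!m t. m \<in> carrier M ==> t \<in> carrier T ==> Q (t \<odot>\<^bsub>Y M\<^esub> j M m)"
  and "!!y z. y \<in> carrier (Y M) ==> z \<in> carrier (Y M) ==> Q y ==> Q z ==> Q (y \<oplus>\<^bsub>Y M\<^esub> z)"
 shows "Q y"
proof -
 interpret p: tensor_pair S M hT by (rule tensor_pair_Y[OF M])
 note p.extend_scalars_simps [simp del]
 show ?thesis using y[unfolded carrier_Y]
 proof (induction rule: p.tensor_induct)
  case (pure m t)
  then show ?case using assms(3)[of m t] ptY_eq[OF M, of m t] by simp
 next
  case (add y z)
  then show ?case using assms(4)[of y z] by (simp add: carrier_Y add_Y)
 qed
qed

lemma Y_hom_eqI:
 assumes M: "module S M" and f: "module_hom T (Y M) N f" and g: "module_hom T (Y M) N g"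
  and "!!m. m \<in> carrier M ==> f (j M m) = g (j M m)" and y: "y \<in> carrier (Y M)"
 shows "f y = g y"
 using M y
 by (induction rule: Y_induct) (simp_all add: assms(4) module_homD[OF f] module_homD[OF g] j_closed[OF M])

lemma
 assumes M: "module S M" and M': "module S M'" and g: "module_hom S M M' g"
 shows tensor_map_Y_hom: "module_hom T (Y M) (Y M') (tensor_map S M hT M' hT g (\<lambda>t. t))" (is "module_hom _ _ _ ?g")
  and tensor_map_Y_pt: "m \<in> carrier M ==> t \<in> carrier T ==>
   tensor_map S M hT M' hT g (\<lambda>t. t) (pure_tensor S M hT m t) = pure_tensor S M' hT (g m) t"
proof -
 have id: "module_hom S hT hT (\<lambda>t. t)" by (rule module_homI) auto
 interpret Y: module T "Y M" by (rule module_Y[OF M])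
 interpret Y': module T "Y M'" by (rule module_Y[OF M'])
 show pt: "?g (pure_tensor S M hT m t) = pure_tensor S M' hT (g m) t" if "m \<in> carrier M" "t \<in> carrier T" for m t
  using tensor_map_pt[OF tensor_pair_Y[OF M] tensor_pair_Y[OF M'] g id] that by simp
 have ad: "additive (Y M) (Y M') ?g"
  using additive_tensor_map[OF tensor_pair_Y[OF M] tensor_pair_Y[OF M'] g id] by (simp add: additive_def carrier_Y add_Y)
 show "module_hom T (Y M) (Y M') ?g"
 proof (rule module_homI)
  fix r y assume r: "r \<in> carrier T" and y: "y \<in> carrier (Y M)"
  show "?g (r \<odot>\<^bsub>Y M\<^esub> y) = r \<odot>\<^bsub>Y M'\<^esub> ?g y"
   using M y
  proof (induction rule: Y_induct)
   case (pure m t)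
   then show ?case
    using r module_homD(1)[OF g] by (simp add: ptY_eq[OF M, symmetric] smult_ptY[OF M] smult_ptY[OF M'] pt)
  next
   case (add y z)
   then show ?case
    using r by (simp add: Y.smult_r_distr Y'.smult_r_distr additive_add[OF ad] additive_closed[OF ad])
  qed
 qed (use ad in \<open>auto simp: additive_closed additive_add\<close>)
qed

text \<open>The base change of a linear functional, with the extension of scalars of
  \<open>S\<close> to \<open>T\<close> identified with \<open>T\<close>.\<close>

definition lift_coord where "lift_coord M f = tensor_lift T (\<lambda>m t. h (f m) \<otimes>\<^sub>T t)"

lemma
 assumes M: "module S M" and f: "module_hom S M (self_module S) f"
 shows lift_coord_hom: "module_hom T (Y M) (self_module T) (lift_coord M f)"
  and lift_coord_j: "m \<in> carrier M ==> lift_coord M f (j M m) = h (f m)"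
proof -
 note f' = module_homD[OF f, simplified]
 interpret p: tensor_pair S M hT by (rule tensor_pair_Y[OF M])
 note p.extend_scalars_simps [simp del]
 interpret Y: module T "Y M" by (rule module_Y[OF M])
 have bal: "balanced S M hT T (\<lambda>m t. h (f m) \<otimes>\<^sub>T t)"
  by (rule balancedI)
   (auto simp: f' ring_hom_add[OF h] ring_hom_mult[OF h] TB.S.l_distr TB.S.r_distr TB.S.m_ac)
 have T: "abelian_group T" by (rule TB.S.abelian_group_axioms)
 have pt: "lift_coord M f (pure_tensor S M hT m t) = h (f m) \<otimes>\<^sub>T t" if "m \<in> carrier M" "t \<in> carrier T" for m t
  unfolding lift_coord_def using p.tensor_lift_pure[OF T bal, of m t] that by simp
 show "lift_coord M f (j M m) = h (f m)" if "m \<in> carrier M" for m using pt[OF that TB.S.one_closed] that f' by simp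
 have ad: "additive (Y M) T (lift_coord M f)"
  using p.additive_tensor_lift[OF T bal] by (simp add: lift_coord_def additive_def carrier_Y add_Y)
 show "module_hom T (Y M) (self_module T) (lift_coord M f)"
 proof (rule module_homI)
  fix r y assume r: "r \<in> carrier T" and y: "y \<in> carrier (Y M)"
  have "lift_coord M f (r \<odot>\<^bsub>Y M\<^esub> y) = r \<otimes>\<^sub>T lift_coord M f y"
   using M y
  proof (induction rule: Y_induct)
   case (pure m t)
   then show ?case
    using r f' by (simp add: ptY_eq[OF M, symmetric] smult_ptY[OF M] pt TB.S.m_lcomm)
  next
   case (add y z)
   then show ?case
    using r by (simp add: Y.smult_r_distr TB.S.r_distr additive_add[OF ad] additive_closed[OF ad])
  qed
  then show "lift_coord M f (r \<odot>\<^bsub>Y M\<^esub> y) = r \<odot>\<^bsub>self_module T\<^esub> lift_coord M f y" by simp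
 qed (use ad in \<open>auto simp: additive_closed additive_add\<close>)
qed

text \<open>The expansion \<open>?g\<close> and the identity are both linear over \<open>T\<close>
  and agree on the image of \<open>j M\<close>, which generates.\<close>

lemma dual_basis_Y:
 assumes M: "module S M" and db: "dual_basis S M I e l"
 shows "dual_basis T (Y M) I (\<lambda>a. j M (e a)) (\<lambda>a. lift_coord M (l a))"
proof -
 note d = dual_basisD[OF db]
 interpret M: module S M by (rule M)
 interpret Y: module T "Y M" by (rule module_Y[OF M])
 have l: "module_hom S M (self_module S) (l a)" if "a \<in> I" for a using db that by (simp add: dual_basis_def)
 note lh = lift_coord_hom[OF M l] and lj = lift_coord_j[OF M l] and je = j_closed[OF M d(2)]
 note lD = module_homD[OF lh, simplified]
 let ?g = "\<lambda>y. \<Oplus>\<^bsub>Y M\<^esub>a\<in>I. lift_coord M (l a) y \<odot>\<^bsub>Y M\<^esub> j M (e a)"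
 have "module_hom T (Y M) (Y M) ?g"
 proof (rule module_homI)
  fix y z assume yz: "y \<in> carrier (Y M)" "z \<in> carrier (Y M)"
  have "?g (y \<oplus>\<^bsub>Y M\<^esub> z) = (\<Oplus>\<^bsub>Y M\<^esub>a\<in>I. lift_coord M (l a) y \<odot>\<^bsub>Y M\<^esub> j M (e a) \<oplus>\<^bsub>Y M\<^esub> lift_coord M (l a) z \<odot>\<^bsub>Y M\<^esub> j M (e a))"
   using yz lD je by (intro Y.M.finsum_cong') (auto simp: Y.smult_l_distr)
  also have "... = ?g y \<oplus>\<^bsub>Y M\<^esub> ?g z" using yz lD je by (intro Y.M.finsum_addf) auto
  finally show "?g (y \<oplus>\<^bsub>Y M\<^esub> z) = ?g y \<oplus>\<^bsub>Y M\<^esub> ?g z" .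
 next
  fix r y assume ry: "r \<in> carrier T" "y \<in> carrier (Y M)"
  have "?g (r \<odot>\<^bsub>Y M\<^esub> y) = (\<Oplus>\<^bsub>Y M\<^esub>a\<in>I. r \<odot>\<^bsub>Y M\<^esub> (lift_coord M (l a) y \<odot>\<^bsub>Y M\<^esub> j M (e a)))"
   using ry lD je by (intro Y.M.finsum_cong') (auto simp: Y.smult_assoc1)
  also have "... = r \<odot>\<^bsub>Y M\<^esub> ?g y" using ry lD je by (intro Y.smult_finsum[symmetric]) auto
  finally show "?g (r \<odot>\<^bsub>Y M\<^esub> y) = r \<odot>\<^bsub>Y M\<^esub> ?g y" .
 qed (use lD je in \<open>auto intro!: Y.M.finsum_closed\<close>)
 moreover have "module_hom T (Y M) (Y M) (\<lambda>y. y)" by (rule module_homI) auto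
 moreover have "j M m = ?g (j M m)" if m: "m \<in> carrier M" for m
 proof -
  have "j M m = j M (\<Oplus>\<^sub>M a\<in>I. l a m \<odot>\<^sub>M e a)" using d(6)[OF m] by simp
  also have "... = (\<Oplus>\<^bsub>Y M\<^esub>a\<in>I. j M (l a m \<odot>\<^sub>M e a))"
   using d m by (intro additive_finsum[OF M.M.abelian_group_axioms Y.M.abelian_group_axioms j_additive[OF M]]) auto
  also have "... = ?g (j M m)" using d m je lj by (intro Y.M.finsum_cong') (auto simp: j_smult[OF M])
  finally show ?thesis .
 qed
 ultimately have "y = ?g y" if "y \<in> carrier (Y M)" for y using Y_hom_eqI[OF M _ _ _ that, of "Y M" "\<lambda>y. y" ?g] by blast
 then show ?thesis unfolding dual_basis_def using d(1) je lh by auto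
qed

context
 fixes M :: "('s, 'm) module" and \<tau>
 assumes M: "module S M" and \<tau>: "module_hom S (pullback S \<sigma> M) M \<tau>"
begin

abbreviation "sM \<equiv> pullback S \<sigma> M"
abbreviation "bcf \<equiv> base_change_frob S \<sigma> T \<sigma>T h M \<tau>"

text \<open>The second statement is what later arguments use: \<open>j M\<close> intertwines the
  semilinear operators before and after base change. The nested lifts in
  \<open>pullback_base_change\<close> are evaluated once for this purpose.\<close>

lemma
 shows base_change_frob_hom: "module_hom T (pullback T \<sigma>T (Y M)) (Y M) bcf"
  and semilinear_base_change_frob: "m \<in> carrier M ==>
   semilinear T \<sigma>T (Y M) bcf (j M m) = j M (semilinear S \<sigma> M \<tau> m)"
proof -
 note sM = SA.module_pullback[OF M]
 interpret M: module S M by (rule M)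
 interpret Y: module T "Y M" by (rule module_Y[OF M])
 interpret N: module T "Y sM" by (rule module_Y[OF sM])
 interpret p: tensor_pair S M hT by (rule tensor_pair_Y[OF M])
 note p.extend_scalars_simps [simp del]
 interpret ps: tensor_pair S sM hT by (rule tensor_pair_Y[OF sM])
 note ps.extend_scalars_simps [simp del]
 interpret pb: tensor_pair S M "alg_via \<sigma> S" by (rule SA.tensor_pair_pullback[OF M])
 interpret q: tensor_pair T "Y M" "alg_via \<sigma>T T" by (rule TB.tensor_pair_pullback[OF module_Y[OF M]])
 note pbc = SA.pb_closed[OF M]
 have N: "abelian_group (Y sM)" by (rule N.M.abelian_group_axioms)
 \<comment> \<open>The inner lift of \<open>pullback_base_change\<close>. That it is balanced
   combines the relation of the \<open>\<sigma>\<close>-pullback with the compatibility of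
   \<open>h\<close> with the two Frobenius maps.\<close>
 let ?c = "\<lambda>m s. pure_tensor S sM hT (SA.pb M m \<one>\<^sub>S) (\<sigma>T s)"
 have \<sigma>T: "\<sigma>T (s \<oplus>\<^sub>T t) = \<sigma>T s \<oplus>\<^sub>T \<sigma>T t" "\<sigma>T (s \<otimes>\<^sub>T t) = \<sigma>T s \<otimes>\<^sub>T \<sigma>T t" if "s \<in> carrier T" "t \<in> carrier T" for s t
  using ring_hom_add[OF TB.\<sigma>] ring_hom_mult[OF TB.\<sigma>] that by auto
 have bal: "balanced S M hT (Y sM) ?c"
 proof (rule balancedI)
  fix m t assume m: "m \<in> carrier M" and t: "t \<in> carrier hT"
  show "?c m t \<in> carrier (Y sM)" using ptY_closed[OF sM] pbc m t by simp
  show "?c (m \<oplus>\<^sub>M m') t = ?c m t \<oplus>\<^bsub>Y sM\<^esub> ?c m' t" if m': "m' \<in> carrier M" for m'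
  proof -
   have "SA.pb M (m \<oplus>\<^sub>M m') \<one>\<^sub>S = SA.pb M m \<one>\<^sub>S \<oplus>\<^sub>sM SA.pb M m' \<one>\<^sub>S"
    using pb.pt_add_l[OF m m', of "\<one>\<^sub>S"] by (simp add: SA.add_pullback)
   then show ?thesis using ps.pt_add_l[of "SA.pb M m \<one>\<^sub>S" "SA.pb M m' \<one>\<^sub>S" "\<sigma>T t"] pbc m m' t by (simp add: add_Y)
  qed
  show "?c m (t \<oplus>\<^sub>hT t') = ?c m t \<oplus>\<^bsub>Y sM\<^esub> ?c m t'" if "t' \<in> carrier hT" for t'
   using ps.pt_add_r[of "SA.pb M m \<one>\<^sub>S" "\<sigma>T t" "\<sigma>T t'"] pbc m t that \<sigma>T by (simp add: add_Y)
  show "?c (s \<odot>\<^sub>M m) t = ?c m (s \<odot>\<^sub>hT t)" if s: "s \<in> carrier S" for s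
  proof -
   have "SA.pb M (s \<odot>\<^sub>M m) \<one>\<^sub>S = \<sigma> s \<odot>\<^sub>sM SA.pb M m \<one>\<^sub>S"
    using pb.pt_smult[OF s m, of "\<one>\<^sub>S"] SA.pullback_smult_pb[OF M m, of "\<sigma> s" "\<one>\<^sub>S"] s by simp
   then show ?thesis
    using ps.pt_smult[of "\<sigma> s" "SA.pb M m \<one>\<^sub>S" "\<sigma>T t"] s m t pbc \<sigma>T h_\<sigma> by simp
  qed
 qed
 define P where "P = tensor_lift (Y sM) ?c"
 have P: "P (pure_tensor S M hT m t) = ?c m t" if "m \<in> carrier M" "t \<in> carrier T" for m t
  unfolding P_def using p.tensor_lift_pure[OF N bal, of m t] that by simp
 have Pad: "additive (Y M) (Y sM) P"
  using p.additive_tensor_lift[OF N bal] by (simp add: P_def additive_def carrier_Y add_Y)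
 note Pc = additive_closed[OF Pad] and Pa = additive_add[OF Pad]
 have Ps: "P (t \<odot>\<^bsub>Y M\<^esub> y) = \<sigma>T t \<odot>\<^bsub>Y sM\<^esub> P y" if t: "t \<in> carrier T" and y: "y \<in> carrier (Y M)" for t y
  using M y
 proof (induction rule: Y_induct)
  case (pure m r)
  then show ?case
   using t pbc smult_ptY[OF sM] \<sigma>T by (simp add: ptY_eq[OF M, symmetric] smult_ptY[OF M] P)
 next
  case (add y z)
  then show ?case using t by (simp add: Y.smult_r_distr N.smult_r_distr Pa Pc)
 qed
 let ?L = "\<lambda>y t. t \<odot>\<^bsub>Y sM\<^esub> P y"
 \<comment> \<open>The semilinearity \<open>Ps\<close> is precisely the balancing condition of the
   pullback along \<open>\<sigma>T\<close>.\<close>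
 have balL: "balanced T (Y M) (alg_via \<sigma>T T) (Y sM) ?L"
  by (rule balancedI)
   (use Pc Pa Ps in \<open>auto simp: N.smult_l_distr N.smult_r_distr N.smult_assoc1[symmetric] TB.S.m_comm\<close>)
 define W where "W = pullback_base_change S \<sigma> T \<sigma>T h M"
 have W_eq: "W = tensor_lift (Y sM) ?L"
  by (simp add: W_def pullback_base_change_def Let_def P_def fun_eq_iff)
 have W: "W (TB.pb (Y M) y t) = t \<odot>\<^bsub>Y sM\<^esub> P y" if "y \<in> carrier (Y M)" "t \<in> carrier T" for y t
  unfolding W_eq using q.tensor_lift_pure[OF N balL, of y t] that by simp
 have Wad: "additive (pullback T \<sigma>T (Y M)) (Y sM) W"
  using q.additive_tensor_lift[OF N balL] by (simp add: W_eq additive_def TB.carrier_pullback TB.add_pullback)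
 interpret pT: module T "pullback T \<sigma>T (Y M)" by (rule TB.module_pullback[OF module_Y[OF M]])
 note G = module_homD[OF tensor_map_Y_hom[OF sM M \<tau>]]
 have bcf: "bcf Z = tensor_map S sM hT M hT \<tau> (\<lambda>t. t) (W Z)" for Z
  by (simp add: base_change_frob_def W_def)
 have Wh: "W (r \<odot>\<^bsub>pullback T \<sigma>T (Y M)\<^esub> Z) = r \<odot>\<^bsub>Y sM\<^esub> W Z"
  if r: "r \<in> carrier T" and Z: "Z \<in> carrier (pullback T \<sigma>T (Y M))" for r Z
  using Z[unfolded TB.carrier_pullback]
 proof (induction rule: q.tensor_induct)
  case (pure y t)
  then show ?case
   using r Pc TB.pullback_smult_pb[OF module_Y[OF M], of y r t] by (simp add: W N.smult_assoc1)
 next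
  case (add Z Z')
  then have "Z \<in> carrier (pullback T \<sigma>T (Y M))" "Z' \<in> carrier (pullback T \<sigma>T (Y M))" by (simp_all add: TB.carrier_pullback)
  then show ?case
   using add r additive_add[OF Wad] additive_closed[OF Wad]
   by (simp add: TB.add_pullback[symmetric] pT.smult_r_distr N.smult_r_distr)
 qed
 show "module_hom T (pullback T \<sigma>T (Y M)) (Y M) bcf"
  unfolding bcf using additive_add[OF Wad] additive_closed[OF Wad] Wh G by (intro module_homI) (auto simp: bcf)
 show "semilinear T \<sigma>T (Y M) bcf (j M m) = j M (semilinear S \<sigma> M \<tau> m)" if m: "m \<in> carrier M" for m
 proof -
  have "W (TB.pb (Y M) (j M m) \<one>\<^sub>T) = ?c m \<one>\<^sub>T"
   using W[OF j_closed[OF M m] TB.S.one_closed] P[OF m TB.S.one_closed] Pc[OF j_closed[OF M m]] by simp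
  then show ?thesis
   unfolding semilinear_def bcf using tensor_map_Y_pt[OF sM M \<tau> pbc[OF m SA.S.one_closed], of "\<one>\<^sub>T"] ring_hom_one[OF TB.\<sigma>] by simp
 qed
qed

end

end

section \<open>The natural map between the modules of homomorphisms\<close>

lemma (in abelian_group) finsum_lessThan_add:
 fixes n m :: nat
 assumes "!!k. k < n + m ==> g k \<in> carrier G"
 shows "(\<Oplus>k\<in>{..<n + m}. g k) = (\<Oplus>k\<in>{..<n}. g k) \<oplus> (\<Oplus>k\<in>{..<m}. g (n + k))"
 using assms
proof (induction m)
 case 0
 then show ?case by (simp add: finsum_closed)
next
 case (Suc m)
 have c: "g \<in> {..<n} \<rightarrow> carrier G" "(\<lambda>k. g (n + k)) \<in> {..<m} \<rightarrow> carrier G" "g (n + m) \<in> carrier G" "g \<in> {..<n + m} \<rightarrow> carrier G"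
  using Suc.prems by auto
 have "(\<Oplus>k\<in>{..<n + Suc m}. g k) = g (n + m) \<oplus> (\<Oplus>k\<in>{..<n + m}. g k)"
  using c by (simp add: lessThan_Suc)
 also have "... = (\<Oplus>k\<in>{..<n}. g k) \<oplus> (g (n + m) \<oplus> (\<Oplus>k\<in>{..<m}. g (n + k)))"
  using Suc c by (simp add: a_ac finsum_closed)
 also have "g (n + m) \<oplus> (\<Oplus>k\<in>{..<m}. g (n + k)) = (\<Oplus>k\<in>{..<Suc m}. g (n + k))"
  using c by (simp add: lessThan_Suc)
 finally show ?case .
qed

text \<open>Presents a tensor as a finite family over an initial segment, the shape in which
  \<open>relations_descend\<close> can be applied. Sums of tensors are handled by concatenating
  families.\<close>

lemma (in tensor_pair) tensor_finsum:
 assumes "Z \<in> carrier TT"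
 shows "\<exists>(n::nat) f a. (\<forall>k<n. f k \<in> carrier M & a k \<in> carrier N) & Z = (\<Oplus>\<^sub>TT k\<in>{..<n}. pt (f k) (a k))"
 using assms
proof (induction rule: tensor_induct)
 case (pure x y)
 interpret T: abelian_group TT by (rule abelian_group_tensor)
 have "pt x y = (\<Oplus>\<^sub>TT k\<in>{..<1::nat}. pt x y)" using pure by (simp add: lessThan_Suc)
 then show ?case using pure by (intro exI[of _ 1] exI[of _ "\<lambda>_. x"] exI[of _ "\<lambda>_. y"]) auto
next
 case (add Z Z')
 interpret T: abelian_group TT by (rule abelian_group_tensor)
 from add.IH show ?case
 proof (elim exE conjE)
  fix n m :: nat and f f' a a'
  assume 1: "\<forall>k<n. f k \<in> carrier M & a k \<in> carrier N" "Z = (\<Oplus>\<^sub>TT k\<in>{..<n}. pt (f k) (a k))"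
   and 2: "\<forall>k<m. f' k \<in> carrier M & a' k \<in> carrier N" "Z' = (\<Oplus>\<^sub>TT k\<in>{..<m}. pt (f' k) (a' k))"
  define F where "F k = (if k < n then f k else f' (k - n))" for k
  define E where "E k = (if k < n then a k else a' (k - n))" for k
  have c: "F k \<in> carrier M" "E k \<in> carrier N" if "k < n + m" for k
   using 1(1) 2(1) that by (auto simp: F_def E_def)
  have s1: "(\<Oplus>\<^sub>TT k\<in>{..<n}. pt (F k) (E k)) = Z"
   unfolding 1(2) using 1(1) by (intro T.finsum_cong') (auto simp: F_def E_def)
  have s2: "(\<Oplus>\<^sub>TT k\<in>{..<m}. pt (F (n + k)) (E (n + k))) = Z'"
   unfolding 2(2) using 2(1) by (intro T.finsum_cong') (auto simp: F_def E_def)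
  have "(\<Oplus>\<^sub>TT k\<in>{..<n + m}. pt (F k) (E k)) = Z \<oplus>\<^sub>TT Z'"
   using T.finsum_lessThan_add[of n m "\<lambda>k. pt (F k) (E k)"] c s1 s2 by simp
  then show ?case
   by (intro exI[of _ "n + m"] exI[of _ F] exI[of _ E]) (use c in auto)
 qed
qed

lemma module_hom_restrict:
 assumes "module R M" "module_hom R M N f"
 shows "module_hom R M N (restrict f (carrier M))"
proof -
 interpret module R M by fact
 show ?thesis using module_homD[OF assms(2)] by (intro module_homI) auto
qed

context frob_base_change
begin

text \<open>One index type for two kinds of conditions: \<open>None\<close> encodes compatibility
  with Frobenius, and the \<open>Some b\<close> encode linearity over the large ring through its
  finitely many generators.\<close>

definition operator where
 "operator S' \<sigma>' M \<tau> \<beta>' w = (case w of None => semilinear S' \<sigma>' M \<tau> | Some b => (\<lambda>m. \<beta>' b \<odot>\<^sub>M m))"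

abbreviation "opS \<equiv> \<lambda>M \<tau>. operator S \<sigma> M \<tau> \<beta>"
abbreviation "opT \<equiv> \<lambda>M \<phi>. operator T \<sigma>T M \<phi> (\<lambda>b. h (\<beta> b))"
abbreviation "Om \<equiv> insert None (Some ` J)"

lemma \<beta>_closed [simp]: "b \<in> J ==> \<beta> b \<in> carrier S"
 using dual_basisD(2)[OF dbS] by simp

lemma opS_hom:
 assumes "module S M" "module_hom S (pullback S \<sigma> M) M \<tau>" "w \<in> Om"
 shows "module_hom A (restrict_scalars iA M) (restrict_scalars iA M) (opS M \<tau> w)"
proof -
 interpret M: module S M by fact
 show ?thesis
 proof (cases w)
  case None
  then show ?thesis using SA.semilinear_hom[OF assms(1,2)] by (simp add: operator_def)
 next
  case (Some b)
  then have "\<beta> b \<in> carrier S" using assms(3) by auto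
  then show ?thesis
   unfolding Some by (intro module_homI) (simp_all add: operator_def M.smult_r_distr M.smult_assoc1[symmetric] SA.S.m_comm)
 qed
qed

lemma opT_hom:
 assumes "module T N" "module_hom T (pullback T \<sigma>T N) N \<phi>" "w \<in> Om"
 shows "module_hom B (restrict_scalars iB N) (restrict_scalars iB N) (opT N \<phi> w)"
proof -
 interpret N: module T N by fact
 show ?thesis
 proof (cases w)
  case None
  then show ?thesis using TB.semilinear_hom[OF assms(1,2)] by (simp add: operator_def)
 next
  case (Some b)
  then have "h (\<beta> b) \<in> carrier T" using assms(3) by auto
  then show ?thesis
   unfolding Some by (intro module_homI) (simp_all add: operator_def N.smult_r_distr N.smult_assoc1[symmetric] TB.S.m_comm)
 qed
qed

lemma opT_j:
 assumes "module S M" "module_hom S (pullback S \<sigma> M) M \<tau>" "w \<in> Om" "m \<in> carrier M"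
 shows "opT (Y M) (base_change_frob S \<sigma> T \<sigma>T h M \<tau>) w (j M m) = j M (opS M \<tau> w m)"
 using assms(3) semilinear_base_change_frob[OF assms(1,2,4)] j_smult[OF assms(1,4)] by (auto simp: operator_def)

text \<open>The third statement is the condition \<open>lY\<close> of
  \<open>operator_base_change\<close>: on the image of \<open>j M\<close>, coordinates over
  \<open>B\<close> are images of coordinates over \<open>A\<close>.\<close>

lemma dual_bases_restricted:
 assumes M: "module S M" and db: "dual_basis S M I e l"
 shows "dual_basis A (restrict_scalars iA M) (I \<times> J) (\<lambda>p. \<beta> (snd p) \<odot>\<^sub>M e (fst p)) (\<lambda>p x. \<kappa> (snd p) (l (fst p) x))"
  and "dual_basis B (restrict_scalars iB (Y M)) (I \<times> J) (\<lambda>p. j M (\<beta> (snd p) \<odot>\<^sub>M e (fst p)))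
   (\<lambda>p y. \<kappa>T (snd p) (lift_coord M (l (fst p)) y))"
  and "p \<in> I \<times> J ==> m \<in> carrier M ==>
   \<kappa>T (snd p) (lift_coord M (l (fst p)) (j M m)) = \<iota> (\<kappa> (snd p) (l (fst p) m))"
proof -
 note d = dual_basisD[OF db]
 show "dual_basis A (restrict_scalars iA M) (I \<times> J) (\<lambda>p. \<beta> (snd p) \<odot>\<^sub>M e (fst p)) (\<lambda>p x. \<kappa> (snd p) (l (fst p) x))"
  by (rule restrict_dual_basis[OF A.cring_axioms SA.i M db dbS])
 show "dual_basis B (restrict_scalars iB (Y M)) (I \<times> J) (\<lambda>p. j M (\<beta> (snd p) \<odot>\<^sub>M e (fst p)))
   (\<lambda>p y. \<kappa>T (snd p) (lift_coord M (l (fst p)) y))"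
  by (rule dual_basis_cong[OF module_restrict_scalars[OF B.cring_axioms module_Y[OF M] TB.i]
     restrict_dual_basis[OF B.cring_axioms TB.i module_Y[OF M] dual_basis_Y[OF M db] dbT]])
   (use d(2) in \<open>auto simp: j_smult[OF M]\<close>)
 assume p: "p \<in> I \<times> J" and m: "m \<in> carrier M"
 have "module_hom S M (self_module S) (l (fst p))" using db p by (auto simp: dual_basis_def)
 from lift_coord_j[OF M this m] show "\<kappa>T (snd p) (lift_coord M (l (fst p)) (j M m)) = \<iota> (\<kappa> (snd p) (l (fst p) m))"
  using p d(3)[of "fst p" m] m by (auto simp: \<kappa>T)
qed

context
 fixes M :: "('s, 'm) module" and \<tau> and M' :: "('s, 'n) module" and \<tau>' and I :: "'i set" and e l and I' :: "'i' set" and e' l'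
 assumes M: "module S M" and \<tau>: "module_hom S (pullback S \<sigma> M) M \<tau>"
  and M': "module S M'" and \<tau>': "module_hom S (pullback S \<sigma> M') M' \<tau>'"
  and db: "dual_basis S M I e l" and db': "dual_basis S M' I' e' l'"
begin

abbreviation "\<phi> \<equiv> base_change_frob S \<sigma> T \<sigma>T h M \<tau>"
abbreviation "\<phi>' \<equiv> base_change_frob S \<sigma> T \<sigma>T h M' \<tau>'"
abbreviation "HA \<equiv> frob_hom iA S \<sigma> M \<tau> M' \<tau>'"
abbreviation "HB \<equiv> frob_hom iB T \<sigma>T (Y M) \<phi> (Y M') \<phi>'"
abbreviation "loc \<equiv> \<lambda>f. restrict (tensor_map S M hT M' hT f (\<lambda>t. t)) (carrier (Y M))"
abbreviation "HAB \<equiv> extend_scalars A HA (alg_via \<iota> B)"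
abbreviation "nat_map \<equiv> tensor_lift HB (\<lambda>f a. a \<odot>\<^sub>HB loc f)"
abbreviation "XA == restrict_scalars iA M"
abbreviation "XA' == restrict_scalars iA M'"
abbreviation "YB == restrict_scalars iB (Y M)"
abbreviation "YB' == restrict_scalars iB (Y M')"

interpretation M: module S M by (rule M)
interpretation M': module S M' by (rule M')
interpretation Y: module T "Y M" by (rule module_Y[OF M])
interpretation Y': module T "Y M'" by (rule module_Y[OF M'])
interpretation HA: module A HA by (rule SA.module_frob_hom[OF M \<tau> M' \<tau>'])

lemmas \<phi>_hom = base_change_frob_hom[OF M \<tau>] base_change_frob_hom[OF M' \<tau>']
lemmas HAD = SA.frob_homD[OF M \<tau> M' \<tau>']
lemmas HBD = TB.frob_homD[OF module_Y[OF M] \<phi>_hom(1) module_Y[OF M'] \<phi>_hom(2)]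

interpretation HB: module B HB
 by (rule TB.module_frob_hom[OF module_Y[OF M] \<phi>_hom(1) module_Y[OF M'] \<phi>_hom(2)])

interpretation te: tensor_ext A HA "alg_via \<iota> B"
 by (rule tensor_ext.intro[OF HA.module_axioms algebra_alg_via[OF A.cring_axioms B.cring_axioms hom]])

text \<open>The image of \<open>j M\<close> generates \<open>Y M\<close>, and extensional maps that
  agree on the carrier are equal.\<close>

lemma HB_eqI:
 assumes "G \<in> carrier HB" "G' \<in> carrier HB" "!!m. m \<in> carrier M ==> G (j M m) = G' (j M m)"
 shows "G = G'"
 using Y_hom_eqI[OF M HBD(6)[OF assms(1)] HBD(6)[OF assms(2)] assms(3)] HBD(1)[OF assms(1)] HBD(1)[OF assms(2)]
 by (intro extensionalityI) auto

lemma loc_j: "f \<in> carrier HA ==> m \<in> carrier M ==> loc f (j M m) = j M' (f m)"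
 using tensor_map_Y_pt[OF M M' HAD(6)] j_closed[OF M] by simp

text \<open>On the image of \<open>j M\<close> the two Frobenius operators come from
  \<open>M\<close> and \<open>M'\<close>, where \<open>f\<close> commutes with them; semilinearity
  extends this to all of \<open>Y M\<close>.\<close>

lemma loc_closed:
 assumes f: "f \<in> carrier HA"
 shows "loc f \<in> carrier HB"
proof -
 note g = tensor_map_Y_hom[OF M M' HAD(6)[OF f]]
 note G = module_hom_restrict[OF module_Y[OF M] g]
 note G' = module_homD[OF G]
 note sl = TB.semilinear_closed[OF module_Y[OF M] \<phi>_hom(1)] TB.semilinear_closed[OF module_Y[OF M'] \<phi>_hom(2)]
  and sa = TB.semilinear_add[OF module_Y[OF M] \<phi>_hom(1)] TB.semilinear_add[OF module_Y[OF M'] \<phi>_hom(2)]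
  and ss = TB.semilinear_smult[OF module_Y[OF M] \<phi>_hom(1)] TB.semilinear_smult[OF module_Y[OF M'] \<phi>_hom(2)]
 have "loc f (semilinear T \<sigma>T (Y M) \<phi> y) = semilinear T \<sigma>T (Y M') \<phi>' (loc f y)" if y: "y \<in> carrier (Y M)" for y
  using M y
 proof (induction rule: Y_induct)
  case (pure m t)
  have jm: "j M m \<in> carrier (Y M)" by (rule j_closed[OF M pure(1)])
  have fm: "f m \<in> carrier M'" by (rule HAD(2)[OF f pure(1)])
  have sm: "semilinear S \<sigma> M \<tau> m \<in> carrier M" by (rule SA.semilinear_closed[OF M \<tau> pure(1)])
  have "loc f (semilinear T \<sigma>T (Y M) \<phi> (t \<odot>\<^bsub>Y M\<^esub> j M m)) = \<sigma>T t \<odot>\<^bsub>Y M'\<^esub> loc f (semilinear T \<sigma>T (Y M) \<phi> (j M m))"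
   unfolding ss(1)[OF jm pure(2)] by (rule G'(3)[OF _ sl(1)[OF jm]]) (use pure in simp)
  also have "loc f (semilinear T \<sigma>T (Y M) \<phi> (j M m)) = j M' (semilinear S \<sigma> M' \<tau>' (f m))"
   unfolding semilinear_base_change_frob[OF M \<tau> pure(1)] loc_j[OF f sm] HAD(5)[OF f pure(1)] ..
  also have "... = semilinear T \<sigma>T (Y M') \<phi>' (loc f (j M m))"
   unfolding semilinear_base_change_frob[OF M' \<tau>' fm] loc_j[OF f pure(1)] ..
  also have "\<sigma>T t \<odot>\<^bsub>Y M'\<^esub> ... = semilinear T \<sigma>T (Y M') \<phi>' (t \<odot>\<^bsub>Y M'\<^esub> loc f (j M m))"
   by (rule ss(2)[OF G'(1)[OF jm] pure(2), symmetric])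
  finally show ?case unfolding G'(3)[OF pure(2) jm] .
 next
  case (add y z)
  then show ?case
   unfolding sa(1)[OF add(1,2)] G'(2)[OF add(1,2)] sa(2)[OF G'(1)[OF add(1)] G'(1)[OF add(2)]]
   using G'(2)[OF sl(1)[OF add(1)] sl(1)[OF add(2)]] by simp
 qed
 then show ?thesis
  by (intro TB.frob_homI[OF module_Y[OF M] \<phi>_hom(1) module_Y[OF M'] \<phi>_hom(2) _ G]) auto
qed

lemma balanced_loc: "balanced A HA (alg_via \<iota> B) HB (\<lambda>f a. a \<odot>\<^sub>HB loc f)"
proof -
 have ladd: "loc (f \<oplus>\<^sub>HA g) = loc f \<oplus>\<^sub>HB loc g" if f: "f \<in> carrier HA" and g: "g \<in> carrier HA" for f g
 proof (rule HB_eqI)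
  fix m assume m: "m \<in> carrier M"
  show "loc (f \<oplus>\<^sub>HA g) (j M m) = (loc f \<oplus>\<^sub>HB loc g) (j M m)"
   unfolding loc_j[OF HA.M.a_closed[OF f g] m]
   using loc_j[OF f m] loc_j[OF g m] j_closed[OF M m] m additive_add[OF j_additive[OF M'] HAD(2)[OF f m] HAD(2)[OF g m]]
   by simp
 qed (use f g loc_closed HA.M.a_closed HB.M.a_closed in blast)+
 have lsm: "loc (a \<odot>\<^sub>HA f) = \<iota> a \<odot>\<^sub>HB loc f" if a: "a \<in> carrier A" and f: "f \<in> carrier HA" for a f
 proof (rule HB_eqI)
  fix m assume m: "m \<in> carrier M"
  show "loc (a \<odot>\<^sub>HA f) (j M m) = (\<iota> a \<odot>\<^sub>HB loc f) (j M m)"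
   unfolding loc_j[OF HA.smult_closed[OF a f] m]
   using loc_j[OF f m] j_closed[OF M m] m a j_smult[OF M' HAD(2)[OF f m], of "iA a"] h_i[OF a] by simp
 qed (use a f loc_closed HA.smult_closed HB.smult_closed \<iota>_closed in blast)+
 show ?thesis
  by (rule balancedI)
   (use loc_closed in \<open>auto simp: ladd lsm HB.smult_l_distr HB.smult_r_distr HB.smult_assoc1[symmetric] B.m_comm
     simp del: frob_hom_simps\<close>)
qed

lemma nat_map_pt:
 "f \<in> carrier HA ==> a \<in> carrier B ==> nat_map (pure_tensor A HA (alg_via \<iota> B) f a) = a \<odot>\<^sub>HB loc f"
 by (subst te.tensor_lift_pure[OF HB.M.abelian_group_axioms balanced_loc]) simp_all

lemma nat_map_hom: "module_hom B HAB HB nat_map"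
proof -
 note ad = te.additive_tensor_lift[OF HB.M.abelian_group_axioms balanced_loc]
 show ?thesis
 proof (rule module_homI)
  fix b Z assume b: "b \<in> carrier B" and Z: "Z \<in> carrier HAB"
  interpret E: module B HAB by (rule module_ring_transfer[OF te.module_ext B.cring_axioms]) simp_all
  show "nat_map (b \<odot>\<^sub>HAB Z) = b \<odot>\<^sub>HB nat_map Z"
   using Z[unfolded te.extend_scalars_simps]
  proof (induction rule: te.tensor_induct)
   case (pure f a)
   then have a: "a \<in> carrier B" by simp
   have e: "b \<odot>\<^sub>HAB te.pt f a = te.pt f (b \<otimes>\<^sub>B a)" using te.ext_smult_pt[of b f a] b pure by simp
   show ?case
    unfolding e nat_map_pt[OF pure(1) a] nat_map_pt[OF pure(1) B.m_closed[OF b a]]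
    by (rule HB.smult_assoc1[OF b a loc_closed[OF pure(1)]])
  next
   case (add Z Z')
   have e: "b \<odot>\<^sub>HAB (Z \<oplus>\<^sub>te.TT Z') = b \<odot>\<^sub>HAB Z \<oplus>\<^sub>te.TT b \<odot>\<^sub>HAB Z'"
    using E.smult_r_distr[OF b, of Z Z'] add(1,2) by simp
   have c: "b \<odot>\<^sub>HAB Z \<in> carrier te.TT" "b \<odot>\<^sub>HAB Z' \<in> carrier te.TT"
    using E.smult_closed[OF b] add(1,2) by simp_all
   show ?case
    unfolding e additive_add[OF ad c] additive_add[OF ad add(1,2)] add(3,4)
    by (rule HB.smult_r_distr[OF b additive_closed[OF ad add(1)] additive_closed[OF ad add(2)], symmetric])
  qed
 qed (use additive_add[OF ad] additive_closed[OF ad] in \<open>auto simp del: frob_hom_simps\<close>)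
qed

lemma operator_base_change_restricted:
 "operator_base_change A B \<iota> D XA XA'
  YB YB' (j M) (j M')
  (I \<times> J) (\<lambda>p. \<beta> (snd p) \<odot>\<^sub>M e (fst p)) (\<lambda>p x. \<kappa> (snd p) (l (fst p) x))
  (\<lambda>p y. \<kappa>T (snd p) (lift_coord M (l (fst p)) y))
  (I' \<times> J) (\<lambda>p. \<beta> (snd p) \<odot>\<^sub>M' e' (fst p)) (\<lambda>p x. \<kappa> (snd p) (l' (fst p) x))
  (\<lambda>p y. \<kappa>T (snd p) (lift_coord M' (l' (fst p)) y))
  Om (opS M \<tau>) (opS M' \<tau>') (opT (Y M) \<phi>) (opT (Y M') \<phi>')"
proof (intro operator_base_change.intro operator_base_change_axioms.intro valuation_base_change_axioms
  module_restrict_scalars[OF A.cring_axioms _ SA.i] module_restrict_scalars[OF B.cring_axioms _ TB.i] module_Y M M')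
 show "additive XA YB (j M)"
  "additive XA' YB' (j M')"
  using j_additive[OF M] j_additive[OF M'] by (simp_all add: additive_def)
qed (use dual_bases_restricted[OF M db] dual_bases_restricted[OF M' db'] opS_hom[OF M \<tau>] opS_hom[OF M' \<tau>']
  opT_hom[OF module_Y[OF M'] \<phi>_hom(2)] opT_j[OF M \<tau>] opT_j[OF M' \<tau>'] dual_basisD(1)[OF dbS]
  in \<open>simp_all add: j_smult[OF M] j_smult[OF M'] h_i\<close>)

interpretation obc: operator_base_change A B \<iota> D "XA" "XA'"
 "YB" "YB'" "j M" "j M'"
 "I \<times> J" "\<lambda>p. \<beta> (snd p) \<odot>\<^sub>M e (fst p)" "\<lambda>p x. \<kappa> (snd p) (l (fst p) x)"
 "\<lambda>p y. \<kappa>T (snd p) (lift_coord M (l (fst p)) y)"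
 "I' \<times> J" "\<lambda>p. \<beta> (snd p) \<odot>\<^sub>M' e' (fst p)" "\<lambda>p x. \<kappa> (snd p) (l' (fst p) x)"
 "\<lambda>p y. \<kappa>T (snd p) (lift_coord M' (l' (fst p)) y)"
 Om "opS M \<tau>" "opS M' \<tau>'" "opT (Y M) \<phi>" "opT (Y M') \<phi>'"
 by (rule operator_base_change_restricted)

lemma HA_hom: "f \<in> carrier HA ==> module_hom A XA XA' f"
 using HAD(2-4)[of f] by (intro module_homI) auto

lemma nat_map_finsum:
 assumes "finite K" "!!k. k \<in> K ==> f k \<in> carrier HA" "!!k. k \<in> K ==> a k \<in> carrier B"
 shows "nat_map (\<Oplus>\<^sub>te.TT k\<in>K. te.pt (f k) (a k)) = (\<Oplus>\<^sub>HB k\<in>K. a k \<odot>\<^sub>HB loc (f k))" (is "?l = ?r")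
  and "m \<in> carrier M ==> (\<Oplus>\<^sub>HB k\<in>K. a k \<odot>\<^sub>HB loc (f k)) (j M m) =
   (\<Oplus>\<^sub>YB' k\<in>K. a k \<odot>\<^sub>YB' j M' (f k m))"
proof -
 note ad = te.additive_tensor_lift[OF HB.M.abelian_group_axioms balanced_loc]
 have cl: "a k \<odot>\<^sub>HB loc (f k) \<in> carrier HB" if "k \<in> K" for k
  using assms(2,3) that loc_closed HB.smult_closed by blast
 have "?l = (\<Oplus>\<^sub>HB k\<in>K. nat_map (te.pt (f k) (a k)))"
  using assms by (intro additive_finsum[OF te.abelian_group_tensor HB.M.abelian_group_axioms ad]) auto
 also have "... = ?r"
 proof (rule HB.M.finsum_cong')
  show "nat_map (te.pt (f k) (a k)) = a k \<odot>\<^sub>HB loc (f k)" if "k \<in> K" for k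
   using nat_map_pt assms(2,3) that by blast
 qed (use cl in auto)
 finally show "?l = ?r" .
 assume m: "m \<in> carrier M"
 have "?r (j M m) = (\<Oplus>\<^bsub>Y M'\<^esub>k\<in>K. (a k \<odot>\<^sub>HB loc (f k)) (j M m))"
  using cl by (intro TB.finsum_frob_hom[OF module_Y[OF M] \<phi>_hom(1) module_Y[OF M'] \<phi>_hom(2) assms(1) _ j_closed[OF M m]]) auto
 also have "... = (\<Oplus>\<^bsub>Y M'\<^esub>k\<in>K. iB (a k) \<odot>\<^bsub>Y M'\<^esub> j M' (f k m))"
 proof (rule Y'.M.finsum_cong')
  fix k assume k: "k \<in> K"
  show "(a k \<odot>\<^sub>HB loc (f k)) (j M m) = iB (a k) \<odot>\<^bsub>Y M'\<^esub> j M' (f k m)"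
   using loc_j[OF assms(2)[OF k] m] j_closed[OF M m] by simp
 qed (use assms HAD(2)[OF _ m] j_closed[OF M'] in auto)
 finally show "?r (j M m) = (\<Oplus>\<^sub>YB' k\<in>K. a k \<odot>\<^sub>YB' j M' (f k m))"
  by (simp add: finsum_transfer[of "YB'" "Y M'"])
qed

text \<open>A tensor in the kernel is a relation over \<open>B\<close> among the \<open>f k\<close>.
  Once its coefficients are expressed through relations \<open>z q\<close> over \<open>A\<close>,
  the scalars \<open>z q k\<close> are moved to the first factors, where they add up to
  zero.\<close>

lemma nat_map_kernel:
 assumes Z: "Z \<in> carrier te.TT" and Z0: "nat_map Z = \<zero>\<^sub>HB"
 shows "Z = \<zero>\<^sub>te.TT"
proof -
 from te.tensor_finsum[OF Z] show ?thesis
 proof (elim exE conjE)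
  fix n :: nat and f a
  assume fa: "\<forall>k<n. f k \<in> carrier HA & a k \<in> carrier (alg_via \<iota> B)" and Zs: "Z = (\<Oplus>\<^sub>te.TT k\<in>{..<n}. te.pt (f k) (a k))"
  let ?K = "{..<n}"
  have f: "f k \<in> carrier HA" and a: "a k \<in> carrier B" if "k \<in> ?K" for k using fa that by auto
  have sum0: "(\<Oplus>\<^sub>HB k\<in>?K. a k \<odot>\<^sub>HB loc (f k)) = \<zero>\<^sub>HB"
   using nat_map_finsum(1)[of ?K f a] f a Z0 Zs by simp
  have eq: "(\<Oplus>\<^sub>YB' k\<in>?K. a k \<odot>\<^sub>YB' j M' (f k m)) = \<zero>\<^sub>YB'"
   if m: "m \<in> carrier XA" for m
  proof -
   have "m \<in> carrier M" using m by simp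
   then have "(\<Oplus>\<^sub>HB k\<in>?K. a k \<odot>\<^sub>HB loc (f k)) (j M m) =
     (\<Oplus>\<^sub>YB' k\<in>?K. a k \<odot>\<^sub>YB' j M' (f k m))"
    by (intro nat_map_finsum(2)) (use f a in auto)
   then show ?thesis unfolding sum0 using j_closed[OF M \<open>m \<in> carrier M\<close>] by simp
  qed
  have "\<exists>L\<subseteq>?K. \<exists>b z. b \<in> L \<rightarrow> carrier B & (\<forall>q\<in>L. z q \<in> ?K \<rightarrow> carrier A) &
   (\<forall>k\<in>?K. a k = (\<Oplus>\<^sub>B q\<in>L. b q \<otimes>\<^sub>B \<iota> (z q k))) &
   (\<forall>q\<in>L. \<forall>x\<in>carrier XA.
    (\<Oplus>\<^sub>XA' k\<in>?K. z q k \<odot>\<^sub>XA' f k x) = \<zero>\<^sub>XA')"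
  proof (rule obc.relations_descend)
   show "finite ?K" "a \<in> ?K \<rightarrow> carrier B" using a by auto
  qed (rule HA_hom[OF f] eq, assumption)+
  then show ?thesis
  proof (elim exE conjE)
   fix L b z
   assume L: "L \<subseteq> ?K" and b: "b \<in> L \<rightarrow> carrier B" and z: "\<forall>q\<in>L. z q \<in> ?K \<rightarrow> carrier A"
    and ab: "\<forall>k\<in>?K. a k = (\<Oplus>\<^sub>B q\<in>L. b q \<otimes>\<^sub>B \<iota> (z q k))"
    and zf: "\<forall>q\<in>L. \<forall>x\<in>carrier XA.
     (\<Oplus>\<^sub>XA' k\<in>?K. z q k \<odot>\<^sub>XA' f k x) = \<zero>\<^sub>XA'"
   have finL: "finite L" using L by (rule finite_subset) simp
   have bq: "b q \<in> carrier B" and zq: "z q k \<in> carrier A" if "q \<in> L" "k \<in> ?K" for q k using b z that by auto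
   have bq': "b q \<in> carrier B" if "q \<in> L" for q using b that by auto
   have zfc: "z q k \<odot>\<^sub>HA f k \<in> carrier HA" if "q \<in> L" "k \<in> ?K" for q k
    using HA.smult_closed[OF zq[OF that] f[OF that(2)]] .
   \<comment> \<open>The relations are given pointwise on the underlying modules; extensionality
     makes them equations in the module of homomorphisms.\<close>
   have comb: "(\<Oplus>\<^sub>HA k\<in>?K. z q k \<odot>\<^sub>HA f k) = \<zero>\<^sub>HA" (is "?s = _") if q: "q \<in> L" for q
   proof -
    have s: "?s \<in> carrier HA" using zfc[OF q] by (intro HA.M.finsum_closed) auto
    have "?s m = \<zero>\<^sub>HA m" if m: "m \<in> carrier M" for m
    proof -
     have "?s m = (\<Oplus>\<^sub>M' k\<in>?K. (z q k \<odot>\<^sub>HA f k) m)"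
      using zfc[OF q] by (intro SA.finsum_frob_hom[OF M \<tau> M' \<tau>' _ _ m]) auto
     also have "... = (\<Oplus>\<^sub>M' k\<in>?K. iA (z q k) \<odot>\<^sub>M' f k m)"
      using m HAD(2)[OF f m] zq[OF q] by (intro M'.M.finsum_cong') auto
     also have "... = \<zero>\<^sub>M'" using bspec[OF bspec[OF zf q], of m] m by (simp add: finsum_transfer[of "XA'" M'])
     finally show ?thesis using m by simp
    qed
    then show ?thesis
     using HAD(1)[OF s] HAD(1)[OF HA.M.zero_closed] by (intro extensionalityI) auto
   qed
   have "Z = (\<Oplus>\<^sub>te.TT k\<in>?K. \<Oplus>\<^sub>te.TT q\<in>L. te.pt (z q k \<odot>\<^sub>HA f k) (b q))"
    unfolding Zs
   proof (rule te.T.finsum_cong')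
    fix k assume k: "k \<in> ?K"
    have "additive (alg_via \<iota> B) te.TT (te.pt (f k))"
     using te.pt_add_r[OF f[OF k]] te.pt_closed[OF f[OF k]] by (intro additiveI) auto
    then have ptad: "additive B te.TT (te.pt (f k))" by (simp add: additive_def)
    have "te.pt (f k) (a k) = te.pt (f k) (\<Oplus>\<^sub>B q\<in>L. b q \<otimes>\<^sub>B \<iota> (z q k))" using ab k by simp
    also have "... = (\<Oplus>\<^sub>te.TT q\<in>L. te.pt (f k) (b q \<otimes>\<^sub>B \<iota> (z q k)))"
     using bq zq k by (intro additive_finsum[OF B.abelian_group_axioms te.abelian_group_tensor ptad]) auto
    also have "... = (\<Oplus>\<^sub>te.TT q\<in>L. te.pt (z q k \<odot>\<^sub>HA f k) (b q))"
    proof (rule te.T.finsum_cong')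
     fix q assume q: "q \<in> L"
     have "te.pt (z q k \<odot>\<^sub>HA f k) (b q) = te.pt (f k) (\<iota> (z q k) \<otimes>\<^sub>B b q)"
      using te.pt_smult[OF zq[OF q k] f[OF k], of "b q"] bq[OF q k] by (simp del: frob_hom_simps)
     then show "te.pt (f k) (b q \<otimes>\<^sub>B \<iota> (z q k)) = te.pt (z q k \<odot>\<^sub>HA f k) (b q)"
      using bq[OF q k] zq[OF q k] by (simp add: B.m_comm del: frob_hom_simps)
    qed (use zfc[OF _ k] bq[OF _ k] in \<open>auto simp del: frob_hom_simps intro!: te.pt_closed\<close>)
    finally show "te.pt (f k) (a k) = (\<Oplus>\<^sub>te.TT q\<in>L. te.pt (z q k \<odot>\<^sub>HA f k) (b q))" .
   qed (use zfc bq in \<open>auto simp del: frob_hom_simps intro!: te.T.finsum_closed te.pt_closed\<close>)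
   also have "... = (\<Oplus>\<^sub>te.TT q\<in>L. \<Oplus>\<^sub>te.TT k\<in>?K. te.pt (z q k \<odot>\<^sub>HA f k) (b q))"
    using zfc bq' by (intro te.T.finsum_swap finL) (auto simp del: frob_hom_simps intro!: te.pt_closed)
   also have "... = (\<Oplus>\<^sub>te.TT q\<in>L. \<zero>\<^sub>te.TT)"
   proof (rule te.T.finsum_cong')
    fix q assume q: "q \<in> L"
    have ptad: "additive HA te.TT (\<lambda>g. te.pt g (b q))"
     using te.pt_add_l[of _ _ "b q"] te.pt_closed[of _ "b q"] bq'[OF q] by (intro additiveI) auto
    have "(\<Oplus>\<^sub>te.TT k\<in>?K. te.pt (z q k \<odot>\<^sub>HA f k) (b q)) = te.pt (\<Oplus>\<^sub>HA k\<in>?K. z q k \<odot>\<^sub>HA f k) (b q)"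
     using zfc[OF q] by (intro additive_finsum[OF HA.M.abelian_group_axioms te.abelian_group_tensor ptad, symmetric]) auto
    then show "(\<Oplus>\<^sub>te.TT k\<in>?K. te.pt (z q k \<odot>\<^sub>HA f k) (b q)) = \<zero>\<^sub>te.TT"
     unfolding comb[OF q] using te.pt_zero_l[of "b q"] bq'[OF q] by (simp del: frob_hom_simps)
   qed auto
   also have "... = \<zero>\<^sub>te.TT" by (rule te.T.finsum_zero)
   finally show ?thesis .
  qed
 qed
qed

text \<open>The maps provided by \<open>hom_descends\<close> are linear over \<open>A\<close> at
  first. Commuting with the operators \<open>Some b\<close> makes them linear over \<open>S\<close>,
  and commuting with \<open>None\<close> makes them compatible with Frobenius.\<close>

lemma nat_map_surj:
 assumes G: "G \<in> carrier HB"
 shows "\<exists>Z\<in>carrier te.TT. nat_map Z = G"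
proof -
 have Gh: "module_hom B YB YB' G"
  using HBD(2-4)[OF G] by (intro module_homI) auto
 have comm: "G (opT (Y M) \<phi> w y) = opT (Y M') \<phi>' w (G y)" if "w \<in> Om" "y \<in> carrier YB" for w y
  using that HBD(4,5)[OF G] by (auto simp: operator_def)
 have "\<exists>K\<subseteq>(I \<times> J) \<times> (I' \<times> J). \<exists>a f. a \<in> K \<rightarrow> carrier B &
  (\<forall>k\<in>K. module_hom A XA XA' (f k) &
   (\<forall>w\<in>Om. \<forall>x\<in>carrier XA. f k (opS M \<tau> w x) = opS M' \<tau>' w (f k x))) &
  (\<forall>x\<in>carrier XA. G (j M x) =
   (\<Oplus>\<^sub>YB' k\<in>K. a k \<odot>\<^sub>YB' j M' (f k x)))"
  by (rule obc.hom_descends[OF Gh]) (rule comm)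
 then show ?thesis
 proof (elim exE conjE)
  fix K a f
  assume K: "K \<subseteq> (I \<times> J) \<times> (I' \<times> J)" and a: "a \<in> K \<rightarrow> carrier B"
   and f: "\<forall>k\<in>K. module_hom A XA XA' (f k) &
    (\<forall>w\<in>Om. \<forall>x\<in>carrier XA. f k (opS M \<tau> w x) = opS M' \<tau>' w (f k x))"
   and Gj: "\<forall>x\<in>carrier XA. G (j M x) =
    (\<Oplus>\<^sub>YB' k\<in>K. a k \<odot>\<^sub>YB' j M' (f k x))"
  have finK: "finite K"
   by (rule finite_subset[OF K]) (use dual_basisD(1)[OF db] dual_basisD(1)[OF db'] dual_basisD(1)[OF dbS] in auto)
  \<comment> \<open>Members of the module of homomorphisms are extensional, so the maps are cut down
    to the carrier.\<close>
  define g where "g k = restrict (f k) (carrier M)" for k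
  have gA: "g k \<in> carrier HA" if k: "k \<in> K" for k
  proof -
   note fk = bspec[OF f k]
   have op: "f k (opS M \<tau> w m) = opS M' \<tau>' w (f k m)" if "w \<in> Om" "m \<in> carrier M" for w m
    using bspec[OF bspec[OF conjunct2[OF fk] that(1)], of m] that(2) by simp
   have S: "module_hom S M M' (f k)"
    by (rule module_hom_extend_scalars[OF SA.i M M' dbS conjunct1[OF fk]])
     (use op[of "Some _"] in \<open>auto simp: operator_def\<close>)
   have s: "f k (semilinear S \<sigma> M \<tau> m) = semilinear S \<sigma> M' \<tau>' (f k m)" if "m \<in> carrier M" for m
    using op[of None m] that by (simp add: operator_def)
   show ?thesis unfolding g_def
    by (rule SA.frob_homI[OF M \<tau> M' \<tau>' _ module_hom_restrict[OF M S]])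
     (use s SA.semilinear_closed[OF M \<tau>] in auto)
  qed
  have ak: "a k \<in> carrier B" if "k \<in> K" for k using a that by auto
  let ?Z = "\<Oplus>\<^sub>te.TT k\<in>K. te.pt (g k) (a k)"
  have Z: "?Z \<in> carrier te.TT" using gA ak by (intro te.T.finsum_closed) auto
  have "nat_map ?Z = G"
  proof (rule HB_eqI[OF _ G])
   show "nat_map ?Z \<in> carrier HB" using module_homD(1)[OF nat_map_hom, of ?Z] Z by simp
   fix m assume m: "m \<in> carrier M"
   have "nat_map ?Z (j M m) = (\<Oplus>\<^sub>YB' k\<in>K. a k \<odot>\<^sub>YB' j M' (g k m))"
    using nat_map_finsum[OF finK, of g a] gA ak m by simp
   then show "nat_map ?Z (j M m) = G (j M m)" using Gj m by (simp add: g_def)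
  qed
  then show ?thesis using Z by blast
 qed
qed

theorem nat_map_iso: "module_iso B HAB HB nat_map"
proof -
 note ad = te.additive_tensor_lift[OF HB.M.abelian_group_axioms balanced_loc]
 note cl = additive_closed[OF ad]
 have "inj_on nat_map (carrier te.TT)"
 proof (rule inj_onI)
  fix Z Z' assume Z: "Z \<in> carrier te.TT" "Z' \<in> carrier te.TT" and e: "nat_map Z = nat_map Z'"
  have "nat_map (Z \<ominus>\<^sub>te.TT Z') = nat_map Z \<oplus>\<^sub>HB (\<ominus>\<^sub>HB nat_map Z')"
   using Z additive_add[OF ad] additive_minus[OF te.abelian_group_tensor HB.M.abelian_group_axioms ad Z(2)]
   by (simp add: a_minus_def)
  also have "... = \<zero>\<^sub>HB" unfolding e using HB.M.r_neg[OF cl[OF Z(2)]] .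
  finally have "Z \<ominus>\<^sub>te.TT Z' = \<zero>\<^sub>te.TT" using nat_map_kernel Z by blast
  then have "Z \<oplus>\<^sub>te.TT \<ominus>\<^sub>te.TT Z' = \<zero>\<^sub>te.TT" by (simp add: a_minus_def)
  then show "Z = Z'" using te.T.minus_equality[of Z "\<ominus>\<^sub>te.TT Z'"] Z te.T.minus_minus[OF Z(2)] by simp
 qed
 moreover have "nat_map ` carrier te.TT = carrier HB" using nat_map_surj cl by blast
 ultimately show ?thesis using nat_map_hom by (simp add: module_iso_def bij_betw_def)
qed

end

end


section \<open>Finite fields and the theorem\<close>

context field
begin

lemma psum_1: "c 0 \<in> carrier R ==> x \<in> carrier R ==> psum c (Suc 0) x = c 0"
 by (simp add: psum_def lessThan_Suc)

text \<open>Horner's scheme for division by \<open>x \<ominus> r\<close>, with the value at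
  \<open>r\<close> as remainder. That the quotient keeps the leading coefficient is recorded for the
  count of roots.\<close>

lemma psum_synthetic_division:
 assumes "!!i. i \<le> n ==> c i \<in> carrier R" "r \<in> carrier R"
 shows "\<exists>d. (\<forall>i<n. d i \<in> carrier R) & (\<forall>m. n = Suc m --> d m = c n) &
  (\<forall>x\<in>carrier R. psum c (Suc n) x = psum c (Suc n) r \<oplus> (x \<ominus> r) \<otimes> psum d n x)"
 using assms(1)
proof (induction n arbitrary: c)
 case 0
 then show ?case using assms(2) by (intro exI[of _ "\<lambda>_. \<zero>"]) (auto simp: psum_1)
next
 case (Suc n)
 let ?c = "\<lambda>i. c (Suc i)"
 have c: "?c i \<in> carrier R" if "i \<le> n" for i using Suc.prems that by auto
 have "\<exists>d. (\<forall>i<n. d i \<in> carrier R) & (\<forall>m. n = Suc m --> d m = c (Suc n)) &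
  (\<forall>x\<in>carrier R. psum ?c (Suc n) x = psum ?c (Suc n) r \<oplus> (x \<ominus> r) \<otimes> psum d n x)"
  by (rule Suc.IH) (rule c)
 then show ?case
 proof (elim exE conjE)
  fix d assume d: "\<forall>i<n. d i \<in> carrier R" and top: "\<forall>m. n = Suc m --> d m = c (Suc n)"
   and div: "\<forall>x\<in>carrier R. psum ?c (Suc n) x = psum ?c (Suc n) r \<oplus> (x \<ominus> r) \<otimes> psum d n x"
  define e where "e = psum ?c (Suc n) r"
  define d' where "d' i = (case i of 0 => e | Suc j => d j)" for i
  have e: "e \<in> carrier R" unfolding e_def using c assms(2) by (intro psum_closed) auto
  have dc: "d' i \<in> carrier R" if "i < Suc n" for i using that d e by (auto simp: d'_def split: nat.split)
  have key: "c0 \<oplus> x \<otimes> (e \<oplus> (x \<ominus> r) \<otimes> p) = (c0 \<oplus> r \<otimes> e) \<oplus> (x \<ominus> r) \<otimes> (e \<oplus> x \<otimes> p)"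
   if "c0 \<in> carrier R" "x \<in> carrier R" "p \<in> carrier R" for c0 x p
   using that e assms(2) by algebra
  have "psum c (Suc (Suc n)) x = psum c (Suc (Suc n)) r \<oplus> (x \<ominus> r) \<otimes> psum d' (Suc n) x" if x: "x \<in> carrier R" for x
  proof -
   have 1: "psum c (Suc (Suc n)) x = c 0 \<oplus> x \<otimes> psum ?c (Suc n) x" using Suc.prems x by (intro psum_Suc2) auto
   have 2: "psum c (Suc (Suc n)) r = c 0 \<oplus> r \<otimes> e" unfolding e_def using Suc.prems assms(2) by (intro psum_Suc2) auto
   have 3: "psum d' (Suc n) x = e \<oplus> x \<otimes> psum d n x" using psum_Suc2[of n d' x] dc x by (simp add: d'_def)
   have 4: "psum ?c (Suc n) x = e \<oplus> (x \<ominus> r) \<otimes> psum d n x" unfolding e_def using bspec[OF div x] .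
   show ?thesis unfolding 1 2 3 4 using d x Suc.prems[of 0] by (intro key) auto
  qed
  moreover have "d' n = c (Suc n)"
  proof (cases n)
   case 0
   then show ?thesis using c assms(2) by (simp add: d'_def e_def psum_1)
  next
   case (Suc m)
   then show ?thesis using top by (simp add: d'_def)
  qed
  ultimately show ?thesis using dc by (intro exI[of _ d']) auto
 qed
qed

text \<open>Dividing by the factor of a root \<open>r\<close> leaves a quotient that vanishes at the
  other roots and is zero by induction. So the leading coefficient is zero, and the induction
  hypothesis applies again to the remaining coefficients with the same roots.\<close>

lemma psum_roots_zero:
 assumes "!!i. i < n ==> c i \<in> carrier R" "finite Z" "Z \<subseteq> carrier R" "n \<le> card Z" "!!x. x \<in> Z ==> psum c n x = \<zero>"
 shows "\<forall>i<n. c i = \<zero>"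
 using assms
proof (induction n arbitrary: c Z)
 case (Suc n)
 have "Z ~= {}" using Suc.prems(4) by auto
 then obtain r where r: "r \<in> Z" by auto
 have rR: "r \<in> carrier R" using r Suc.prems by auto
 have "\<exists>d. (\<forall>i<n. d i \<in> carrier R) & (\<forall>m. n = Suc m --> d m = c n) &
  (\<forall>x\<in>carrier R. psum c (Suc n) x = psum c (Suc n) r \<oplus> (x \<ominus> r) \<otimes> psum d n x)"
  by (rule psum_synthetic_division) (use Suc.prems(1) rR in auto)
 then have top: "c n = \<zero>"
 proof (elim exE conjE)
  fix d assume d: "\<forall>i<n. d i \<in> carrier R" and top: "\<forall>m. n = Suc m --> d m = c n"
   and div: "\<forall>x\<in>carrier R. psum c (Suc n) x = psum c (Suc n) r \<oplus> (x \<ominus> r) \<otimes> psum d n x"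
  have "\<forall>i<n. d i = \<zero>"
  proof (rule Suc.IH)
   show "finite (Z - {r})" "Z - {r} \<subseteq> carrier R" "n \<le> card (Z - {r})" using Suc.prems(2-4) r by auto
   fix x assume x: "x \<in> Z - {r}"
   then have xR: "x \<in> carrier R" using Suc.prems(3) by auto
   have p: "psum d n x \<in> carrier R" using d xR by simp
   have "(x \<ominus> r) \<otimes> psum d n x = \<zero>" using bspec[OF div xR] Suc.prems(5)[OF r] Suc.prems(5)[of x] x xR rR p by simp
   moreover have "x \<ominus> r ~= \<zero>" using x xR rR by simp
   ultimately show "psum d n x = \<zero>" using integral[of "x \<ominus> r" "psum d n x"] xR rR p by auto
  qed (use d in auto)
  then show ?thesis
  proof (cases n)
   case 0
   then show ?thesis using Suc.prems(5)[OF r] Suc.prems(1) rR by (simp add: psum_1)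
  qed (use top in auto)
 qed
 have "\<forall>i<n. c i = \<zero>"
 proof (rule Suc.IH[of c Z])
  show "psum c n x = \<zero>" if "x \<in> Z" for x
   using Suc.prems(5)[OF that] psum_Suc[of n c x] Suc.prems(1,3) that top by (simp add: subset_iff)
 qed (use Suc.prems in auto)
 then show ?case using top by (simp add: less_Suc_eq)
qed simp

lemma psum_add:
 assumes "!!i. i < n ==> c i \<in> carrier R" "!!i. i < n ==> d i \<in> carrier R" "x \<in> carrier R"
 shows "psum (\<lambda>i. c i \<oplus> d i) n x = psum c n x \<oplus> psum d n x"
proof -
 have "psum (\<lambda>i. c i \<oplus> d i) n x = (\<Oplus>i\<in>{..<n}. c i \<otimes> x [^] i \<oplus> d i \<otimes> x [^] i)"
  unfolding psum_def using assms by (intro finsum_cong') (auto simp: l_distr)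
 then show ?thesis unfolding psum_def using assms by (simp add: finsum_addf Pi_def)
qed

text \<open>By Pascal's rule the coefficients for \<open>Suc n\<close> are the sum of those for
  \<open>n\<close> and of their shift, which matches multiplication by
  \<open>x \<oplus> \<one>\<close>.\<close>

lemma binomial_one_psum:
 assumes x: "x \<in> carrier R"
 shows "(x \<oplus> \<one>) [^] n = psum (\<lambda>i. add_pow R (n choose i) \<one>) (Suc n) x"
proof (induction n)
 case 0
 then show ?case using x by (simp add: psum_1)
next
 case (Suc n)
 define b where "b n i = add_pow R (n choose i) \<one>" for n i :: nat
 have b: "b n i \<in> carrier R" for n i by (simp add: b_def)
 define P where "P = psum (b n) (Suc n) x"
 define P' where "P' = psum (\<lambda>i. b n (Suc i)) (Suc n) x"
 have PR: "P \<in> carrier R" "P' \<in> carrier R" unfolding P_def P'_def using b x by simp_all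
 have "P = psum (b n) (Suc (Suc n)) x"
  unfolding P_def using psum_Suc[of "Suc n" "b n" x] b x by (simp add: b_def binomial_eq_0)
 also have "... = b n 0 \<oplus> x \<otimes> P'" unfolding P'_def using b x by (intro psum_Suc2) auto
 finally have P: "P = \<one> \<oplus> x \<otimes> P'" by (simp add: b_def)
 have "psum (b (Suc n)) (Suc (Suc n)) x = b (Suc n) 0 \<oplus> x \<otimes> psum (\<lambda>i. b (Suc n) (Suc i)) (Suc n) x"
  using b x by (intro psum_Suc2) auto
 also have "(\<lambda>i. b (Suc n) (Suc i)) = (\<lambda>i. b n i \<oplus> b n (Suc i))"
  by (simp add: b_def add.nat_pow_mult)
 also have "psum ... (Suc n) x = P \<oplus> P'" unfolding P_def P'_def by (rule psum_add) (use b x in auto)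
 also have "b (Suc n) 0 \<oplus> x \<otimes> (P \<oplus> P') = \<one> \<oplus> x \<otimes> (P \<oplus> P')" by (simp add: b_def)
 also have "... = P \<otimes> (x \<oplus> \<one>)"
 proof -
  have "\<one> \<oplus> x \<otimes> (P \<oplus> P') = x \<otimes> P \<oplus> (\<one> \<oplus> x \<otimes> P')" using x PR by algebra
  also have "... = P \<otimes> (x \<oplus> \<one>)" unfolding P[symmetric] using x PR by (simp add: r_distr m_comm a_comm)
  finally show ?thesis .
 qed
 finally show ?case using Suc by (simp add: P_def b_def[abs_def])
qed

text \<open>Lagrange's theorem in the multiplicative group, whose order is one less than that of the
  field; zero is treated apart.\<close>

lemma finite_field_pow_order:
 assumes fin: "finite (carrier R)" and c: "c \<in> carrier R"
 shows "c [^] order R = c"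
proof -
 have q: "order R > 0" using fin c by (auto simp: order_def card_gt_0_iff)
 show ?thesis
 proof (cases "c = \<zero>")
  case True
  then show ?thesis using q by (simp add: nat_pow_zero)
 next
  case False
  interpret g: group "Multiplicative_Group.mult_of R" by (rule field_mult_group)
  have "c [^] (order R - 1) = \<one>"
   using g.pow_order_eq_1[of c] c False order_mult_of[OF fin] by (simp add: nat_pow_def Multiplicative_Group.mult_of_def)
  then have "c [^] Suc (order R - 1) = c" using c by simp
  then show ?thesis using q by simp
 qed
qed

end

text \<open>\<open>(X + 1)\<^sup>q - X\<^sup>q - 1\<close> has degree less than \<open>q\<close> and vanishes on all \<open>q\<close> elements of \<open>k\<close>, so the inner
 binomial coefficients vanish in \<open>k\<close>, hence in \<open>L\<close>.\<close>

lemma frobenius_add: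
 assumes k: "field k" "finite (carrier k)" and L: "field L" "algebra k L" and xy: "x \<in> carrier L" "y \<in> carrier L"
 shows "(x \<oplus>\<^sub>L y) [^]\<^sub>L order k = x [^]\<^sub>L order k \<oplus>\<^sub>L y [^]\<^sub>L order k"
proof -
 interpret k: field k by (rule k)
 interpret L: field L by (rule L)
 interpret kL: algebra k L by (rule L)
 let ?q = "order k"
 have "card {\<zero>\<^sub>k, \<one>\<^sub>k} \<le> ?q" unfolding order_def by (rule card_mono[OF k(2)]) auto
 then obtain q where q: "?q = Suc q" by (cases ?q) auto
 define b where "b i = add_pow k (?q choose i) \<one>\<^sub>k" for i
 \<comment> \<open>The inner binomial coefficients: the constant one is replaced by zero, and the
   leading one falls away because only \<open>?q\<close> coefficients are summed.\<close>
 define b' where "b' i = (case i of 0 => \<zero>\<^sub>k | Suc j => b (Suc j))" for i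
 have b: "b i \<in> carrier k" "b' i \<in> carrier k" for i by (auto simp: b_def b'_def split: nat.split)
 have "k.psum b' ?q c = \<zero>\<^sub>k" if c: "c \<in> carrier k" for c
 proof -
  let ?P = "k.psum (\<lambda>i. b (Suc i)) q c"
  have P: "?P \<in> carrier k" using b c by simp
  have "c \<oplus>\<^sub>k \<one>\<^sub>k = k.psum b (Suc ?q) c"
   using k.binomial_one_psum[OF c, of ?q] k.finite_field_pow_order[OF k(2), of "c \<oplus>\<^sub>k \<one>\<^sub>k"] c by (simp add: b_def[abs_def])
  also have "... = b ?q \<otimes>\<^sub>k c [^]\<^sub>k ?q \<oplus>\<^sub>k k.psum b ?q c" by (rule k.psum_Suc) (use b c in auto)
  also have "... = c \<oplus>\<^sub>k k.psum b (Suc q) c" using k.finite_field_pow_order[OF k(2) c] c by (simp add: b_def q[symmetric])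
  also have "k.psum b (Suc q) c = b 0 \<oplus>\<^sub>k c \<otimes>\<^sub>k ?P" by (rule k.psum_Suc2) (use b c in auto)
  also have "b 0 = \<one>\<^sub>k" by (simp add: b_def)
  finally have e: "\<one>\<^sub>k = \<one>\<^sub>k \<oplus>\<^sub>k c \<otimes>\<^sub>k ?P"
   using k.add.l_cancel[of c "\<one>\<^sub>k" "\<one>\<^sub>k \<oplus>\<^sub>k c \<otimes>\<^sub>k ?P"] c P by simp
  have "k.psum b' (Suc q) c = b' 0 \<oplus>\<^sub>k c \<otimes>\<^sub>k k.psum (\<lambda>i. b' (Suc i)) q c" by (rule k.psum_Suc2) (use b c in auto)
  also have "... = c \<otimes>\<^sub>k ?P" using c P by (simp add: b'_def)
  also have "... = \<zero>\<^sub>k" using e k.add.l_cancel[of "\<one>\<^sub>k" "\<zero>\<^sub>k" "c \<otimes>\<^sub>k ?P"] c P by simp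
  finally show ?thesis by (simp add: q)
 qed
 then have "\<forall>i<?q. b' i = \<zero>\<^sub>k"
  by (intro k.psum_roots_zero[of _ _ "carrier k"]) (use b k(2) in \<open>auto simp: order_def\<close>)
 then have bk: "add_pow k (?q choose Suc i) \<one>\<^sub>k = \<zero>\<^sub>k" if "i < q" for i
  using that unfolding q by (auto simp: b'_def b_def q dest: spec[of _ "Suc i"])
 \<comment> \<open>Carries the vanishing of the binomial coefficients from \<open>k\<close> to
   \<open>L\<close>.\<close>
 have hom: "(add_pow k (n) \<one>\<^sub>k) \<odot>\<^sub>L \<one>\<^sub>L = add_pow L (n) \<one>\<^sub>L" for n :: nat
  by (induction n) (auto simp: kL.smult_l_distr)
 define c where "c i = add_pow L (?q choose i) \<one>\<^sub>L" for i
 have c: "c i \<in> carrier L" for i by (simp add: c_def)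
 have cz: "c (Suc i) = \<zero>\<^sub>L" if "i < q" for i
  unfolding c_def hom[symmetric] bk[OF that] by simp
 have one: "(z \<oplus>\<^sub>L \<one>\<^sub>L) [^]\<^sub>L ?q = z [^]\<^sub>L ?q \<oplus>\<^sub>L \<one>\<^sub>L" if z: "z \<in> carrier L" for z
 proof -
  have "(z \<oplus>\<^sub>L \<one>\<^sub>L) [^]\<^sub>L ?q = L.psum c (Suc ?q) z" using L.binomial_one_psum[OF z] by (simp add: c_def[abs_def])
  also have "... = c ?q \<otimes>\<^sub>L z [^]\<^sub>L ?q \<oplus>\<^sub>L L.psum c ?q z" by (rule L.psum_Suc) (use c z in auto)
  also have "c ?q = \<one>\<^sub>L" by (simp add: c_def)
  also have "L.psum c ?q z = c 0 \<oplus>\<^sub>L z \<otimes>\<^sub>L L.psum (\<lambda>i. c (Suc i)) q z"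
   unfolding q by (rule L.psum_Suc2) (use c z in auto)
  also have "L.psum (\<lambda>i. c (Suc i)) q z = \<zero>\<^sub>L"
   unfolding L.psum_def using cz z by (intro L.add.finprod_one_eqI) auto
  also have "c 0 = \<one>\<^sub>L" by (simp add: c_def)
  finally show ?thesis using z by simp
 qed
 show ?thesis
 proof (cases "y = \<zero>\<^sub>L")
  case True
  then show ?thesis using xy q L.nat_pow_zero[of ?q] by simp
 next
  case False
  note iy = L.inv_nonzero[OF xy(2) False]
  \<comment> \<open>Reduction to the second summand \<open>\<one>\<^sub>L\<close> by
    homogeneity.\<close>
  let ?z = "x \<otimes>\<^sub>L inv\<^bsub>L\<^esub> y"
  have zy: "?z \<otimes>\<^sub>L y = x" by (rule L.inv_cancel(2)[OF xy(2) False xy(1)])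
  have "x \<oplus>\<^sub>L y = (?z \<oplus>\<^sub>L \<one>\<^sub>L) \<otimes>\<^sub>L y" using xy iy zy by (simp add: L.l_distr)
  then have "(x \<oplus>\<^sub>L y) [^]\<^sub>L ?q = (?z \<oplus>\<^sub>L \<one>\<^sub>L) [^]\<^sub>L ?q \<otimes>\<^sub>L y [^]\<^sub>L ?q"
   using xy iy by (simp add: L.nat_pow_distrib)
  also have "... = ?z [^]\<^sub>L ?q \<otimes>\<^sub>L y [^]\<^sub>L ?q \<oplus>\<^sub>L y [^]\<^sub>L ?q" using one[of ?z] xy iy by (simp add: L.l_distr)
  also have "?z [^]\<^sub>L ?q \<otimes>\<^sub>L y [^]\<^sub>L ?q = (?z \<otimes>\<^sub>L y) [^]\<^sub>L ?q" using xy iy by (intro L.nat_pow_distrib[symmetric]) auto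
  finally show ?thesis unfolding zy .
 qed
qed

lemma frobenius_hom:
 assumes k: "field k" "finite (carrier k)" and L: "field L" "algebra k L"
 shows "(\<lambda>b. b [^]\<^sub>L order k) \<in> ring_hom L L" "module_hom k L L (\<lambda>b. b [^]\<^sub>L order k)"
proof -
 interpret k: field k by (rule k)
 interpret L: field L by (rule L)
 interpret kL: algebra k L by (rule L)
 show "(\<lambda>b. b [^]\<^sub>L order k) \<in> ring_hom L L"
  by (rule ring_hom_memI) (auto simp: frobenius_add[OF k L] L.nat_pow_distrib)
 have "(c \<odot>\<^sub>L x) [^]\<^sub>L n = c [^]\<^sub>k n \<odot>\<^sub>L x [^]\<^sub>L n" if cx: "c \<in> carrier k" "x \<in> carrier L" for c x and n :: nat
 proof (induction n)
  case (Suc n)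
  have "(c [^]\<^sub>k n \<odot>\<^sub>L x [^]\<^sub>L n) \<otimes>\<^sub>L (c \<odot>\<^sub>L x) = (c [^]\<^sub>k n \<otimes>\<^sub>k c) \<odot>\<^sub>L (x [^]\<^sub>L n \<otimes>\<^sub>L x)"
   using cx by (simp add: kL.smult_assoc2 kL.smult_assoc3 kL.smult_assoc1[symmetric] k.m_comm)
  then show ?case using Suc cx by simp
 qed (use cx in simp)
 then show "module_hom k L L (\<lambda>b. b [^]\<^sub>L order k)"
  using frobenius_add[OF k L] k.finite_field_pow_order[OF k(2)] by (intro module_homI) auto
qed

text \<open>A spanning set of least size is a basis, and finiteness of the module makes the whole
  carrier a finite spanning set to start from. The chosen coordinates are linear because they are
  unique.\<close>

lemma finite_dual_basis:
 fixes R :: "('a, 'x) ring_scheme" and M :: "('a, 'm) module"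
 assumes "field R" "module R M" and fin: "finite (carrier M)"
 shows "\<exists>G l. dual_basis R M G (\<lambda>x. x) l"
proof -
 interpret R: field R by fact
 interpret M: module R M by fact
 define comb where "comb G c = (\<Oplus>\<^sub>M y\<in>G. c y \<odot>\<^sub>M y)" for G and c :: "'m => 'a"
 define spans where "spans G \<longleftrightarrow> G \<subseteq> carrier M & (\<forall>x\<in>carrier M. \<exists>c. c \<in> G \<rightarrow> carrier R & x = comb G c)" for G
 have "spans (carrier M)"
  unfolding spans_def
 proof (intro conjI ballI exI)
  fix x assume x: "x \<in> carrier M"
  let ?c = "\<lambda>y. if x = y then \<one>\<^sub>R else \<zero>\<^sub>R"
  show "?c \<in> carrier M \<rightarrow> carrier R" by auto
  have "comb (carrier M) ?c = (\<Oplus>\<^sub>M y\<in>carrier M. if x = y then y else \<zero>\<^sub>M)"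
   unfolding comb_def by (intro M.finsum_cong') auto
  also have "... = x" using M.add.finprod_singleton[OF x fin, of "\<lambda>y. y"] by simp
  finally show "x = comb (carrier M) ?c" ..
 qed simp
 then obtain G where G: "spans G" and min: "!!Z. spans Z ==> card G \<le> card Z"
  using ex_has_least_nat[of spans "carrier M" card] by blast
 have XM: "G \<subseteq> carrier M" and finX: "finite G" using G fin by (auto simp: spans_def intro: finite_subset)
 have comb_closed: "comb G c \<in> carrier M" if "c \<in> G \<rightarrow> carrier R" for c
  unfolding comb_def using that XM by (intro M.finsum_closed) auto
 have comb_add: "comb G (\<lambda>y. c y \<oplus>\<^sub>R d y) = comb G c \<oplus>\<^sub>M comb G d" if "c \<in> G \<rightarrow> carrier R" "d \<in> G \<rightarrow> carrier R" for c d
 proof -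
  have "comb G (\<lambda>y. c y \<oplus>\<^sub>R d y) = (\<Oplus>\<^sub>M y\<in>G. c y \<odot>\<^sub>M y \<oplus>\<^sub>M d y \<odot>\<^sub>M y)"
   unfolding comb_def using that XM by (intro M.finsum_cong') (auto simp: M.smult_l_distr Pi_iff subset_iff)
  then show ?thesis unfolding comb_def using that XM by (subst (asm) M.finsum_addf) auto
 qed
 have comb_smult: "comb G (\<lambda>y. a \<otimes>\<^sub>R c y) = a \<odot>\<^sub>M comb G c" if "a \<in> carrier R" "c \<in> G \<rightarrow> carrier R" for a c
 proof -
  have "a \<odot>\<^sub>M comb G c = (\<Oplus>\<^sub>M y\<in>G. a \<odot>\<^sub>M (c y \<odot>\<^sub>M y))"
   unfolding comb_def using that XM by (intro M.smult_finsum) auto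
  also have "... = comb G (\<lambda>y. a \<otimes>\<^sub>R c y)"
   unfolding comb_def using that XM by (intro M.finsum_cong') (auto simp: M.smult_assoc1 Pi_iff subset_iff)
  finally show ?thesis ..
 qed
 have indep: "c y0 = \<zero>\<^sub>R" if c: "c \<in> G \<rightarrow> carrier R" "comb G c = \<zero>\<^sub>M" and y0: "y0 \<in> G" for c y0
 proof (rule ccontr)
  assume n: "c y0 ~= \<zero>\<^sub>R"
  have cy: "c y0 \<in> carrier R" using c y0 by auto
  note ic = R.inv_nonzero[OF cy n]
  have "spans (G - {y0})"
   unfolding spans_def
  proof (intro conjI ballI)
   show "G - {y0} \<subseteq> carrier M" using XM by auto
   fix x assume x: "x \<in> carrier M"
   then obtain d where d: "d \<in> G \<rightarrow> carrier R" "x = comb G d" using G by (auto simp: spans_def)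
   \<comment> \<open>Chosen so that adding \<open>a\<close> times the relation \<open>c\<close> to
     the expansion \<open>d\<close> removes \<open>y0\<close>.\<close>
   define a where "a = \<ominus>\<^sub>R (d y0 \<otimes>\<^sub>R inv\<^bsub>R\<^esub> (c y0))"
   have dy: "d y0 \<in> carrier R" using d y0 by auto
   have a: "a \<in> carrier R" unfolding a_def using dy ic by simp
   define d' where "d' y = d y \<oplus>\<^sub>R a \<otimes>\<^sub>R c y" for y
   have ac: "(\<lambda>y. a \<otimes>\<^sub>R c y) \<in> G \<rightarrow> carrier R" using a c by auto
   have d': "d' \<in> G \<rightarrow> carrier R" unfolding d'_def using a c d by auto
   have "a \<otimes>\<^sub>R c y0 = \<ominus>\<^sub>R d y0"
    unfolding a_def using dy ic cy R.inv_cancel(2)[OF cy n dy] by (simp add: R.l_minus)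
   then have d0: "d' y0 = \<zero>\<^sub>R" unfolding d'_def using dy by (simp add: R.r_neg)
   have "comb G d' = x" unfolding d'_def comb_add[OF d(1) ac] comb_smult[OF a c(1)] c(2) using d(2) x a by simp
   moreover have "comb G d' = comb (G - {y0}) d'"
    unfolding comb_def using finX XM d' d0 y0
    by (intro M.add.finprod_mono_neutral_cong_right) (auto simp: Pi_iff subset_iff)
   ultimately show "\<exists>c. c \<in> G - {y0} \<rightarrow> carrier R & x = comb (G - {y0}) c"
    using d' by (intro exI[of _ d']) auto
  qed
  from min[OF this] show False using card_Diff1_less[OF finX y0] by linarith
 qed
 have unique: "c y = d y" if c: "c \<in> G \<rightarrow> carrier R" and d: "d \<in> G \<rightarrow> carrier R" and e: "comb G c = comb G d" and y: "y \<in> G" for c d y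
 proof -
  have md: "(\<lambda>y. \<ominus>\<^sub>R \<one>\<^sub>R \<otimes>\<^sub>R d y) \<in> G \<rightarrow> carrier R" using d by auto
  have m: "comb G d \<in> carrier M" by (rule comb_closed[OF d])
  have "comb G (\<lambda>y. c y \<oplus>\<^sub>R (\<ominus>\<^sub>R \<one>\<^sub>R \<otimes>\<^sub>R d y)) = comb G d \<oplus>\<^sub>M (\<ominus>\<^sub>R \<one>\<^sub>R) \<odot>\<^sub>M comb G d"
   unfolding comb_add[OF c md] comb_smult[OF R.a_inv_closed[OF R.one_closed] d] e ..
  also have "... = \<one>\<^sub>R \<odot>\<^sub>M comb G d \<oplus>\<^sub>M (\<ominus>\<^sub>R \<one>\<^sub>R) \<odot>\<^sub>M comb G d" using m by simp
  also have "... = (\<one>\<^sub>R \<oplus>\<^sub>R \<ominus>\<^sub>R \<one>\<^sub>R) \<odot>\<^sub>M comb G d"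
   by (rule M.smult_l_distr[symmetric, OF R.one_closed R.a_inv_closed[OF R.one_closed] m])
  also have "... = \<zero>\<^sub>M" unfolding R.r_neg[OF R.one_closed] using m by simp
  finally have z: "comb G (\<lambda>y. c y \<oplus>\<^sub>R (\<ominus>\<^sub>R \<one>\<^sub>R \<otimes>\<^sub>R d y)) = \<zero>\<^sub>M" .
  have mem: "(\<lambda>y. c y \<oplus>\<^sub>R (\<ominus>\<^sub>R \<one>\<^sub>R \<otimes>\<^sub>R d y)) \<in> G \<rightarrow> carrier R"
  proof (rule Pi_I)
   fix z assume z: "z \<in> G"
   show "c z \<oplus>\<^sub>R (\<ominus>\<^sub>R \<one>\<^sub>R \<otimes>\<^sub>R d z) \<in> carrier R"
    by (rule R.a_closed[OF funcset_mem[OF c z] funcset_mem[OF md z]])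
  qed
  have cd: "c y \<in> carrier R" "d y \<in> carrier R" using c d y by auto
  have "c y \<oplus>\<^sub>R (\<ominus>\<^sub>R \<one>\<^sub>R \<otimes>\<^sub>R d y) = \<zero>\<^sub>R" by (rule indep[OF mem z y])
  then have "c y \<ominus>\<^sub>R d y = \<zero>\<^sub>R" using cd by (simp add: R.l_minus a_minus_def)
  then show ?thesis using cd by simp
 qed
 define rep where "rep x = (SOME c. c \<in> G \<rightarrow> carrier R & x = comb G c)" for x
 have rep: "rep x \<in> G \<rightarrow> carrier R" "x = comb G (rep x)" if "x \<in> carrier M" for x
 proof -
  have "\<exists>c. c \<in> G \<rightarrow> carrier R & x = comb G c" using G that by (simp add: spans_def)
  from someI_ex[OF this] show "rep x \<in> G \<rightarrow> carrier R" "x = comb G (rep x)" unfolding rep_def by auto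
 qed
 have "dual_basis R M G (\<lambda>x. x) (\<lambda>y x. rep x y)"
  unfolding dual_basis_def
 proof (intro conjI ballI)
  fix y assume y: "y \<in> G"
  show "module_hom R M (self_module R) (\<lambda>x. rep x y)"
  proof (rule module_homI)
   show "rep x y \<in> carrier (self_module R)" if "x \<in> carrier M" for x using rep(1)[OF that] y by auto
   show "rep (x \<oplus>\<^sub>M z) y = rep x y \<oplus>\<^bsub>self_module R\<^esub> rep z y" if xz: "x \<in> carrier M" "z \<in> carrier M" for x z
   proof -
    have "comb G (rep (x \<oplus>\<^sub>M z)) = comb G (\<lambda>y. rep x y \<oplus>\<^sub>R rep z y)"
     unfolding comb_add[OF rep(1)[OF xz(1)] rep(1)[OF xz(2)]]
     using rep(2)[OF M.a_closed[OF xz]] rep(2)[OF xz(1)] rep(2)[OF xz(2)] by simp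
    from unique[OF rep(1)[OF M.a_closed[OF xz]] _ this y] rep(1)[OF xz(1)] rep(1)[OF xz(2)]
    show ?thesis by (auto simp: Pi_iff)
   qed
   show "rep (a \<odot>\<^sub>M x) y = a \<odot>\<^bsub>self_module R\<^esub> rep x y" if ax: "a \<in> carrier R" "x \<in> carrier M" for a x
   proof -
    have "comb G (rep (a \<odot>\<^sub>M x)) = comb G (\<lambda>y. a \<otimes>\<^sub>R rep x y)"
     unfolding comb_smult[OF ax(1) rep(1)[OF ax(2)]]
     using rep(2)[OF M.smult_closed[OF ax]] rep(2)[OF ax(2)] by simp
    from unique[OF rep(1)[OF M.smult_closed[OF ax]] _ this y] rep(1)[OF ax(2)] ax(1)
    show ?thesis by (auto simp: Pi_iff)
   qed
  qed
 qed (use finX XM rep(2) in \<open>auto simp: comb_def\<close>)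
 then show ?thesis by blast
qed

section \<open>Coordinates on a tensor product of algebras\<close>

context tensor_algebra
begin

text \<open>The functional \<open>f\<close> applied to the second factor, with the tensor product of
  \<open>M\<close> and \<open>R\<close> identified with \<open>M\<close>.\<close>

definition tensor_coord where "tensor_coord f = tensor_lift M (\<lambda>a y. f y \<odot>\<^sub>M a)"

lemma
 assumes f: "module_hom R N (self_module R) f"
 shows tensor_coord_pt: "x \<in> carrier M ==> y \<in> carrier N ==> tensor_coord f (pt x y) = f y \<odot>\<^sub>M x"
  and tensor_coord_additive: "additive TT M (tensor_coord f)"
proof -
 note f' = module_homD[OF f, simplified]
 have M: "abelian_group M" by (rule ring.is_abelian_group[OF cring.axioms(1)[OF M.M_cring]])
 have bal: "balanced R M N M (\<lambda>a y. f y \<odot>\<^sub>M a)"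
  by (rule balancedI)
   (auto simp: f' M.smult_r_distr M.smult_l_distr M.smult_assoc1[symmetric] M.R.m_comm)
 show "tensor_coord f (pt x y) = f y \<odot>\<^sub>M x" if "x \<in> carrier M" "y \<in> carrier N"
  unfolding tensor_coord_def by (rule tensor_lift_pure[OF M bal that])
 show "additive TT M (tensor_coord f)" unfolding tensor_coord_def by (rule additive_tensor_lift[OF M bal])
qed

text \<open>The expansion formula is additive in the tensor, so it reduces to pure tensors, where it
  is the expansion of the second factor with the coefficients moved to the first.\<close>

lemma tensor_dual_basis:
 assumes db: "dual_basis R N J b l"
 shows "dual_basis M (alg_via (\<lambda>a. pt a \<one>\<^sub>N) TT) J (\<lambda>i. pt \<one>\<^sub>M (b i)) (\<lambda>i. tensor_coord (l i))"
proof -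
 note d = dual_basisD[OF db]
 have l: "module_hom R N (self_module R) (l i)" if "i \<in> J" for i using db that by (simp add: dual_basis_def)
 note cpt = tensor_coord_pt[OF l] and cad = tensor_coord_additive[OF l]
 note cc = additive_closed[OF cad] and ca = additive_add[OF cad]
 have lin: "tensor_coord (l i) (pt a \<one>\<^sub>N \<otimes>\<^sub>TT Z) = a \<otimes>\<^sub>M tensor_coord (l i) Z"
  if i: "i \<in> J" and a: "a \<in> carrier M" and Z: "Z \<in> carrier TT" for i a Z
  using Z
 proof (induction rule: tensor_induct)
  case (pure x y)
  then show ?case
   using i a d(3) by (simp add: tensor_mult_pt cpt M.smult_assoc3)
 next
  case (add Z Z')
  have p: "pt a \<one>\<^sub>N \<in> carrier TT" using a by simp
  then show ?case using add i a by (simp add: tensor_r_distr tensor_mult_closed ca cc M.r_distr)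
 qed
 have exp: "Z = (\<Oplus>\<^sub>TT i\<in>J. pt (tensor_coord (l i) Z) (b i))" if Z: "Z \<in> carrier TT" for Z
 proof (rule additive_eqI[OF _ _ Z, of TT "\<lambda>Z. Z"])
  show "additive TT TT (\<lambda>Z. Z)" by (auto intro: additiveI)
  show "additive TT TT (\<lambda>Z. \<Oplus>\<^sub>TT i\<in>J. pt (tensor_coord (l i) Z) (b i))"
  proof (rule additiveI)
   fix Z Z' assume Z: "Z \<in> carrier TT" "Z' \<in> carrier TT"
   have "(\<Oplus>\<^sub>TT i\<in>J. pt (tensor_coord (l i) (Z \<oplus>\<^sub>TT Z')) (b i)) =
     (\<Oplus>\<^sub>TT i\<in>J. pt (tensor_coord (l i) Z) (b i) \<oplus>\<^sub>TT pt (tensor_coord (l i) Z') (b i))"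
    using Z d(2) by (intro T.finsum_cong') (auto simp: ca cc pt_add_l)
   also have "... = (\<Oplus>\<^sub>TT i\<in>J. pt (tensor_coord (l i) Z) (b i)) \<oplus>\<^sub>TT (\<Oplus>\<^sub>TT i\<in>J. pt (tensor_coord (l i) Z') (b i))"
    using Z d(2) cc by (intro T.finsum_addf) auto
   finally show "(\<Oplus>\<^sub>TT i\<in>J. pt (tensor_coord (l i) (Z \<oplus>\<^sub>TT Z')) (b i)) =
    (\<Oplus>\<^sub>TT i\<in>J. pt (tensor_coord (l i) Z) (b i)) \<oplus>\<^sub>TT (\<Oplus>\<^sub>TT i\<in>J. pt (tensor_coord (l i) Z') (b i))" .
  qed (use d(2) cc in \<open>auto intro!: T.finsum_closed\<close>)
  fix x y assume xy: "x \<in> carrier M" "y \<in> carrier N"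
  have ad: "additive N TT (pt x)" using xy by (intro additiveI) (auto simp: pt_add_r)
  have N: "abelian_group N" by (rule ring.is_abelian_group[OF cring.axioms(1)[OF N.M_cring]])
  have "pt x y = pt x (\<Oplus>\<^sub>N i\<in>J. l i y \<odot>\<^sub>N b i)" using d(6)[OF xy(2)] by simp
  also have "... = (\<Oplus>\<^sub>TT i\<in>J. pt x (l i y \<odot>\<^sub>N b i))"
   using d(2,3) xy by (intro additive_finsum[OF N abelian_group_tensor ad]) auto
  also have "... = (\<Oplus>\<^sub>TT i\<in>J. pt (tensor_coord (l i) (pt x y)) (b i))"
   using d(2,3) xy by (intro T.finsum_cong') (auto simp: cpt pt_smult)
  finally show "pt x y = (\<Oplus>\<^sub>TT i\<in>J. pt (tensor_coord (l i) (pt x y)) (b i))" .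
 qed
 have one: "pt a y = pt a \<one>\<^sub>N \<otimes>\<^sub>TT pt \<one>\<^sub>M y" if "a \<in> carrier M" "y \<in> carrier N" for a y
  using that by (simp add: tensor_mult_pt)
 show ?thesis
  unfolding dual_basis_def
 proof (intro conjI ballI)
  fix Z assume "Z \<in> carrier (alg_via (\<lambda>a. pt a \<one>\<^sub>N) TT)"
  then have Z: "Z \<in> carrier TT" by simp
  have "(\<Oplus>\<^sub>TT i\<in>J. pt (tensor_coord (l i) Z) (b i)) = (\<Oplus>\<^sub>TT i\<in>J. pt (tensor_coord (l i) Z) \<one>\<^sub>N \<otimes>\<^sub>TT pt \<one>\<^sub>M (b i))"
   using cc[OF _ Z] d(2) by (intro T.finsum_cong') (auto simp: one[symmetric])
  then show "Z = (\<Oplus>\<^bsub>alg_via (\<lambda>a. pt a \<one>\<^sub>N) TT\<^esub>i\<in>J.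
    tensor_coord (l i) Z \<odot>\<^bsub>alg_via (\<lambda>a. pt a \<one>\<^sub>N) TT\<^esub> pt \<one>\<^sub>M (b i))"
   using exp[OF Z] by (simp add: finsum_transfer[of "alg_via (\<lambda>a. pt a \<one>\<^sub>N) TT" TT])
 qed (use d(1,2) cc ca lin in \<open>auto intro!: module_homI\<close>)
qed

end

section \<open>The coefficient rings of motives and of local shtukas\<close>

lemma module_hom_id: "module_hom R M M (\<lambda>x. x)"
 by (rule module_homI) auto

lemma frob_pt:
 assumes ta: "tensor_algebra k B L" and k: "field k" "finite (carrier k)" and L: "field L"
  and ab: "a \<in> carrier B" "b \<in> carrier L"
 shows "frob k B L (pure_tensor k B L a b) = pure_tensor k B L a (b [^]\<^sub>L order k)"
proof -
 interpret tensor_algebra k B L by (rule ta)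
 show ?thesis
  unfolding frob_def
  by (rule tensor_map_pt[OF tensor_pair_axioms tensor_pair_axioms module_hom_id
     frobenius_hom(2)[OF k L N.algebra_axioms] ab])
qed

text \<open>Frobenius acts on the second factor alone, where it is a ring homomorphism over
  \<open>k\<close> and fixes \<open>\<one>\<^sub>L\<close>.\<close>

lemma frob_ring_tensor:
 assumes ta: "tensor_algebra k B L" and k: "field k" "finite (carrier k)" and L: "field L"
 shows "frob_ring B (tensor k B L) (\<lambda>a. pure_tensor k B L a \<one>\<^sub>L) (frob k B L)"
proof -
 interpret tensor_algebra k B L by (rule ta)
 interpret L: field L by (rule L)
 have L': "algebra k L" by (rule N.algebra_axioms)
 have one: "\<one>\<^sub>L \<in> carrier L" by simp
 have id: "(\<lambda>a. a) \<in> ring_hom B B" by (rule ring_hom_memI) auto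
 show ?thesis
 proof (intro frob_ring.intro frob_ring_axioms.intro)
  show "cring B" by (rule M.M_cring)
  show "cring (tensor k B L)" by (rule cring_tensor)
  show "(\<lambda>a. pure_tensor k B L a \<one>\<^sub>L) \<in> ring_hom B (tensor k B L)" by (rule pt_one_ring_hom)
  show "frob k B L \<in> ring_hom (tensor k B L) (tensor k B L)"
   unfolding frob_def
   by (rule tensor_map_ring_hom[OF ta ta module_hom_id frobenius_hom(2)[OF k L L'] id frobenius_hom(1)[OF k L L']])
  show "frob k B L (pure_tensor k B L r \<one>\<^sub>L) = pure_tensor k B L r \<one>\<^sub>L" if "r \<in> carrier B" for r
   using frob_pt[OF ta k L that one] by simp
 qed
qed

theorem theorem8p7:
  fixes k :: "'k ring" and F :: "('k, 'f) module" and xs :: "'f list" and P :: "'f set"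
    and A :: "('k, 'f) module" and L :: "('k, 'l) module" and c :: "'f \<Rightarrow> 'l"
    and M :: "(('f, 'l) tens, 'm) module" and \<tau> :: "('m, ('f, 'l) tens) tens \<Rightarrow> 'm"
    and M' :: "(('f, 'l) tens, 'n) module" and \<tau>' :: "('n, ('f, 'l) tens) tens \<Rightarrow> 'n"
    and r d r' d' :: nat and v :: "'f set"
  assumes "smooth_projective_curve k F xs"
    and "rational_point k F xs P"
    and "A = coord_ring k F xs P"
    and "field L" and "finite (carrier L)" and "algebra k L"
    and "c \<in> ring_hom A L"
    and "\<And>a x. a \<in> carrier k \<Longrightarrow> x \<in> carrier A \<Longrightarrow> c (a \<odot>\<^bsub>A\<^esub> x) = a \<odot>\<^bsub>L\<^esub> c x"
    and "pure_motive k F xs P L c r d M \<tau>"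
    and "pure_motive k F xs P L c r' d' M' \<tau>'"
    and "maximalideal v A"
  shows "module_iso (completion A v) (motive_hom_at k A L v M \<tau> M' \<tau>') (local_hom k A L v M \<tau> M' \<tau>')
           (natural_map k A L v M \<tau> M' \<tau>') \<and>
         (\<forall>f\<in>carrier (motive_hom k A L M \<tau> M' \<tau>'). \<forall>a\<in>carrier (completion A v).
            natural_map k A L v M \<tau> M' \<tau>'
                (pure_tensor A (motive_hom k A L M \<tau> M' \<tau>')
                   (alg_via (completion_map A v) (completion A v)) f a)
              = a \<odot>\<^bsub>local_hom k A L v M \<tau> M' \<tau>'\<^esub> localize_map k A L v M M' f)"
proof -
 have fink: "finite (carrier k)" and curve: "integral_projective_curve k F xs"
  using assms(1) by (auto simp: smooth_projective_curve_def)
 have k: "field k" using curve by (simp add: integral_projective_curve_def)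
 note G = regular_curve_uniformizer[OF curve smooth_projective_curve_regular[OF assms(1)] assms(3)]
 \<comment> \<open>The uniformizer at \<open>v\<close> provided by regularity; through it the
   completion satisfies \<open>valuation_base_change\<close>.\<close>
 obtain t where t: "t \<in> v" "\<forall>c\<in>carrier A. c ~= \<zero>\<^sub>A -->
   (\<exists>(n::nat) s s'. s \<in> carrier A - v & s' \<in> carrier A - v & s \<otimes>\<^sub>A c = s' \<otimes>\<^sub>A t [^]\<^sub>A n)"
  using G(3)[OF assms(11)] by blast
 interpret A: domain A by (rule G(1))
 interpret co: completion_uniformizer A v t
  by (intro completion_uniformizer.intro completion_at_maximal.intro completion_uniformizer_axioms.intro)
   (use G(1) assms(11) t in auto)
 let ?B = "completion A v" and ?i = "completion_map A v"
 have kB: "algebra k ?B" by (rule co.algebra_C[OF G(2)])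
 have taA: "tensor_algebra k A L" by (rule tensor_algebra.intro[OF G(2) assms(6)])
 have taB: "tensor_algebra k ?B L" by (rule tensor_algebra.intro[OF kB assms(6)])
 interpret ta: tensor_algebra k A L by (rule taA)
 interpret tb: tensor_algebra k ?B L by (rule taB)
 interpret L: field L by (rule assms(4))
 have one: "\<one>\<^sub>L \<in> carrier L" by simp
 note fp = frob_pt[OF taA k fink assms(4)] frob_pt[OF taB k fink assms(4)]
 interpret fA: frob_ring A "tensor k A L" "\<lambda>a. pure_tensor k A L a \<one>\<^sub>L" "frob k A L"
  by (rule frob_ring_tensor[OF taA k fink assms(4)])
 interpret fB: frob_ring ?B "tensor k ?B L" "\<lambda>a. pure_tensor k ?B L a \<one>\<^sub>L" "frob k ?B L"
  by (rule frob_ring_tensor[OF taB k fink assms(4)])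
 have ih: "module_hom k A ?B ?i"
  by (rule module_homI) (use co.\<iota>_hom co.\<iota>_smult[OF G(2)] in \<open>auto simp: ring_hom_def\<close>)
 let ?h = "local_ring_map k A L v"
 have hpt: "?h (pure_tensor k A L a b) = pure_tensor k ?B L (?i a) b" if "a \<in> carrier A" "b \<in> carrier L" for a b
  unfolding local_ring_map_def
  by (rule tensor_map_pt[OF ta.tensor_pair_axioms tb.tensor_pair_axioms ih module_hom_id that])
 have idL: "(\<lambda>b. b) \<in> ring_hom L L" by (rule ring_hom_memI) auto
 have h: "?h \<in> ring_hom (tensor k A L) (tensor k ?B L)"
  unfolding local_ring_map_def by (rule tensor_map_ring_hom[OF taA taB ih module_hom_id co.\<iota>_hom idL])
 \<comment> \<open>Frobenius acts on the factor \<open>L\<close> and completion on the other factor,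
   so they commute on pure tensors.\<close>
 have hs: "?h (frob k A L s) = frob k ?B L (?h s)" if s: "s \<in> carrier (tensor k A L)" for s
  using s
 proof (induction rule: ta.tensor_induct)
  case (pure a b)
  then show ?case using ring_hom_closed[OF co.\<iota>_hom] by (simp add: fp hpt)
 next
  case (add Z Z')
  then show ?case
   using ring_hom_closed[OF h] ring_hom_add[OF h] ring_hom_add[OF fA.\<sigma>] ring_hom_add[OF fB.\<sigma>] by simp
 qed
 \<comment> \<open>Finiteness of \<open>L\<close> enters here: one dual basis of \<open>L\<close>
   over \<open>k\<close> gives dual bases of both coefficient rings, over \<open>A\<close> and over
   the completion.\<close>
 obtain J l where db: "dual_basis k L J (\<lambda>x. x) l"
  using finite_dual_basis[OF k ta.N.module_axioms assms(5)] by blast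
 note d = dual_basisD[OF db]
 have lh: "module_hom k L (self_module k) (l b)" if "b \<in> J" for b using db that by (simp add: dual_basis_def)
 \<comment> \<open>The coordinates read the factor \<open>L\<close> only and are therefore
   compatible with completing the other factor.\<close>
 have coord: "tb.tensor_coord (l b) (?h s) = ?i (ta.tensor_coord (l b) s)" if b: "b \<in> J" and s: "s \<in> carrier (tensor k A L)" for b s
  using s
 proof (induction rule: ta.tensor_induct)
  case (pure a y)
  then show ?case
   using ring_hom_closed[OF co.\<iota>_hom] d(3)[OF b]
   by (simp add: hpt ta.tensor_coord_pt[OF lh[OF b]] tb.tensor_coord_pt[OF lh[OF b]] co.\<iota>_smult[OF G(2)])
 next
  case (add Z Z')
  then show ?case
   using ring_hom_closed[OF h] ring_hom_add[OF h] ring_hom_add[OF co.\<iota>_hom]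
    additive_add[OF ta.tensor_coord_additive[OF lh[OF b]]] additive_closed[OF ta.tensor_coord_additive[OF lh[OF b]]]
    additive_add[OF tb.tensor_coord_additive[OF lh[OF b]]]
   by simp
 qed
 have i1: "?i \<one>\<^sub>A = \<one>\<^bsub>?B\<^esub>" by (rule ring_hom_one[OF co.\<iota>_hom])
 have dbT: "dual_basis ?B (alg_via (\<lambda>a. pure_tensor k ?B L a \<one>\<^sub>L) (tensor k ?B L)) J
   (\<lambda>b. ?h (pure_tensor k A L \<one>\<^sub>A b)) (\<lambda>b. tb.tensor_coord (l b))"
  by (rule dual_basis_cong[OF _ tb.tensor_dual_basis[OF db]])
   (use algebra.axioms(1)[OF algebra_alg_via[OF tb.M.M_cring tb.cring_tensor fB.i]] d(2) in \<open>auto simp: hpt i1\<close>)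
 interpret bc: frob_base_change A ?B ?i "carrier A - v" "tensor k A L" "tensor k ?B L"
  "\<lambda>a. pure_tensor k A L a \<one>\<^sub>L" "frob k A L" "\<lambda>a. pure_tensor k ?B L a \<one>\<^sub>L" "frob k ?B L"
  ?h J "\<lambda>b. pure_tensor k A L \<one>\<^sub>A b" "\<lambda>b. ta.tensor_coord (l b)" "\<lambda>b. tb.tensor_coord (l b)"
  by (intro frob_base_change.intro frob_base_change_axioms.intro co.valuation_base_change
    fA.frob_ring_axioms fB.frob_ring_axioms h hs ta.tensor_dual_basis[OF db] dbT coord hpt one)
 have mot: "locally_free (tensor k A L) M r" "module_hom (tensor k A L) (pullback (tensor k A L) (frob k A L) M) M \<tau>"
  "locally_free (tensor k A L) M' r'" "module_hom (tensor k A L) (pullback (tensor k A L) (frob k A L) M') M' \<tau>'"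
  using assms(9,10) unfolding pure_motive_def Let_def assms(3) by blast+
 have mods: "module (tensor k A L) M" "module (tensor k A L) M'" using mot by (auto simp: locally_free_def)
 obtain I and e :: "('f, 'l) tens \<times> nat => 'm" and lM where dbM: "dual_basis (tensor k A L) M I e lM"
  using locally_free_dual_basis[OF mot(1)] by blast
 obtain I' and e' :: "('f, 'l) tens \<times> nat => 'n" and lM' where dbM': "dual_basis (tensor k A L) M' I' e' lM'"
  using locally_free_dual_basis[OF mot(3)] by blast
 note prems = mods(1) mot(2) mods(2) mot(4) dbM dbM'
 \<comment> \<open>Unfolded, the objects of the statement are literally those of the abstract
   comparison.\<close>
 show ?thesis
  unfolding motive_hom_at_def motive_hom_def local_hom_def natural_map_def local_module_def local_frob_def
   localize_map_def Let_def
  using bc.nat_map_iso[OF prems] bc.nat_map_pt[OF prems] by blast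
qed


end
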